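(* Let $S=\{\phi_1,\dots,\phi_s\}$ be a set of endomorphisms of $\mathbb{P}^N$ defined over $\overline{\mathbb{Q}}$ all of degree at least two (and with pairwise distinct degrees if $s\ge2$). Then there exist an effectively computable positive constant $b$ and a constant $B_S$, depending only on $S$, such that $$\#\{Q\in\mathrm{Orb}_S(P) : H(Q)\leq B\}\ll(\log B)^{b}$$ holds for all $P\in\mathbb{P}^N(\overline{\mathbb{Q}})$ with $H(P)>B_S$.
   Context: $H$ is the absolute multiplicative Weil height on $\mathbb{P}^N(\overline{\mathbb{Q}})$. An endomorphism of $\mathbb{P}^N$ of degree $d$ is a morphism given by $N+1$ homogeneous polynomials of degree $d$ with no common zero over $\overline{\mathbb{Q}}$. $M_S$ is the monoid (with identity map) of all finite compositions of elements of $S$, and $\mathrm{Orb}_S(P)=\{f(P): f\in M_S\}$ is the total orbit of $P$. The notation $A(B)\ll C(B)$ means that there is a constant $c>0$ (which may depend on $S$ and $P$, but not on $B$) with $A(B)\le c\,C(B)$ for all sufficiently large $B$. *)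

theory Defs
  imports
    "HOL-Analysis.Analysis"
    "HOL-Computational_Algebra.Polynomial"
    "HOL-Library.Poly_Mapping"
    "HOL-Library.Landau_Symbols"
    "HOL-Library.Nat_Bijection"
    "HOL-Algebra.Ideal_Product"
    "HOL-Algebra.QuotRing"
    "HOL-Algebra.Subrings"
begin

section \<open>Projective space over the algebraic numbers\<close>

text \<open>
  The field of algebraic numbers is \<open>{z :: complex. algebraic z}\<close>. Homogeneous coordinates
  \<open>x\<^sub>0, \<dots>, x\<^sub>N\<close> are functions on \<open>nat\<close> that vanish beyond \<open>N\<close>, and a point of projective
  \<open>N\<close>-space is the class of all its coordinate vectors.
\<close>

type_synonym point = "(nat \<Rightarrow> complex) set"

definition coord_vecs :: "nat \<Rightarrow> (nat \<Rightarrow> complex) set" where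
  "coord_vecs N = {x. (\<forall>i. algebraic (x i)) \<and> (\<forall>i>N. x i = 0) \<and> (\<exists>i. x i \<noteq> 0)}"

definition proj_rel :: "nat \<Rightarrow> ((nat \<Rightarrow> complex) \<times> (nat \<Rightarrow> complex)) set" where
  "proj_rel N = {(x, y). x \<in> coord_vecs N \<and> y \<in> coord_vecs N \<and>
     (\<exists>c. algebraic c \<and> c \<noteq> 0 \<and> y = (\<lambda>i. c * x i))}"

definition proj_space :: "nat \<Rightarrow> point set" where
  "proj_space N = coord_vecs N // proj_rel N"


section \<open>The absolute multiplicative Weil height\<close>

definition complex_ring :: "complex set \<Rightarrow> complex ring" where
  "complex_ring A = \<lparr>carrier = A, mult = (*), one = 1, zero = 0, add = (+)\<rparr>"

abbreviation rat_scale :: "rat \<Rightarrow> complex \<Rightarrow> complex" where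
  "rat_scale q z \<equiv> of_rat q * z"

definition number_field :: "complex set \<Rightarrow> bool" where
  "number_field K \<longleftrightarrow> subfield K (complex_ring UNIV) \<and>
     (\<exists>B. finite B \<and> K = module.span rat_scale B)"

definition field_degree :: "complex set \<Rightarrow> nat" where
  "field_degree K = vector_space.dim rat_scale K"

text \<open>Embeddings of \<open>K\<close> into \<open>\<complex>\<close>; extensionality makes them a finite set of functions.\<close>

definition embeddings :: "complex set \<Rightarrow> (complex \<Rightarrow> complex) set" where
  "embeddings K = ring_hom (complex_ring K) (complex_ring UNIV) \<inter> extensional K"

definition int_ring :: "complex set \<Rightarrow> complex ring" where
  "int_ring K = complex_ring {z \<in> K. algebraic_int z}"

definition finite_places :: "complex set \<Rightarrow> complex set set" where
  "finite_places K = {\<pp>. primeideal \<pp> (int_ring K) \<and> \<pp> \<noteq> {0}}"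

definition ideal_norm :: "complex set \<Rightarrow> complex set \<Rightarrow> nat" where
  "ideal_norm K \<pp> = card (carrier (int_ring K Quot \<pp>))"

text \<open>The exponent of \<open>\<pp>\<close> in the factorisation of the principal ideal generated by the
  integer \<open>a \<noteq> 0\<close>.\<close>

definition ord_int :: "complex set \<Rightarrow> complex set \<Rightarrow> complex \<Rightarrow> nat" where
  "ord_int K \<pp> a = Max {n. a \<in> \<pp> [^]\<^bsub>ideals_set (int_ring K)\<^esub> n}"

text \<open>Well defined because every element of \<open>K\<close> is a quotient of integers of \<open>K\<close>, and \<open>ord_int\<close>
  is additive on products.\<close>

definition ord_frac :: "complex set \<Rightarrow> complex set \<Rightarrow> complex \<Rightarrow> int" where
  "ord_frac K \<pp> z = (THE k. \<exists>a b. a \<in> carrier (int_ring K) - {0} \<and>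
     b \<in> carrier (int_ring K) - {0} \<and> z = a / b \<and>
     k = int (ord_int K \<pp> a) - int (ord_int K \<pp> b))"

definition finite_abs :: "complex set \<Rightarrow> complex set \<Rightarrow> complex \<Rightarrow> real" where
  "finite_abs K \<pp> z =
     (if z = 0 then 0 else real (ideal_norm K \<pp>) powi (- ord_frac K \<pp> z))"

definition finite_max :: "complex set \<Rightarrow> nat \<Rightarrow> (nat \<Rightarrow> complex) \<Rightarrow> complex set \<Rightarrow> real" where
  "finite_max K N x \<pp> = Max ((\<lambda>i. finite_abs K \<pp> (x i)) ` {..N})"

text \<open>
  The product over all places \<open>v\<close> of \<open>max\<^sub>i \<parallel>x\<^sub>i\<parallel>\<^sub>v\<close>, where \<open>\<parallel>z\<parallel>\<^sub>v\<close> is the normalised absolute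
  value \<open>\<bar>z\<bar>\<^sub>v\<close> to the power \<open>[K\<^sub>v : \<rat>\<^sub>v]\<close>. At a prime \<open>\<pp>\<close> this is the norm of \<open>\<pp>\<close> to the
  power \<open>- ord\<^sub>\<pp> z\<close>; at an archimedean place it is \<open>\<bar>\<sigma> z\<bar>\<close> for a real embedding \<open>\<sigma>\<close> and
  \<open>\<bar>\<sigma> z\<bar>\<^sup>2\<close> for a pair of complex conjugate ones, so that the archimedean factors form a product
  over all embeddings. Only finitely many factors differ from \<open>1\<close>.
\<close>

definition field_height :: "complex set \<Rightarrow> nat \<Rightarrow> (nat \<Rightarrow> complex) \<Rightarrow> real" where
  "field_height K N x =
     (\<Prod>\<sigma>\<in>embeddings K. Max ((\<lambda>i. cmod (\<sigma> (x i))) ` {..N})) *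
     (\<Prod>\<pp> | \<pp> \<in> finite_places K \<and> finite_max K N x \<pp> \<noteq> 1. finite_max K N x \<pp>)"

text \<open>The value depends neither on the coordinates \<open>x\<close> chosen for \<open>P\<close> nor on the number field
  \<open>K\<close> containing them.\<close>

definition weil_height :: "nat \<Rightarrow> point \<Rightarrow> real" where
  "weil_height N P = (SOME h. \<exists>x\<in>P. \<exists>K. number_field K \<and> range x \<subseteq> K \<and>
     h = field_height K N x powr (1 / real (field_degree K)))"


section \<open>Endomorphisms and orbits\<close>

text \<open>Polynomials in the variables \<open>X\<^sub>0, X\<^sub>1, \<dots>\<close> map exponent vectors to coefficients.\<close>

type_synonym mpoly = "(nat \<Rightarrow>\<^sub>0 nat) \<Rightarrow>\<^sub>0 complex"

definition mpoly_eval :: "mpoly \<Rightarrow> (nat \<Rightarrow> complex) \<Rightarrow> complex" where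
  "mpoly_eval p x = (\<Sum>m\<in>Poly_Mapping.keys p.
     Poly_Mapping.lookup p m * (\<Prod>i\<in>Poly_Mapping.keys m. x i ^ Poly_Mapping.lookup m i))"

definition homogeneous_on :: "nat \<Rightarrow> nat \<Rightarrow> mpoly \<Rightarrow> bool" where
  "homogeneous_on N d p \<longleftrightarrow> (\<forall>m\<in>Poly_Mapping.keys p.
     Poly_Mapping.keys m \<subseteq> {..N} \<and> (\<Sum>i\<in>Poly_Mapping.keys m. Poly_Mapping.lookup m i) = d)"

definition algebraic_coeffs :: "mpoly \<Rightarrow> bool" where
  "algebraic_coeffs p \<longleftrightarrow> (\<forall>m. algebraic (Poly_Mapping.lookup p m))"

definition defines_endo :: "nat \<Rightarrow> nat \<Rightarrow> (nat \<Rightarrow> mpoly) \<Rightarrow> bool" where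
  "defines_endo N d F \<longleftrightarrow>
     (\<forall>i\<le>N. homogeneous_on N d (F i) \<and> algebraic_coeffs (F i)) \<and>
     (\<forall>x\<in>coord_vecs N. \<exists>i\<le>N. mpoly_eval (F i) x \<noteq> 0)"

definition proj_map :: "nat \<Rightarrow> (nat \<Rightarrow> mpoly) \<Rightarrow> point \<Rightarrow> point" where
  "proj_map N F = (\<lambda>P\<in>proj_space N.
     proj_rel N `` ((\<lambda>x i. if i \<le> N then mpoly_eval (F i) x else 0) ` P))"

definition endomorphism :: "nat \<Rightarrow> nat \<Rightarrow> (point \<Rightarrow> point) \<Rightarrow> bool" where
  "endomorphism N d \<phi> \<longleftrightarrow> (\<exists>F. defines_endo N d F \<and> \<phi> = proj_map N F)"

inductive_set comp_monoid :: "('a \<Rightarrow> 'a) set \<Rightarrow> ('a \<Rightarrow> 'a) set" for S where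
  id: "id \<in> comp_monoid S"
| comp: "\<phi> \<in> S \<Longrightarrow> f \<in> comp_monoid S \<Longrightarrow> \<phi> \<circ> f \<in> comp_monoid S"

definition orbit :: "('a \<Rightarrow> 'a) set \<Rightarrow> 'a \<Rightarrow> 'a set" where
  "orbit S P = {f P | f. f \<in> comp_monoid S}"


section \<open>Effective computability\<close>

text \<open>Partial recursive functions: programs, and the relation ``program \<open>r\<close> halts on the
  arguments \<open>xs\<close> with result \<open>y\<close>''.\<close>

datatype recf = Zero | Succ | Proj nat | Comp recf "recf list" | Prec recf recf | Mu recf

inductive computes :: "recf \<Rightarrow> nat list \<Rightarrow> nat \<Rightarrow> bool" where
  "computes Zero xs 0"
| "computes Succ [x] (Suc x)"
| "i < length xs \<Longrightarrow> computes (Proj i) xs (xs ! i)"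
| "list_all2 (\<lambda>g y. computes g xs y) gs ys \<Longrightarrow> computes f ys z \<Longrightarrow> computes (Comp f gs) xs z"
| "computes f xs y \<Longrightarrow> computes (Prec f g) (0 # xs) y"
| "computes (Prec f g) (n # xs) y \<Longrightarrow> computes g (n # y # xs) z \<Longrightarrow>
     computes (Prec f g) (Suc n # xs) z"
| "computes f (n # xs) 0 \<Longrightarrow> (\<And>m. m < n \<Longrightarrow> \<exists>y. computes f (m # xs) (Suc y)) \<Longrightarrow>
     computes (Mu f) xs n"

definition decode_rat :: "nat \<Rightarrow> real" where
  "decode_rat k = (case prod_decode k of (a, m) \<Rightarrow> real_of_int (int_decode a) / real (Suc m))"

text \<open>An algebraic number is presented by an integer polynomial \<open>p \<noteq> 0\<close> and a rational disc
  in which it is the only root of \<open>p\<close>.\<close>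

definition codes_algebraic :: "nat \<Rightarrow> complex \<Rightarrow> bool" where
  "codes_algebraic k \<alpha> \<longleftrightarrow> (\<exists>c u v r p. k = list_encode [c, u, v, r] \<and>
     p = Poly (map (\<lambda>a. of_int (int_decode a)) (list_decode c)) \<and> p \<noteq> 0 \<and>
     {z. poly p z = 0 \<and> dist z (Complex (decode_rat u) (decode_rat v)) < decode_rat r} = {\<alpha>})"

text \<open>A polynomial is presented by a list of terms, each an exponent list with a coefficient.\<close>

definition codes_mpoly :: "nat \<Rightarrow> mpoly \<Rightarrow> bool" where
  "codes_mpoly k p \<longleftrightarrow> (\<exists>ts.
     list_all2 (\<lambda>j (e, a). \<exists>c. j = prod_encode (list_encode e, c) \<and> codes_algebraic c a)
       (list_decode k) ts \<and>
     p = (\<Sum>(e, a)\<leftarrow>ts. Poly_Mapping.single (Poly_Mapping.nth e) a))"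

definition codes_endo :: "nat \<Rightarrow> nat \<Rightarrow> (point \<Rightarrow> point) \<Rightarrow> bool" where
  "codes_endo N k \<phi> \<longleftrightarrow> (\<exists>ps d. list_all2 codes_mpoly (list_decode k) ps \<and>
     length ps = Suc N \<and> defines_endo N d (\<lambda>i. ps ! i) \<and> \<phi> = proj_map N (\<lambda>i. ps ! i))"

definition codes_system :: "nat \<Rightarrow> nat \<Rightarrow> (point \<Rightarrow> point) set \<Rightarrow> bool" where
  "codes_system k N S \<longleftrightarrow> (\<exists>c \<phi>s. k = prod_encode (N, c) \<and>
     list_all2 (codes_endo N) (list_decode c) \<phi>s \<and> S = set \<phi>s)"

text \<open>From every presentation of \<open>S\<close>, the program \<open>r\<close> approximates the real number \<open>b\<close> to any
  prescribed accuracy.\<close>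

definition computes_real_from ::
    "recf \<Rightarrow> nat \<Rightarrow> (point \<Rightarrow> point) set \<Rightarrow> real \<Rightarrow> bool" where
  "computes_real_from r N S b \<longleftrightarrow> (\<forall>k. codes_system k N S \<longrightarrow>
     (\<forall>n. \<exists>q. computes r [k, n] q \<and> \<bar>decode_rat q - b\<bar> \<le> 1 / 2 ^ n))"

end

theory Submission
  imports Defs "Jordan_Normal_Form.Char_Poly"
begin

text \<open>
  Since the degrees are distinct and at least \<open>2\<close>, the sum of \<open>1 / deg(\<phi>)\<^sup>2\<close> over \<open>\<phi> \<in> S\<close> is less
  than \<open>1\<close>. Weighting each word over \<open>S\<close> by the inverse square of its total degree then shows that
  there are only \<open>O(X\<^sup>2)\<close> words of total degree at most \<open>X\<close>. The inequality
  \<open>H(P)\<^sup>d \<le> C H(\<phi>(P))\<close> makes \<open>ln H\<close> grow along the orbit at least like the total degree as soon as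
  \<open>H(P)\<close> exceeds a constant, so the points with \<open>H(Q) \<le> B\<close> come from words of total degree
  \<open>O(ln B)\<close>. Hence the exponent \<open>b = 2\<close> serves for every \<open>S\<close>, and a constant program computes it.

  For the height inequality, a power of the ideal generated by the coordinates of \<open>P\<close> is principal,
  so after a finite extension \<open>P\<close> has integral coordinates generating the unit ideal, and its height
  is a product of archimedean factors only. The Nullstellensatz gives relations
  \<open>M x\<^sub>j\<^sup>e\<^sup>+\<^sup>d = \<Sum>\<^sub>i h\<^sub>j\<^sub>i F\<^sub>i\<close> with integral forms \<open>h\<^sub>j\<^sub>i\<close>. They bound the archimedean factors of \<open>P\<close> by
  those of \<open>\<phi>(P)\<close>, and they show that the common factor of the values \<open>F\<^sub>i(x)\<close> divides \<open>M\<close>.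
\<close>

text \<open>Why inverse squares: the weights 1/deg^s must sum to less than 1 over every finite set
  of distinct degrees. Among integers s, this fails for s = 1 and holds for s = 2 by telescoping.
  The exponent of the weight becomes the exponent of X in the count, hence b = 2. Only a lower bound
  for H(\<phi>(P)) enters, and its constant must not depend on the field in which P gets its special
  coordinates. The archimedean estimates are therefore uniform in the field and the embedding, and
  only products normalised by the field degree are compared. The obstacle is arithmetic: the height
  is defined through prime ideals, so factorisation, indices and the class group must be available.
  The route is unusual. A pigeonhole argument in a lattice box gives every nonzero ideal an element
  of small norm. This yields finitely many ideal classes, then a principal power of each ideal, then
  invertibility; factorisation into primes comes last.\<close>

no_notation Finite_Cartesian_Product.vec_nth (infixl \<open>$\<close> 90)
hide_const (open) Determinants.det up_ring.coeff up_ring.monom module.smult Coset.order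

text \<open>As introduction rules these facts send the classical reasoner into long searches.\<close>

declare algebraic_int_imp_algebraic [rule del]
declare algebraic_int_minus [rule del] algebraic_int_inverse [rule del]
  algebraic_int_nth_root_real [rule del] algebraic_int_sqrt [rule del] algebraic_int_csqrt [rule del]
  algebraic_int_cnj [rule del] algebraic_int_of_real [rule del]
declare algebraic_minus [rule del] algebraic_inverse [rule del]
  algebraic_nth_root_real [rule del] algebraic_sqrt [rule del] algebraic_csqrt [rule del]
  algebraic_cnj [rule del] algebraic_of_real [rule del]

section \<open>Polynomials and determinants over a subring\<close>

definition coeffs_in :: "'a::zero set \<Rightarrow> 'a poly \<Rightarrow> bool" where
  "coeffs_in R p \<longleftrightarrow> (\<forall>i. coeff p i \<in> R)"

text \<open>The instances are the integers, the rationals, the algebraic integers, the algebraic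
  numbers, multiplier rings of lattices, number fields with their integers, and polynomials over a
  subring. Closure arguments and division with remainder are thus carried out once.\<close>

locale subring_set =
  fixes R :: "'a::comm_ring_1 set"
  assumes zero [intro, simp]: "0 \<in> R" and one [intro, simp]: "1 \<in> R"
    and add [intro]: "a \<in> R \<Longrightarrow> b \<in> R \<Longrightarrow> a + b \<in> R"
    and neg [intro]: "a \<in> R \<Longrightarrow> - a \<in> R"
    and mult [intro]: "a \<in> R \<Longrightarrow> b \<in> R \<Longrightarrow> a * b \<in> R"
begin

lemma diff [intro]: "a \<in> R \<Longrightarrow> b \<in> R \<Longrightarrow> a - b \<in> R"
  using add[of a "-b"] neg by auto

lemma sum [intro]: "(\<And>i. i \<in> A \<Longrightarrow> f i \<in> R) \<Longrightarrow> sum f A \<in> R"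
  by (induction A rule: infinite_finite_induct) auto

lemma prod [intro]: "(\<And>i. i \<in> A \<Longrightarrow> f i \<in> R) \<Longrightarrow> prod f A \<in> R"
  by (induction A rule: infinite_finite_induct) auto

lemma power [intro]: "a \<in> R \<Longrightarrow> a ^ n \<in> R"
  by (induction n) auto

lemma of_nat [intro, simp]: "of_nat n \<in> R"
  by (induction n) auto

lemma of_int [intro, simp]: "of_int n \<in> R"
  by (cases n rule: int_cases2) auto

lemma subring_coeffs_in: "subring_set {p. coeffs_in R p}"
proof
  fix p q assume "p \<in> {p. coeffs_in R p}" "q \<in> {p. coeffs_in R p}"
  then show "p * q \<in> {p. coeffs_in R p}"
    by (auto simp: coeffs_in_def coeff_mult intro!: sum)
qed (auto simp: coeffs_in_def coeff_1)

lemma poly_in: "coeffs_in R p \<Longrightarrow> x \<in> R \<Longrightarrow> poly p x \<in> R"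
  unfolding poly_altdef coeffs_in_def by auto

lemma coeffs_in_pCons: "coeffs_in R (pCons a p) \<longleftrightarrow> a \<in> R \<and> coeffs_in R p"
  unfolding coeffs_in_def by (auto simp: coeff_pCons split: nat.splits)

lemma coeffs_in_monom: "a \<in> R \<Longrightarrow> coeffs_in R (monom a n)"
  unfolding coeffs_in_def by auto

lemma coeffs_in_smult: "a \<in> R \<Longrightarrow> coeffs_in R p \<Longrightarrow> coeffs_in R (smult a p)"
  unfolding coeffs_in_def by auto

lemma coeffs_in_pcompose: "coeffs_in R p \<Longrightarrow> coeffs_in R q \<Longrightarrow> coeffs_in R (pcompose p q)"
proof (induction p)
  case (pCons a p)
  interpret P: subring_set "{p. coeffs_in R p}" by (rule subring_coeffs_in)
  show ?case using pCons P.add[of "[:a:]" "q * pcompose p q"] P.mult[of q "pcompose p q"]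
    by (auto simp: coeffs_in_pCons pcompose_pCons) (auto simp: coeffs_in_def)
qed auto

text \<open>Dividing by a monic polynomial never divides coefficients, so quotient and remainder
  stay over \<open>R\<close>. The alternative \<open>r = 0\<close> covers a divisor of degree
  0.\<close>

lemma monic_division:
  assumes g: "coeffs_in R g" "lead_coeff g = 1" and p: "coeffs_in R p"
  shows "\<exists>q r. coeffs_in R q \<and> coeffs_in R r \<and> p = q * g + r \<and> (r = 0 \<or> degree r < degree g)"
  using p
proof (induction "degree p" arbitrary: p rule: less_induct)
  case less
  interpret P: subring_set "{p. coeffs_in R p}" by (rule subring_coeffs_in)
  show ?case
  proof (cases "p = 0 \<or> degree p < degree g")
    case True
    then show ?thesis using P.zero less.prems by (intro exI[of _ 0] exI[of _ p]) auto
  next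
    case False
    define m where "m = monom (lead_coeff p) (degree p - degree g)"
    have m: "coeffs_in R m" unfolding m_def using less.prems by (auto intro!: coeffs_in_monom simp: coeffs_in_def)
    have dm: "degree (m * g) \<le> degree p"
      using False degree_mult_le[of m g] degree_monom_le[of "lead_coeff p" "degree p - degree g"]
      unfolding m_def by linarith
    have cm: "coeff (m * g) (degree p) = lead_coeff p"
      using False g(2) coeff_monom_mult[of "lead_coeff p" "degree p - degree g" g "degree p"] by (simp add: m_def)
    have cin: "coeffs_in R (p - m * g)" using P.diff[of p "m * g"] P.mult[of m g] m g less.prems by auto
    \<comment> \<open>In degree 0 the leading term cancels to the zero polynomial and the degree
      cannot drop, so the induction hypothesis is out of reach there.\<close>
    show ?thesis
    proof (cases "degree p = 0")
      case True
      then have "degree (p - m * g) = 0" using dm degree_diff_le_max[of p "m * g"] by auto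
      moreover have "coeff (p - m * g) 0 = 0" using cm True by simp
      ultimately have "p - m * g = 0" using leading_coeff_0_iff[of "p - m * g"] by simp
      then show ?thesis using m P.zero by (intro exI[of _ m] exI[of _ 0]) auto
    next
      case False2: False
      have "degree (p - m * g) < degree p"
        using dm cm False2 by (intro degree_lessI) (auto simp: coeff_eq_0 le_less)
      from less.hyps[OF this cin] obtain q r where
        "coeffs_in R q" "coeffs_in R r" "p - m * g = q * g + r" "r = 0 \<or> degree r < degree g" by blast
      then show ?thesis using P.add[of q m] m
        by (intro exI[of _ "q + m"] exI[of _ r]) (auto simp: algebra_simps)
    qed
  qed
qed

end

lemma subring_Ints: "subring_set (\<int> :: 'a::comm_ring_1 set)"
  by unfold_locales auto

lemma subring_Rats: "subring_set (\<rat> :: 'a::field_char_0 set)"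
  by unfold_locales auto

lemma det_in_subring:
  assumes "subring_set R" "A \<in> carrier_mat n n" "\<And>i j. i < n \<Longrightarrow> j < n \<Longrightarrow> A $$ (i,j) \<in> R"
  shows "det A \<in> R"
proof -
  interpret subring_set R by fact
  show ?thesis unfolding det_def'[OF assms(2)]
    by (rule sum) (auto intro!: mult prod assms(3) simp: sign_def permutes_in_image)
qed

lemma char_poly_coeffs_in:
  assumes "subring_set R" "A \<in> carrier_mat n n" "\<And>i j. i < n \<Longrightarrow> j < n \<Longrightarrow> A $$ (i,j) \<in> R"
  shows "coeffs_in R (char_poly A)"
proof -
  interpret subring_set R by fact
  interpret P: subring_set "{p. coeffs_in R p}" by (rule subring_coeffs_in)
  have "det (char_poly_matrix A) \<in> {p. coeffs_in R p}"
  proof (rule det_in_subring[OF subring_coeffs_in, of _ n])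
    fix i j assume "i < n" "j < n"
    then show "char_poly_matrix A $$ (i, j) \<in> {p. coeffs_in R p}"
      using assms(2,3) P.zero P.one by (auto simp: char_poly_matrix_def coeffs_in_pCons)
  qed (use assms(2) in auto)
  then show ?thesis by (simp add: char_poly_def)
qed

text \<open>Determinant trick: the vector of all elements of \<open>X\<close> is an eigenvector of
  the coefficient matrix for the eigenvalue \<open>z\<close>, so \<open>z\<close> is a root of its
  characteristic polynomial. The element \<open>x0\<close> makes this vector nonzero. Applied over
  the integers it gives integrality, over the rationals algebraicity.\<close>

lemma stable_module_root:
  fixes z :: complex
  assumes R: "subring_set R" and X: "finite X" "x0 \<in> X" "x0 \<noteq> 0"
    and st: "\<And>x. x \<in> X \<Longrightarrow> \<exists>a. (\<forall>y. a y \<in> R) \<and> z * x = (\<Sum>y\<in>X. a y * y)"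
  shows "\<exists>p. coeffs_in R p \<and> lead_coeff p = 1 \<and> poly p z = 0"
proof -
  define n where "n = card X"
  obtain e where e: "bij_betw e {0..<n} X"
    using ex_bij_betw_nat_finite[OF X(1)] by (auto simp: n_def)
  obtain a where a: "\<And>x y. x \<in> X \<Longrightarrow> a x y \<in> R" "\<And>x. x \<in> X \<Longrightarrow> z * x = (\<Sum>y\<in>X. a x y * y)"
    using st by metis
  define A where "A = mat n n (\<lambda>(i,j). a (e i) (e j))"
  define v where "v = vec n e"
  have A: "A \<in> carrier_mat n n" by (simp add: A_def)
  have eX: "e i \<in> X" if "i < n" for i using e that by (auto simp: bij_betw_def)
  have "A *\<^sub>v v = z \<cdot>\<^sub>v v"
  proof (rule eq_vecI)
    fix i assume "i < dim_vec (z \<cdot>\<^sub>v v)"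
    then have i: "i < n" by (simp add: v_def)
    have "(A *\<^sub>v v) $ i = (\<Sum>j=0..<n. a (e i) (e j) * e j)"
      using i by (simp add: A_def v_def scalar_prod_def)
    also have "\<dots> = (\<Sum>y\<in>X. a (e i) y * y)"
      using sum.reindex_bij_betw[OF e] by fast
    also have "\<dots> = z * e i" using a(2)[OF eX[OF i]] by simp
    finally show "(A *\<^sub>v v) $ i = (z \<cdot>\<^sub>v v) $ i" using i by (simp add: v_def)
  qed (simp add: A_def v_def)
  moreover have "v \<noteq> 0\<^sub>v n"
  proof
    assume v0: "v = 0\<^sub>v n"
    obtain i where "i < n" "e i = x0" using e X(2) by (auto simp: bij_betw_def)
    then show False using v0 X(3) by (metis index_vec index_zero_vec(1) v_def)
  qed
  ultimately have "eigenvector A v z" by (simp add: eigenvector_def A_def v_def)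
  then have "poly (char_poly A) z = 0"
    using eigenvalue_root_char_poly[OF A] by (auto simp: eigenvalue_def)
  moreover have "coeffs_in R (char_poly A)"
    by (rule char_poly_coeffs_in[OF R A]) (use a(1) eX in \<open>auto simp: A_def\<close>)
  ultimately show ?thesis using degree_monic_char_poly[OF A] by auto
qed

subsection \<open>Integrality\<close>

definition int_scale :: "int \<Rightarrow> complex \<Rightarrow> complex" where
  "int_scale n z = of_int n * z"

interpretation zmod: Modules.module int_scale
  by unfold_locales (auto simp: algebra_simps int_scale_def)

text \<open>The multiplier ring of the \<int>-module spanned by \<open>X\<close>. For finite
  \<open>X\<close> containing 1, membership certifies integrality, and closure of the integers under
  ring operations reduces to this set being a ring.\<close>

definition mult_stab :: "complex set \<Rightarrow> complex set" where
  "mult_stab X = {z. \<forall>x\<in>X. z * x \<in> zmod.span X}"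

lemma mult_stab_span: "x \<in> zmod.span X \<Longrightarrow> z \<in> mult_stab X \<Longrightarrow> z * x \<in> zmod.span X"
proof (induction x rule: zmod.span_induct_alt)
  case base
  then show ?case by (simp add: zmod.span_zero)
next
  case (step c x y)
  have "z * (int_scale c x + y) = int_scale c (z * x) + z * y" by (simp add: algebra_simps int_scale_def)
  then show ?case using step zmod.span_add[OF zmod.span_scale[of "z * x" X c]]
    by (auto simp: mult_stab_def)
qed

lemma subring_mult_stab: "subring_set (mult_stab X)"
proof
  fix a b assume "a \<in> mult_stab X" "b \<in> mult_stab X"
  then show "a * b \<in> mult_stab X" "a + b \<in> mult_stab X" "- a \<in> mult_stab X"
    using mult_stab_span[of _ X a] zmod.span_neg
    by (auto simp: mult_stab_def mult.assoc distrib_right intro: zmod.span_add)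
qed (auto simp: mult_stab_def zmod.span_base zmod.span_zero)

lemma mult_stab_algebraic_int:
  assumes "finite X" "1 \<in> X" "z \<in> mult_stab X"
  shows "algebraic_int z"
proof -
  have "\<exists>a. (\<forall>y. a y \<in> \<int>) \<and> z * x = (\<Sum>y\<in>X. a y * y)" if x: "x \<in> X" for x
  proof -
    from assms x have "z * x \<in> zmod.span X" by (auto simp: mult_stab_def)
    then obtain u where "z * x = (\<Sum>v\<in>X. of_int (u v) * v)"
      using zmod.span_finite[OF assms(1)] by (auto simp: int_scale_def)
    then show ?thesis by (intro exI[of _ "\<lambda>y. of_int (u y)"]) auto
  qed
  from stable_module_root[OF subring_Ints assms(1,2) _ this]
  obtain p where "coeffs_in \<int> p" "lead_coeff p = 1" "poly p z = 0" by auto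
  then show ?thesis by (intro algebraic_int.intros[of p]) (auto simp: coeffs_in_def)
qed

text \<open>The products of elements of \<open>X\<close> with powers of \<open>z\<close> below the
  degree of \<open>p\<close> span a module on which the old multipliers still act. Multiplication by
  \<open>z\<close> also preserves it, because \<open>p\<close> is monic and rewrites the first
  missing power.\<close>

lemma mult_stab_adjoin:
  assumes X: "finite X" "1 \<in> X" and p: "coeffs_in (mult_stab X) p" "lead_coeff p = 1" "poly p z = 0"
  shows "\<exists>Y. finite Y \<and> 1 \<in> Y \<and> mult_stab X \<subseteq> mult_stab Y \<and> z \<in> mult_stab Y"
proof -
  define m where "m = degree p"
  have m: "m > 0" using p by (intro Nat.gr0I) (auto simp: m_def elim!: degree_eq_zeroE)
  define Y where "Y = (\<lambda>(x,j). x * z ^ j) ` (X \<times> {..<m})"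
  have fin: "finite Y" using X by (auto simp: Y_def)
  have "1 \<in> Y" unfolding Y_def using X m by (intro image_eqI[of _ _ "(1, 0)"]) auto
  have sp: "x * z ^ j \<in> zmod.span Y" if "x \<in> zmod.span X" "j < m" for x j
    using that
  proof (induction x rule: zmod.span_induct_alt)
    case base
    then show ?case by (simp add: zmod.span_zero)
  next
    case (step c x y)
    have "(int_scale c x + y) * z ^ j = int_scale c (x * z ^ j) + y * z ^ j" by (simp add: algebra_simps int_scale_def)
    moreover have "x * z ^ j \<in> Y" using step by (auto simp: Y_def)
    ultimately show ?case using step by (auto intro: zmod.span_add zmod.span_scale zmod.span_base)
  qed
  have "mult_stab X \<subseteq> mult_stab Y"
  proof
    fix w assume w: "w \<in> mult_stab X"
    show "w \<in> mult_stab Y" unfolding mult_stab_def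
    proof safe
      fix y assume "y \<in> Y"
      then obtain x j where y: "y = x * z ^ j" "x \<in> X" "j < m" by (auto simp: Y_def)
      have "w * x \<in> zmod.span X" using w y by (auto simp: mult_stab_def)
      from sp[OF this y(3)] show "w * y \<in> zmod.span Y" by (simp add: y mult.assoc)
    qed
  qed
  moreover have "z \<in> mult_stab Y" unfolding mult_stab_def
  proof safe
    fix y assume "y \<in> Y"
    then obtain x j where y: "y = x * z ^ j" "x \<in> X" "j < m" by (auto simp: Y_def)
    show "z * y \<in> zmod.span Y"
    proof (cases "Suc j < m")
      case True
      have "x * z ^ Suc j \<in> Y" unfolding Y_def using y True by (intro image_eqI[of _ _ "(x, Suc j)"]) auto
      then show ?thesis by (simp add: y zmod.span_base mult_ac)
    next
      case False
      then have j: "Suc j = m" using y by simp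
      have "0 = (\<Sum>i\<le>m. coeff p i * z ^ i)" using p by (simp add: poly_altdef m_def)
      also have "{..m} = insert m {..<m}" by auto
      finally have zm: "z ^ m = - (\<Sum>i<m. coeff p i * z ^ i)"
        using p by (simp add: m_def add_eq_0_iff2)
      have "z * y = x * z ^ m" by (simp add: y j[symmetric])
      also have "\<dots> = (\<Sum>i<m. (- (coeff p i * x)) * z ^ i)"
        unfolding zm sum_negf[symmetric] sum_distrib_left by (rule sum.cong) auto
      also have "\<dots> \<in> zmod.span Y"
        using p y by (intro zmod.span_sum sp zmod.span_neg) (auto simp: coeffs_in_def mult_stab_def)
      finally show ?thesis .
    qed
  qed
  ultimately show ?thesis using fin \<open>1 \<in> Y\<close> by blast
qed

text \<open>Adjoining one element after another keeps the earlier multipliers. A single module for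
  the whole set matters because both operands of a sum or product must lie in the same ring.\<close>

lemma algebraic_int_stab:
  assumes "finite S" "\<And>z. z \<in> S \<Longrightarrow> algebraic_int z"
  shows "\<exists>X. finite X \<and> 1 \<in> X \<and> S \<subseteq> mult_stab X"
  using assms
proof (induction S rule: finite_induct)
  case (insert z S)
  then obtain X where X: "finite X" "1 \<in> X" "S \<subseteq> mult_stab X" by auto
  interpret subring_set "mult_stab X" by (rule subring_mult_stab)
  from insert have "algebraic_int z" by auto
  then obtain p where p: "lead_coeff p = 1" "\<forall>i. coeff p i \<in> \<int>" "poly p z = 0"
    by (auto elim: algebraic_int.cases)
  have "coeffs_in (mult_stab X) p" unfolding coeffs_in_def
  proof
    fix i show "coeff p i \<in> mult_stab X" using p(2) by (metis Ints_cases of_int)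
  qed
  from mult_stab_adjoin[OF X(1,2) this p(1,3)] X(3) show ?case by blast
qed (auto intro: exI[of _ "{1}"])

lemma subring_algebraic_int: "subring_set {z::complex. algebraic_int z}"
proof
  fix a b :: complex assume ab: "a \<in> {z. algebraic_int z}" "b \<in> {z. algebraic_int z}"
  then obtain X where X: "finite X" "1 \<in> X" "{a,b} \<subseteq> mult_stab X"
    using algebraic_int_stab[of "{a,b}"] by auto
  interpret subring_set "mult_stab X" by (rule subring_mult_stab)
  show "a + b \<in> {z. algebraic_int z}" "a * b \<in> {z. algebraic_int z}"
    using X mult_stab_algebraic_int[OF X(1,2)] by auto
qed auto

interpretation AI: subring_set "{z::complex. algebraic_int z}"
  by (rule subring_algebraic_int)

lemma algebraic_int_mult: "algebraic_int (a::complex) \<Longrightarrow> algebraic_int b \<Longrightarrow> algebraic_int (a * b)"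
  using AI.mult unfolding mem_Collect_eq .

lemma algebraic_int_add: "algebraic_int (a::complex) \<Longrightarrow> algebraic_int b \<Longrightarrow> algebraic_int (a + b)"
  using AI.add unfolding mem_Collect_eq .

lemma algebraic_int_power: "algebraic_int (a::complex) \<Longrightarrow> algebraic_int (a ^ n)"
  using AI.power unfolding mem_Collect_eq .

lemma algebraic_int_of_nat: "algebraic_int (of_nat n :: complex)"
  using AI.of_nat unfolding mem_Collect_eq .

text \<open>Transitivity of integrality: all coefficients lie in one multiplier ring, and adjoining
  the root enlarges the module but keeps it finitely generated.\<close>

lemma algebraic_int_monic_root:
  fixes z :: complex
  assumes "coeffs_in {z. algebraic_int z} p" "lead_coeff p = 1" "poly p z = 0"
  shows "algebraic_int z"
proof -
  have "\<exists>X. finite X \<and> 1 \<in> X \<and> set (coeffs p) \<subseteq> mult_stab X"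
    by (rule algebraic_int_stab) (use assms(1) in \<open>auto simp: coeffs_in_def coeffs_def split: if_splits\<close>)
  then obtain X where X: "finite X" "1 \<in> X" "set (coeffs p) \<subseteq> mult_stab X"
    by blast
  interpret subring_set "mult_stab X" by (rule subring_mult_stab)
  have "coeff p i \<in> mult_stab X" for i
  proof (cases "coeff p i = 0")
    case False
    then have "coeff p i \<in> set (coeffs p)" by (intro coeff_in_coeffs le_degree) auto
    then show ?thesis using X(3) by auto
  qed simp
  then have "coeffs_in (mult_stab X) p" by (simp add: coeffs_in_def)
  from mult_stab_adjoin[OF X(1,2) this assms(2,3)] obtain Y where "finite Y" "1 \<in> Y" "z \<in> mult_stab Y"
    by blast
  then show ?thesis by (rule mult_stab_algebraic_int)
qed

text \<open>With leading coefficient a and degree n, multiplying the equation by a^(n-1) turns it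
  into a monic one for a * z. The polynomial \<open>q\<close> in the proof is this rescaled
  equation.\<close>

lemma algebraic_int_lead_coeff_mult:
  fixes z :: complex
  assumes c: "coeffs_in {z. algebraic_int z} p" and "p \<noteq> 0" and z: "poly p z = 0"
  shows "algebraic_int (lead_coeff p * z)"
proof -
  define a where "a = lead_coeff p"
  have a: "a \<noteq> 0" "algebraic_int a" using assms by (auto simp: a_def coeffs_in_def)
  define n where "n = degree p"
  have n: "n > 0"
  proof (rule Nat.gr0I)
    assume "n = 0"
    then obtain c where "p = [:c:]" using degree_eq_zeroE[of p] unfolding n_def by blast
    then show False using assms(2) z by simp
  qed
  define q where "q = monom 1 n + (\<Sum>i<n. monom (coeff p i * a ^ (n - 1 - i)) i)"
  have coeffq: "coeff q i = (if i = n then 1 else if i < n then coeff p i * a ^ (n - 1 - i) else 0)" for i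
    by (auto simp: q_def coeff_sum sum.delta' cong: if_cong)
  have dq: "degree q = n"
  proof (rule antisym)
    show "degree q \<le> n" by (rule degree_le) (auto simp: coeffq)
    show "n \<le> degree q" by (rule le_degree) (auto simp: coeffq)
  qed
  have e: "coeff q i * (a * z) ^ i = a ^ (n - 1) * (coeff p i * z ^ i)" if i: "i \<le> n" for i
  proof (cases "i = n")
    case True
    have "a ^ n = a ^ (n - 1) * a" using n by (cases n) auto
    moreover have "coeff p n = a" by (simp add: a_def n_def)
    moreover have "coeff q i = 1" using True by (simp add: coeffq)
    ultimately show ?thesis unfolding True power_mult_distrib by (simp add: mult_ac del: power_Suc)
  next
    case False
    then have "n - 1 = (n - 1 - i) + i" using i by simp
    then have "a ^ (n - 1) = a ^ (n - 1 - i) * a ^ i" by (metis power_add)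
    moreover have "coeff q i = coeff p i * a ^ (n - 1 - i)" using False i by (simp add: coeffq)
    ultimately show ?thesis unfolding power_mult_distrib by (simp add: mult_ac)
  qed
  have "poly q (a * z) = (\<Sum>i\<le>n. a ^ (n - 1) * (coeff p i * z ^ i))"
    unfolding poly_altdef dq by (rule sum.cong) (auto simp: e)
  also have "\<dots> = a ^ (n - 1) * poly p z" by (simp add: poly_altdef n_def sum_distrib_left)
  finally have "poly q (a * z) = 0" using z by simp
  moreover have "coeffs_in {z. algebraic_int z} q"
    using a(2) c unfolding coeffs_in_def coeffq
    by (auto intro: algebraic_int_mult algebraic_int_power)
  moreover have "lead_coeff q = 1" by (simp add: dq coeffq)
  ultimately have "algebraic_int (a * z)" by (intro algebraic_int_monic_root)
  then show ?thesis by (simp only: a_def)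
qed

lemma algebraic_imp_multiple:
  fixes z :: complex
  assumes "algebraic z"
  shows "\<exists>m::nat. m > 0 \<and> algebraic_int (of_nat m * z)"
proof -
  from assms obtain p where p: "p \<noteq> 0" "poly (map_poly of_int p) z = 0" by (elim algebraicE')
  define a where "a = lead_coeff p"
  have a: "a \<noteq> 0" using p by (simp add: a_def)
  have *: "algebraic_int (lead_coeff (map_poly of_int p) * z)"
    by (rule algebraic_int_lead_coeff_mult) (use p in \<open>auto simp: coeffs_in_def\<close>)
  have "degree (map_poly of_int p :: complex poly) = degree p"
    by (rule degree_map_poly) simp
  then have "lead_coeff (map_poly of_int p) = (of_int a :: complex)"
    by (simp only: a_def coeff_map_poly of_int_0)
  then have "algebraic_int (of_int a * z)" using * by (simp only:)
  then have "algebraic_int (of_int \<bar>a\<bar> * z)"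
    using algebraic_int_minus[of "of_int a * z"] by (cases "a \<ge> 0") simp_all
  moreover have "of_nat (nat \<bar>a\<bar>) = (of_int \<bar>a\<bar> :: complex)"
    by (rule of_nat_nat) simp
  ultimately have "algebraic_int (of_nat (nat \<bar>a\<bar>) * z)" by (simp only:)
  moreover have "nat \<bar>a\<bar> > 0" using a by simp
  ultimately show ?thesis by blast
qed

lemma algebraic_if_multiple:
  fixes z :: complex
  assumes m: "(m::nat) > 0" "algebraic_int (of_nat m * z)"
  shows "algebraic z"
proof -
  from algebraic_int_imp_algebraic[OF m(2)] obtain p where p: "\<And>i. coeff p i \<in> \<int>" "p \<noteq> 0" "poly p (of_nat m * z) = 0"
    unfolding algebraic_def by blast
  define q where "q = pcompose p [:0, of_nat m:]"
  interpret Z: subring_set "\<int> :: complex set" by (rule subring_Ints)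
  have "coeffs_in \<int> [:0, of_nat m :: complex:]"
    unfolding Z.coeffs_in_pCons by (simp add: coeffs_in_def)
  then have "coeffs_in \<int> q" unfolding q_def
    using p(1) by (intro Z.coeffs_in_pcompose) (auto simp: coeffs_in_def)
  moreover have "q \<noteq> 0"
    using p(2) m(1) pcompose_eq_0[of p "[:0, of_nat m:]"] by (auto simp: q_def)
  moreover have "poly q z = 0" using p(3) by (simp add: q_def poly_pcompose mult.commute)
  ultimately show "algebraic z" by (intro algebraicI[of q]) (auto simp: coeffs_in_def)
qed

lemma common_denominator:
  assumes "finite S" "\<And>z. z \<in> S \<Longrightarrow> algebraic (z::complex)"
  shows "\<exists>m::nat. m > 0 \<and> (\<forall>z\<in>S. algebraic_int (of_nat m * z))"
  using assms
proof (induction S rule: finite_induct)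
  case (insert z S)
  then obtain m :: nat where m: "m > 0" "\<forall>z\<in>S. algebraic_int (of_nat m * z)" by auto
  from insert obtain k :: nat where k: "k > 0" "algebraic_int (of_nat k * z)"
    using algebraic_imp_multiple[of z] by blast
  have "algebraic_int (of_nat (m * k) * w)" if "w \<in> insert z S" for w
  proof (cases "w = z")
    case True
    have "algebraic_int (of_nat m * (of_nat k * z))"
      using k(2) by (rule algebraic_int_mult[OF algebraic_int_of_nat])
    then show ?thesis using True by (simp only: of_nat_mult mult.assoc)
  next
    case False
    then have "algebraic_int (of_nat k * (of_nat m * w))"
      using that m by (intro algebraic_int_mult[OF algebraic_int_of_nat, of "of_nat m * w"]) auto
    then show ?thesis by (simp only: of_nat_mult mult_ac)
  qed
  then show ?case using m k by (intro exI[of _ "m * k"]) auto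
qed (auto intro: exI[of _ 1])

lemma subring_algebraic: "subring_set {z::complex. algebraic z}"
proof
  fix a b :: complex assume ab: "a \<in> {z. algebraic z}" "b \<in> {z. algebraic z}"
  have "\<exists>m::nat. m > 0 \<and> (\<forall>z\<in>{a,b}. algebraic_int (of_nat m * z))"
    by (rule common_denominator) (use ab in auto)
  then obtain m :: nat where m: "m > 0" "algebraic_int (of_nat m * a)" "algebraic_int (of_nat m * b)"
    by blast
  have "algebraic_int (of_nat m * (a + b))"
    using algebraic_int_add[OF m(2,3)] by (simp only: distrib_left)
  from algebraic_if_multiple[OF m(1) this] show "a + b \<in> {z. algebraic z}" by simp
  have "algebraic_int (of_nat (m * m) * (a * b))"
    using algebraic_int_mult[OF m(2,3)] by (simp only: of_nat_mult mult_ac)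
  from algebraic_if_multiple[OF _ this] show "a * b \<in> {z. algebraic z}" using m(1) by simp
qed auto

interpretation AN: subring_set "{z::complex. algebraic z}"
  by (rule subring_algebraic)

lemma algebraic_divide: "algebraic (a::complex) \<Longrightarrow> algebraic b \<Longrightarrow> algebraic (a / b)"
  using AN.mult[of a "inverse b"] by (simp add: divide_inverse algebraic_inverse)

text \<open>After clearing denominators the leading coefficient times the root is integral, and
  dividing by the leading coefficient stays algebraic. Thus the algebraic numbers are algebraically
  closed.\<close>

lemma algebraic_poly_root:
  fixes z :: complex
  assumes "coeffs_in {z. algebraic z} p" "p \<noteq> 0" "poly p z = 0"
  shows "algebraic z"
proof -
  have "\<exists>m::nat. m > 0 \<and> (\<forall>z\<in>set (coeffs p). algebraic_int (of_nat m * z))"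
    by (rule common_denominator) (use assms in \<open>auto simp: coeffs_in_def coeffs_def split: if_splits\<close>)
  then obtain m :: nat where m: "m > 0" "\<forall>z\<in>set (coeffs p). algebraic_int (of_nat m * z)"
    by blast
  define q where "q = smult (of_nat m) p"
  have mi: "algebraic_int (of_nat m * coeff p i)" for i
  proof (cases "coeff p i = 0")
    case False
    then have "coeff p i \<in> set (coeffs p)" by (intro coeff_in_coeffs le_degree) auto
    then show ?thesis using m by auto
  qed simp
  have q: "coeffs_in {z. algebraic_int z} q" "q \<noteq> 0" "poly q z = 0"
    using mi m assms by (auto simp: q_def coeffs_in_def)
  have "algebraic (lead_coeff q * z / lead_coeff q)"
    using algebraic_int_lead_coeff_mult[OF q] q(1)
    by (intro algebraic_divide algebraic_int_imp_algebraic) (auto simp: coeffs_in_def)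
  then show ?thesis using q(2) by simp
qed

context subring_set
begin

lemma coeffs_in_0 [simp]: "coeffs_in R 0"
  by (simp add: coeffs_in_def)

lemma coeffs_in_1 [simp]: "coeffs_in R 1"
  by (simp add: coeffs_in_def coeff_1)

end

section \<open>Subfields of the complex numbers and number fields\<close>

locale csubfield = subring_set K for K :: "complex set" +
  assumes inverse [intro]: "x \<in> K \<Longrightarrow> inverse x \<in> K"
begin

lemma divide [intro]: "x \<in> K \<Longrightarrow> y \<in> K \<Longrightarrow> x / y \<in> K"
  unfolding divide_inverse by auto

lemma of_rat [intro, simp]: "of_rat q \<in> K"
  by (cases q) (auto simp: of_rat_rat)

lemma Rats_subset: "\<rat> \<subseteq> K"
  by (auto simp: Rats_def)

lemma coeffs_in_Rats: "coeffs_in \<rat> p \<Longrightarrow> coeffs_in K p"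
  using Rats_subset by (auto simp: coeffs_in_def)

end

lemma csubfield_Rats: "csubfield \<rat>"
  by (intro csubfield.intro subring_Rats csubfield_axioms.intro) auto

lemma field_complex_ring: "field (complex_ring UNIV)"
proof (rule cring.cring_fieldI2)
  show "cring (complex_ring UNIV)"
    by (intro cringI abelian_groupI comm_monoidI)
      (auto simp: complex_ring_def algebra_simps intro: exI[of _ "- x" for x])
  show "\<exists>b\<in>carrier (complex_ring UNIV). a \<otimes>\<^bsub>complex_ring UNIV\<^esub> b = \<one>\<^bsub>complex_ring UNIV\<^esub>"
    if "a \<noteq> \<zero>\<^bsub>complex_ring UNIV\<^esub>" for a
    using that by (auto simp: complex_ring_def intro: exI[of _ "inverse a"])
qed (auto simp: complex_ring_def)

lemma complex_ring_simps [simp]: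
  "carrier (complex_ring A) = A" "x \<otimes>\<^bsub>complex_ring A\<^esub> y = x * y" "x \<oplus>\<^bsub>complex_ring A\<^esub> y = x + y"
  "\<one>\<^bsub>complex_ring A\<^esub> = 1" "\<zero>\<^bsub>complex_ring A\<^esub> = 0"
  by (simp_all add: complex_ring_def)

lemma complex_ring_neg: "\<ominus>\<^bsub>complex_ring UNIV\<^esub> x = - x"
proof -
  interpret field "complex_ring UNIV" by (rule field_complex_ring)
  show ?thesis by (rule minus_equality) auto
qed

lemma complex_ring_inv: "x \<noteq> 0 \<Longrightarrow> inv\<^bsub>complex_ring UNIV\<^esub> x = inverse x"
proof -
  assume "x \<noteq> 0"
  interpret field "complex_ring UNIV" by (rule field_complex_ring)
  show ?thesis using \<open>x \<noteq> 0\<close> by (intro comm_inv_char) auto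
qed

lemma subfield_complex_iff: "subfield K (complex_ring UNIV) \<longleftrightarrow> csubfield K"
proof
  assume K: "subfield K (complex_ring UNIV)"
  interpret F: field "complex_ring UNIV" by (rule field_complex_ring)
  note E = subringE[OF subfieldE(1)[OF K]]
  show "csubfield K"
  proof
    fix x assume x: "x \<in> K"
    show "inverse x \<in> K"
    proof (cases "x = 0")
      case False
      then show ?thesis using F.subfield_m_inv(1)[OF K, of x] x complex_ring_inv[of x] by auto
    qed (use x in auto)
  qed (use E in \<open>auto simp: complex_ring_neg\<close>)
next
  assume "csubfield K"
  then interpret K: csubfield K .
  interpret F: field "complex_ring UNIV" by (rule field_complex_ring)
  show "subfield K (complex_ring UNIV)"
  proof (rule F.subfieldI')
    show "subring K (complex_ring UNIV)"
      by (rule F.subringI) (auto simp: complex_ring_neg)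
  qed (auto simp: complex_ring_inv)
qed

interpretation Q: Vector_Spaces.vector_space rat_scale
  by unfold_locales (auto simp: algebra_simps of_rat_add of_rat_mult)

lemma number_field_iff: "number_field K \<longleftrightarrow> csubfield K \<and> (\<exists>B. finite B \<and> K = Q.span B)"
  unfolding number_field_def subfield_complex_iff ..

lemma csubfield_subspace: "csubfield K \<Longrightarrow> Q.subspace K"
proof -
  assume "csubfield K"
  then interpret csubfield K .
  show ?thesis by (rule Q.subspaceI) auto
qed

lemma number_field_csubfield: "number_field K \<Longrightarrow> csubfield K"
  by (simp add: number_field_iff)

text \<open>Multiplication by \<open>z\<close> preserves the span of \<open>B\<close>, so the
  determinant trick over the rationals applies. The span contains 1, hence \<open>B\<close> has the
  nonzero member that the trick requires.\<close>

lemma number_field_algebraic: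
  assumes "number_field K" "z \<in> K"
  shows "algebraic z"
proof -
  obtain B where B: "finite B" "K = Q.span B" and K: "csubfield K"
    using assms(1) by (auto simp: number_field_iff)
  interpret csubfield K by fact
  have "\<not> B \<subseteq> {0}"
  proof
    assume "B \<subseteq> {0}"
    then have "Q.span B \<subseteq> Q.span {0}" by (rule Q.span_mono)
    moreover have "Q.span {0} = {0 :: complex}" by simp
    ultimately show False using one B(2) by auto
  qed
  then obtain x0 where x0: "x0 \<in> B" "x0 \<noteq> 0" by auto
  have "\<exists>a. (\<forall>y. a y \<in> \<rat>) \<and> z * x = (\<Sum>y\<in>B. a y * y)" if x: "x \<in> B" for x
  proof -
    have "x \<in> K" unfolding B(2) using x by (rule Q.span_base)
    then have "z * x \<in> K" using assms(2) by (intro mult)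
    then have "z * x \<in> Q.span B" unfolding B(2) .
    then obtain u where "z * x = (\<Sum>v\<in>B. of_rat (u v) * v)"
      using Q.span_finite[OF B(1)] by auto
    then show ?thesis by (intro exI[of _ "\<lambda>y. of_rat (u y)"]) auto
  qed
  from stable_module_root[OF subring_Rats B(1) x0 this]
  obtain p where "coeffs_in \<rat> p" "lead_coeff p = 1" "poly p z = 0" by auto
  then show ?thesis by (intro algebraicI'[of p]) (auto simp: coeffs_in_def)
qed

subsection \<open>Minimal polynomials\<close>

text \<open>The monic generator of the ideal of polynomials over \<open>K\<close> vanishing at
  \<open>z\<close>. Divisibility is the form in which minimality is applied throughout.\<close>

definition is_min_poly :: "complex set \<Rightarrow> complex \<Rightarrow> complex poly \<Rightarrow> bool" where
  "is_min_poly K z f \<longleftrightarrow> coeffs_in K f \<and> lead_coeff f = 1 \<and> poly f z = 0 \<and>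
     (\<forall>p. coeffs_in K p \<and> poly p z = 0 \<longrightarrow> (\<exists>q. coeffs_in K q \<and> p = q * f))"

lemma is_min_polyD:
  assumes "is_min_poly K z f" "coeffs_in K p" "poly p z = 0"
  shows "\<exists>q. coeffs_in K q \<and> p = q * f"
  using assms unfolding is_min_poly_def by blast

lemma algebraic_rat_poly:
  assumes "algebraic (z::complex)"
  shows "\<exists>p. coeffs_in \<rat> p \<and> p \<noteq> 0 \<and> poly p z = 0"
  using assms unfolding algebraic_altdef coeffs_in_def by blast

context csubfield
begin

lemma ex_min_poly:
  assumes z: "algebraic z"
  shows "\<exists>f. is_min_poly K z f"
proof -
  define P where "P = (\<lambda>p. coeffs_in K p \<and> p \<noteq> 0 \<and> poly p z = 0)"
  have "\<exists>p. P p" using algebraic_rat_poly[OF z] coeffs_in_Rats unfolding P_def by blast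
  then obtain f0 where f0: "P f0" and min: "\<And>p. P p \<Longrightarrow> degree f0 \<le> degree p"
    using ex_has_least_nat[of P _ degree] by blast
  define f where "f = smult (inverse (lead_coeff f0)) f0"
  have c: "coeffs_in K f" unfolding f_def
    using f0 by (intro coeffs_in_smult inverse) (auto simp: P_def coeffs_in_def)
  have l: "lead_coeff f = 1" using f0 by (simp add: f_def P_def)
  have d: "degree f = degree f0" using f0 by (simp add: f_def P_def)
  have r: "poly f z = 0" using f0 by (simp add: f_def P_def)
  have "\<exists>q. coeffs_in K q \<and> p = q * f" if p: "coeffs_in K p" "poly p z = 0" for p
  proof -
    obtain q r where qr: "coeffs_in K q" "coeffs_in K r" "p = q * f + r" "r = 0 \<or> degree r < degree f"
      using monic_division[OF c l p(1)] by blast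
    have "poly r z = 0" using qr(3) p(2) \<open>poly f z = 0\<close> by simp
    have "r = 0"
    proof (rule ccontr)
      assume "r \<noteq> 0"
      then have "P r" using qr(2) \<open>poly r z = 0\<close> by (simp add: P_def)
      from min[OF this] show False using qr(4) d \<open>r \<noteq> 0\<close> by simp
    qed
    then show ?thesis using qr by auto
  qed
  then show ?thesis using c l r unfolding is_min_poly_def by blast
qed

text \<open>Write f = q * g. The number \<open>z\<close> is a root of \<open>g\<close> or of
  \<open>q\<close>. In the first case \<open>f\<close> and \<open>g\<close> divide each other; in
  the second \<open>f\<close> divides \<open>q\<close>, and \<open>g\<close> would be
  constant.\<close>

lemma min_poly_root_eq:
  assumes f: "is_min_poly K z f" and w: "poly f w = 0" and g: "is_min_poly K w g"
  shows "g = f"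
proof -
  from f g w obtain q where q: "coeffs_in K q" "f = q * g"
    unfolding is_min_poly_def by blast
  have nz: "f \<noteq> 0" "g \<noteq> 0" using f g unfolding is_min_poly_def by auto
  have "q \<noteq> 0" using q nz by auto
  have lq: "lead_coeff q = 1" using f g q by (simp add: is_min_poly_def lead_coeff_mult)
  have "poly q z * poly g z = 0" using f q by (simp add: is_min_poly_def)
  then consider "poly g z = 0" | "poly q z = 0" by auto
  then show ?thesis
  proof cases
    case 1
    then obtain q' where "g = q' * f" using f g unfolding is_min_poly_def by blast
    then have "degree g = degree q' + degree f" using nz by (auto simp: degree_mult_eq)
    moreover have "degree f = degree q + degree g" using q nz \<open>q \<noteq> 0\<close> by (simp add: degree_mult_eq)
    ultimately have "degree q = 0" by simp
    then have "q = 1" using lq by (metis degree_0_id monom_eq_1 monom_0 of_nat_1 one_pCons)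
    then show ?thesis using q by simp
  next
    case 2
    then obtain q' where "q = q' * f" using f q unfolding is_min_poly_def by blast
    then have "degree f \<le> degree q" using \<open>q \<noteq> 0\<close> by (auto simp: degree_mult_eq)
    moreover have "degree f = degree q + degree g" using q nz \<open>q \<noteq> 0\<close> by (simp add: degree_mult_eq)
    ultimately have "degree g = 0" by simp
    then obtain c where "g = [:c:]" by (rule degree_eq_zeroE)
    then show ?thesis using g nz by (auto simp: is_min_poly_def)
  qed
qed

lemma min_poly_algebraic:
  assumes "\<And>x. x \<in> K \<Longrightarrow> algebraic x" "is_min_poly K z f" "poly f w = 0"
  shows "algebraic w"
proof (rule algebraic_poly_root)
  show "coeffs_in {z. algebraic z} f" "f \<noteq> 0" using assms by (auto simp: is_min_poly_def coeffs_in_def)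
qed fact

text \<open>Separability: \<open>f\<close> is also the minimal polynomial of \<open>w\<close>, so a
  derivative vanishing at \<open>w\<close> would be a nonzero multiple of \<open>f\<close> of
  smaller degree.\<close>

lemma min_poly_order:
  assumes K: "\<And>x. x \<in> K \<Longrightarrow> algebraic x" and f: "is_min_poly K z f" and w: "poly f w = 0"
  shows "order w f = 1"
proof -
  have fw: "is_min_poly K w f"
    using min_poly_root_eq[OF f w] ex_min_poly[OF min_poly_algebraic[OF K f w]] by auto
  have f0: "f \<noteq> 0" using f by (auto simp: is_min_poly_def)
  have "degree f \<noteq> 0"
  proof
    assume "degree f = 0"
    then obtain c where "f = [:c:]" by (rule degree_eq_zeroE)
    then show False using f0 w by simp
  qed
  have cin: "coeffs_in K (pderiv f)"
    using f by (auto simp: is_min_poly_def coeffs_in_def coeff_pderiv simp del: of_nat_Suc)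
  have "poly (pderiv f) w \<noteq> 0"
  proof
    assume "poly (pderiv f) w = 0"
    then obtain q where q: "pderiv f = q * f" using fw cin unfolding is_min_poly_def by blast
    have "pderiv f \<noteq> 0" using \<open>degree f \<noteq> 0\<close> by (simp add: pderiv_eq_0_iff)
    then have "degree f \<le> degree (pderiv f)" using q f0 by (auto simp: degree_mult_eq)
    then show False using degree_pderiv[of f] \<open>degree f \<noteq> 0\<close> by simp
  qed
  then have "order w (pderiv f) = 0" by (simp add: order_0I)
  moreover have "order w f \<noteq> 0" using f0 w order_root[of f w] by simp
  moreover have "pderiv f \<noteq> 0" using \<open>degree f \<noteq> 0\<close> by (simp add: pderiv_eq_0_iff)
  ultimately show ?thesis using order_pderiv[of f w] f0 w by simp
qed

lemma card_min_poly_roots: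
  assumes K: "\<And>x. x \<in> K \<Longrightarrow> algebraic x" and f: "is_min_poly K z f"
  shows "card {w. poly f w = 0} = degree f"
proof -
  have f0: "f \<noteq> 0" using f by (auto simp: is_min_poly_def)
  have "proots f = mset_set {w. poly f w = 0}"
  proof (rule multiset_eqI)
    fix w show "count (proots f) w = count (mset_set {w. poly f w = 0}) w"
      using min_poly_order[OF K f, of w] f0 poly_roots_finite[OF f0] order_root[of f w]
      by (cases "poly f w = 0") auto
  qed
  then show ?thesis using size_proots_complex[of f] by simp
qed

end

subsection \<open>Simple extensions of the rationals\<close>

definition Q_adjoin :: "complex \<Rightarrow> complex set" where
  "Q_adjoin z = {poly p z | p. coeffs_in \<rat> p}"

interpretation RatF: csubfield "\<rat>" by (rule csubfield_Rats)
interpretation RP: subring_set "{p::complex poly. coeffs_in \<rat> p}" by (rule RatF.subring_coeffs_in)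

lemma in_Q_adjoin: "z \<in> Q_adjoin z"
  unfolding Q_adjoin_def
  by (rule CollectI, rule exI[of _ "[:0,1:]"]) (auto simp: RatF.coeffs_in_pCons)

lemma Q_adjoin_algebraic:
  assumes z: "algebraic z" and x: "x \<in> Q_adjoin z"
  shows "algebraic x"
proof -
  from x obtain p where p: "coeffs_in \<rat> p" "x = poly p z" by (auto simp: Q_adjoin_def)
  have "coeffs_in {z. algebraic z} p" using p(1) rat_imp_algebraic by (auto simp: coeffs_in_def)
  then show ?thesis using AN.poly_in[of p z] z p(2) by simp
qed

text \<open>A polynomial relation for \<open>x\<close> with nonzero constant term c has the form c +
  x * q(x) = 0, which exhibits the inverse of \<open>x\<close> as - q(x) / c.\<close>

lemma csubfield_Q_adjoin:
  assumes z: "algebraic z"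
  shows "csubfield (Q_adjoin z)"
proof -
  have sr: "subring_set (Q_adjoin z)"
  proof
    show "0 \<in> Q_adjoin z" unfolding Q_adjoin_def using RP.zero by (auto intro!: exI[of _ 0])
    show "1 \<in> Q_adjoin z" unfolding Q_adjoin_def using RP.one by (auto intro!: exI[of _ 1])
    fix a assume "a \<in> Q_adjoin z"
    then obtain p where p: "coeffs_in \<rat> p" "a = poly p z" by (auto simp: Q_adjoin_def)
    show "- a \<in> Q_adjoin z" unfolding Q_adjoin_def using p RP.neg by (auto intro!: exI[of _ "- p"])
    fix b assume "b \<in> Q_adjoin z"
    then obtain q where q: "coeffs_in \<rat> q" "b = poly q z" by (auto simp: Q_adjoin_def)
    show "a + b \<in> Q_adjoin z" unfolding Q_adjoin_def using p q RP.add by (auto intro!: exI[of _ "p + q"])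
    show "a * b \<in> Q_adjoin z" unfolding Q_adjoin_def using p q RP.mult by (auto intro!: exI[of _ "p * q"])
  qed
  interpret subring_set "Q_adjoin z" by fact
  have Rats: "c \<in> Q_adjoin z" if "c \<in> \<rat>" for c
    unfolding Q_adjoin_def using that RP.zero by (auto intro!: exI[of _ "[:c:]"] simp: RatF.coeffs_in_pCons)
  note alg = Q_adjoin_algebraic[OF z]
  have "inverse x \<in> Q_adjoin z" if x: "x \<in> Q_adjoin z" for x
  proof (cases "x = 0")
    case False
    then obtain p where p: "p \<noteq> 0" "coeff p 0 \<noteq> 0" "poly (map_poly of_int p) x = 0"
      using algebraicE'_nonzero[OF alg[OF x]] by metis
    obtain c q where cq: "p = pCons c q" by (cases p)
    define q' :: "complex poly" where "q' = map_poly of_int q"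
    have q': "poly q' x \<in> Q_adjoin z"
      using x by (intro poly_in) (auto simp: q'_def coeffs_in_def)
    have "of_int c + x * poly q' x = 0"
    proof -
      have "map_poly of_int (pCons c q) = pCons (of_int c) q'"
        by (intro poly_eqI) (simp add: q'_def coeff_map_poly coeff_pCons split: nat.splits)
      then show ?thesis using p(3) by (simp add: cq)
    qed
    then have "x * (- poly q' x) = of_int c" by (simp add: add_eq_0_iff2)
    moreover have "c \<noteq> 0" using p(2) cq by simp
    ultimately have "inverse x = (- poly q' x) * inverse (of_int c)"
      using False by (simp add: field_simps)
    moreover have "inverse (of_int c) \<in> Q_adjoin z" by (rule Rats) auto
    ultimately show ?thesis using q' by auto
  qed (use x in auto)
  then show ?thesis using sr by (intro csubfield.intro csubfield_axioms.intro)
qed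

lemma Q_adjoin_subset: "csubfield K \<Longrightarrow> z \<in> K \<Longrightarrow> Q_adjoin z \<subseteq> K"
proof -
  assume K: "csubfield K" "z \<in> K"
  interpret csubfield K by fact
  show ?thesis using K by (auto simp: Q_adjoin_def intro!: poly_in coeffs_in_Rats)
qed

lemma Q_adjoin_eq_span:
  assumes f: "is_min_poly \<rat> z f"
  shows "Q_adjoin z = Q.span ((\<lambda>i. z ^ i) ` {..<degree f})"
    and "inj_on (\<lambda>i. z ^ i) {..<degree f}"
    and "Q.independent ((\<lambda>i. z ^ i) ` {..<degree f})"
proof -
  have f1: "coeffs_in \<rat> f" "lead_coeff f = 1" "poly f z = 0" using f by (auto simp: is_min_poly_def)
  have min: "p = 0" if "coeffs_in \<rat> p" "poly p z = 0" "degree p < degree f" for p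
  proof (rule ccontr)
    assume "p \<noteq> 0"
    from is_min_polyD[OF f that(1,2)] obtain q where "p = q * f" by blast
    then have "degree f \<le> degree p" using \<open>p \<noteq> 0\<close> by (auto simp: degree_mult_eq)
    then show False using that by simp
  qed
  show "Q_adjoin z = Q.span ((\<lambda>i. z ^ i) ` {..<degree f})"
  proof (intro equalityI subsetI)
    fix x assume "x \<in> Q_adjoin z"
    then obtain p where p: "coeffs_in \<rat> p" "x = poly p z" by (auto simp: Q_adjoin_def)
    obtain q r where qr: "coeffs_in \<rat> r" "p = q * f + r" "r = 0 \<or> degree r < degree f"
      using RatF.monic_division[OF f1(1,2) p(1)] by blast
    have "x = poly r z" using p qr f1 by simp
    also have "\<dots> = (\<Sum>i\<le>degree r. coeff r i * z ^ i)" by (rule poly_altdef)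
    also have "\<dots> \<in> Q.span ((\<lambda>i. z ^ i) ` {..<degree f})"
    proof (cases "r = 0")
      case False
      show ?thesis
      proof (rule Q.span_sum)
        fix i assume i: "i \<in> {..degree r}"
        obtain c where "coeff r i = of_rat c" using qr(1) by (auto simp: coeffs_in_def Rats_def)
        then show "coeff r i * z ^ i \<in> Q.span ((\<lambda>i. z ^ i) ` {..<degree f})"
          using i qr(3) False by (auto intro!: Q.span_scale[OF Q.span_base])
      qed
    qed (simp add: Q.span_zero)
    finally show "x \<in> Q.span ((\<lambda>i. z ^ i) ` {..<degree f})" .
  next
    fix x assume "x \<in> Q.span ((\<lambda>i. z ^ i) ` {..<degree f})"
    moreover have "algebraic z" using f1 by (intro algebraicI'[of f]) (auto simp: coeffs_in_def)
    then have "csubfield (Q_adjoin z)" by (rule csubfield_Q_adjoin)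
    then interpret csubfield "Q_adjoin z" .
    have "Q.span ((\<lambda>i. z ^ i) ` {..<degree f}) \<subseteq> Q_adjoin z"
      by (rule Q.span_minimal) (auto intro: in_Q_adjoin csubfield_subspace csubfield_axioms csubfield.intro subring_set_axioms)
    ultimately show "x \<in> Q_adjoin z" by auto
  qed
  have pol: "\<forall>i<degree f. c i = 0" if c: "\<And>i. c i \<in> \<rat>" "(\<Sum>i<degree f. c i * z ^ i) = 0" for c
  proof (cases "degree f = 0")
    case False
    define p where "p = (\<Sum>i<degree f. monom (c i) i)"
    have cp: "coeff p i = (if i < degree f then c i else 0)" for i
      by (auto simp: p_def coeff_sum sum.delta' cong: if_cong)
    have "degree p < degree f"
      using False by (intro degree_lessI) (auto simp: cp)
    then have "p = 0" using c by (intro min) (auto simp: coeffs_in_def cp, simp add: p_def poly_sum poly_monom)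
    then show ?thesis using cp by (metis coeff_0)
  qed auto
  show inj: "inj_on (\<lambda>i. z ^ i) {..<degree f}"
  proof (rule inj_onI, rule ccontr)
    fix i j assume ij: "i \<in> {..<degree f}" "j \<in> {..<degree f}" "z ^ i = z ^ j" "i \<noteq> j"
    \<comment> \<open>These are the coefficients of X^i - X^j, which would vanish at
      \<open>z\<close> in degree below that of the minimal polynomial.\<close>
    define c :: "nat \<Rightarrow> complex" where "c = (\<lambda>k. if k = i then 1 else if k = j then -1 else 0)"
    have "(\<Sum>k<degree f. c k * z ^ k) = (\<Sum>k\<in>{i,j}. c k * z ^ k)"
      using ij by (intro sum.mono_neutral_right) (auto simp: c_def)
    also have "\<dots> = 0" using ij by (simp add: c_def)
    finally have "\<forall>k<degree f. c k = 0" by (intro pol) (auto simp: c_def)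
    then show False using ij by (auto simp: c_def)
  qed
  show "Q.independent ((\<lambda>i. z ^ i) ` {..<degree f})"
  proof (rule Q.independent_if_scalars_zero)
    fix g x assume s: "(\<Sum>x\<in>(\<lambda>i. z ^ i) ` {..<degree f}. rat_scale (g x) x) = 0"
      and x: "x \<in> (\<lambda>i. z ^ i) ` {..<degree f}"
    have "(\<Sum>i<degree f. of_rat (g (z ^ i)) * z ^ i) = 0" using s inj by (simp add: sum.reindex)
    then have "\<forall>i<degree f. of_rat (g (z ^ i)) = (0::complex)" by (intro pol) auto
    then show "g x = 0" using x by auto
  qed auto
qed

lemma number_field_Q_adjoin:
  assumes "algebraic z"
  shows "number_field (Q_adjoin z)"
proof -
  obtain f where f: "is_min_poly \<rat> z f" using RatF.ex_min_poly[OF assms] by auto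
  show ?thesis unfolding number_field_iff
    using csubfield_Q_adjoin[OF assms] Q_adjoin_eq_span(1)[OF f] by blast
qed

lemma field_degree_Q_adjoin:
  assumes f: "is_min_poly \<rat> z f"
  shows "field_degree (Q_adjoin z) = degree f"
proof -
  have "field_degree (Q_adjoin z) = Q.dim ((\<lambda>i. z ^ i) ` {..<degree f})"
    unfolding field_degree_def Q_adjoin_eq_span(1)[OF f] by (rule Q.dim_span)
  also have "\<dots> = card ((\<lambda>i. z ^ i) ` {..<degree f})"
    by (rule Q.dim_eq_card_independent[OF Q_adjoin_eq_span(3)[OF f]])
  finally show ?thesis using card_image[OF Q_adjoin_eq_span(2)[OF f]] by simp
qed

text \<open>Choose \<open>t\<close> outside a finite set so that \<open>b\<close> is the only common
  root of \<open>g\<close> and of f(\<theta> - t X), where \<theta> = a + t b. Both are multiples of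
  the minimal polynomial of \<open>b\<close> over the field of \<theta>; being separable with a
  single root, that polynomial is linear.\<close>

lemma primitive_element_2:
  assumes a: "algebraic a" and b: "algebraic b"
  shows "\<exists>t::nat. a \<in> Q_adjoin (a + of_nat t * b) \<and> b \<in> Q_adjoin (a + of_nat t * b)"
proof -
  obtain f where f: "is_min_poly \<rat> a f" using RatF.ex_min_poly[OF a] by auto
  obtain g where g: "is_min_poly \<rat> b g" using RatF.ex_min_poly[OF b] by auto
  have fg0: "f \<noteq> 0" "g \<noteq> 0" using f g by (auto simp: is_min_poly_def)
  \<comment> \<open>Pairs with b' = b contribute the value 0 of a division by zero, which only
    excludes t = 0.\<close>
  define E where "E = (\<lambda>(a',b'). (a' - a) / (b - b')) ` ({w. poly f w = 0} \<times> {w. poly g w = 0})"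
  have "finite E" using fg0 poly_roots_finite by (auto simp: E_def)
  moreover have "infinite (range (of_nat :: nat \<Rightarrow> complex))"
    by (rule range_inj_infinite) (simp add: inj_of_nat)
  ultimately obtain t :: nat where t: "of_nat t \<notin> E" by (metis finite_subset image_subsetI)
  define \<theta> where "\<theta> = a + of_nat t * b"
  have th: "algebraic \<theta>" unfolding \<theta>_def
    using AN.add[of a "of_nat t * b"] AN.mult[of "of_nat t" b] AN.of_nat[of t] a b by simp
  interpret K: csubfield "Q_adjoin \<theta>" by (rule csubfield_Q_adjoin[OF th])
  have Kalg: "algebraic x" if "x \<in> Q_adjoin \<theta>" for x using Q_adjoin_algebraic[OF th that] .
  obtain m where m: "is_min_poly (Q_adjoin \<theta>) b m" using K.ex_min_poly[OF b] by auto
  have only_b: "w = b" if w: "poly m w = 0" for w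
  proof (rule ccontr)
    assume "w \<noteq> b"
    have "coeffs_in (Q_adjoin \<theta>) g" using g by (auto simp: is_min_poly_def intro: K.coeffs_in_Rats)
    moreover have "poly g b = 0" using g by (simp add: is_min_poly_def)
    ultimately obtain q where "g = q * m" using is_min_polyD[OF m] by blast
    then have gw: "poly g w = 0" using w by simp
    define h where "h = pcompose f [:\<theta>, - of_nat t:]"
    have "coeffs_in (Q_adjoin \<theta>) h" unfolding h_def
    proof (rule K.coeffs_in_pcompose)
      show "coeffs_in (Q_adjoin \<theta>) f"
        using f by (intro K.coeffs_in_Rats) (simp add: is_min_poly_def)
      show "coeffs_in (Q_adjoin \<theta>) [:\<theta>, - of_nat t:]"
        using in_Q_adjoin[of \<theta>] K.of_nat[of t] by (auto simp: K.coeffs_in_pCons)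
    qed
    moreover have "poly h b = 0" using f by (simp add: h_def poly_pcompose is_min_poly_def \<theta>_def mult.commute)
    ultimately obtain q where "h = q * m" using is_min_polyD[OF m] by blast
    then have "poly h w = 0" using w by simp
    then have "poly f (\<theta> - of_nat t * w) = 0" by (simp add: h_def poly_pcompose mult.commute)
    then have "(\<theta> - of_nat t * w - a) / (b - w) \<in> E" unfolding E_def using gw by force
    moreover have "(\<theta> - of_nat t * w - a) / (b - w) = of_nat t"
      using \<open>w \<noteq> b\<close> by (simp add: \<theta>_def field_simps)
    ultimately show False using t by simp
  qed
  have "{w. poly m w = 0} = {b}" using only_b m by (auto simp: is_min_poly_def)
  then have "degree m = 1" using K.card_min_poly_roots[OF Kalg m] by simp
  then obtain c d where cd: "m = [:c, d:]" by (metis degree1_coeffs)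
  have "d = 1" using m \<open>degree m = 1\<close> cd by (simp add: is_min_poly_def)
  then have "b = - c" using m cd by (simp add: is_min_poly_def add_eq_0_iff)
  moreover have "c \<in> Q_adjoin \<theta>" using m cd by (simp add: is_min_poly_def K.coeffs_in_pCons)
  ultimately have bK: "b \<in> Q_adjoin \<theta>" by auto
  have "a = \<theta> - of_nat t * b" by (simp add: \<theta>_def)
  also have "\<dots> \<in> Q_adjoin \<theta>" using bK in_Q_adjoin by auto
  finally show ?thesis using bK unfolding \<theta>_def by blast
qed

lemma primitive_element_finite:
  assumes "finite B" "csubfield K" "B \<subseteq> K" "\<And>x. x \<in> B \<Longrightarrow> algebraic x"
  shows "\<exists>\<theta>\<in>K. algebraic \<theta> \<and> B \<subseteq> Q_adjoin \<theta>"
  using assms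
proof (induction B rule: finite_induct)
  case empty
  then interpret csubfield K by simp
  show ?case by (intro bexI[of _ 0]) auto
next
  case (insert b B)
  interpret csubfield K by fact
  obtain a where a: "a \<in> K" "algebraic a" "B \<subseteq> Q_adjoin a" using insert by auto
  have b: "b \<in> K" "algebraic b" using insert by auto
  obtain t :: nat where t: "a \<in> Q_adjoin (a + of_nat t * b)" "b \<in> Q_adjoin (a + of_nat t * b)"
    using primitive_element_2[OF a(2) b(2)] by auto
  have th: "algebraic (a + of_nat t * b)"
    using AN.add[of a "of_nat t * b"] AN.mult[of "of_nat t" b] AN.of_nat[of t] a b by simp
  have "Q_adjoin a \<subseteq> Q_adjoin (a + of_nat t * b)"
    by (rule Q_adjoin_subset[OF csubfield_Q_adjoin[OF th] t(1)])
  then show ?case using a b t th by (intro bexI[of _ "a + of_nat t * b"]) auto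
qed

lemma number_field_primitive:
  assumes K: "number_field K"
  shows "\<exists>\<theta>. algebraic \<theta> \<and> K = Q_adjoin \<theta>"
proof -
  obtain B where B: "finite B" "K = Q.span B" using K by (auto simp: number_field_iff)
  have BK: "B \<subseteq> K" unfolding B(2) by (rule Q.span_superset)
  have cK: "csubfield K" using K by (rule number_field_csubfield)
  obtain \<theta> where th: "\<theta> \<in> K" "algebraic \<theta>" "B \<subseteq> Q_adjoin \<theta>"
    using primitive_element_finite[OF B(1) cK BK] number_field_algebraic[OF K] BK by blast
  have "K \<subseteq> Q_adjoin \<theta>" unfolding B(2)
    by (rule Q.span_minimal[OF th(3) csubfield_subspace[OF csubfield_Q_adjoin[OF th(2)]]])
  then show ?thesis using Q_adjoin_subset[OF cK th(1)] th(2) by blast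
qed

lemma ex_number_field:
  assumes "finite B" "\<And>x. x \<in> B \<Longrightarrow> algebraic x"
  shows "\<exists>K. number_field K \<and> B \<subseteq> K"
proof -
  have "csubfield {z. algebraic z}"
    by (intro csubfield.intro csubfield_axioms.intro subring_algebraic) (auto simp: algebraic_inverse)
  from primitive_element_finite[OF assms(1) this] assms(2) number_field_Q_adjoin
  show ?thesis by blast
qed

subsection \<open>Embeddings\<close>

lemma embeddings_iff:
  "\<sigma> \<in> embeddings K \<longleftrightarrow> \<sigma> \<in> extensional K \<and> \<sigma> 1 = 1 \<and>
     (\<forall>x\<in>K. \<forall>y\<in>K. \<sigma> (x + y) = \<sigma> x + \<sigma> y \<and> \<sigma> (x * y) = \<sigma> x * \<sigma> y)"
  unfolding embeddings_def Ring.ring_hom_def by auto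

locale embedding = csubfield K for K +
  fixes \<sigma>
  assumes emb: "\<sigma> \<in> embeddings K"
begin

lemma add_hom: "x \<in> K \<Longrightarrow> y \<in> K \<Longrightarrow> \<sigma> (x + y) = \<sigma> x + \<sigma> y"
  and mult_hom: "x \<in> K \<Longrightarrow> y \<in> K \<Longrightarrow> \<sigma> (x * y) = \<sigma> x * \<sigma> y"
  and one_hom [simp]: "\<sigma> 1 = 1"
  using emb unfolding embeddings_iff by auto

lemma zero_hom [simp]: "\<sigma> 0 = 0"
  using add_hom[of 0 0] by simp

lemma minus_hom: "x \<in> K \<Longrightarrow> \<sigma> (- x) = - \<sigma> x"
  using add_hom[of x "-x"] neg[of x] by (simp add: eq_neg_iff_add_eq_0 add.commute)

lemma of_nat_hom [simp]: "\<sigma> (of_nat n) = of_nat n"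
  by (induction n) (auto simp: add_hom)

lemma of_int_hom [simp]: "\<sigma> (of_int n) = of_int n"
  by (cases n rule: int_cases2) (auto simp: minus_hom)

lemma inverse_hom:
  assumes "x \<in> K" "x \<noteq> 0"
  shows "\<sigma> x \<noteq> 0" "\<sigma> (inverse x) = inverse (\<sigma> x)"
proof -
  have "\<sigma> x * \<sigma> (inverse x) = 1"
    using mult_hom[of x "inverse x"] assms by auto
  then show "\<sigma> x \<noteq> 0" "\<sigma> (inverse x) = inverse (\<sigma> x)"
    by (auto simp: inverse_unique)
qed

lemma divide_hom: "x \<in> K \<Longrightarrow> y \<in> K \<Longrightarrow> y \<noteq> 0 \<Longrightarrow> \<sigma> (x / y) = \<sigma> x / \<sigma> y"
  by (simp add: divide_inverse mult_hom inverse inverse_hom)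

lemma Rats_hom [simp]: "x \<in> \<rat> \<Longrightarrow> \<sigma> x = x"
  by (erule Rats_cases') (use divide_hom[OF of_int of_int] in auto)

lemma sum_hom: "(\<And>i. i \<in> A \<Longrightarrow> f i \<in> K) \<Longrightarrow> \<sigma> (sum f A) = (\<Sum>i\<in>A. \<sigma> (f i))"
  by (induction A rule: infinite_finite_induct) (auto simp: add_hom sum)

lemma power_hom: "x \<in> K \<Longrightarrow> \<sigma> (x ^ n) = \<sigma> x ^ n"
  by (induction n) (auto simp: mult_hom power)

lemma poly_hom: "coeffs_in \<rat> p \<Longrightarrow> x \<in> K \<Longrightarrow> \<sigma> (poly p x) = poly p (\<sigma> x)"
proof (induction p)
  case (pCons a p)
  have "a \<in> \<rat>" "coeffs_in \<rat> p" using pCons by (auto simp: RatF.coeffs_in_pCons)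
  then have aK: "a \<in> K" and pK: "poly p x \<in> K"
    using Rats_subset pCons.prems(2) by (auto intro: poly_in coeffs_in_Rats)
  have "\<sigma> (x * poly p x) = \<sigma> x * \<sigma> (poly p x)" by (rule mult_hom[OF pCons.prems(2) pK])
  moreover have "x * poly p x \<in> K" using pK pCons.prems(2) by auto
  ultimately have "\<sigma> (a + x * poly p x) = a + \<sigma> x * \<sigma> (poly p x)"
    using add_hom[OF aK] \<open>a \<in> \<rat>\<close> by simp
  then show ?case using pCons.IH[OF \<open>coeffs_in \<rat> p\<close> pCons.prems(2)] by simp
qed simp

lemma algebraic_int_hom:
  assumes "x \<in> K" "algebraic_int x"
  shows "algebraic_int (\<sigma> x)"
proof -
  from assms(2) obtain p where p: "lead_coeff p = 1" "\<forall>i. coeff p i \<in> \<int>" "poly p x = 0"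
    by (auto elim: algebraic_int.cases)
  have "coeffs_in \<rat> p" using p(2) Ints_subset_Rats by (auto simp: coeffs_in_def)
  then have "poly p (\<sigma> x) = 0" using poly_hom[of p x] assms(1) p(3) by simp
  then show ?thesis using p by (intro algebraic_int.intros[of p])
qed

end

lemma embedding_restrict:
  assumes "csubfield K" "csubfield L" "K \<subseteq> L" "\<tau> \<in> embeddings L"
  shows "restrict \<tau> K \<in> embeddings K"
proof -
  interpret K: csubfield K by fact
  interpret L: csubfield L by fact
  show ?thesis using assms(3,4) unfolding embeddings_iff by (auto simp: subset_iff)
qed

text \<open>An embedding is determined by the image of the generator. Conversely p(z) is sent to
  p(w); this is well defined because the difference of two representing polynomials is a multiple of
  \<open>f\<close>.\<close>

lemma bij_betw_embeddings:
  assumes f: "is_min_poly \<rat> z f"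
  shows "bij_betw (\<lambda>\<sigma>. \<sigma> z) (embeddings (Q_adjoin z)) {w. poly f w = 0}"
proof -
  define K where "K = Q_adjoin z"
  have f1: "coeffs_in \<rat> f" "lead_coeff f = 1" "poly f z = 0" using f by (auto simp: is_min_poly_def)
  have alg: "algebraic z" using f1 by (intro algebraicI'[of f]) (auto simp: coeffs_in_def)
  interpret csubfield K unfolding K_def by (rule csubfield_Q_adjoin[OF alg])
  have zK: "z \<in> K" unfolding K_def by (rule in_Q_adjoin)
  show ?thesis unfolding K_def[symmetric] bij_betw_def
  proof
    show "inj_on (\<lambda>\<sigma>. \<sigma> z) (embeddings K)"
    proof (rule inj_onI)
      fix \<sigma> \<tau> assume st: "\<sigma> \<in> embeddings K" "\<tau> \<in> embeddings K" "\<sigma> z = \<tau> z"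
      interpret S: embedding K \<sigma> by unfold_locales fact
      interpret T: embedding K \<tau> by unfold_locales fact
      show "\<sigma> = \<tau>"
      proof (rule extensionalityI[of _ K])
        fix x assume "x \<in> K"
        then obtain p where "coeffs_in \<rat> p" "x = poly p z" by (auto simp: K_def Q_adjoin_def)
        then show "\<sigma> x = \<tau> x" using S.poly_hom T.poly_hom zK st(3) by simp
      qed (use st in \<open>auto simp: embeddings_iff\<close>)
    qed
    show "(\<lambda>\<sigma>. \<sigma> z) ` embeddings K = {w. poly f w = 0}"
    proof (intro equalityI subsetI)
      fix w assume "w \<in> (\<lambda>\<sigma>. \<sigma> z) ` embeddings K"
      then obtain \<sigma> where s: "\<sigma> \<in> embeddings K" "w = \<sigma> z" by auto
      interpret S: embedding K \<sigma> by unfold_locales fact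
      show "w \<in> {w. poly f w = 0}" using S.poly_hom[OF f1(1) zK] f1(3) s(2) by simp
    next
      fix w assume "w \<in> {w. poly f w = 0}"
      then have w: "poly f w = 0" by simp
      define \<sigma> where "\<sigma> = restrict (\<lambda>x. poly (SOME p. coeffs_in \<rat> p \<and> x = poly p z) w) K"
      have val: "\<sigma> (poly p z) = poly p w" if p: "coeffs_in \<rat> p" for p
      proof -
        define q where "q = (SOME q. coeffs_in \<rat> q \<and> poly p z = poly q z)"
        have q: "coeffs_in \<rat> q \<and> poly p z = poly q z"
          unfolding q_def by (rule someI[of _ p]) (use p in simp)
        have pK: "poly p z \<in> K" using p by (auto simp: K_def Q_adjoin_def)
        have "coeffs_in \<rat> (p - q)" using RP.diff[of p q] p q by simp
        then obtain r where "p - q = r * f" using is_min_polyD[OF f, of "p - q"] q by auto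
        then have "poly p w = poly q w"
          using w by (metis diff_eq_eq mult_zero_right poly_add poly_mult add.left_neutral)
        then show ?thesis using pK by (simp add: \<sigma>_def q_def)
      qed
      have "\<sigma> \<in> embeddings K" unfolding embeddings_iff
      proof (intro conjI ballI)
        show "\<sigma> \<in> extensional K" by (simp add: \<sigma>_def)
        show "\<sigma> 1 = 1" using val[of 1] by simp
        fix x y assume "x \<in> K" "y \<in> K"
        then obtain p q where pq: "coeffs_in \<rat> p" "x = poly p z" "coeffs_in \<rat> q" "y = poly q z"
          by (auto simp: K_def Q_adjoin_def)
        show "\<sigma> (x + y) = \<sigma> x + \<sigma> y"
          using val[of "p + q"] val[of p] val[of q] pq RP.add[of p q] by simp
        show "\<sigma> (x * y) = \<sigma> x * \<sigma> y"
          using val[of "p * q"] val[of p] val[of q] pq RP.mult[of p q] by simp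
      qed
      moreover have "\<sigma> z = w"
        using val[of "[:0,1:]"] by (simp add: RatF.coeffs_in_pCons)
      ultimately show "w \<in> (\<lambda>\<sigma>. \<sigma> z) ` embeddings K" by auto
    qed
  qed
qed

lemma embeddings_number_field:
  assumes K: "number_field K"
  shows "finite (embeddings K)" "card (embeddings K) = field_degree K" "field_degree K > 0"
proof -
  obtain z where z: "algebraic z" "K = Q_adjoin z" using number_field_primitive[OF K] by auto
  obtain f where f: "is_min_poly \<rat> z f" using RatF.ex_min_poly[OF z(1)] by auto
  have f0: "f \<noteq> 0" using f by (auto simp: is_min_poly_def)
  note b = bij_betw_embeddings[OF f, folded z(2)]
  show "finite (embeddings K)" using bij_betw_finite[OF b] poly_roots_finite[OF f0] by simp
  have "card {w. poly f w = 0} = degree f"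
    by (rule RatF.card_min_poly_roots[OF rat_imp_algebraic f])
  then show c: "card (embeddings K) = field_degree K"
    using bij_betw_same_card[OF b] field_degree_Q_adjoin[OF f] z(2) by simp
  have "z \<in> {w. poly f w = 0}" using f by (simp add: is_min_poly_def)
  then have "embeddings K \<noteq> {}" using b unfolding bij_betw_def by blast
  then show "field_degree K > 0" using c \<open>finite (embeddings K)\<close> card_gt_0_iff by metis
qed

text \<open>The polynomial \<open>\<Prod>\<^sub>\<sigma> (X - \<sigma> c)\<close> is the characteristic polynomial of multiplication by \<open>c\<close>,
  since the vectors of conjugates of a power basis diagonalise that map.\<close>

lemma conjugates_poly_rational:
  assumes K: "number_field K" and c: "c \<in> K"
  shows "coeffs_in \<rat> (\<Prod>\<sigma>\<in>embeddings K. [:- \<sigma> c, 1:])"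
proof -
  obtain z where z: "algebraic z" "K = Q_adjoin z" using number_field_primitive[OF K] by auto
  obtain f where f: "is_min_poly \<rat> z f" using RatF.ex_min_poly[OF z(1)] by auto
  interpret csubfield K by (rule number_field_csubfield[OF K])
  have zK: "z \<in> K" using z(2) in_Q_adjoin by simp
  define n where "n = degree f"
  have cardn: "card (embeddings K) = n"
    using embeddings_number_field(2)[OF K] field_degree_Q_adjoin[OF f] z(2) by (simp add: n_def)
  obtain e where e: "bij_betw e {0..<n} (embeddings K)"
    using ex_bij_betw_nat_finite[OF embeddings_number_field(1)[OF K]] cardn by auto
  have eE: "e k \<in> embeddings K" if "k < n" for k using e that by (auto simp: bij_betw_def)
  have "\<exists>a. (\<forall>j. a j \<in> \<rat>) \<and> c * z ^ i = (\<Sum>j=0..<n. a j * z ^ j)" for i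
  proof -
    have "c * z ^ i \<in> K" using c zK by auto
    then have "c * z ^ i \<in> Q.span ((\<lambda>i. z ^ i) ` {..<n})"
      unfolding z(2) Q_adjoin_eq_span(1)[OF f] n_def .
    then obtain u where "c * z ^ i = (\<Sum>x\<in>(\<lambda>i. z ^ i) ` {..<n}. of_rat (u x) * x)"
      using Q.span_finite[of "(\<lambda>i. z ^ i) ` {..<n}"] by auto
    also have "\<dots> = (\<Sum>j=0..<n. of_rat (u (z ^ j)) * z ^ j)"
      using Q_adjoin_eq_span(2)[OF f] by (simp add: sum.reindex n_def atLeast0LessThan)
    finally show ?thesis by (intro exI[of _ "\<lambda>j. of_rat (u (z ^ j))"]) auto
  qed
  then obtain a where a: "\<And>i j. a i j \<in> \<rat>" "\<And>i. c * z ^ i = (\<Sum>j=0..<n. a i j * z ^ j)"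
    by metis
  define A where "A = mat n n (\<lambda>(i,j). a i j)"
  define V where "V = mat n n (\<lambda>(j,k). e k z ^ j)"
  define D where "D = mat n n (\<lambda>(i,j). if i = j then e i c else 0)"
  have carr: "A \<in> carrier_mat n n" "V \<in> carrier_mat n n" "D \<in> carrier_mat n n"
    by (auto simp: A_def V_def D_def)
  have AV: "A * V = V * D"
  proof (rule eq_matI)
    fix i k assume "i < dim_row (V * D)" "k < dim_col (V * D)"
    then have ik: "i < n" "k < n" by (auto simp: V_def D_def)
    interpret S: embedding K "e k" by unfold_locales (rule eE[OF ik(2)])
    have zjK: "z ^ j \<in> K" "a i j * z ^ j \<in> K" for j using zK a(1)[of i j] Rats_subset by auto
    have "(A * V) $$ (i,k) = (\<Sum>j=0..<n. a i j * e k z ^ j)"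
      using ik by (simp add: A_def V_def scalar_prod_def)
    also have "\<dots> = e k (\<Sum>j=0..<n. a i j * z ^ j)"
      using zjK a(1) Rats_subset zK by (subst S.sum_hom) (auto simp: S.mult_hom S.power_hom subset_iff)
    also have "\<dots> = e k c * e k z ^ i"
      using a(2)[of i] c zK zjK by (auto simp flip: S.mult_hom S.power_hom)
    also have "\<dots> = (\<Sum>j=0..<n. if j = k then e j z ^ i * e j c else 0)"
      using ik by (subst sum.delta) (auto simp: mult.commute)
    also have "\<dots> = (\<Sum>j=0..<n. e j z ^ i * (if j = k then e j c else 0))"
      by (rule sum.cong) auto
    also have "\<dots> = (V * D) $$ (i,k)"
      using ik by (simp add: V_def D_def scalar_prod_def)
    finally show "(A * V) $$ (i,k) = (V * D) $$ (i,k)" .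
  qed (auto simp: A_def V_def D_def)
  \<comment> \<open>Vandermonde argument: a kernel vector is the coefficient list of a nonzero
    polynomial of degree below n vanishing at n distinct conjugates.\<close>
  have "det (transpose_mat V) \<noteq> 0"
  proof
    assume "det (transpose_mat V) = 0"
    then obtain v where v: "v \<in> carrier_vec n" "v \<noteq> 0\<^sub>v n" "transpose_mat V *\<^sub>v v = 0\<^sub>v n"
      using det_0_iff_vec_prod_zero[of "transpose_mat V" n] carr by auto
    define p where "p = (\<Sum>i<n. monom (v $ i) i)"
    have cp: "coeff p i = (if i < n then v $ i else 0)" for i
      by (auto simp: p_def coeff_sum sum.delta' cong: if_cong)
    have "p \<noteq> 0"
    proof
      assume "p = 0"
      then have "v = 0\<^sub>v n" using v(1) cp by (intro eq_vecI) (auto, metis coeff_0)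
      then show False using v by simp
    qed
    have "poly p (\<sigma> z) = 0" if s: "\<sigma> \<in> embeddings K" for \<sigma>
    proof -
      have "\<sigma> \<in> e ` {0..<n}" using s e by (simp add: bij_betw_def)
      then obtain k where k: "k < n" "e k = \<sigma>" by auto
      have "0 = (transpose_mat V *\<^sub>v v) $ k" using v(3) k by simp
      also have "\<dots> = (\<Sum>i=0..<n. e k z ^ i * v $ i)"
        using k v(1) by (simp add: V_def scalar_prod_def)
      also have "\<dots> = poly p (\<sigma> z)"
        by (simp add: p_def poly_sum poly_monom k(2) atLeast0LessThan mult.commute)
      finally show ?thesis by simp
    qed
    then have sub: "(\<lambda>\<sigma>. \<sigma> z) ` embeddings K \<subseteq> {w. poly p w = 0}" by auto
    have "card ((\<lambda>\<sigma>. \<sigma> z) ` embeddings K) = n"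
      unfolding cardn[symmetric]
      by (rule card_image) (use bij_betw_embeddings[OF f, folded z(2)] in \<open>simp add: bij_betw_def\<close>)
    then have "n \<le> card {w. poly p w = 0}"
      using card_mono[OF poly_roots_finite[OF \<open>p \<noteq> 0\<close>] sub] by simp
    also have "\<dots> \<le> degree p" by (rule card_poly_roots_bound[OF \<open>p \<noteq> 0\<close>])
    finally have "n \<le> degree p" .
    moreover have "coeff p (degree p) \<noteq> 0" using \<open>p \<noteq> 0\<close> by simp
    ultimately show False using cp[of "degree p"] \<open>n \<le> degree p\<close> by auto
  qed
  then have "det V \<noteq> 0" using det_transpose[OF carr(2)] by simp
  then have "V \<in> Units (ring_mat TYPE(complex) n ())" by (rule det_non_zero_imp_unit[OF carr(2)])
  then obtain W where W: "W \<in> carrier_mat n n" "V * W = 1\<^sub>m n" "W * V = 1\<^sub>m n"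
    by (auto simp: Units_def ring_mat_def)
  have "A = A * (V * W)" using W carr by simp
  also have "\<dots> = V * D * W" using AV assoc_mult_mat[OF carr(1,2) W(1)] by simp
  finally have "similar_mat A D"
    unfolding similar_mat_def similar_mat_wit_def Let_def
    using carr W by (intro exI[of _ V] exI[of _ W]) auto
  then have "char_poly A = char_poly D" by (rule char_poly_similar)
  also have "\<dots> = (\<Prod>a\<leftarrow>diag_mat D. [:- a, 1:])"
    by (rule char_poly_upper_triangular[OF carr(3)]) (auto simp: D_def upper_triangular_def)
  also have "diag_mat D = map (\<lambda>k. e k c) [0..<n]"
    by (auto simp: diag_mat_def D_def)
  also have "(\<Prod>a\<leftarrow>map (\<lambda>k. e k c) [0..<n]. [:- a, 1:]) = (\<Prod>k\<in>{0..<n}. [:- e k c, 1:])"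
    by (simp add: prod.list_conv_set_nth o_def)
  also have "\<dots> = (\<Prod>\<sigma>\<in>embeddings K. [:- \<sigma> c, 1:])"
    by (rule prod.reindex_bij_betw[OF e])
  finally show ?thesis
    using char_poly_coeffs_in[OF subring_Rats carr(1)] a(1) by (simp add: A_def)
qed

section \<open>The field norm and the extension of embeddings\<close>

definition fnorm :: "complex set \<Rightarrow> complex \<Rightarrow> complex" where
  "fnorm K c = (\<Prod>\<sigma>\<in>embeddings K. \<sigma> c)"

text \<open>Up to sign this is the constant coefficient of the rational polynomial formed from the
  conjugates of \<open>c\<close>.\<close>

lemma fnorm_Rats:
  assumes K: "number_field K" and c: "c \<in> K"
  shows "fnorm K c \<in> \<rat>"
proof -
  define ch where "ch = (\<Prod>\<sigma>\<in>embeddings K. [:- \<sigma> c, 1:])"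
  have "poly ch 0 \<in> \<rat>"
    using conjugates_poly_rational[OF K c] by (intro RatF.poly_in) (auto simp: ch_def)
  moreover have "poly ch 0 = (-1) ^ card (embeddings K) * fnorm K c"
    by (simp add: ch_def poly_prod prod_uminus fnorm_def)
  ultimately have *: "(-1) ^ card (embeddings K) * fnorm K c \<in> \<rat>" by simp
  show ?thesis
  proof (cases "even (card (embeddings K))")
    case False
    then show ?thesis using Rats_minus_iff[of "fnorm K c"] * by simp
  qed (use * in simp)
qed

lemma fnorm_Ints:
  assumes K: "number_field K" and c: "c \<in> K" "algebraic_int c"
  shows "fnorm K c \<in> \<int>"
proof (rule rational_algebraic_int_is_int)
  show "fnorm K c \<in> \<rat>" by (rule fnorm_Rats[OF K c(1)])
  interpret csubfield K by (rule number_field_csubfield[OF K])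
  have "algebraic_int (\<sigma> c)" if "\<sigma> \<in> embeddings K" for \<sigma>
  proof -
    interpret embedding K \<sigma> by unfold_locales fact
    show ?thesis by (rule algebraic_int_hom[OF c])
  qed
  then show "algebraic_int (fnorm K c)" unfolding fnorm_def using AI.prod[of "embeddings K"] by simp
qed

lemma fnorm_mult:
  assumes "number_field K" "x \<in> K" "y \<in> K"
  shows "fnorm K (x * y) = fnorm K x * fnorm K y"
proof -
  interpret csubfield K by (rule number_field_csubfield) fact
  have "\<sigma> (x * y) = \<sigma> x * \<sigma> y" if "\<sigma> \<in> embeddings K" for \<sigma>
    using that assms by (auto simp: embeddings_iff)
  then show ?thesis unfolding fnorm_def prod.distrib[symmetric] by (intro prod.cong refl)
qed

lemma fnorm_eq_0_iff:
  assumes "number_field K" "x \<in> K"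
  shows "fnorm K x = 0 \<longleftrightarrow> x = 0"
proof -
  interpret csubfield K by (rule number_field_csubfield) fact
  have fin: "finite (embeddings K)" "card (embeddings K) > 0"
    using embeddings_number_field[OF assms(1)] by auto
  have "\<sigma> x = 0 \<longleftrightarrow> x = 0" if "\<sigma> \<in> embeddings K" for \<sigma>
  proof -
    interpret embedding K \<sigma> by unfold_locales fact
    show ?thesis using inverse_hom(1)[OF assms(2)] by auto
  qed
  then show ?thesis using fin unfolding fnorm_def by (auto simp: card_gt_0_iff)
qed

lemma fnorm_of_nat: "number_field K \<Longrightarrow> fnorm K (of_nat m) = of_nat m ^ field_degree K"
proof -
  assume K: "number_field K"
  interpret csubfield K by (rule number_field_csubfield) fact
  have "\<sigma> (of_nat m) = of_nat m" if "\<sigma> \<in> embeddings K" for \<sigma>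
  proof -
    interpret embedding K \<sigma> by unfold_locales fact
    show ?thesis by simp
  qed
  then have "fnorm K (of_nat m) = (\<Prod>\<sigma>\<in>embeddings K. of_nat m)"
    unfolding fnorm_def by (intro prod.cong refl)
  then show ?thesis by (simp add: embeddings_number_field(2)[OF K])
qed

text \<open>Every root of \<open>p\<close> has \<open>f\<close> as its minimal polynomial, so
  factors \<open>f\<close> can be split off until a monic constant is left.\<close>

lemma rational_poly_same_roots:
  assumes f: "is_min_poly \<rat> z f" and p: "coeffs_in \<rat> p" "lead_coeff p = 1"
    and roots: "\<And>w. poly p w = 0 \<Longrightarrow> poly f w = 0"
  shows "\<exists>k. p = f ^ k"
  using p roots
proof (induction "degree p" arbitrary: p rule: less_induct)
  case less
  have f1: "f \<noteq> 0" "lead_coeff f = 1" using f by (auto simp: is_min_poly_def)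
  have "degree f \<noteq> 0"
  proof
    assume "degree f = 0"
    then obtain c where "f = [:c:]" by (rule degree_eq_zeroE)
    then have "poly f z = 1" using f1 by simp
    then show False using f by (simp add: is_min_poly_def)
  qed
  have p0: "p \<noteq> 0" using less.prems(2) by auto
  show ?case
  proof (cases "degree p = 0")
    case True
    then obtain c where "p = [:c:]" by (rule degree_eq_zeroE)
    then have "p = f ^ 0" using less.prems(2) by (simp add: one_pCons)
    then show ?thesis by blast
  next
    case False
    then obtain w where w: "poly p w = 0"
      using fundamental_theorem_of_algebra[of p] by (auto simp: constant_degree)
    have fw: "poly f w = 0" using less.prems(3)[OF w] .
    have "algebraic w" using RatF.min_poly_algebraic[OF rat_imp_algebraic f fw] .
    then obtain g where g: "is_min_poly \<rat> w g" using RatF.ex_min_poly by blast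
    then have "is_min_poly \<rat> w f" using RatF.min_poly_root_eq[OF f fw g] by simp
    then obtain q where q: "coeffs_in \<rat> q" "p = q * f" using is_min_polyD less.prems(1) w by blast
    have q0: "q \<noteq> 0" using q p0 by auto
    have "degree p = degree q + degree f" using q q0 f1 by (simp add: degree_mult_eq)
    then have "degree q < degree p" using \<open>degree f \<noteq> 0\<close> by simp
    moreover have "lead_coeff q = 1" using less.prems(2) q f1 by (simp add: lead_coeff_mult)
    moreover have "poly f v = 0" if "poly q v = 0" for v using less.prems(3)[of v] that q by simp
    ultimately obtain k where "q = f ^ k" using less.hyps[OF _ q(1)] by blast
    then have "p = f ^ Suc k" using q(2) by (simp add: mult.commute)
    then show ?thesis by blast
  qed
qed

text \<open>The product of X - \<tau> z over the embeddings \<tau> of \<open>L\<close> is rational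
  and all its roots are conjugates of \<open>z\<close>, so it is a power f^k. Since \<open>f\<close>
  is separable, each conjugate has multiplicity k, and the multiplicity of \<sigma> z counts the
  extensions of \<sigma>.\<close>

lemma embeddings_fibre:
  assumes K: "number_field K" and L: "number_field L" and KL: "K \<subseteq> L"
  shows "\<exists>k. field_degree L = k * field_degree K \<and>
    (\<forall>\<sigma>\<in>embeddings K. card {\<tau> \<in> embeddings L. restrict \<tau> K = \<sigma>} = k)"
proof -
  obtain z where z: "algebraic z" "K = Q_adjoin z" using number_field_primitive[OF K] by auto
  obtain f where f: "is_min_poly \<rat> z f" using RatF.ex_min_poly[OF z(1)] by auto
  interpret K: csubfield K by (rule number_field_csubfield[OF K])
  interpret L: csubfield L by (rule number_field_csubfield[OF L])
  have zK: "z \<in> K" using z(2) in_Q_adjoin by simp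
  have zL: "z \<in> L" using zK KL by auto
  have f1: "coeffs_in \<rat> f" "lead_coeff f = 1" "poly f z = 0" "f \<noteq> 0" using f by (auto simp: is_min_poly_def)
  have finL: "finite (embeddings L)" by (rule embeddings_number_field(1)[OF L])
  define ch where "ch = (\<Prod>\<tau>\<in>embeddings L. [:- \<tau> z, 1:])"
  have roots: "poly f w = 0" if w: "poly ch w = 0" for w
  proof -
    obtain \<tau> where t: "\<tau> \<in> embeddings L" "w = \<tau> z" using w finL by (auto simp: ch_def poly_prod)
    interpret embedding L \<tau> by unfold_locales fact
    show ?thesis using poly_hom[OF f1(1) zL] f1(3) t(2) by simp
  qed
  have "lead_coeff ch = 1" by (simp add: ch_def lead_coeff_prod)
  moreover have "coeffs_in \<rat> ch" unfolding ch_def by (rule conjugates_poly_rational[OF L zL])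
  ultimately obtain k where k: "ch = f ^ k" using rational_poly_same_roots[OF f] roots by blast
  have "degree ch = card (embeddings L)"
    by (simp add: ch_def degree_prod_eq_sum_degree)
  then have deg: "field_degree L = k * field_degree K"
    using k f1(4) embeddings_number_field(2)[OF L] field_degree_Q_adjoin[OF f] z(2)
    by (simp add: degree_power_eq mult.commute)
  have b: "bij_betw (\<lambda>\<sigma>. \<sigma> z) (embeddings K) {w. poly f w = 0}"
    using bij_betw_embeddings[OF f] z(2) by simp
  have "card {\<tau> \<in> embeddings L. restrict \<tau> K = \<sigma>} = k" if s: "\<sigma> \<in> embeddings K" for \<sigma>
  proof -
    have w: "poly f (\<sigma> z) = 0" using b s by (auto simp: bij_betw_def)
    have "{\<tau> \<in> embeddings L. restrict \<tau> K = \<sigma>} = {\<tau> \<in> embeddings L. \<tau> z = \<sigma> z}"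
    proof (intro Collect_cong conj_cong refl iffI)
      fix \<tau> assume t: "\<tau> \<in> embeddings L" "\<tau> z = \<sigma> z"
      have "restrict \<tau> K \<in> embeddings K"
        by (rule embedding_restrict[OF _ _ KL t(1)]) unfold_locales
      then show "restrict \<tau> K = \<sigma>"
        using b s t(2) zK unfolding bij_betw_def inj_on_def by auto
    qed (use zK in auto)
    also have "card \<dots> = order (\<sigma> z) ch"
    proof -
      have "order w (\<Prod>\<tau>\<in>E. [:- \<tau> z, 1:]) = card {\<tau> \<in> E. \<tau> z = w}" if "finite E" for E and w :: complex
        using that
      proof (induction E rule: finite_induct)
        case (insert \<tau> E)
        have "[:- \<tau> z, 1:] \<noteq> 0" "(\<Prod>\<tau>\<in>E. [:- \<tau> z, 1:]) \<noteq> 0"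
          using insert(1) by (simp_all add: prod_zero_iff)
        then have nz: "[:- \<tau> z, 1:] * (\<Prod>\<tau>\<in>E. [:- \<tau> z, 1:]) \<noteq> 0"
          using no_zero_divisors by blast
        have "order w [:- \<tau> z, 1:] = (if \<tau> z = w then 1 else 0)"
          using order_power_n_n[of w 1] by (auto intro: order_0I)
        moreover have "{\<tau>' \<in> insert \<tau> E. \<tau>' z = w} = (if \<tau> z = w then insert \<tau> {\<tau>' \<in> E. \<tau>' z = w} else {\<tau>' \<in> E. \<tau>' z = w})"
          by auto
        ultimately show ?case using insert order_mult[OF nz, of w] by simp
      qed (simp add: order_0I)
      then show ?thesis using finL by (simp add: ch_def)
    qed
    also have "\<dots> = k * order (\<sigma> z) f"
    proof -
      have "order v (f ^ k) = k * order v f" for v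
      proof (induction k)
        case (Suc k)
        have "f * f ^ k \<noteq> 0" using f1(4) by simp
        from order_mult[OF this, of v] Suc show ?case by simp
      qed (simp add: order_0I)
      then show ?thesis using k by simp
    qed
    also have "order (\<sigma> z) f = 1" by (rule RatF.min_poly_order[OF rat_imp_algebraic f w])
    finally show ?thesis by (simp only: mult_1_right)
  qed
  then show ?thesis using deg by blast
qed

text \<open>Each factor over \<open>K\<close> occurs as often over \<open>L\<close> as the degree
  grows, and the root by the field degree cancels this. Independence of the archimedean height from
  the field rests on it.\<close>

lemma prod_embeddings_extend:
  fixes G :: "(complex \<Rightarrow> complex) \<Rightarrow> real"
  assumes K: "number_field K" and L: "number_field L" and KL: "K \<subseteq> L"
    and G: "\<And>\<sigma>. \<sigma> \<in> embeddings K \<Longrightarrow> G \<sigma> \<ge> 0"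
  shows "(\<Prod>\<tau>\<in>embeddings L. G (restrict \<tau> K)) powr (1 / field_degree L) =
         (\<Prod>\<sigma>\<in>embeddings K. G \<sigma>) powr (1 / field_degree K)"
proof -
  obtain k where k: "field_degree L = k * field_degree K"
    "\<And>\<sigma>. \<sigma> \<in> embeddings K \<Longrightarrow> card {\<tau> \<in> embeddings L. restrict \<tau> K = \<sigma>} = k"
    using embeddings_fibre[OF K L KL] by blast
  have k0: "k > 0" "field_degree K > 0" using k(1) embeddings_number_field(3)[OF L] by auto
  have "(\<Prod>\<tau>\<in>embeddings L. G (restrict \<tau> K)) =
      (\<Prod>\<sigma>\<in>embeddings K. \<Prod>\<tau>\<in>{\<tau> \<in> embeddings L. restrict \<tau> K = \<sigma>}. G (restrict \<tau> K))"
    using embedding_restrict[OF number_field_csubfield[OF K] number_field_csubfield[OF L] KL]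
    by (intro prod.group[symmetric] embeddings_number_field(1) K L) auto
  also have "\<dots> = (\<Prod>\<sigma>\<in>embeddings K. G \<sigma> ^ k)"
    by (intro prod.cong refl) (simp add: k(2))
  also have "\<dots> = (\<Prod>\<sigma>\<in>embeddings K. G \<sigma>) ^ k" by (rule prod_power_distrib[symmetric])
  finally have eq: "(\<Prod>\<tau>\<in>embeddings L. G (restrict \<tau> K)) = (\<Prod>\<sigma>\<in>embeddings K. G \<sigma>) ^ k" .
  have P: "(\<Prod>\<sigma>\<in>embeddings K. G \<sigma>) \<ge> 0" using G by (intro prod_nonneg) auto
  have "(\<Prod>\<sigma>\<in>embeddings K. G \<sigma>) ^ k = (\<Prod>\<sigma>\<in>embeddings K. G \<sigma>) powr (real k)"
    using P k0(1) by (cases "(\<Prod>\<sigma>\<in>embeddings K. G \<sigma>) = 0") (auto simp: powr_realpow)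
  then show ?thesis unfolding eq using k k0 by (simp add: powr_powr)
qed

subsection \<open>Index of additive subgroups\<close>

definition add_subgroup :: "complex set \<Rightarrow> bool" where
  "add_subgroup A \<longleftrightarrow> 0 \<in> A \<and> (\<forall>x\<in>A. \<forall>y\<in>A. x - y \<in> A)"

definition coset_of :: "complex set \<Rightarrow> complex \<Rightarrow> complex set" where
  "coset_of B a = (\<lambda>b. b + a) ` B"

text \<open>The index is \<open>0\<close> when it is infinite.\<close>

definition idx :: "complex set \<Rightarrow> complex set \<Rightarrow> nat" where
  "idx A B = card (coset_of B ` A)"

definition transversal :: "complex set \<Rightarrow> complex set \<Rightarrow> complex set \<Rightarrow> bool" where
  "transversal T A B \<longleftrightarrow> T \<subseteq> A \<and> (\<forall>a\<in>A. \<exists>t\<in>T. a - t \<in> B) \<and> (\<forall>s\<in>T. \<forall>t\<in>T. s - t \<in> B \<longrightarrow> s = t)"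

lemma add_subgroupD:
  assumes "add_subgroup A"
  shows "0 \<in> A" "x \<in> A \<Longrightarrow> y \<in> A \<Longrightarrow> x - y \<in> A" "x \<in> A \<Longrightarrow> - x \<in> A" "x \<in> A \<Longrightarrow> y \<in> A \<Longrightarrow> x + y \<in> A"
proof -
  show 1: "0 \<in> A" and 2: "x \<in> A \<Longrightarrow> y \<in> A \<Longrightarrow> x - y \<in> A" for x y
    using assms by (auto simp: add_subgroup_def)
  show 3: "x \<in> A \<Longrightarrow> - x \<in> A" for x using 2[OF 1, of x] by simp
  show "x \<in> A \<Longrightarrow> y \<in> A \<Longrightarrow> x + y \<in> A" using 2[OF _ 3, of x y] by simp
qed

lemma add_subgroup_sum: "add_subgroup A \<Longrightarrow> (\<And>i. i \<in> I \<Longrightarrow> f i \<in> A) \<Longrightarrow> sum f I \<in> A"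
  by (induction I rule: infinite_finite_induct) (auto simp: add_subgroupD)

lemma coset_of_eq_iff:
  assumes "add_subgroup B"
  shows "coset_of B a = coset_of B a' \<longleftrightarrow> a - a' \<in> B"
proof
  assume "coset_of B a = coset_of B a'"
  moreover have "a \<in> coset_of B a" using add_subgroupD(1)[OF assms] by (force simp: coset_of_def)
  ultimately obtain b where "b \<in> B" "a = b + a'" by (auto simp: coset_of_def)
  then show "a - a' \<in> B" by simp
next
  assume d: "a - a' \<in> B"
  have "b + a \<in> coset_of B a'" if "b \<in> B" for b
    using add_subgroupD(4)[OF assms that d] unfolding coset_of_def
    by (intro image_eqI[of _ _ "b + (a - a')"]) auto
  moreover have "b + a' \<in> coset_of B a" if "b \<in> B" for b
    using add_subgroupD(2)[OF assms that d] unfolding coset_of_def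
    by (intro image_eqI[of _ _ "b - (a - a')"]) auto
  ultimately show "coset_of B a = coset_of B a'" by (auto simp: coset_of_def)
qed

lemma ex_transversal:
  assumes "add_subgroup B"
  shows "\<exists>T. transversal T A B"
proof -
  obtain T where T: "T \<subseteq> A" "inj_on (coset_of B) T" "coset_of B ` A = coset_of B ` T"
    by (meson subset_image_inj order_refl)
  have "\<exists>t\<in>T. a - t \<in> B" if "a \<in> A" for a
  proof -
    have "coset_of B a \<in> coset_of B ` T" using that T(3) by blast
    then show ?thesis using coset_of_eq_iff[OF assms] by blast
  qed
  moreover have "s = t" if "s \<in> T" "t \<in> T" "s - t \<in> B" for s t
    using T(2) that coset_of_eq_iff[OF assms, of s t] by (simp add: inj_on_def)
  ultimately have "transversal T A B" using T(1) unfolding transversal_def by blast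
  then show ?thesis by blast
qed

lemma transversal_bij:
  assumes "add_subgroup B" "transversal T A B"
  shows "bij_betw (coset_of B) T (coset_of B ` A)"
  unfolding bij_betw_def
proof
  show "inj_on (coset_of B) T"
    using assms coset_of_eq_iff[OF assms(1)] by (auto simp: transversal_def inj_on_def)
  show "coset_of B ` T = coset_of B ` A"
  proof
    show "coset_of B ` T \<subseteq> coset_of B ` A" using assms(2) by (auto simp: transversal_def)
    show "coset_of B ` A \<subseteq> coset_of B ` T"
    proof
      fix X assume "X \<in> coset_of B ` A"
      then obtain a where a: "a \<in> A" "X = coset_of B a" by auto
      then obtain t where "t \<in> T" "a - t \<in> B" using assms(2) by (auto simp: transversal_def)
      then show "X \<in> coset_of B ` T" using a coset_of_eq_iff[OF assms(1), of a t] by auto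
    qed
  qed
qed

text \<open>For infinite index both sides are 0, so the index formulas below hold without a case
  distinction.\<close>

lemma idx_transversal: "add_subgroup B \<Longrightarrow> transversal T A B \<Longrightarrow> idx A B = card T"
  unfolding idx_def using bij_betw_same_card[OF transversal_bij] by metis

text \<open>Sums of representatives for the two successive quotients form a system of
  representatives for the whole quotient.\<close>

lemma idx_mult:
  assumes B: "add_subgroup B" and C: "add_subgroup C" and sub: "C \<subseteq> B" "B \<subseteq> A" and A: "add_subgroup A"
  shows "idx A C = idx A B * idx B C"
proof -
  obtain T where T: "transversal T A B" using ex_transversal[OF B] by blast
  obtain S where S: "transversal S B C" using ex_transversal[OF C] by blast
  have eq: "t = t' \<and> s = s'" if "t \<in> T" "t' \<in> T" "s \<in> S" "s' \<in> S" "(t + s) - (t' + s') \<in> C" for t t' s s'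
  proof -
    have "s' - s \<in> B" using that S add_subgroupD(2)[OF B] by (auto simp: transversal_def)
    moreover have "(t + s) - (t' + s') \<in> B" using that sub by auto
    ultimately have "((t + s) - (t' + s')) + (s' - s) \<in> B" by (intro add_subgroupD(4)[OF B])
    then have "t - t' \<in> B" by (simp add: algebra_simps)
    then have "t = t'" using T that by (auto simp: transversal_def)
    then have "s - s' \<in> C" using that by simp
    then show ?thesis using S that \<open>t = t'\<close> by (auto simp: transversal_def)
  qed
  have inj: "inj_on (\<lambda>(t,s). t + s) (T \<times> S)"
    using eq add_subgroupD(1)[OF C] by (force simp: inj_on_def)
  have "transversal ((\<lambda>(t,s). t + s) ` (T \<times> S)) A C"
    unfolding transversal_def
  proof (intro conjI ballI)
    show "(\<lambda>(t,s). t + s) ` (T \<times> S) \<subseteq> A"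
      using T S sub add_subgroupD(4)[OF A] by (auto simp: transversal_def subset_iff)
    fix a assume "a \<in> A"
    then obtain t where t: "t \<in> T" "a - t \<in> B" using T by (auto simp: transversal_def)
    then obtain s where s: "s \<in> S" "(a - t) - s \<in> C" using S by (auto simp: transversal_def)
    show "\<exists>x\<in>(\<lambda>(t,s). t + s) ` (T \<times> S). a - x \<in> C"
    proof (rule bexI)
      show "a - (t + s) \<in> C" using s(2) by (simp add: algebra_simps)
      show "t + s \<in> (\<lambda>(t,s). t + s) ` (T \<times> S)" using t s by (intro image_eqI[of _ _ "(t, s)"]) auto
    qed
  next
    fix x y assume "x \<in> (\<lambda>(t,s). t + s) ` (T \<times> S)" "y \<in> (\<lambda>(t,s). t + s) ` (T \<times> S)"
    then obtain t s t' s' where "t \<in> T" "t' \<in> T" "s \<in> S" "s' \<in> S" "x = t + s" "y = t' + s'"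
      by auto
    then show "x - y \<in> C \<longrightarrow> x = y" using eq[of t t' s s'] by auto
  qed
  then have "idx A C = card ((\<lambda>(t,s). t + s) ` (T \<times> S))" by (rule idx_transversal[OF C])
  also have "\<dots> = card T * card S" using card_image[OF inj] by (simp add: card_cartesian_product)
  also have "\<dots> = idx A B * idx B C" using idx_transversal[OF B T] idx_transversal[OF C S] by simp
  finally show ?thesis .
qed

lemma add_subgroup_scale: "add_subgroup A \<Longrightarrow> add_subgroup ((*) c ` A)"
  unfolding add_subgroup_def by (auto simp flip: right_diff_distrib)

lemma idx_scale:
  assumes c: "c \<noteq> 0" and B: "add_subgroup B"
  shows "idx ((*) c ` A) ((*) c ` B) = idx A B"
proof -
  obtain T where T: "transversal T A B" using ex_transversal[OF B] by blast
  have "c * x - c * y \<in> (*) c ` B \<longleftrightarrow> x - y \<in> B" for x y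
    using c by (auto simp flip: right_diff_distrib)
  then have "transversal ((*) c ` T) ((*) c ` A) ((*) c ` B)"
    using T unfolding transversal_def by (simp add: image_mono)
  then have "idx ((*) c ` A) ((*) c ` B) = card ((*) c ` T)"
    by (rule idx_transversal[OF add_subgroup_scale[OF B]])
  also have "\<dots> = card T" using c by (intro card_image) (auto simp: inj_on_def)
  finally show ?thesis using idx_transversal[OF B T] by simp
qed

lemma idx_self: "add_subgroup A \<Longrightarrow> idx A A = 1"
  using idx_transversal[of A "{0}" A] by (auto simp: transversal_def add_subgroupD)

lemma idx_pigeonhole:
  assumes B: "add_subgroup B" and pos: "idx A B > 0" and f: "\<And>i. i \<in> I \<Longrightarrow> f i \<in> A" and c: "card I > idx A B"
  shows "\<exists>i\<in>I. \<exists>j\<in>I. i \<noteq> j \<and> f i - f j \<in> B"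
proof -
  have fin: "finite (coset_of B ` A)" using pos unfolding idx_def by (rule card_ge_0_finite)
  have "card ((\<lambda>i. coset_of B (f i)) ` I) \<le> idx A B"
    unfolding idx_def by (rule card_mono[OF fin]) (use f in auto)
  then have "\<not> inj_on (\<lambda>i. coset_of B (f i)) I" using c card_image by fastforce
  then show ?thesis unfolding inj_on_def coset_of_eq_iff[OF B] by blast
qed

lemma idx_eq_1: "add_subgroup B \<Longrightarrow> B \<subseteq> A \<Longrightarrow> 0 \<in> A \<Longrightarrow> idx A B = 1 \<Longrightarrow> A = B"
proof -
  assume B: "add_subgroup B" "B \<subseteq> A" "0 \<in> A" "idx A B = 1"
  have "a \<in> B" if "a \<in> A" for a
  proof (rule ccontr)
    assume "a \<notin> B"
    then have "card {0, a} > idx A B" using add_subgroupD(1)[OF B(1)] B(4) by (auto simp: card_insert_if)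
    then have "\<exists>i\<in>{0,a}. \<exists>j\<in>{0,a}. i \<noteq> j \<and> i - j \<in> B"
      using idx_pigeonhole[OF B(1), of A "{0,a}" "\<lambda>x. x"] B that by auto
    then show False using \<open>a \<notin> B\<close> add_subgroupD(3)[OF B(1), of "-a"] by auto
  qed
  then show ?thesis using B by auto
qed

lemma finite_transversal:
  assumes "transversal T A B" "add_subgroup B" "idx A B > 0"
  shows "finite T"
  using assms idx_transversal card_ge_0_finite by metis

subsection \<open>Rings of integers\<close>

definition ints_of :: "complex set \<Rightarrow> complex set" where
  "ints_of K = {z \<in> K. algebraic_int z}"

locale nfield =
  fixes K :: "complex set"
  assumes number_field: "number_field K"

sublocale nfield \<subseteq> csubfield K
  by (rule number_field_csubfield[OF number_field])

sublocale nfield \<subseteq> Oint: subring_set "ints_of K"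
  by unfold_locales
    (auto simp: ints_of_def intro: AI.add[simplified] AI.mult[simplified] AI.neg[simplified])

context nfield
begin

abbreviation "\<O> \<equiv> ints_of K"
abbreviation "n \<equiv> field_degree K"
abbreviation "Emb \<equiv> embeddings K"
abbreviation "Nm \<equiv> fnorm K"

lemma n_pos: "n > 0" by (rule embeddings_number_field(3)[OF number_field])
lemma finite_Emb: "finite Emb" by (rule embeddings_number_field(1)[OF number_field])
lemma card_Emb: "card Emb = n" by (rule embeddings_number_field(2)[OF number_field])

lemma OK: "x \<in> \<O> \<Longrightarrow> x \<in> K" by (simp add: ints_of_def)

lemma O_multiple: "finite S \<Longrightarrow> S \<subseteq> K \<Longrightarrow> \<exists>m::nat. m > 0 \<and> (\<forall>x\<in>S. of_nat m * x \<in> \<O>)"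
  using common_denominator[of S] number_field_algebraic[OF number_field] unfolding ints_of_def
  by (metis (no_types, lifting) mem_Collect_eq mult of_nat subset_iff)

lemma add_subgroup_O: "add_subgroup \<O>"
  by (auto simp: add_subgroup_def)

lemma Nm_int: "c \<in> \<O> \<Longrightarrow> \<exists>k::int. Nm c = of_int k"
  using fnorm_Ints[OF number_field] by (auto simp: ints_of_def elim: Ints_cases)

lemma Nm_ge_1: "c \<in> \<O> \<Longrightarrow> c \<noteq> 0 \<Longrightarrow> cmod (Nm c) \<ge> 1"
proof -
  assume c: "c \<in> \<O>" "c \<noteq> 0"
  obtain k :: int where k: "Nm c = of_int k" using Nm_int[OF c(1)] by blast
  have "Nm c \<noteq> 0" using fnorm_eq_0_iff[OF number_field OK[OF c(1)]] c(2) by simp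
  then have "k \<noteq> 0" using k by auto
  then show ?thesis using k by simp
qed

lemma Nm_mult: "x \<in> K \<Longrightarrow> y \<in> K \<Longrightarrow> Nm (x * y) = Nm x * Nm y"
  by (rule fnorm_mult[OF number_field])

lemma Nm_1: "Nm 1 = 1"
  using fnorm_of_nat[OF number_field, of 1] by simp

lemma Nm_power: "x \<in> K \<Longrightarrow> Nm (x ^ k) = Nm x ^ k"
  by (induction k) (simp_all add: Nm_1 Nm_mult power)

text \<open>The inclusion of \<open>K\<close> is one of the embeddings, cut down to \<open>K\<close>
  to be extensional. The product of the other conjugates is integral and equals
  \<open>Nm c / c\<close>, which shows that it lies in \<open>K\<close>.\<close>

lemma cofactor:
  assumes c: "c \<in> \<O>" "c \<noteq> 0"
  shows "\<exists>c'\<in>\<O>. c * c' = Nm c"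
proof -
  define \<iota> where "\<iota> = restrict (\<lambda>x::complex. x) K"
  have i: "\<iota> \<in> Emb" unfolding embeddings_iff \<iota>_def by auto
  have "Nm c = \<iota> c * (\<Prod>\<sigma>\<in>Emb - {\<iota>}. \<sigma> c)"
    unfolding fnorm_def by (rule prod.remove[OF finite_Emb i])
  moreover have "\<iota> c = c" using OK[OF c(1)] by (simp add: \<iota>_def)
  ultimately have eq: "c * (\<Prod>\<sigma>\<in>Emb - {\<iota>}. \<sigma> c) = Nm c" by simp
  have "algebraic_int (\<sigma> c)" if "\<sigma> \<in> Emb" for \<sigma>
  proof -
    interpret embedding K \<sigma> by unfold_locales fact
    show ?thesis using algebraic_int_hom c by (auto simp: ints_of_def)
  qed
  then have "algebraic_int (\<Prod>\<sigma>\<in>Emb - {\<iota>}. \<sigma> c)" using AI.prod[of "Emb - {\<iota>}"] by simp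
  moreover have "(\<Prod>\<sigma>\<in>Emb - {\<iota>}. \<sigma> c) = Nm c / c" using eq c by (simp add: field_simps)
  moreover have "Nm c / c \<in> K"
    using fnorm_Rats[OF number_field OK[OF c(1)]] Rats_subset OK[OF c(1)] by auto
  ultimately show ?thesis using eq by (intro bexI[of _ "Nm c / c"]) (auto simp: ints_of_def)
qed

section \<open>Lattices in the ring of integers\<close>

lemma integral_primitive:
  "\<exists>\<theta> f. \<theta> \<in> \<O> \<and> K = Q_adjoin \<theta> \<and> is_min_poly \<rat> \<theta> f \<and> degree f = n"
proof -
  obtain z where z: "algebraic z" "K = Q_adjoin z" using number_field_primitive[OF number_field] by auto
  have zK: "z \<in> K" using z in_Q_adjoin by simp
  obtain m :: nat where m: "m > 0" "of_nat m * z \<in> \<O>" using O_multiple[of "{z}"] zK by auto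
  define \<theta> where "\<theta> = of_nat m * z"
  have alg: "algebraic \<theta>" using m(2) by (auto simp: \<theta>_def ints_of_def intro: algebraic_int_imp_algebraic)
  interpret T: csubfield "Q_adjoin \<theta>" by (rule csubfield_Q_adjoin[OF alg])
  have "z = \<theta> / of_nat m" using m by (simp add: \<theta>_def)
  then have "z \<in> Q_adjoin \<theta>" using in_Q_adjoin[of \<theta>] by auto
  then have "K \<subseteq> Q_adjoin \<theta>" using z Q_adjoin_subset T.csubfield_axioms by blast
  moreover have "Q_adjoin \<theta> \<subseteq> K"
    using m(2) by (intro Q_adjoin_subset csubfield_axioms) (auto simp: \<theta>_def ints_of_def)
  ultimately have KQ: "K = Q_adjoin \<theta>" by auto
  obtain f where f: "is_min_poly \<rat> \<theta> f" using RatF.ex_min_poly[OF alg] by auto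
  show ?thesis using KQ f field_degree_Q_adjoin[OF f] m(2) unfolding \<theta>_def by metis
qed

text \<open>A rational basis of \<open>K\<close> made of algebraic integers, with both conditions
  phrased over \<int>. It need not generate \<open>\<O>\<close>: an element is only guaranteed to
  have some positive integer multiple in the span.\<close>

definition int_basis :: "(nat \<Rightarrow> complex) \<Rightarrow> bool" where
  "int_basis w \<longleftrightarrow> (\<forall>i<n. w i \<in> \<O>) \<and> (\<forall>c::nat \<Rightarrow> int. (\<Sum>i<n. of_int (c i) * w i) = 0 \<longrightarrow> (\<forall>i<n. c i = 0)) \<and>
     (\<forall>z\<in>K. \<exists>D::nat. D > 0 \<and> (\<exists>c::nat \<Rightarrow> int. of_nat D * z = (\<Sum>i<n. of_int (c i) * w i)))"

lemma int_basisD: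
  assumes "int_basis w"
  shows "i < n \<Longrightarrow> w i \<in> \<O>"
    and "(\<Sum>i<n. of_int (c i) * w i) = 0 \<Longrightarrow> \<forall>i<n. c i = 0"
    and "z \<in> K \<Longrightarrow> \<exists>D::nat. D > 0 \<and> (\<exists>c::nat \<Rightarrow> int. of_nat D * z = (\<Sum>i<n. of_int (c i) * w i))"
  using assms by (simp_all add: int_basis_def)

lemma integral_basis: "\<exists>w. int_basis w"
proof -
  obtain \<theta> f where th: "\<theta> \<in> \<O>" "K = Q_adjoin \<theta>" and f: "is_min_poly \<rat> \<theta> f" "degree f = n"
    using integral_primitive by blast
  have 1: "\<forall>i<n. \<theta> ^ i \<in> \<O>" using th(1) by auto
  have 2: "\<forall>i<n. c i = 0" if "(\<Sum>i<n. of_int (c i) * \<theta> ^ i) = 0" for c :: "nat \<Rightarrow> int"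
  proof -
    define p where "p = (\<Sum>i<n. monom (of_int (c i) :: complex) i)"
    have cp: "coeff p i = (if i < n then of_int (c i) else 0)" for i
      by (auto simp: p_def coeff_sum sum.delta' cong: if_cong)
    have "coeffs_in \<rat> p" by (auto simp: coeffs_in_def cp)
    moreover have "poly p \<theta> = 0" using that by (simp add: p_def poly_sum poly_monom)
    ultimately obtain q where q: "p = q * f" using is_min_polyD[OF f(1)] by blast
    have "p = 0"
    proof (rule ccontr)
      assume "p \<noteq> 0"
      then have "n \<le> degree p" using q f(2) by (auto simp: degree_mult_eq)
      then have "coeff p (degree p) = 0" by (simp add: cp)
      then show False using \<open>p \<noteq> 0\<close> by simp
    qed
    then show ?thesis using cp by (metis coeff_0 of_int_eq_0_iff)
  qed
  have 3: "\<exists>D::nat. D > 0 \<and> (\<exists>c::nat \<Rightarrow> int. of_nat D * z = (\<Sum>i<n. of_int (c i) * \<theta> ^ i))" if z: "z \<in> K" for z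
  proof -
    have "K = Q.span ((\<lambda>i. \<theta> ^ i) ` {..<n})"
      using trans[OF th(2) Q_adjoin_eq_span(1)[OF f(1)]] unfolding f(2) .
    from equalityD1[OF this, THEN subsetD, OF z]
    have "z \<in> Q.span ((\<lambda>i. \<theta> ^ i) ` {..<n})" .
    then obtain u where "z = (\<Sum>x\<in>(\<lambda>i. \<theta> ^ i) ` {..<n}. of_rat (u x) * x)"
      using Q.span_finite[of "(\<lambda>i. \<theta> ^ i) ` {..<n}"] by auto
    also have "\<dots> = (\<Sum>j<n. of_rat (u (\<theta> ^ j)) * \<theta> ^ j)"
      using Q_adjoin_eq_span(2)[OF f(1)] f(2) by (simp add: sum.reindex)
    finally have zs: "z = (\<Sum>j<n. of_rat (u (\<theta> ^ j)) * \<theta> ^ j)" .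
    have "\<exists>m::nat. m > 0 \<and> (\<forall>x\<in>(\<lambda>j. of_rat (u (\<theta> ^ j))) ` {..<n}. algebraic_int (of_nat m * x :: complex))"
      by (rule common_denominator) (auto intro: rat_imp_algebraic)
    then obtain D :: nat where D: "D > 0" "\<And>j. j < n \<Longrightarrow> algebraic_int (of_nat D * of_rat (u (\<theta> ^ j)) :: complex)"
      by auto
    have "\<exists>k::int. of_nat D * of_rat (u (\<theta> ^ j)) = (of_int k :: complex)" if "j < n" for j
      using rational_algebraic_int_is_int[OF D(2)[OF that]] by (auto elim: Ints_cases)
    then obtain c :: "nat \<Rightarrow> int" where c: "\<And>j. j < n \<Longrightarrow> of_nat D * of_rat (u (\<theta> ^ j)) = (of_int (c j) :: complex)"
      by metis
    have "of_nat D * z = (\<Sum>j<n. of_int (c j) * \<theta> ^ j)"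
      unfolding zs sum_distrib_left by (rule sum.cong) (simp_all add: c[symmetric])
    then show ?thesis using D(1) by blast
  qed
  have "int_basis (\<lambda>i. \<theta> ^ i)" unfolding int_basis_def
    by (intro conjI allI impI ballI 1 2[rule_format] 3)
  then show ?thesis by blast
qed

text \<open>For the lattice \<open>L\<close> of an integral basis the index of kL is k^n by
  comparing coordinates modulo k. To pass to \<open>\<O>\<close> before knowing it to be finitely
  generated, any finite set of elements incongruent modulo m is enclosed in a lattice between
  \<open>L\<close> and a fraction of \<open>L\<close>. There the index is the same, and the
  pigeonhole principle bounds the set.\<close>

lemma idx_O_multiple:
  assumes m: "m > 0"
  shows "idx \<O> ((*) (of_nat m) ` \<O>) > 0" "idx \<O> ((*) (of_nat m) ` \<O>) \<le> m ^ n"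
proof -
  obtain w where "int_basis w" using integral_basis by blast
  note w = int_basisD[OF this]
  define L where "L = {\<Sum>i<n. of_int (c i) * w i | c :: nat \<Rightarrow> int. True}"
  have L: "add_subgroup L" unfolding add_subgroup_def
  proof (intro conjI ballI)
    show "0 \<in> L" unfolding L_def by (intro CollectI exI[of _ "\<lambda>_. 0"]) simp
    fix x y assume "x \<in> L" "y \<in> L"
    then obtain c d :: "nat \<Rightarrow> int" where "x = (\<Sum>i<n. of_int (c i) * w i)" "y = (\<Sum>i<n. of_int (d i) * w i)"
      by (auto simp: L_def)
    then have "x - y = (\<Sum>i<n. of_int (c i - d i) * w i)" by (simp add: algebra_simps sum_subtractf)
    then show "x - y \<in> L" unfolding L_def by (intro CollectI exI[of _ "\<lambda>i. c i - d i"]) simp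
  qed
  have LO: "L \<subseteq> \<O>" unfolding L_def using w(1) by auto
  have L_multiple: "of_nat k * x \<in> L" if "x \<in> L" for k x
    using that by (induction k) (auto simp: L algebra_simps add_subgroupD)
  have idxL: "idx L ((*) (of_nat k) ` L) = k ^ n" if k: "k > 0" for k
  proof -
    define P where "P = PiE {..<n} (\<lambda>_. {0..<k})"
    define g where "g = (\<lambda>a::nat \<Rightarrow> nat. \<Sum>i<n. of_nat (a i) * w i)"
    have diff: "g a - g b = (\<Sum>i<n. of_int (int (a i) - int (b i)) * w i)" for a b
      by (simp add: g_def algebra_simps sum_subtractf)
    have eq: "a = b" if ab: "a \<in> P" "b \<in> P" "g a - g b \<in> (*) (of_nat k) ` L" for a b
    proof -
      from ab(3) obtain c :: "nat \<Rightarrow> int" where "g a - g b = of_nat k * (\<Sum>i<n. of_int (c i) * w i)"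
        by (auto simp: L_def)
      then have "(\<Sum>i<n. of_int (int (a i) - int (b i) - int k * c i) * w i) = 0"
        unfolding diff by (simp add: sum_subtractf sum_distrib_left left_diff_distrib mult.assoc)
      from w(2)[OF this] have z: "int (a i) - int (b i) = int k * c i" if "i < n" for i
        using that by auto
      have "a i = b i" if i: "i < n" for i
      proof -
        have "a i < k" "b i < k" using ab i by (auto simp: P_def PiE_iff)
        then have "\<bar>int k * c i\<bar> < int k * 1" using z[OF i] by linarith
        then have "c i = 0" using k by (simp add: abs_mult)
        then show ?thesis using z[OF i] by simp
      qed
      then show ?thesis using ab by (intro extensionalityI[of a "{..<n}" b]) (auto simp: P_def PiE_def)
    qed
    have inj: "inj_on g P"
      by (rule inj_onI, rule eq) (auto simp: add_subgroupD[OF add_subgroup_scale[OF L]])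
    have "transversal (g ` P) L ((*) (of_nat k) ` L)" unfolding transversal_def
    proof (intro conjI ballI)
      have "g a \<in> L" for a unfolding g_def L_def by (intro CollectI exI[of _ "\<lambda>i. int (a i)"]) simp
      then show "g ` P \<subseteq> L" by auto
      fix x assume "x \<in> L"
      then obtain c :: "nat \<Rightarrow> int" where c: "x = (\<Sum>i<n. of_int (c i) * w i)" by (auto simp: L_def)
      define a where "a = restrict (\<lambda>i. nat (c i mod int k)) {..<n}"
      have "a \<in> P" using k by (auto simp: a_def P_def nat_less_iff)
      have "x - g a = of_nat k * (\<Sum>i<n. of_int (c i div int k) * w i)"
      proof -
        have "of_int (c i) * w i - of_nat (a i) * w i = of_nat k * (of_int (c i div int k) * w i)" if "i < n" for i
        proof -
          have "int (a i) = c i mod int k" using that k by (simp add: a_def)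
          then have "c i = int k * (c i div int k) + int (a i)" by simp
          then have "(of_int (c i) :: complex) = of_int (int k * (c i div int k) + int (a i))" by simp
          then show ?thesis by (simp add: algebra_simps)
        qed
        then show ?thesis unfolding c g_def sum_distrib_left sum_subtractf[symmetric]
          by (intro sum.cong) auto
      qed
      moreover have "(\<Sum>i<n. of_int (c i div int k) * w i) \<in> L"
        unfolding L_def by (intro CollectI exI[of _ "\<lambda>i. c i div int k"]) simp
      ultimately have "x - g a \<in> (*) (of_nat k) ` L" by blast
      then show "\<exists>t\<in>g ` P. x - t \<in> (*) (of_nat k) ` L" using \<open>a \<in> P\<close> by blast
    next
      fix s t assume "s \<in> g ` P" "t \<in> g ` P"
      then show "s - t \<in> (*) (of_nat k) ` L \<longrightarrow> s = t" using eq by blast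
    qed
    then have "idx L ((*) (of_nat k) ` L) = card (g ` P)"
      by (rule idx_transversal[OF add_subgroup_scale[OF L]])
    also have "\<dots> = card P" by (rule card_image[OF inj])
    also have "\<dots> = k ^ n" by (simp add: P_def card_PiE)
    finally show ?thesis .
  qed
  have sgm: "add_subgroup ((*) (of_nat m) ` \<O>)" by (rule add_subgroup_scale[OF add_subgroup_O])
  have bound: "card Y \<le> m ^ n" if Y: "finite Y" "Y \<subseteq> \<O>"
    and inc: "\<And>x y. x \<in> Y \<Longrightarrow> y \<in> Y \<Longrightarrow> x - y \<in> (*) (of_nat m) ` \<O> \<Longrightarrow> x = y" for Y
  proof -
    have "\<exists>D::nat. D > 0 \<and> (\<forall>y\<in>Y. of_nat D * y \<in> L)" using Y
    proof (induction Y rule: finite_induct)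
      case (insert y Y)
      then obtain D :: nat where D: "D > 0" "\<forall>y\<in>Y. of_nat D * y \<in> L" by auto
      obtain E :: nat where E: "E > 0" "of_nat E * y \<in> L"
        using w(3)[of y] insert OK unfolding L_def by blast
      have "of_nat (D * E) * x \<in> L" if "x \<in> insert y Y" for x
        using L_multiple[of "of_nat D * x" E] L_multiple[of "of_nat E * x" D] D E that
        by (auto simp: mult_ac)
      then show ?case using D E by (intro exI[of _ "D * E"]) auto
    qed (auto intro: exI[of _ 1])
    then obtain D :: nat where D: "D > 0" "\<And>y. y \<in> Y \<Longrightarrow> of_nat D * y \<in> L" by auto
    define c :: complex where "c = inverse (of_nat D)"
    have c0: "c \<noteq> 0" using D by (simp add: c_def)
    define L' where "L' = (*) c ` L"
    have L': "add_subgroup L'" unfolding L'_def by (rule add_subgroup_scale[OF L])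
    have L'I: "x \<in> L'" if "of_nat D * x \<in> L" for x
      unfolding L'_def using that D by (intro image_eqI[of _ _ "of_nat D * x"]) (auto simp: c_def)
    \<comment> \<open>This lattice contains the test set \<open>Y\<close>, lies inside
      \<open>\<O>\<close>, and is commensurable with \<open>L\<close> because D clears the
      denominators of \<open>Y\<close>.\<close>
    define M where "M = zmod.span (L \<union> Y)"
    have int_scaleI: "int_scale k x \<in> A" if "add_subgroup A" "x \<in> A" for k x A
    proof -
      have nat: "of_nat j * x \<in> A" for j
        using that by (induction j) (auto simp: algebra_simps add_subgroupD)
      show ?thesis using nat add_subgroupD(3)[OF that(1)] unfolding int_scale_def
        by (cases k rule: int_cases2) auto
    qed
    have sub: "zmod.subspace A" if "add_subgroup A" for A
      using that int_scaleI by (intro zmod.subspaceI) (auto simp: add_subgroupD)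
    have M: "add_subgroup M" unfolding add_subgroup_def M_def
      using zmod.span_zero zmod.span_diff by blast
    have LM: "L \<subseteq> M" "Y \<subseteq> M" unfolding M_def using zmod.span_superset[of "L \<union> Y"] by auto
    have LM': "M \<subseteq> L'" unfolding M_def
      by (rule zmod.span_minimal[OF _ sub[OF L']]) (use L'I D(2) L_multiple in auto)
    have MO: "M \<subseteq> \<O>" unfolding M_def
      by (rule zmod.span_minimal[OF _ sub[OF add_subgroup_O]]) (use LO Y in auto)
    let ?m = "(*) (of_nat m :: complex)"
    have mM: "?m ` M \<subseteq> M" using int_scaleI[OF M, of _ "int m"] by (auto simp: int_scale_def)
    have mL': "?m ` L' \<subseteq> L'" using int_scaleI[OF L', of _ "int m"] by (auto simp: int_scale_def)
    note sg = add_subgroup_scale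
    have scm: "?m ` (*) c ` A = (*) c ` ?m ` A" for A by (auto simp: image_iff mult_ac)
    have "(*) (of_nat D) ` L \<subseteq> L" using L_multiple by auto
    have "c * (of_nat D * x) = x" for x using D by (simp add: c_def)
    then have "L = (*) c ` (*) (of_nat D) ` L" by (simp only: image_image image_ident)
    then have "idx L' L = idx L ((*) (of_nat D) ` L)"
      unfolding L'_def using idx_scale[OF c0 sg[OF L, of "of_nat D"], of L] by simp
    then have "idx L' L > 0" using idxL[OF D(1)] D(1) by simp
    then have r: "idx L' M > 0" using idx_mult[OF M L LM(1) LM' L'] by (simp add: zero_less_mult_iff)
    \<comment> \<open>The index of m M in L' is computed through M and through m L'. The index of M
      in L' equals that of m M in m L' and cancels.\<close>
    have "idx L' (?m ` M) = idx L' M * idx M (?m ` M)"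
      by (rule idx_mult[OF M sg[OF M] mM LM' L'])
    moreover have "idx L' (?m ` M) = idx L' (?m ` L') * idx (?m ` L') (?m ` M)"
      using LM' by (intro idx_mult sg L' M mL') auto
    moreover have "idx (?m ` L') (?m ` M) = idx L' M" using m by (intro idx_scale M) auto
    moreover have "idx L' (?m ` L') = m ^ n"
      unfolding L'_def scm using idx_scale[OF c0 sg[OF L, of "of_nat m"], of L] idxL[OF m] by simp
    ultimately have idxM: "idx M (?m ` M) = m ^ n" using r by simp
    show ?thesis
    proof (rule ccontr)
      assume "\<not> card Y \<le> m ^ n"
      then have "card Y > idx M (?m ` M)" using idxM by simp
      then obtain x y where xy: "x \<in> Y" "y \<in> Y" "x \<noteq> y" "x - y \<in> ?m ` M"
        using idx_pigeonhole[OF sg[OF M], of M "of_nat m" Y "\<lambda>x. x"] idxM m LM(2) by auto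
      then have "x - y \<in> ?m ` \<O>" using MO by auto
      then show False using inc xy by blast
    qed
  qed
  obtain T where T: "transversal T \<O> ((*) (of_nat m) ` \<O>)" using ex_transversal[OF sgm] by blast
  have finT: "finite T"
  proof (rule ccontr)
    assume "infinite T"
    then obtain Y where Y: "Y \<subseteq> T" "finite Y" "card Y = Suc (m ^ n)"
      using infinite_arbitrarily_large by metis
    have "card Y \<le> m ^ n"
      by (rule bound) (use Y T in \<open>unfold transversal_def, blast+\<close>)
    then show False using Y by simp
  qed
  have idxT: "idx \<O> ((*) (of_nat m) ` \<O>) = card T" by (rule idx_transversal[OF sgm T])
  have "T \<noteq> {}" using T by (auto simp: transversal_def)
  then show "idx \<O> ((*) (of_nat m) ` \<O>) > 0" using idxT finT by (simp add: card_gt_0_iff)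
  have "card T \<le> m ^ n" by (rule bound) (use T finT in \<open>auto simp: transversal_def\<close>)
  then show "idx \<O> ((*) (of_nat m) ` \<O>) \<le> m ^ n" using idxT by simp
qed

section \<open>Ideals, elements of small norm and the index of a principal ideal\<close>

definition is_ideal :: "complex set \<Rightarrow> bool" where
  "is_ideal I \<longleftrightarrow> I \<subseteq> \<O> \<and> add_subgroup I \<and> (\<forall>a\<in>\<O>. \<forall>x\<in>I. a * x \<in> I)"

lemma is_idealD:
  assumes "is_ideal I"
  shows "I \<subseteq> \<O>" "add_subgroup I" "a \<in> \<O> \<Longrightarrow> x \<in> I \<Longrightarrow> a * x \<in> I"
  using assms by (auto simp: is_ideal_def)

abbreviation principal :: "complex \<Rightarrow> complex set" where
  "principal c \<equiv> (*) c ` \<O>"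

lemma is_ideal_principal: "c \<in> \<O> \<Longrightarrow> is_ideal (principal c)"
  unfolding is_ideal_def using add_subgroup_scale[OF add_subgroup_O]
  by (auto simp: mult.left_commute)

lemma principal_subset: "is_ideal I \<Longrightarrow> c \<in> I \<Longrightarrow> principal c \<subseteq> I"
  using is_idealD(3) by (auto simp: mult.commute)

text \<open>The cofactor shows that the norm of a nonzero element is a multiple of that element, and
  this norm is a nonzero integer.\<close>

lemma ideal_contains_nat:
  assumes I: "is_ideal I" "I \<noteq> {0}"
  shows "\<exists>m::nat. m > 0 \<and> of_nat m \<in> I"
proof -
  obtain c where c: "c \<in> I" "c \<noteq> 0" using I add_subgroupD(1)[OF is_idealD(2)[OF I(1)]] by blast
  have cO: "c \<in> \<O>" using c I by (auto simp: is_ideal_def)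
  obtain c' where c': "c' \<in> \<O>" "c * c' = Nm c" using cofactor[OF cO c(2)] by blast
  obtain k :: int where k: "Nm c = of_int k" using Nm_int[OF cO] by blast
  have k0: "k \<noteq> 0" using fnorm_eq_0_iff[OF number_field OK[OF cO]] c(2) k by auto
  have "of_int k \<in> I" using is_idealD(3)[OF I(1) c'(1) c(1)] c'(2) k by (simp add: mult.commute)
  then have "of_int \<bar>k\<bar> \<in> I" using add_subgroupD(3)[OF is_idealD(2)[OF I(1)]]
    by (cases "k \<ge> 0") auto
  then have "of_nat (nat \<bar>k\<bar>) \<in> I" by simp
  then show ?thesis using k0 by (intro exI[of _ "nat \<bar>k\<bar>"]) auto
qed

lemma idx_ideal_pos:
  assumes I: "is_ideal I" "I \<noteq> {0}"
  shows "idx \<O> I > 0"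
proof -
  obtain m :: nat where m: "m > 0" "of_nat m \<in> I" using ideal_contains_nat[OF I] by blast
  have "idx \<O> (principal (of_nat m)) = idx \<O> I * idx I (principal (of_nat m))"
    by (intro idx_mult is_idealD I(1) add_subgroup_scale add_subgroup_O principal_subset m)
  then show ?thesis using idx_O_multiple(1)[OF m(1)] by (simp add: zero_less_mult_iff)
qed

text \<open>The pigeonhole principle for a box in the lattice spanned by an integral basis.\<close>

lemma small_element:
  "\<exists>A>0. \<forall>I. is_ideal I \<and> I \<noteq> {0} \<longrightarrow>
     (\<exists>\<beta>\<in>I. \<beta> \<noteq> 0 \<and> cmod (Nm \<beta>) \<le> A * real (idx \<O> I))"
proof -
  obtain w where "int_basis w" using integral_basis by blast
  note w = int_basisD[OF this]
  \<comment> \<open>Each factor bounds a conjugate of a difference of two points of the box with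
    side R, up to the factor R. The summand 1 keeps it positive.\<close>
  define A where "A = (\<Prod>\<sigma>\<in>Emb. 1 + (\<Sum>i<n. cmod (\<sigma> (w i))))"
  have fpos: "1 + (\<Sum>i<n. cmod (\<sigma> (w i))) > 0" for \<sigma>
    using sum_nonneg[of "{..<n}" "\<lambda>i. cmod (\<sigma> (w i))"] by simp
  have "A > 0" unfolding A_def by (intro prod_pos fpos)
  moreover have "\<exists>\<beta>\<in>I. \<beta> \<noteq> 0 \<and> cmod (Nm \<beta>) \<le> A * real (idx \<O> I)" if I: "is_ideal I" "I \<noteq> {0}" for I
  proof -
    define N where "N = idx \<O> I"
    have N: "N > 0" unfolding N_def by (rule idx_ideal_pos[OF I])
    have fin: "finite {R. R ^ n \<le> N}"
    proof (rule finite_subset)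
      show "{R. R ^ n \<le> N} \<subseteq> {..N}"
      proof
        fix R assume "R \<in> {R. R ^ n \<le> N}"
        moreover have "R \<le> R ^ n" using n_pos by (cases R) (auto intro: self_le_power)
        ultimately show "R \<in> {..N}" by auto
      qed
    qed simp
    \<comment> \<open>The largest integer with R^n \<le> N: the box then has (R+1)^n > N points,
      enough for a collision, while the norm of the difference is at most A * R^n \<le> A *
      N.\<close>
    define R where "R = Max {R. R ^ n \<le> N}"
    have "0 \<in> {R. R ^ n \<le> N}" using n_pos by (simp add: zero_power)
    then have "R \<in> {R. R ^ n \<le> N}" unfolding R_def using Max_in[OF fin] by blast
    then have R1: "R ^ n \<le> N" by simp
    have R2: "N < Suc R ^ n"
    proof (rule ccontr)
      assume "\<not> N < Suc R ^ n"
      then have "Suc R \<in> {R. R ^ n \<le> N}" by simp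
      from Max_ge[OF fin this] show False unfolding R_def by simp
    qed
    define P where "P = PiE {..<n} (\<lambda>_. {0..<Suc R})"
    define g where "g = (\<lambda>a::nat \<Rightarrow> nat. \<Sum>i<n. of_nat (a i) * w i)"
    have gO: "g a \<in> \<O>" for a unfolding g_def using w(1) by auto
    have "card P = Suc R ^ n" by (simp add: P_def card_PiE)
    then have "card P > idx \<O> I" using R2 N_def by simp
    then obtain a b where ab: "a \<in> P" "b \<in> P" "a \<noteq> b" "g a - g b \<in> I"
      using idx_pigeonhole[OF is_idealD(2)[OF I(1)] idx_ideal_pos[OF I], of P g] gO by blast
    define \<beta> where "\<beta> = g a - g b"
    have diff: "\<beta> = (\<Sum>i<n. of_int (int (a i) - int (b i)) * w i)"
      by (simp add: \<beta>_def g_def algebra_simps sum_subtractf)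
    have "\<beta> \<noteq> 0"
    proof
      assume "\<beta> = 0"
      then have "\<forall>i<n. int (a i) - int (b i) = 0"
        using w(2)[of "\<lambda>i. int (a i) - int (b i)"] diff by simp
      then have "a = b" using ab(1,2) by (intro extensionalityI[of a "{..<n}" b]) (auto simp: P_def PiE_def)
      then show False using ab by simp
    qed
    have s: "cmod (\<sigma> \<beta>) \<le> real R * (1 + (\<Sum>i<n. cmod (\<sigma> (w i))))" if "\<sigma> \<in> Emb" for \<sigma>
    proof -
      interpret embedding K \<sigma> by unfold_locales fact
      have "\<sigma> \<beta> = (\<Sum>i<n. of_int (int (a i) - int (b i)) * \<sigma> (w i))"
        unfolding diff using w(1) OK by (subst sum_hom) (auto simp del: of_int_diff simp: mult_hom mult)
      also have "cmod \<dots> \<le> (\<Sum>i<n. cmod (of_int (int (a i) - int (b i)) * \<sigma> (w i)))" by (rule norm_sum)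
      also have "\<dots> \<le> (\<Sum>i<n. real R * cmod (\<sigma> (w i)))"
      proof (rule sum_mono)
        fix i assume "i \<in> {..<n}"
        then have "a i \<le> R" "b i \<le> R" using ab(1,2) by (auto simp: P_def PiE_iff less_Suc_eq_le)
        then have "\<bar>int (a i) - int (b i)\<bar> \<le> int R" by linarith
        then have "cmod (of_int (int (a i) - int (b i))) \<le> real R"
          unfolding norm_of_int by linarith
        then show "cmod (of_int (int (a i) - int (b i)) * \<sigma> (w i)) \<le> real R * cmod (\<sigma> (w i))"
          unfolding norm_mult by (intro mult_right_mono) auto
      qed
      also have "\<dots> \<le> real R * (1 + (\<Sum>i<n. cmod (\<sigma> (w i))))"
        by (simp add: sum_distrib_left distrib_left)
      finally show ?thesis .
    qed
    have "cmod (Nm \<beta>) = (\<Prod>\<sigma>\<in>Emb. cmod (\<sigma> \<beta>))" by (simp add: fnorm_def prod_norm)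
    also have "\<dots> \<le> (\<Prod>\<sigma>\<in>Emb. real R * (1 + (\<Sum>i<n. cmod (\<sigma> (w i)))))"
      by (intro prod_mono conjI s) auto
    also have "\<dots> = real R ^ n * A" by (simp add: prod.distrib A_def card_Emb)
    also have "\<dots> \<le> real N * A"
      using R1 \<open>A > 0\<close> by (intro mult_right_mono) (auto simp flip: of_nat_power)
    finally have "cmod (Nm \<beta>) \<le> A * real (idx \<O> I)" by (simp add: N_def mult.commute)
    then show ?thesis using ab(4) \<open>\<beta> \<noteq> 0\<close> unfolding \<beta>_def by blast
  qed
  ultimately show ?thesis by blast
qed

lemma idx_principal_mult:
  assumes "c \<in> \<O>" "d \<in> \<O>" "c \<noteq> 0"
  shows "idx \<O> (principal (c * d)) = idx \<O> (principal c) * idx \<O> (principal d)"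
proof -
  have "principal (c * d) = (*) c ` principal d" by (auto simp: image_image mult.assoc)
  moreover have "idx \<O> ((*) c ` principal d) = idx \<O> (principal c) * idx (principal c) ((*) c ` principal d)"
    using assms by (intro idx_mult add_subgroup_scale add_subgroup_O) auto
  moreover have "idx (principal c) ((*) c ` principal d) = idx \<O> (principal d)"
    using assms by (intro idx_scale add_subgroup_scale add_subgroup_O)
  ultimately show ?thesis by simp
qed

lemma principal_nonzero: "c \<noteq> 0 \<Longrightarrow> principal c \<noteq> {0}"
  by (metis Oint.one imageI mult.right_neutral singletonD)

text \<open>The small element of \<open>c\<O>\<close> bounds \<open>\<bar>N c\<bar>\<close> by a constant times the index. Powers of \<open>c\<close>
  remove the constant, and the cofactor of \<open>c\<close> in its norm gives the converse.\<close>

lemma idx_principal: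
  assumes c: "c \<in> \<O>" "c \<noteq> 0"
  shows "real (idx \<O> (principal c)) = cmod (Nm c)"
proof -
  obtain A where A: "A > 0" "\<And>I. is_ideal I \<Longrightarrow> I \<noteq> {0} \<Longrightarrow>
     (\<exists>\<beta>\<in>I. \<beta> \<noteq> 0 \<and> cmod (Nm \<beta>) \<le> A * real (idx \<O> I))"
    using small_element by blast
  have le: "cmod (Nm c) \<le> real (idx \<O> (principal c))" if c: "c \<in> \<O>" "c \<noteq> 0" for c
  proof -
    have b: "cmod (Nm c) \<le> A * real (idx \<O> (principal c))" if c: "c \<in> \<O>" "c \<noteq> 0" for c
    proof -
      obtain \<beta> where be: "\<beta> \<in> principal c" "\<beta> \<noteq> 0" "cmod (Nm \<beta>) \<le> A * real (idx \<O> (principal c))"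
        using A(2)[OF is_ideal_principal[OF c(1)] principal_nonzero[OF c(2)]] by blast
      then obtain g where g: "g \<in> \<O>" "\<beta> = c * g" by auto
      have "g \<noteq> 0" using g be by auto
      have "cmod (Nm c) * 1 \<le> cmod (Nm c) * cmod (Nm g)"
        using Nm_ge_1[OF g(1) \<open>g \<noteq> 0\<close>] by (intro mult_left_mono) auto
      also have "\<dots> = cmod (Nm \<beta>)" using g c OK by (simp add: Nm_mult norm_mult)
      finally show ?thesis using be by simp
    qed
    define x where "x = cmod (Nm c)"
    define y where "y = real (idx \<O> (principal c))"
    have ypos: "y > 0" unfolding y_def
      using idx_ideal_pos[OF is_ideal_principal[OF c(1)] principal_nonzero[OF c(2)]] by simp
    have idxp: "idx \<O> (principal (c ^ k)) = idx \<O> (principal c) ^ k" for k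
    proof (induction k)
      case 0
      show ?case using idx_self[OF add_subgroup_O] by simp
    next
      case (Suc k)
      then show ?case using idx_principal_mult[of c "c ^ k"] c by auto
    qed
    have pw: "x ^ k \<le> A * y ^ k" for k
      using b[of "c ^ k"] c Nm_power[of c k] OK[OF c(1)] idxp[of k]
      by (simp add: x_def y_def norm_power Oint.power)
    have "x \<le> y"
    proof (rule ccontr)
      assume "\<not> x \<le> y"
      then have "x / y > 1" using ypos by simp
      then obtain k where "A < (x / y) ^ k" using real_arch_pow by blast
      then show False using pw[of k] ypos by (simp add: power_divide field_simps)
    qed
    then show ?thesis by (simp add: x_def y_def)
  qed
  obtain c' where c': "c' \<in> \<O>" "c * c' = Nm c" using cofactor[OF c] by blast
  obtain k :: int where k: "Nm c = of_int k" using Nm_int[OF c(1)] by blast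
  have N0: "Nm c \<noteq> 0" using fnorm_eq_0_iff[OF number_field OK[OF c(1)]] c(2) by simp
  have k0: "k \<noteq> 0" using N0 k by auto
  have c'0: "c' \<noteq> 0" using c' N0 by auto
  define m where "m = nat \<bar>k\<bar>"
  have m: "m > 0" using k0 by (simp add: m_def)
  have "k = int m \<or> k = - int m" unfolding m_def by auto
  then have km: "of_int k = (of_nat m :: complex) \<or> of_int k = - (of_nat m :: complex)"
    by auto
  have "principal (of_int k) = principal (of_nat m)"
    using km
  proof
    assume "of_int k = - (of_nat m :: complex)"
    moreover have "principal (- (of_nat m)) = principal (of_nat m)"
    proof -
      have "uminus ` \<O> = \<O>"
      proof (intro equalityI subsetI)
        fix x assume "x \<in> \<O>"
        then have "- x \<in> \<O>" by (rule Oint.neg)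
        then show "x \<in> uminus ` \<O>" by (intro image_eqI[of _ _ "- x"]) auto
      qed (auto intro: Oint.neg)
      moreover have "principal (- of_nat m) = (*) (of_nat m) ` uminus ` \<O>"
        by (simp add: image_image)
      ultimately show ?thesis by simp
    qed
    ultimately show ?thesis by simp
  qed simp
  then have "idx \<O> (principal c) * idx \<O> (principal c') = idx \<O> (principal (of_nat m))"
    using idx_principal_mult[OF c(1) c'(1) c(2)] c'(2) k by simp
  then have up: "real (idx \<O> (principal c)) * real (idx \<O> (principal c')) \<le> real m ^ n"
    using idx_O_multiple(2)[OF m] by (metis of_nat_le_iff of_nat_mult of_nat_power)
  have "Nm (of_int k) = Nm c * Nm c'" using Nm_mult[of c c'] c'(2) OK c(1) c'(1) k by simp
  moreover have "cmod (Nm (of_int k)) = real m ^ n"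
  proof -
    have "Nm (- x) = Nm (-1) * Nm x" if "x \<in> K" for x using Nm_mult[of "-1" x] that by auto
    moreover have "cmod (Nm (-1)) = 1"
    proof -
      have "Nm (-1) * Nm (-1) = 1" using Nm_mult[of "-1" "-1"] Nm_1 by auto
      then have "cmod (Nm (-1)) ^ 2 = 1 ^ 2" by (metis norm_mult norm_one power2_eq_square power_one)
      then have "cmod (Nm (-1)) = 1 \<or> cmod (Nm (-1)) = -1" by (simp add: power2_eq_1_iff)
      then show ?thesis using norm_ge_zero[of "Nm (-1)"] by linarith
    qed
    moreover have Nmm: "cmod (Nm (of_nat m)) = real m ^ n"
      by (simp add: fnorm_of_nat[OF number_field] norm_power)
    ultimately have "cmod (Nm (- of_nat m)) = real m ^ n"
      by (simp only: of_nat norm_mult mult_1_left)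
    then show ?thesis using km Nmm by metis
  qed
  ultimately have eq: "cmod (Nm c) * cmod (Nm c') = real m ^ n" by (simp add: norm_mult)
  have l1: "cmod (Nm c) \<le> real (idx \<O> (principal c))" by (rule le[OF c])
  have l2: "cmod (Nm c') \<le> real (idx \<O> (principal c'))" by (rule le[OF c'(1) c'0])
  have p2: "cmod (Nm c') > 0" using Nm_ge_1[OF c'(1) c'0] by linarith
  \<comment> \<open>Both indices dominate the corresponding norms, while the product of the indices
    is at most m^n, the product of the norms. Hence neither inequality can be strict.\<close>
  have "real (idx \<O> (principal c)) * cmod (Nm c') \<le> real (idx \<O> (principal c)) * real (idx \<O> (principal c'))"
    using l2 by (intro mult_left_mono) auto
  also have "\<dots> \<le> cmod (Nm c) * cmod (Nm c')" using up eq by simp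
  finally have "real (idx \<O> (principal c)) \<le> cmod (Nm c)" using p2 by simp
  then show ?thesis using l1 by simp
qed

end

subsection \<open>Ideals of the ring of integers\<close>

context nfield
begin

abbreviation "RO \<equiv> int_ring K"

lemma RO_simps [simp]:
  "carrier RO = \<O>" "x \<otimes>\<^bsub>RO\<^esub> y = x * y" "x \<oplus>\<^bsub>RO\<^esub> y = x + y" "\<one>\<^bsub>RO\<^esub> = 1" "\<zero>\<^bsub>RO\<^esub> = 0"
  by (simp_all add: int_ring_def ints_of_def)

lemma cring_RO: "cring RO"
proof (intro cringI abelian_groupI comm_monoidI)
  fix x assume "x \<in> carrier RO"
  then show "\<exists>y\<in>carrier RO. y \<oplus>\<^bsub>RO\<^esub> x = \<zero>\<^bsub>RO\<^esub>" by (intro bexI[of _ "- x"]) auto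
qed (auto simp: algebra_simps)

sublocale RO: cring RO by (rule cring_RO)

lemma RO_neg: "x \<in> \<O> \<Longrightarrow> \<ominus>\<^bsub>RO\<^esub> x = - x"
  by (rule RO.minus_equality) auto

text \<open>The bridge that lets products and powers of ideals come from HOL-Algebra while elements
  are handled by ordinary complex arithmetic.\<close>

lemma ideal_iff: "ideal I RO \<longleftrightarrow> is_ideal I"
proof
  assume "ideal I RO"
  then interpret I: ideal I RO .
  have sub: "I \<subseteq> \<O>" using I.a_subset by simp
  have "x - y \<in> I" if "x \<in> I" "y \<in> I" for x y
  proof -
    have yO: "y \<in> \<O>" using that sub by auto
    from I.a_closed[OF that(1) I.a_inv_closed[OF that(2)]] show ?thesis
      unfolding RO_neg[OF yO] RO_simps by simp
  qed
  then show "is_ideal I"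
    unfolding is_ideal_def add_subgroup_def using sub I.zero_closed I.I_l_closed by auto
next
  assume I: "is_ideal I"
  note sg = add_subgroupD[OF is_idealD(2)[OF I]]
  show "ideal I RO"
  proof (rule idealI)
    show "subgroup I (add_monoid RO)"
    proof (rule RO.add.subgroupI)
      fix x assume x: "x \<in> I"
      then show "\<ominus>\<^bsub>RO\<^esub> x \<in> I"
        using RO_neg[of x] sg(3) is_idealD(1)[OF I] by auto
    qed (use is_idealD(1)[OF I] sg in auto)
  next
    show "ring RO" by (rule RO.ring_axioms)
    fix a x assume "a \<in> I" "x \<in> carrier RO"
    then have "x * a \<in> I" using is_idealD(3)[OF I] by simp
    then show "x \<otimes>\<^bsub>RO\<^esub> a \<in> I" "a \<otimes>\<^bsub>RO\<^esub> x \<in> I" by (simp_all add: mult.commute)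
  qed
qed

definition iprod :: "complex set \<Rightarrow> complex set \<Rightarrow> complex set" where
  "iprod I J = ideal_prod RO I J"

definition ipow :: "complex set \<Rightarrow> nat \<Rightarrow> complex set" where
  "ipow I k = I [^]\<^bsub>ideals_set RO\<^esub> k"

lemma is_ideal_iprod: "is_ideal I \<Longrightarrow> is_ideal J \<Longrightarrow> is_ideal (iprod I J)"
  using RO.ideal_prod_is_ideal by (simp add: iprod_def ideal_iff)

lemma iprod_comm: "is_ideal I \<Longrightarrow> is_ideal J \<Longrightarrow> iprod I J = iprod J I"
  using RO.ideal_prod_commute by (simp add: iprod_def ideal_iff)

lemma iprod_assoc: "is_ideal I \<Longrightarrow> is_ideal J \<Longrightarrow> is_ideal L \<Longrightarrow> iprod (iprod I J) L = iprod I (iprod J L)"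
  using RO.ideal_prod_assoc by (simp add: iprod_def ideal_iff)

lemma is_ideal_O: "is_ideal \<O>"
  unfolding is_ideal_def using add_subgroup_O by auto

lemma iprod_O: "is_ideal I \<Longrightarrow> iprod I \<O> = I"
  using RO.ideal_prod_one[of I] by (simp add: iprod_def ideal_iff)

lemma iprod_O_left: "is_ideal I \<Longrightarrow> iprod \<O> I = I"
  using iprod_O iprod_comm is_ideal_O by metis

lemma iprodI: "i \<in> I \<Longrightarrow> j \<in> J \<Longrightarrow> i * j \<in> iprod I J"
  using ideal_prod.prod[of i I j J RO] by (simp add: iprod_def)

lemma iprod_least:
  assumes "\<And>i j. i \<in> I \<Longrightarrow> j \<in> J \<Longrightarrow> i * j \<in> X" "\<And>x y. x \<in> X \<Longrightarrow> y \<in> X \<Longrightarrow> x + y \<in> X"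
  shows "iprod I J \<subseteq> X"
proof
  fix x assume "x \<in> iprod I J"
  then show "x \<in> X" unfolding iprod_def
    by (induction rule: ideal_prod.induct) (use assms in auto)
qed

lemma ideal_add: "is_ideal I \<Longrightarrow> x \<in> I \<Longrightarrow> y \<in> I \<Longrightarrow> x + y \<in> I"
  using add_subgroupD(4)[OF is_idealD(2)] .

lemma ideal_0: "is_ideal I \<Longrightarrow> 0 \<in> I"
  using add_subgroupD(1)[OF is_idealD(2)] .

lemma iprod_mono: "is_ideal I \<Longrightarrow> is_ideal J' \<Longrightarrow> J \<subseteq> J' \<Longrightarrow> iprod I J \<subseteq> iprod I J'"
  by (rule iprod_least) (auto intro: iprodI ideal_add[OF is_ideal_iprod])

lemma iprod_subset:
  assumes I: "is_ideal I" and J: "is_ideal J"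
  shows "iprod I J \<subseteq> J" "iprod I J \<subseteq> I"
proof -
  have *: "iprod I J \<subseteq> J" if I: "is_ideal I" and J: "is_ideal J" for I J
    by (rule iprod_least) (use is_idealD(1)[OF I] is_idealD(3)[OF J] ideal_add[OF J] in blast)+
  show "iprod I J \<subseteq> J" by (rule *[OF I J])
  show "iprod I J \<subseteq> I" using *[OF J I] iprod_comm[OF I J] by simp
qed

lemma inverse_cancel: "(c::complex) \<noteq> 0 \<Longrightarrow> inverse c * (c * x) = x" "(c::complex) \<noteq> 0 \<Longrightarrow> c * (inverse c * x) = x"
  by (simp_all flip: mult.assoc)

lemma ipow_0 [simp]: "ipow I 0 = \<O>"
  by (simp add: ipow_def ideals_set_def)

lemma ipow_Suc: "ipow I (Suc k) = iprod (ipow I k) I"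
  by (simp add: ipow_def iprod_def ideals_set_def nat_pow_def)

lemma is_ideal_ipow: "is_ideal I \<Longrightarrow> is_ideal (ipow I k)"
  by (induction k) (auto simp: ipow_Suc is_ideal_O is_ideal_iprod)

lemma ipow_add: "is_ideal I \<Longrightarrow> ipow I (a + b) = iprod (ipow I a) (ipow I b)"
proof (induction b)
  case (Suc b)
  then show ?case using is_ideal_ipow[of I] iprod_assoc[of "ipow I a" "ipow I b" I] by (simp add: ipow_Suc)
qed (simp add: iprod_O is_ideal_ipow)

lemma iprod_principal:
  assumes c: "c \<in> \<O>" and I: "is_ideal I"
  shows "iprod (principal c) I = (*) c ` I"
proof
  show "iprod (principal c) I \<subseteq> (*) c ` I"
    using is_idealD[OF I] ideal_add[OF I]
    by (intro iprod_least) (auto simp: mult.assoc simp flip: distrib_left)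
  show "(*) c ` I \<subseteq> iprod (principal c) I"
  proof
    fix x assume "x \<in> (*) c ` I"
    then obtain i where "i \<in> I" "x = (c * 1) * i" by auto
    then show "x \<in> iprod (principal c) I" using Oint.one by (auto intro!: iprodI simp del: mult_1_right)
  qed
qed

lemma iprod_scale:
  assumes "is_ideal I" "is_ideal J"
  shows "iprod ((*) c ` I) J = (*) c ` iprod I J"
proof
  show "iprod ((*) c ` I) J \<subseteq> (*) c ` iprod I J"
    using ideal_add[OF is_ideal_iprod[OF assms]]
    by (intro iprod_least) (auto simp: mult.assoc intro: iprodI simp flip: distrib_left)
  show "(*) c ` iprod I J \<subseteq> iprod ((*) c ` I) J"
  proof -
    have "iprod I J \<subseteq> {x. c * x \<in> iprod ((*) c ` I) J}"
    proof (rule iprod_least)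
      fix i j assume ij: "i \<in> I" "j \<in> J"
      then have "(c * i) * j \<in> iprod ((*) c ` I) J" by (intro iprodI) auto
      then show "i * j \<in> {x. c * x \<in> iprod ((*) c ` I) J}" by (simp add: mult.assoc)
    next
      fix x y assume "x \<in> {x. c * x \<in> iprod ((*) c ` I) J}" "y \<in> {x. c * x \<in> iprod ((*) c ` I) J}"
      then have "c * x + c * y \<in> iprod ((*) c ` I) J"
        using ideal_prod.sum[of _ RO "(*) c ` I" J] by (auto simp: iprod_def)
      then show "x + y \<in> {x. c * x \<in> iprod ((*) c ` I) J}" by (simp add: distrib_left)
    qed
    then show ?thesis by auto
  qed
qed

lemma nonzero_iff: "is_ideal I \<Longrightarrow> I \<noteq> {0} \<longleftrightarrow> (\<exists>x\<in>I. x \<noteq> 0)"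
  using ideal_0 by blast

lemma iprod_nonzero:
  assumes "is_ideal I" "is_ideal J" "I \<noteq> {0}" "J \<noteq> {0}"
  shows "iprod I J \<noteq> {0}"
proof -
  obtain i j where "i \<in> I" "i \<noteq> 0" "j \<in> J" "j \<noteq> 0" using assms nonzero_iff by metis
  then have "i * j \<in> iprod I J" "i * j \<noteq> 0" by (auto intro: iprodI)
  then show ?thesis by blast
qed

lemma O_nonzero: "\<O> \<noteq> {0}"
  using Oint.one by force

lemma ipow_nonzero: "is_ideal I \<Longrightarrow> I \<noteq> {0} \<Longrightarrow> ipow I k \<noteq> {0}"
  by (induction k) (simp_all add: O_nonzero ipow_Suc iprod_nonzero is_ideal_ipow)

lemma ideal_1: "is_ideal I \<Longrightarrow> 1 \<in> I \<Longrightarrow> I = \<O>"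
  using is_idealD(1,3)[of I] by (metis mult.right_neutral subsetI subset_antisym)

lemma scale_subset_iff: "(c::complex) \<noteq> 0 \<Longrightarrow> (*) c ` X \<subseteq> (*) c ` Y \<longleftrightarrow> X \<subseteq> Y"
  by (rule inj_image_subset_iff) (auto simp: inj_on_def)

lemma scale_eq_iff: "(c::complex) \<noteq> 0 \<Longrightarrow> (*) c ` X = (*) c ` Y \<longleftrightarrow> X = Y"
  by (simp add: set_eq_subset scale_subset_iff)

lemma is_ideal_scale:
  assumes "is_ideal I" "\<And>x. x \<in> I \<Longrightarrow> c * x \<in> \<O>"
  shows "is_ideal ((*) c ` I)"
  unfolding is_ideal_def
proof (intro conjI ballI)
  show "(*) c ` I \<subseteq> \<O>" using assms(2) by auto
  show "add_subgroup ((*) c ` I)" by (rule add_subgroup_scale[OF is_idealD(2)[OF assms(1)]])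
  fix a x assume "a \<in> \<O>" "x \<in> (*) c ` I"
  then show "a * x \<in> (*) c ` I" using is_idealD(3)[OF assms(1)] by (auto simp: mult.left_commute)
qed

subsection \<open>Finiteness of the class number and invertibility of ideals\<close>

text \<open>Such an ideal is a union of cosets of the principal ideal of m, and there are only
  finitely many cosets.\<close>

lemma finite_ideals_containing:
  assumes m: "m > 0"
  shows "finite {J. is_ideal J \<and> of_nat m \<in> J}"
proof -
  let ?P = "principal (of_nat m)"
  have P: "add_subgroup ?P" by (rule add_subgroup_scale[OF add_subgroup_O])
  have fin: "finite (coset_of ?P ` \<O>)"
    using idx_O_multiple(1)[OF m] unfolding idx_def by (rule card_ge_0_finite)
  have inj: "inj_on (\<lambda>J. coset_of ?P ` J) {J. is_ideal J \<and> of_nat m \<in> J}"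
  proof (rule inj_onI)
    have sub: "J \<subseteq> J'" if J: "coset_of ?P ` J = coset_of ?P ` J'" "is_ideal J'" "of_nat m \<in> J'" for J J'
    proof
      fix x assume "x \<in> J"
      then obtain y where y: "y \<in> J'" "coset_of ?P x = coset_of ?P y" using J(1) by blast
      then have "x - y \<in> ?P" using coset_of_eq_iff[OF P] by simp
      then have "x - y \<in> J'" using principal_subset[OF J(2,3)] by auto
      then have "(x - y) + y \<in> J'" using y(1) by (intro ideal_add[OF J(2)])
      then show "x \<in> J'" by simp
    qed
    fix J J' assume "J \<in> {J. is_ideal J \<and> of_nat m \<in> J}" "J' \<in> {J. is_ideal J \<and> of_nat m \<in> J}"
      and "coset_of ?P ` J = coset_of ?P ` J'"
    then show "J = J'" using sub[of J J'] sub[of J' J] by auto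
  qed
  have "(\<lambda>J. coset_of ?P ` J) ` {J. is_ideal J \<and> of_nat m \<in> J} \<subseteq> Pow (coset_of ?P ` \<O>)"
    using is_idealD(1) by auto
  then show ?thesis using inj fin by (meson finite_Pow_iff finite_imageD finite_subset)
qed

text \<open>For a small element \<beta> of \<open>I\<close>, the index q of its principal ideal in
  \<open>I\<close> is at most \<open>A\<close>. Among the multiples 0, ..., q of any element of
  \<open>I\<close>, two agree modulo \<beta>, so some d with 0 < d \<le> q multiplies that element
  into the principal ideal. A common multiple t of all such d makes J = (t / \<beta>) I an ideal
  containing t. With \<open>finite_ideals_containing\<close> this is the finiteness of the class
  number.\<close>

lemma class_representatives:
  "\<exists>t::nat. t > 0 \<and> (\<forall>I. is_ideal I \<and> I \<noteq> {0} \<longrightarrow>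
     (\<exists>\<beta>\<in>\<O>. \<beta> \<noteq> 0 \<and> (\<exists>J. is_ideal J \<and> of_nat t \<in> J \<and> (*) (of_nat t) ` I = (*) \<beta> ` J)))"
proof -
  obtain A where A: "A > 0" "\<And>I. is_ideal I \<Longrightarrow> I \<noteq> {0} \<Longrightarrow>
     (\<exists>\<beta>\<in>I. \<beta> \<noteq> 0 \<and> cmod (Nm \<beta>) \<le> A * real (idx \<O> I))"
    using small_element by blast
  \<comment> \<open>The factorial is divisible by every d that the pigeonhole argument can produce,
    and it is independent of \<open>I\<close>.\<close>
  define t :: nat where "t = fact (nat \<lfloor>A\<rfloor>)"
  have t: "t > 0" by (simp add: t_def)
  have "\<exists>\<beta>\<in>\<O>. \<beta> \<noteq> 0 \<and> (\<exists>J. is_ideal J \<and> of_nat t \<in> J \<and> (*) (of_nat t) ` I = (*) \<beta> ` J)"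
    if I: "is_ideal I" "I \<noteq> {0}" for I
  proof -
    obtain \<beta> where be: "\<beta> \<in> I" "\<beta> \<noteq> 0" "cmod (Nm \<beta>) \<le> A * real (idx \<O> I)"
      using A(2)[OF I] by blast
    have bO: "\<beta> \<in> \<O>" using be is_idealD(1)[OF I(1)] by auto
    let ?P = "principal \<beta>"
    have P: "add_subgroup ?P" by (rule add_subgroup_scale[OF add_subgroup_O])
    define q where "q = idx I ?P"
    have "idx \<O> ?P = idx \<O> I * q" unfolding q_def
      by (intro idx_mult is_idealD P add_subgroup_O I principal_subset be)
    then have eq: "real (idx \<O> I) * real q = cmod (Nm \<beta>)"
      using idx_principal[OF bO be(2)] by simp
    have Ipos: "real (idx \<O> I) > 0" using idx_ideal_pos[OF I] by simp
    have "cmod (Nm \<beta>) > 0" using Nm_ge_1[OF bO be(2)] by linarith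
    then have qpos: "q > 0" using eq by (metis of_nat_0 mult_zero_right less_irrefl gr0I)
    have "real q * real (idx \<O> I) \<le> A * real (idx \<O> I)" using eq be(3) by (simp add: mult.commute)
    then have "real q \<le> A" using Ipos by (rule mult_right_le_imp_le)
    then have qA: "q \<le> nat \<lfloor>A\<rfloor>" by (simp add: le_nat_floor)
    have ta: "of_nat t * a \<in> ?P" if a: "a \<in> I" for a
    proof -
      have "of_nat i * a \<in> I" for i :: nat using is_idealD(3)[OF I(1) _ a] by auto
      then have "\<exists>i\<in>{0..q}. \<exists>j\<in>{0..q}. i \<noteq> j \<and> of_nat i * a - of_nat j * a \<in> ?P"
        using idx_pigeonhole[OF P, of I "{0..q}" "\<lambda>i. of_nat i * a"] qpos by (simp add: q_def)
      then obtain i j where "i \<in> {0..q}" "j \<in> {0..q}" and ij': "i \<noteq> j" "of_nat i * a - of_nat j * a \<in> ?P"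
        by blast
      then have ij: "i \<le> q" "j \<le> q" by auto
      have "\<exists>d. 0 < d \<and> d \<le> q \<and> of_nat d * a \<in> ?P"
      proof (cases "i > j")
        case True
        then have "of_nat (i - j) * a = of_nat i * a - of_nat j * a"
          by (simp add: of_nat_diff left_diff_distrib)
        then have "of_nat (i - j) * a \<in> ?P" using ij'(2) by (simp only:)
        then show ?thesis using True ij by (intro exI[of _ "i - j"] conjI) auto
      next
        case False
        then have "of_nat (j - i) * a = - (of_nat i * a - of_nat j * a)"
          by (simp add: of_nat_diff left_diff_distrib)
        then have "of_nat (j - i) * a \<in> ?P" using add_subgroupD(3)[OF P ij'(2)] by (simp only:)
        then show ?thesis using False ij ij'(1) by (intro exI[of _ "j - i"] conjI) auto
      qed
      then obtain d where d: "0 < d" "d \<le> q" "of_nat d * a \<in> ?P" by blast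
      have "d dvd t" unfolding t_def using d qA by (intro dvd_fact) auto
      then obtain e where "t = d * e" by auto
      then have *: "of_nat t * a = of_nat e * (of_nat d * a)" by simp
      show ?thesis unfolding * by (rule is_idealD(3)[OF is_ideal_principal[OF bO] Oint.of_nat d(3)])
    qed
    define J where "J = (*) (of_nat t / \<beta>) ` I"
    have JO: "of_nat t / \<beta> * x \<in> \<O>" if "x \<in> I" for x
    proof -
      obtain y where "y \<in> \<O>" "of_nat t * x = \<beta> * y" using ta[OF \<open>x \<in> I\<close>] by auto
      then have "of_nat t / \<beta> * x = y" using be(2) by (simp add: field_simps)
      then show ?thesis using \<open>y \<in> \<O>\<close> by simp
    qed
    have "is_ideal J" unfolding J_def by (rule is_ideal_scale[OF I(1) JO])
    moreover have "of_nat t \<in> J" unfolding J_def using be by (intro image_eqI[of _ _ \<beta>]) auto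
    moreover have "(*) (of_nat t) ` I = (*) \<beta> ` J"
      using be(2) by (simp add: J_def image_image)
    ultimately show ?thesis using bO be(2) by blast
  qed
  then show ?thesis using t by blast
qed

text \<open>All w^k * c lie in \<open>C\<close>, hence in \<open>\<O>\<close>, which is finite
  modulo \<open>c\<close>. Two of them are congruent, so a difference of two powers of
  \<open>w\<close> equals an integer o', and this is a monic equation for \<open>w\<close>.\<close>

lemma stabiliser_integral:
  assumes C: "is_ideal C" "C \<noteq> {0}" and w: "w \<in> K" "\<And>x. x \<in> C \<Longrightarrow> w * x \<in> C"
  shows "w \<in> \<O>"
proof -
  obtain c where c: "c \<in> C" "c \<noteq> 0" using C nonzero_iff by blast
  have cO: "c \<in> \<O>" using c is_idealD(1)[OF C(1)] by auto
  have wC: "w ^ k * c \<in> C" for k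
    by (induction k) (use c w(2) in \<open>auto simp: mult.assoc\<close>)
  let ?P = "principal c"
  have P: "add_subgroup ?P" by (rule add_subgroup_scale[OF add_subgroup_O])
  have "\<exists>i\<in>{0..idx \<O> ?P}. \<exists>j\<in>{0..idx \<O> ?P}. i \<noteq> j \<and> w ^ i * c - w ^ j * c \<in> ?P"
    using wC is_idealD(1)[OF C(1)] idx_ideal_pos[OF is_ideal_principal[OF cO] principal_nonzero[OF c(2)]]
    by (intro idx_pigeonhole[OF P]) auto
  then obtain i j where "i \<noteq> j" "w ^ i * c - w ^ j * c \<in> ?P" by blast
  then obtain k l where kl: "k > l" "w ^ k * c - w ^ l * c \<in> ?P"
  proof (cases "i < j")
    case True
    then show ?thesis using add_subgroupD(3)[OF P \<open>w ^ i * c - w ^ j * c \<in> ?P\<close>] that[of i j]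
      by (simp only: minus_diff_eq)
  next
    case False
    then show ?thesis using \<open>i \<noteq> j\<close> \<open>w ^ i * c - w ^ j * c \<in> ?P\<close> that[of j i] by (meson linorder_neqE_nat)
  qed
  then obtain o' where o': "o' \<in> \<O>" "w ^ k * c - w ^ l * c = c * o'" by auto
  have "(w ^ k - w ^ l) * c = o' * c" using o'(2) by (simp add: algebra_simps)
  then have eq: "w ^ k - w ^ l = o'" using c(2) by simp
  define p where "p = monom 1 k - monom 1 l - [:o':]"
  have cp: "coeff p i = (if i = k then 1 else 0) - (if i = l then 1 else 0) - (if i = 0 then o' else 0)" for i
    by (auto simp: p_def coeff_pCons split: nat.splits)
  have "degree p = k"
  proof (rule antisym)
    show "degree p \<le> k" by (rule degree_le) (use kl in \<open>auto simp: cp\<close>)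
    show "k \<le> degree p" by (rule le_degree) (use kl in \<open>auto simp: cp\<close>)
  qed
  then have "lead_coeff p = 1" using kl by (simp add: cp)
  moreover have "coeffs_in {z. algebraic_int z} p"
  proof -
    have "coeff p i \<in> \<O>" for i unfolding cp using o'(1) by auto
    then show ?thesis by (simp add: coeffs_in_def ints_of_def)
  qed
  moreover have "poly p w = 0" using eq by (simp add: p_def poly_monom)
  ultimately have "algebraic_int w" by (intro algebraic_int_monic_root)
  then show ?thesis using w(1) by (simp add: ints_of_def)
qed

text \<open>Nakayama's lemma, by eliminating one generator at a time.\<close>

lemma nakayama_aux:
  assumes B: "is_ideal B"
  shows "1 - u \<in> B \<Longrightarrow> (\<And>i. i < (r::nat) \<Longrightarrow> \<exists>b. (\<forall>j<r. b j \<in> B) \<and> u * g i = (\<Sum>j<r. b j * g j)) \<Longrightarrow>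
     \<exists>u'. 1 - u' \<in> B \<and> (\<forall>i<r. u' * g i = 0)"
proof (induction r arbitrary: u)
  case (Suc r)
  have mem: "x \<in> \<O>" if "1 - x \<in> B" for x
  proof -
    have "1 - (1 - x) \<in> \<O>" using that is_idealD(1)[OF B] Oint.diff[OF Oint.one, of "1 - x"] by blast
    then show ?thesis by simp
  qed
  note sg = add_subgroupD[OF is_idealD(2)[OF B]]
  obtain b where b: "\<forall>j<Suc r. b j \<in> B" "u * g r = (\<Sum>j<Suc r. b j * g j)"
    using Suc.prems(2)[of r] by auto
  \<comment> \<open>Moving the own term of the last generator to the left expresses v * g r by the
    other generators, and \<open>v\<close> is still 1 modulo \<open>B\<close>. Multiplying the other
    relations by \<open>v\<close> then eliminates g r.\<close>
  define v where "v = u - b r"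
  have v: "v * g r = (\<Sum>j<r. b j * g j)" using b(2) by (simp add: v_def algebra_simps)
  have v1: "1 - v \<in> B" using sg(4)[OF Suc.prems(1), of "b r"] b(1) by (simp add: v_def algebra_simps)
  have uv1: "1 - u * v \<in> B"
  proof -
    have *: "1 - u * v = (1 - u) + u * (1 - v)" by (simp add: algebra_simps)
    show ?thesis unfolding * by (rule sg(4)[OF Suc.prems(1) is_idealD(3)[OF B mem[OF Suc.prems(1)] v1]])
  qed
  have "\<exists>d. (\<forall>j<r. d j \<in> B) \<and> (u * v) * g i = (\<Sum>j<r. d j * g j)" if i: "i < r" for i
  proof -
    obtain e where e: "\<forall>j<Suc r. e j \<in> B" "u * g i = (\<Sum>j<Suc r. e j * g j)"
      using Suc.prems(2)[of i] i by auto
    have "(u * v) * g i = v * (u * g i)" by simp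
    also have "\<dots> = (\<Sum>j<r. v * (e j * g j)) + e r * (v * g r)"
      unfolding e(2) by (simp add: distrib_left sum_distrib_left)
    also have "\<dots> = (\<Sum>j<r. (v * e j + e r * b j) * g j)"
      unfolding v by (simp add: sum_distrib_left distrib_right sum.distrib mult.assoc)
    finally have "(u * v) * g i = (\<Sum>j<r. (v * e j + e r * b j) * g j)" .
    moreover have "v * e j + e r * b j \<in> B" if "j < r" for j
      using that b(1) e(1) mem[OF v1] is_idealD(1)[OF B]
      by (intro sg(4) is_idealD(3)[OF B]) (auto simp: subset_iff)
    ultimately show ?thesis by (intro exI[of _ "\<lambda>j. v * e j + e r * b j"]) auto
  qed
  then obtain u' where u': "1 - u' \<in> B" "\<forall>i<r. u' * g i = 0" using Suc.IH[OF uv1] by blast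
  have "1 - u' * v \<in> B"
  proof -
    have *: "1 - u' * v = (1 - u') + u' * (1 - v)" by (simp add: algebra_simps)
    show ?thesis unfolding * by (rule sg(4)[OF u'(1) is_idealD(3)[OF B mem[OF u'(1)] v1]])
  qed
  moreover have "u' * v * g i = 0" if "i < Suc r" for i
  proof (cases "i = r")
    case True
    have "u' * v * g r = (\<Sum>j<r. b j * (u' * g j))"
      by (simp add: mult.assoc v sum_distrib_left mult.left_commute)
    also have "\<dots> = 0" using u'(2) by (intro sum.neutral) auto
    finally show ?thesis using True by simp
  next
    case False
    then have "u' * g i = 0" using u'(2) that by auto
    then show ?thesis by auto
  qed
  ultimately show ?case by blast
qed auto

text \<open>An integer m in \<open>C\<close> together with representatives of \<open>C\<close>
  modulo m generates, and the representatives are finite in number because the index of m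
  \<open>\<O>\<close> is.\<close>

lemma ideal_finitely_generated:
  assumes C: "is_ideal C" "C \<noteq> {0}"
  shows "\<exists>r g. (\<forall>i<r. g i \<in> C) \<and> (\<forall>x\<in>C. \<exists>a. (\<forall>i<r. a i \<in> \<O>) \<and> x = (\<Sum>i<(r::nat). a i * g i))"
proof -
  obtain m :: nat where m: "m > 0" "of_nat m \<in> C" using ideal_contains_nat[OF C] by blast
  let ?P = "principal (of_nat m)"
  have P: "add_subgroup ?P" by (rule add_subgroup_scale[OF add_subgroup_O])
  have PC: "?P \<subseteq> C" by (rule principal_subset[OF C(1) m(2)])
  have "idx \<O> ?P = idx \<O> C * idx C ?P"
    by (intro idx_mult is_idealD C(1) P add_subgroup_O PC)
  then have pos: "idx C ?P > 0" using idx_O_multiple(1)[OF m(1)] by (metis gr0I mult_0_right)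
  obtain T where T: "transversal T C ?P" using ex_transversal[OF P] by blast
  have finT: "finite T" by (rule finite_transversal[OF T P pos])
  define G where "G = insert (of_nat m) T"
  obtain r g where g: "bij_betw g {0..<(r::nat)} G"
    using ex_bij_betw_nat_finite[of G] finT by (auto simp: G_def)
  have "\<exists>a. (\<forall>i<r. a i \<in> \<O>) \<and> x = (\<Sum>i<r. a i * g i)" if x: "x \<in> C" for x
  proof -
    obtain t where t: "t \<in> T" "x - t \<in> ?P" using T x unfolding transversal_def by blast
    then obtain y where y: "y \<in> \<O>" "x - t = of_nat m * y" by auto
    obtain i j where ij: "i < r" "g i = t" "j < r" "g j = of_nat m"
    proof -
      have "t \<in> g ` {0..<r}" "of_nat m \<in> g ` {0..<r}" using g t(1) by (auto simp: bij_betw_def G_def)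
      then show ?thesis using that by auto
    qed
    \<comment> \<open>If the representative \<open>t\<close> is \<open>of_nat m\<close> itself, then
      i = j, and the two contributions add up in one coefficient.\<close>
    define a where "a = (\<lambda>k. (if k = i then 1 else 0) + (if k = j then y else 0))"
    have "(\<Sum>k<r. a k * g k) = (\<Sum>k<r. if k = i then g k else 0) + (\<Sum>k<r. if k = j then y * g k else 0)"
      unfolding a_def distrib_right sum.distrib by (intro arg_cong2[of _ _ _ _ "(+)"] sum.cong) auto
    also have "\<dots> = x" using ij y(2) by (simp add: algebra_simps)
    finally show ?thesis using y(1) by (intro exI[of _ a]) (auto simp: a_def)
  qed
  moreover have "g i \<in> C" if "i < r" for i
  proof -
    have "g i \<in> G" using g that by (auto simp: bij_betw_def)
    moreover have "G \<subseteq> C" using T m(2) unfolding G_def transversal_def by simp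
    ultimately show ?thesis by blast
  qed
  ultimately show ?thesis by blast
qed

text \<open>The elimination yields u' congruent to 1 modulo \<open>B\<close> that kills all
  generators. Some generator is nonzero and there are no zero divisors, so u' = 0 and
  \<open>B\<close> contains 1.\<close>

lemma nakayama:
  assumes B: "is_ideal B" and C: "is_ideal C" "C \<noteq> {0}" and eq: "C \<subseteq> iprod B C"
  shows "B = \<O>"
proof -
  obtain r g where g: "\<forall>i<r. g i \<in> C" "\<And>x. x \<in> C \<Longrightarrow> \<exists>a. (\<forall>i<r. a i \<in> \<O>) \<and> x = (\<Sum>i<(r::nat). a i * g i)"
    using ideal_finitely_generated[OF C] by blast
  define X where "X = {x. \<exists>b. (\<forall>i<r. b i \<in> B) \<and> x = (\<Sum>i<r. b i * g i)}"
  have "iprod B C \<subseteq> X"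
  proof (rule iprod_least)
    fix i c assume ic: "i \<in> B" "c \<in> C"
    obtain a where a: "\<forall>k<r. a k \<in> \<O>" "c = (\<Sum>k<r. a k * g k)" using g(2)[OF ic(2)] by blast
    have "\<forall>k<r. a k * i \<in> B" using is_idealD(3)[OF B _ ic(1)] a(1) by blast
    moreover have "i * c = (\<Sum>k<r. a k * i * g k)"
      unfolding a(2) by (simp add: sum_distrib_left mult_ac)
    ultimately show "i * c \<in> X" unfolding X_def
      by (intro CollectI exI[of _ "\<lambda>k. a k * i"] conjI)
  next
    fix x y assume "x \<in> X" "y \<in> X"
    then obtain b d where "\<forall>i<r. b i \<in> B" "x = (\<Sum>i<r. b i * g i)" "\<forall>i<r. d i \<in> B" "y = (\<Sum>i<r. d i * g i)"
      unfolding X_def by blast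
    then show "x + y \<in> X" unfolding X_def using ideal_add[OF B]
      by (intro CollectI exI[of _ "\<lambda>k. b k + d k"]) (auto simp: distrib_right sum.distrib)
  qed
  then have "\<exists>b. (\<forall>j<r. b j \<in> B) \<and> 1 * g i = (\<Sum>j<r. b j * g j)" if "i < r" for i
    using eq g(1) that by (auto simp: X_def subset_iff)
  then obtain u' where u': "1 - u' \<in> B" "\<forall>i<r. u' * g i = 0"
    using nakayama_aux[OF B, of 1 r g] ideal_0[OF B] by auto
  have "\<exists>i<r. g i \<noteq> 0"
  proof (rule ccontr)
    assume "\<not> (\<exists>i<r. g i \<noteq> 0)"
    then have "x = 0" if "x \<in> C" for x using g(2)[OF that] by auto
    then show False using C nonzero_iff by blast
  qed
  then have "u' = 0" using u'(2) by auto
  then show ?thesis using u'(1) ideal_1[OF B] by simp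
qed

text \<open>Two powers of \<open>I\<close> with exponents k < l share a class representative. With C
  = I^k and B = I^(l-k) this reads \<gamma> C = B C. The elements of \<gamma>^(-1) B stabilise
  \<open>C\<close> and are therefore integral, so B' = \<gamma>^(-1) B is an ideal with B' C = C.
  Nakayama gives B' = \<open>\<O>\<close>, and \<open>B\<close> is generated by \<gamma>.\<close>

lemma ideal_power_principal:
  assumes I: "is_ideal I" "I \<noteq> {0}"
  shows "\<exists>h c. h > 0 \<and> c \<in> \<O> \<and> c \<noteq> 0 \<and> ipow I h = principal c"
proof -
  obtain t :: nat where t: "t > 0" "\<And>I. is_ideal I \<Longrightarrow> I \<noteq> {0} \<Longrightarrow>
     \<exists>\<beta>\<in>\<O>. \<beta> \<noteq> 0 \<and> (\<exists>J. is_ideal J \<and> of_nat t \<in> J \<and> (*) (of_nat t) ` I = (*) \<beta> ` J)"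
    using class_representatives by blast
  have "\<exists>\<beta> J. \<beta> \<in> \<O> \<and> \<beta> \<noteq> 0 \<and> is_ideal J \<and> of_nat t \<in> J \<and> (*) (of_nat t) ` ipow I k = (*) \<beta> ` J" for k
  proof -
    from t(2)[OF is_ideal_ipow[OF I(1)] ipow_nonzero[OF I]]
    obtain \<beta> where b: "\<beta> \<in> \<O>" "\<beta> \<noteq> 0 \<and> (\<exists>J. is_ideal J \<and> of_nat t \<in> J \<and> (*) (of_nat t) ` ipow I k = (*) \<beta> ` J)"
      by (rule bexE)
    from conjunct2[OF b(2)] obtain J where "is_ideal J \<and> of_nat t \<in> J \<and> (*) (of_nat t) ` ipow I k = (*) \<beta> ` J"
      by (rule exE)
    with b show ?thesis by (intro exI[of _ \<beta>] exI[of _ J] conjI) simp_all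
  qed
  then obtain \<beta> J where bJ: "\<And>k. \<beta> k \<in> \<O>" "\<And>k. \<beta> k \<noteq> 0" "\<And>k. is_ideal (J k)" "\<And>k. of_nat t \<in> J k"
     "\<And>k. (*) (of_nat t) ` ipow I k = (*) (\<beta> k) ` J k"
    by metis
  have "finite (range J)"
    by (rule finite_subset[OF _ finite_ideals_containing[OF t(1)]]) (use bJ in auto)
  then have "\<not> inj J" using finite_imageD infinite_UNIV_nat by blast
  then obtain k l where "k \<noteq> l" "J k = J l" by (auto simp: inj_on_def)
  then obtain k l where kl: "k < l" "J k = J l" by (metis linorder_neqE_nat)
  define C where "C = ipow I k"
  define h where "h = l - k"
  define B where "B = ipow I h"
  have C: "is_ideal C" "C \<noteq> {0}" unfolding C_def using is_ideal_ipow ipow_nonzero I by auto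
  have B: "is_ideal B" unfolding B_def using is_ideal_ipow I by auto
  have "ipow I l = iprod B C"
    using ipow_add[OF I(1), of h k] kl(1) by (simp add: h_def B_def C_def)
  moreover have "(*) (\<beta> l) ` ipow I k = (*) (\<beta> k) ` ipow I l"
  proof -
    have "(*) (of_nat t) ` (*) (\<beta> l) ` ipow I k = (*) (\<beta> l) ` (*) (of_nat t) ` ipow I k"
      by (simp add: image_image mult.left_commute)
    also have "\<dots> = (*) (\<beta> k) ` (*) (\<beta> l) ` J l" unfolding bJ(5) kl(2)
      by (simp add: image_image mult.left_commute)
    also have "\<dots> = (*) (of_nat t) ` (*) (\<beta> k) ` ipow I l"
      unfolding bJ(5)[symmetric] by (simp add: image_image mult.left_commute)
    finally show ?thesis using t(1) by (simp only: scale_eq_iff of_nat_eq_0_iff neq0_conv)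
  qed
  ultimately have e1: "(*) (\<beta> l) ` C = (*) (\<beta> k) ` iprod B C" by (simp add: C_def)
  define \<gamma> where "\<gamma> = \<beta> l / \<beta> k"
  have g0: "\<gamma> \<noteq> 0" using bJ(2) by (simp add: \<gamma>_def)
  have gK: "\<gamma> \<in> K" using bJ(1) OK unfolding \<gamma>_def by auto
  have "\<beta> l = \<beta> k * \<gamma>" using bJ(2) by (simp add: \<gamma>_def)
  then have "(*) (\<beta> k) ` (*) \<gamma> ` C = (*) (\<beta> k) ` iprod B C"
    using e1 by (simp add: image_image mult.assoc)
  then have gC: "(*) \<gamma> ` C = iprod B C" by (simp add: scale_eq_iff bJ(2))
  have quot: "inverse \<gamma> * b \<in> \<O>" if b: "b \<in> B" for b
  proof (rule stabiliser_integral[OF C])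
    show "inverse \<gamma> * b \<in> K" using gK b is_idealD(1)[OF B] OK by auto
    fix x assume "x \<in> C"
    then have "b * x \<in> (*) \<gamma> ` C" unfolding gC using b by (intro iprodI)
    then obtain y where "y \<in> C" "b * x = \<gamma> * y" by blast
    then show "inverse \<gamma> * b * x \<in> C" by (simp only: mult.assoc inverse_cancel[OF g0])
  qed
  define B' where "B' = (*) (inverse \<gamma>) ` B"
  have B': "is_ideal B'" unfolding B'_def by (rule is_ideal_scale[OF B quot])
  have BB': "B = (*) \<gamma> ` B'" by (simp only: B'_def image_image inverse_cancel[OF g0] image_ident)
  have "(*) \<gamma> ` C = (*) \<gamma> ` iprod B' C" using gC iprod_scale[OF B' C(1), of \<gamma>] BB' by simp
  then have "C = iprod B' C" using g0 scale_eq_iff by blast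
  then have "B' = \<O>" using nakayama[OF B' C] by simp
  then have "B = principal \<gamma>" using BB' by simp
  moreover have "\<gamma> \<in> \<O>"
  proof -
    have "\<gamma> * 1 \<in> principal \<gamma>" by blast
    then show ?thesis using \<open>B = principal \<gamma>\<close> is_idealD(1)[OF B] by auto
  qed
  ultimately show ?thesis using g0 kl(1) unfolding B_def h_def by (intro exI[of _ "l - k"] exI[of _ \<gamma>]) auto
qed

lemma ideal_inverse:
  assumes I: "is_ideal I" "I \<noteq> {0}"
  shows "\<exists>I' c. is_ideal I' \<and> c \<in> \<O> \<and> c \<noteq> 0 \<and> iprod I' I = principal c"
proof -
  obtain h c where hc: "h > 0" "c \<in> \<O>" "c \<noteq> 0" "ipow I h = principal c"
    using ideal_power_principal[OF I] by blast
  have "iprod (ipow I (h - 1)) I = ipow I h" using hc(1) ipow_Suc[of I "h - 1"] by simp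
  then show ?thesis using hc is_ideal_ipow[OF I(1)] by auto
qed

lemma ideal_cancel:
  assumes I: "is_ideal I" "I \<noteq> {0}" and J: "is_ideal J" "is_ideal J'" and sub: "iprod I J \<subseteq> iprod I J'"
  shows "J \<subseteq> J'"
proof -
  obtain I' c where I': "is_ideal I'" "c \<in> \<O>" "c \<noteq> 0" "iprod I' I = principal c"
    using ideal_inverse[OF I] by blast
  have "iprod I' (iprod I X) = (*) c ` X" if "is_ideal X" for X
    using iprod_assoc[OF I'(1) I(1) that] I'(4) iprod_principal[OF I'(2) that] by simp
  then have "(*) c ` J \<subseteq> (*) c ` J'"
    using iprod_mono[OF I'(1) is_ideal_iprod[OF I(1) J(2)] sub] J by simp
  then show ?thesis using scale_subset_iff[OF I'(3)] by simp
qed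

text \<open>The cofactor ideal is I' J divided by c, where I' I is generated by c; containment of
  \<open>J\<close> in \<open>I\<close> is what makes this quotient integral.\<close>

lemma ideal_contains_divides:
  assumes I: "is_ideal I" "I \<noteq> {0}" and J: "is_ideal J" "J \<subseteq> I"
  shows "\<exists>B. is_ideal B \<and> J = iprod I B"
proof -
  obtain I' c where I': "is_ideal I'" "c \<in> \<O>" "c \<noteq> 0" "iprod I' I = principal c"
    using ideal_inverse[OF I] by blast
  have sub: "iprod I' J \<subseteq> principal c" using iprod_mono[OF I'(1) I(1) J(2)] I'(4) by simp
  define B where "B = (*) (inverse c) ` iprod I' J"
  have B: "is_ideal B" unfolding B_def
  proof (rule is_ideal_scale[OF is_ideal_iprod[OF I'(1) J(1)]])
    fix x assume "x \<in> iprod I' J"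
    then obtain y where "y \<in> \<O>" "x = c * y" using sub by auto
    then show "inverse c * x \<in> \<O>" by (simp only: inverse_cancel[OF I'(3)])
  qed
  have cB: "(*) c ` B = iprod I' J" by (simp only: B_def image_image inverse_cancel[OF I'(3)] image_ident)
  have "(*) c ` iprod I B = iprod I ((*) c ` B)"
    using iprod_scale[OF B I(1), of c] iprod_comm[OF I(1)] B cB is_ideal_iprod[OF I'(1) J(1)] by simp
  also have "\<dots> = iprod (iprod I' I) J"
    unfolding cB using iprod_assoc[OF I(1) I'(1) J(1)] iprod_comm[OF I(1) I'(1)] by simp
  also have "\<dots> = (*) c ` J" unfolding I'(4) by (rule iprod_principal[OF I'(2) J(1)])
  finally have "J = iprod I B" using scale_eq_iff[OF I'(3)] by metis
  then show ?thesis using B by blast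
qed

end

subsection \<open>Prime ideals and valuations\<close>

context nfield
begin

lemma finite_placesD:
  assumes "p \<in> finite_places K"
  shows "is_ideal p" "p \<noteq> {0}" "p \<noteq> \<O>"
    and "a \<in> \<O> \<Longrightarrow> b \<in> \<O> \<Longrightarrow> a * b \<in> p \<Longrightarrow> a \<in> p \<or> b \<in> p"
proof -
  from assms interpret P: primeideal p RO by (simp add: finite_places_def)
  show "is_ideal p" using P.is_ideal by (simp add: ideal_iff)
  show "p \<noteq> {0}" using assms by (simp add: finite_places_def)
  show "p \<noteq> \<O>" using P.I_notcarr by auto
  show "a \<in> \<O> \<Longrightarrow> b \<in> \<O> \<Longrightarrow> a * b \<in> p \<Longrightarrow> a \<in> p \<or> b \<in> p" using P.I_prime by simp
qed

lemma ideal_sum_principal: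
  assumes I: "is_ideal I" and a: "a \<in> \<O>"
  shows "is_ideal {x + a * y | x y. x \<in> I \<and> y \<in> \<O>}"
  unfolding is_ideal_def add_subgroup_def
proof (intro conjI ballI)
  show "{x + a * y | x y. x \<in> I \<and> y \<in> \<O>} \<subseteq> \<O>" using is_idealD(1)[OF I] a by auto
  show "0 \<in> {x + a * y | x y. x \<in> I \<and> y \<in> \<O>}"
    using ideal_0[OF I] by (intro CollectI exI[of _ 0]) auto
next
  fix u v assume "u \<in> {x + a * y | x y. x \<in> I \<and> y \<in> \<O>}" "v \<in> {x + a * y | x y. x \<in> I \<and> y \<in> \<O>}"
  then obtain x y x' y' where "u = x + a * y" "v = x' + a * y'" "x \<in> I" "y \<in> \<O>" "x' \<in> I" "y' \<in> \<O>" by blast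
  then show "u - v \<in> {x + a * y | x y. x \<in> I \<and> y \<in> \<O>}"
    using add_subgroupD(2)[OF is_idealD(2)[OF I]]
    by (intro CollectI exI[of _ "x - x'"] exI[of _ "y - y'"]) (auto simp: algebra_simps)
next
  fix c u assume c: "c \<in> \<O>" and "u \<in> {x + a * y | x y. x \<in> I \<and> y \<in> \<O>}"
  then obtain x y where "u = x + a * y" "x \<in> I" "y \<in> \<O>" by blast
  then show "c * u \<in> {x + a * y | x y. x \<in> I \<and> y \<in> \<O>}"
    using is_idealD(3)[OF I c, of x] c
    by (intro CollectI exI[of _ "c * x"] exI[of _ "c * y"]) (auto simp: distrib_left mult.left_commute)
qed

text \<open>Since \<open>p\<close> has finite index, some power of \<open>x\<close> is \<open>1\<close> modulo \<open>p\<close>.\<close>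

lemma prime_inverse:
  assumes p: "p \<in> finite_places K" and x: "x \<in> \<O>" "x \<notin> p"
  shows "\<exists>y\<in>\<O>. 1 - x * y \<in> p"
proof -
  note P = finite_placesD[OF p]
  have "\<exists>i\<in>{0..idx \<O> p}. \<exists>j\<in>{0..idx \<O> p}. i \<noteq> j \<and> x ^ i - x ^ j \<in> p"
    using x(1) idx_ideal_pos[OF P(1,2)] by (intro idx_pigeonhole[OF is_idealD(2)[OF P(1)]]) auto
  then obtain i j where ij: "i \<noteq> j" "x ^ i - x ^ j \<in> p" by blast
  have "\<exists>k l. k < l \<and> x ^ k - x ^ l \<in> p"
  proof (cases "i < j")
    case False
    have "- (x ^ i - x ^ j) \<in> p" by (rule add_subgroupD(3)[OF is_idealD(2)[OF P(1)] ij(2)])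
    then have "x ^ j - x ^ i \<in> p" by simp
    then show ?thesis using False ij(1) by (meson linorder_neqE_nat)
  qed (use ij in blast)
  then obtain k l where kl: "k < l" "x ^ k - x ^ l \<in> p" by blast
  have "x ^ k - x ^ l = x ^ k * (1 - x * x ^ (l - k - 1))"
    using kl(1) by (simp add: right_diff_distrib flip: power_add power_Suc)
  then have "x ^ k \<in> p \<or> 1 - x * x ^ (l - k - 1) \<in> p"
    using P(4)[of "x ^ k" "1 - x * x ^ (l - k - 1)"] kl(2) x(1) by auto
  moreover have "x ^ k \<notin> p" for k
  proof (induction k)
    case 0
    then show ?case using P(3) ideal_1[OF P(1)] by auto
  next
    case (Suc k)
    then show ?case using P(4)[of x "x ^ k"] x by auto
  qed
  ultimately show ?thesis using x(1) by (intro bexI[of _ "x ^ (l - k - 1)"]) auto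
qed

lemma prime_maximal:
  assumes p: "p \<in> finite_places K" and J: "is_ideal J" "p \<subseteq> J"
  shows "J = p \<or> J = \<O>"
proof (rule disjCI)
  assume "J \<noteq> \<O>"
  have "J \<subseteq> p"
  proof
    fix x assume xJ: "x \<in> J"
    show "x \<in> p"
    proof (rule ccontr)
      assume xp: "x \<notin> p"
      have "x \<in> \<O>" using xJ is_idealD(1)[OF J(1)] by auto
      from prime_inverse[OF p this xp] obtain y where y: "y \<in> \<O>" "1 - x * y \<in> p" by blast
      have "x * y \<in> J" using is_idealD(3)[OF J(1) y(1) xJ] by (simp add: mult.commute)
      moreover have "1 - x * y \<in> J" using y(2) J(2) by auto
      ultimately have "(1 - x * y) + x * y \<in> J" by (intro ideal_add[OF J(1)])
      then show False using ideal_1[OF J(1)] \<open>J \<noteq> \<O>\<close> by simp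
    qed
  qed
  then show "J = p" using J(2) by auto
qed

lemma maximal_finite_place:
  assumes M: "is_ideal M" "M \<noteq> {0}" "M \<noteq> \<O>"
    and max: "\<And>J. is_ideal J \<Longrightarrow> M \<subseteq> J \<Longrightarrow> J \<noteq> M \<Longrightarrow> J = \<O>"
  shows "M \<in> finite_places K"
proof -
  have "primeideal M RO"
  proof (rule primeidealI)
    show "ideal M RO" using M(1) by (simp add: ideal_iff)
    show "cring RO" by (rule cring_RO)
    show "carrier RO \<noteq> M" using M(3) by auto
    fix a b assume "a \<in> carrier RO" "b \<in> carrier RO" "a \<otimes>\<^bsub>RO\<^esub> b \<in> M"
    then have ab: "a \<in> \<O>" "b \<in> \<O>" "a * b \<in> M" by auto
    show "a \<in> M \<or> b \<in> M"
    proof (rule disjCI)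
      assume "b \<notin> M"
      define J where "J = {x + b * y | x y. x \<in> M \<and> y \<in> \<O>}"
      have J: "is_ideal J" unfolding J_def by (rule ideal_sum_principal[OF M(1) ab(2)])
      have "M \<subseteq> J"
      proof
        fix x assume "x \<in> M"
        then show "x \<in> J" unfolding J_def by (intro CollectI exI[of _ x] exI[of _ 0]) auto
      qed
      have "b \<in> J" unfolding J_def using ideal_0[OF M(1)] by (intro CollectI exI[of _ 0] exI[of _ 1]) auto
      then have "J = \<O>" using \<open>M \<subseteq> J\<close> \<open>b \<notin> M\<close> max[OF J] by blast
      then obtain x y where xy: "x \<in> M" "y \<in> \<O>" "1 = x + b * y" using Oint.one unfolding J_def by blast
      have "a = a * x + y * (a * b)" using xy(3) by (metis mult.right_neutral distrib_left mult.assoc mult.commute)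
      moreover have "a * x + y * (a * b) \<in> M"
        using is_idealD(3)[OF M(1)] ab xy by (intro ideal_add[OF M(1)]) auto
      ultimately show "a \<in> M" by simp
    qed
  qed
  then show ?thesis using M(2) by (simp add: finite_places_def)
qed

text \<open>A proper ideal of least index above \<open>I\<close> is maximal, since a larger proper
  ideal would have smaller index.\<close>

lemma ideal_below_prime:
  assumes I: "is_ideal I" "I \<noteq> {0}" "I \<noteq> \<O>"
  shows "\<exists>p\<in>finite_places K. I \<subseteq> p"
proof -
  define P where "P = (\<lambda>M. is_ideal M \<and> I \<subseteq> M \<and> M \<noteq> \<O>)"
  have "P I" using I by (simp add: P_def)
  then obtain M where M: "P M" and min: "\<And>J. P J \<Longrightarrow> idx \<O> M \<le> idx \<O> J"
    using ex_has_least_nat[of P I "\<lambda>M. idx \<O> M"] by blast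
  have Mi: "is_ideal M" "I \<subseteq> M" "M \<noteq> \<O>" using M by (auto simp: P_def)
  have M0: "M \<noteq> {0}" using I Mi(2) ideal_0[OF I(1)] by auto
  have "M \<in> finite_places K"
  proof (rule maximal_finite_place[OF Mi(1) M0 Mi(3)], rule ccontr)
    fix J assume J: "is_ideal J" "M \<subseteq> J" "J \<noteq> M" "J \<noteq> \<O>"
    then have "P J" using Mi by (auto simp: P_def)
    have "idx \<O> M = idx \<O> J * idx J M"
      by (intro idx_mult is_idealD J(1) Mi(1) J(2) add_subgroup_O)
    moreover have "idx \<O> M > 0" by (rule idx_ideal_pos[OF Mi(1) M0])
    moreover have "idx J M \<noteq> 1"
      using idx_eq_1[OF is_idealD(2)[OF Mi(1)] J(2) ideal_0[OF J(1)]] J(3) by auto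
    ultimately have "idx \<O> J < idx \<O> M"
      by (cases "idx J M") (simp_all add: nat_0_less_mult_iff del: One_nat_def)
    then show False using min[OF \<open>P J\<close>] by simp
  qed
  then show ?thesis using Mi(2) by blast
qed

text \<open>Take b in \<open>I\<close> outside p I. The ideal p I + b \<open>\<O>\<close> is I D
  with \<open>D\<close> between p and \<open>\<O>\<close>, so it is all of \<open>I\<close>.
  Multiplication by b then carries representatives of \<open>\<O>\<close> modulo p to
  representatives of \<open>I\<close> modulo p I.\<close>

lemma idx_iprod_prime:
  assumes p: "p \<in> finite_places K" and I: "is_ideal I" "I \<noteq> {0}"
  shows "idx \<O> (iprod p I) = idx \<O> p * idx \<O> I"
proof -
  note P = finite_placesD[OF p]
  have pI: "is_ideal (iprod p I)" by (rule is_ideal_iprod[OF P(1) I(1)])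
  have sub: "iprod p I \<subseteq> I" by (rule iprod_subset[OF P(1) I(1)])
  have "iprod p I \<noteq> I"
  proof
    assume "iprod p I = I"
    then have "iprod I \<O> \<subseteq> iprod I p" using iprod_O[OF I(1)] iprod_comm[OF I(1) P(1)] by simp
    then have "\<O> \<subseteq> p" by (rule ideal_cancel[OF I is_ideal_O P(1)])
    then show False using P(3) is_idealD(1)[OF P(1)] by auto
  qed
  then obtain b where b: "b \<in> I" "b \<notin> iprod p I" using sub by blast
  have bO: "b \<in> \<O>" using b(1) is_idealD(1)[OF I(1)] by auto
  define J where "J = {x + b * y | x y. x \<in> iprod p I \<and> y \<in> \<O>}"
  have J: "is_ideal J" unfolding J_def by (rule ideal_sum_principal[OF pI bO])
  have pJ: "iprod p I \<subseteq> J"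
  proof
    fix x assume "x \<in> iprod p I"
    then show "x \<in> J" unfolding J_def by (intro CollectI exI[of _ x] exI[of _ 0]) auto
  qed
  have bJ: "b \<in> J" unfolding J_def using ideal_0[OF pI] by (intro CollectI exI[of _ 0] exI[of _ 1]) auto
  have JI: "J \<subseteq> I"
    unfolding J_def using sub ideal_add[OF I(1)] is_idealD(3)[OF I(1) _ b(1)] by (auto simp: mult.commute[of b])
  obtain D where D: "is_ideal D" "J = iprod I D" using ideal_contains_divides[OF I J JI] by blast
  have "p \<subseteq> D" using pJ D(2) iprod_comm[OF I(1) P(1)] by (intro ideal_cancel[OF I P(1) D(1)]) simp
  then have "D = p \<or> D = \<O>" by (rule prime_maximal[OF p D(1)])
  moreover have "D \<noteq> p" using D(2) bJ b(2) iprod_comm[OF I(1) P(1)] by auto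
  ultimately have JeqI: "J = I" using D iprod_O[OF I(1)] by simp
  obtain T where T: "transversal T \<O> p" using ex_transversal[OF is_idealD(2)[OF P(1)]] by blast
  have inc: "s = t" if st: "s \<in> T" "t \<in> T" "b * s - b * t \<in> iprod p I" for s t
  proof -
    have "s - t \<in> p"
    proof (rule ccontr)
      assume n: "s - t \<notin> p"
      have "s - t \<in> \<O>" using T st by (auto simp: transversal_def)
      from prime_inverse[OF p this n] obtain y where y: "y \<in> \<O>" "1 - (s - t) * y \<in> p" by blast
      have "(1 - (s - t) * y) * b \<in> iprod p I" using y(2) b(1) by (rule iprodI)
      moreover have "y * (b * s - b * t) \<in> iprod p I" by (rule is_idealD(3)[OF pI y(1) st(3)])
      ultimately have "(1 - (s - t) * y) * b + y * (b * s - b * t) \<in> iprod p I" by (rule ideal_add[OF pI])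
      then show False using b(2) by (simp add: algebra_simps)
    qed
    then show ?thesis using T st by (auto simp: transversal_def)
  qed
  have b0: "b \<noteq> 0" using b(2) ideal_0[OF pI] by auto
  have "transversal ((*) b ` T) I (iprod p I)" unfolding transversal_def
  proof (intro conjI ballI impI)
    show "(*) b ` T \<subseteq> I" using T is_idealD(3)[OF I(1) _ b(1)] by (auto simp: transversal_def mult.commute[of b])
    fix a assume "a \<in> I"
    then obtain x y where xy: "x \<in> iprod p I" "y \<in> \<O>" "a = x + b * y" using JeqI unfolding J_def by blast
    obtain t where t: "t \<in> T" "y - t \<in> p" using T xy(2) unfolding transversal_def by blast
    have "x + (y - t) * b \<in> iprod p I" using xy(1) iprodI[OF t(2) b(1)] by (rule ideal_add[OF pI])
    then have "a - b * t \<in> iprod p I" unfolding xy(3) by (simp add: algebra_simps)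
    then show "\<exists>s\<in>(*) b ` T. a - s \<in> iprod p I" using t(1) by blast
  next
    fix s t assume "s \<in> (*) b ` T" "t \<in> (*) b ` T" "s - t \<in> iprod p I"
    then show "s = t" using inc by blast
  qed
  then have "idx I (iprod p I) = card ((*) b ` T)" by (rule idx_transversal[OF is_idealD(2)[OF pI]])
  also have "\<dots> = card T" using b0 by (intro card_image) (auto simp: inj_on_def)
  also have "\<dots> = idx \<O> p" using idx_transversal[OF is_idealD(2)[OF P(1)] T] by simp
  finally have "idx I (iprod p I) = idx \<O> p" .
  moreover have "idx \<O> (iprod p I) = idx \<O> I * idx I (iprod p I)"
    by (intro idx_mult is_idealD I(1) pI sub add_subgroup_O)
  ultimately show ?thesis by simp
qed

lemma idx_prime_gt_1: "p \<in> finite_places K \<Longrightarrow> idx \<O> p > 1"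
  using idx_ideal_pos[OF finite_placesD(1,2)] finite_placesD(3)
    idx_eq_1[OF is_idealD(2)[OF finite_placesD(1)] is_idealD(1)[OF finite_placesD(1)] Oint.zero]
  by (metis One_nat_def Suc_lessI)

text \<open>Existence of prime factorisations in the shape of an induction rule: dividing by a prime
  above \<open>I\<close> lowers the index.\<close>

lemma ideal_induct [consumes 2, case_names one prime]:
  assumes I: "is_ideal I" "I \<noteq> {0}"
    and one: "P \<O>"
    and prime: "\<And>p I. p \<in> finite_places K \<Longrightarrow> is_ideal I \<Longrightarrow> I \<noteq> {0} \<Longrightarrow> P I \<Longrightarrow> P (iprod p I)"
  shows "P I"
  using I
proof (induction "idx \<O> I" arbitrary: I rule: less_induct)
  case less
  show ?case
  proof (cases "I = \<O>")
    case False
    obtain p where p: "p \<in> finite_places K" "I \<subseteq> p" using ideal_below_prime[OF less.prems False] by blast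
    note P = finite_placesD[OF p(1)]
    obtain B where B: "is_ideal B" "I = iprod p B" using ideal_contains_divides[OF P(1,2) less.prems(1) p(2)] by blast
    have B0: "B \<noteq> {0}"
    proof
      assume "B = {0}"
      then have "I \<subseteq> {0}" using iprod_subset(1)[OF P(1) B(1)] B(2) by simp
      then show False using less.prems ideal_0 by blast
    qed
    have "idx \<O> B < idx \<O> I"
      using idx_iprod_prime[OF p(1) B(1) B0] idx_prime_gt_1[OF p(1)] idx_ideal_pos[OF B(1) B0] B(2) by simp
    from less.hyps[OF this B(1) B0] have "P B" .
    then show ?thesis using prime[OF p(1) B(1) B0] B(2) by simp
  qed (use one in simp)
qed

lemma idx_iprod:
  assumes I: "is_ideal I" "I \<noteq> {0}" and J: "is_ideal J" "J \<noteq> {0}"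
  shows "idx \<O> (iprod I J) = idx \<O> I * idx \<O> J"
  using I
proof (induction rule: ideal_induct)
  case one
  then show ?case using iprod_O_left[OF J(1)] idx_self[OF add_subgroup_O] by simp
next
  case (prime p I)
  note P = finite_placesD[OF prime(1)]
  have "idx \<O> (iprod (iprod p I) J) = idx \<O> p * (idx \<O> I * idx \<O> J)"
    using idx_iprod_prime[OF prime(1) is_ideal_iprod[OF prime(2) J(1)] iprod_nonzero[OF prime(2) J(1) prime(3) J(2)]]
      prime(4) iprod_assoc[OF P(1) prime(2) J(1)] by simp
  then show ?case using idx_iprod_prime[OF prime(1-3)] by simp
qed

lemma idx_ipow:
  assumes I: "is_ideal I" "I \<noteq> {0}"
  shows "idx \<O> (ipow I k) = idx \<O> I ^ k"
proof (induction k)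
  case 0
  then show ?case using idx_self[OF add_subgroup_O] by simp
next
  case (Suc k)
  then show ?case using idx_iprod[OF is_ideal_ipow[OF I(1)] ipow_nonzero[OF I] I] by (simp add: ipow_Suc)
qed

text \<open>The exponent of \<open>p\<close> in the factorisation of \<open>I\<close>. The maximum
  is meaningful once the set of exponents is shown to be finite and nonempty in
  \<open>ival_props\<close>.\<close>

definition ival :: "complex set \<Rightarrow> complex set \<Rightarrow> nat" where
  "ival p I = Max {k. I \<subseteq> ipow p k}"

lemma ipow_subset: "is_ideal p \<Longrightarrow> k > 0 \<Longrightarrow> ipow p k \<subseteq> p"
  using iprod_subset(1)[OF is_ideal_ipow] by (cases k) (auto simp: ipow_Suc)

lemma powers_containing_O:
  assumes p: "p \<in> finite_places K"
  shows "{k. \<O> \<subseteq> ipow p k} = {0}"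
proof -
  note P = finite_placesD[OF p]
  have "\<not> \<O> \<subseteq> ipow p k" if "k > 0" for k
    using ipow_subset[OF P(1) that] P(3) is_idealD(1)[OF P(1)] by auto
  then show ?thesis by auto
qed

text \<open>For p = q cancellation shifts the exponents by one, and 0 is added because the power 0
  is the whole ring. For p \<noteq> q some a in p lies outside q, and a is invertible modulo q^k, so
  multiplying by p changes no membership in q^k.\<close>

lemma powers_containing_iprod:
  assumes p: "p \<in> finite_places K" and q: "q \<in> finite_places K" and I: "is_ideal I"
  shows "{k. iprod p I \<subseteq> ipow q k} = (if p = q then insert 0 (Suc ` {k. I \<subseteq> ipow q k}) else {k. I \<subseteq> ipow q k})"
proof -
  note P = finite_placesD[OF p] and Q = finite_placesD[OF q]
  have qk: "is_ideal (ipow q k)" for k by (rule is_ideal_ipow[OF Q(1)])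
  show ?thesis
  proof (cases "p = q")
    case True
    have "iprod p I \<subseteq> ipow p (Suc k) \<longleftrightarrow> I \<subseteq> ipow p k" for k
    proof
      assume "iprod p I \<subseteq> ipow p (Suc k)"
      then have "iprod p I \<subseteq> iprod p (ipow p k)"
        using iprod_comm[OF P(1) is_ideal_ipow[OF P(1)]] by (simp add: ipow_Suc)
      then show "I \<subseteq> ipow p k" by (rule ideal_cancel[OF P(1,2) I is_ideal_ipow[OF P(1)]])
    next
      assume "I \<subseteq> ipow p k"
      from iprod_mono[OF P(1) is_ideal_ipow[OF P(1)] this]
      show "iprod p I \<subseteq> ipow p (Suc k)"
        using iprod_comm[OF P(1) is_ideal_ipow[OF P(1)]] by (simp add: ipow_Suc)
    qed
    moreover have "iprod p I \<subseteq> ipow p 0" using is_idealD(1)[OF is_ideal_iprod[OF P(1) I]] by simp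
    ultimately have "iprod p I \<subseteq> ipow p k \<longleftrightarrow> k \<in> insert 0 (Suc ` {k. I \<subseteq> ipow p k})" for k
      by (cases k) auto
    then show ?thesis using True by auto
  next
    case False
    have "I \<subseteq> ipow q k" if k: "iprod p I \<subseteq> ipow q k" for k
    proof -
      have "\<not> p \<subseteq> q" using prime_maximal[OF p Q(1)] Q(3) False by auto
      then obtain a where a: "a \<in> p" "a \<notin> q" by auto
      have aO: "a \<in> \<O>" using a is_idealD(1)[OF P(1)] by auto
      define L where "L = {x + a * y | x y. x \<in> ipow q k \<and> y \<in> \<O>}"
      have L: "is_ideal L" unfolding L_def by (rule ideal_sum_principal[OF qk aO])
      have "a ^ j \<notin> q" for j
      proof (induction j)
        case 0
        then show ?case using Q(3) ideal_1[OF Q(1)] by auto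
      next
        case (Suc j)
        then show ?case using Q(4)[of a "a ^ j"] aO a by auto
      qed
      have qL: "ipow q k \<subseteq> L"
      proof
        fix x assume "x \<in> ipow q k"
        then show "x \<in> L" unfolding L_def by (intro CollectI exI[of _ x] exI[of _ 0]) auto
      qed
      have aL: "a \<in> L" unfolding L_def using ideal_0[OF qk] by (intro CollectI exI[of _ 0] exI[of _ 1]) auto
      \<comment> \<open>A prime above \<open>L\<close> would contain q^k, hence q, hence equal q,
        although it contains \<open>a\<close>.\<close>
      have "L = \<O>"
      proof (rule ccontr)
        assume "L \<noteq> \<O>"
        moreover have "L \<noteq> {0}" using qL ipow_nonzero[OF Q(1,2), of k] ideal_0[OF qk, of k] by blast
        ultimately obtain r where r: "r \<in> finite_places K" "L \<subseteq> r" using ideal_below_prime[OF L] by blast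
        note R = finite_placesD[OF r(1)]
        have "z \<in> r" if z: "z \<in> q" for z
        proof -
          have zO: "z \<in> \<O>" using z is_idealD(1)[OF Q(1)] by auto
          have zk: "z ^ j \<in> ipow q j" for j
          proof (induction j)
            case (Suc j)
            then show ?case using iprodI[OF Suc z] by (simp add: ipow_Suc mult.commute)
          qed simp
          then have zr: "z ^ k \<in> r" using qL r(2) by auto
          have "z ^ j \<in> r \<Longrightarrow> z \<in> r" for j
          proof (induction j)
            case 0
            then show ?case using R(3) ideal_1[OF R(1)] by auto
          next
            case (Suc j)
            then show ?case using R(4)[of z "z ^ j"] zO by auto
          qed
          then show ?thesis using zr by blast
        qed
        then have "q \<subseteq> r" by auto
        then have "r = q" using prime_maximal[OF q R(1)] R(3) by auto
        then show False using aL a(2) r(2) by auto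
      qed
      then obtain x y where xy: "x \<in> ipow q k" "y \<in> \<O>" "1 = x + a * y" using Oint.one unfolding L_def by blast
      show "I \<subseteq> ipow q k"
      proof
        fix i assume i: "i \<in> I"
        have iO: "i \<in> \<O>" using i is_idealD(1)[OF I] by auto
        have "a * i \<in> ipow q k" using iprodI[OF a(1) i] k by auto
        then have "i * x + y * (a * i) \<in> ipow q k"
          using is_idealD(3)[OF qk] iO xy by (intro ideal_add[OF qk]) auto
        moreover have "i * x + y * (a * i) = i * (x + a * y)" by (simp add: algebra_simps)
        ultimately show "i \<in> ipow q k" using xy(3) by (metis mult.right_neutral)
      qed
    qed
    then show ?thesis using False iprod_subset(1)[OF P(1) I] by auto
  qed
qed

lemma ival_props:
  assumes q: "q \<in> finite_places K" and I: "is_ideal I" "I \<noteq> {0}"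
  shows "finite {k. I \<subseteq> ipow q k} \<and> 0 \<in> {k. I \<subseteq> ipow q k}"
  using I
proof (induction rule: ideal_induct)
  case one
  then show ?case using powers_containing_O[OF q] by simp
next
  case (prime p I)
  then show ?case unfolding powers_containing_iprod[OF prime(1) q prime(2)]
    by (cases "p = q") (simp_all only: if_True if_False simp_thms finite_insert finite_imageI insertI1)
qed

lemma ival_O: "q \<in> finite_places K \<Longrightarrow> ival q \<O> = 0"
  by (simp add: ival_def powers_containing_O)

lemma ival_iprod_prime:
  assumes p: "p \<in> finite_places K" and q: "q \<in> finite_places K" and I: "is_ideal I" "I \<noteq> {0}"
  shows "ival q (iprod p I) = ival q I + (if p = q then 1 else 0)"
proof (cases "p = q")
  case True
  let ?S = "{k. I \<subseteq> ipow q k}"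
  have S: "finite ?S" "?S \<noteq> {}" using ival_props[OF q I] by blast+
  have "ival q (iprod p I) = Max (insert 0 (Suc ` ?S))"
    unfolding ival_def powers_containing_iprod[OF p q I(1)] using True by simp
  also have "\<dots> = Max (Suc ` ?S)" using S by (subst Max_insert) auto
  also have "\<dots> = Suc (Max ?S)" using S by (intro mono_Max_commute[symmetric]) (auto simp: mono_def)
  finally show ?thesis using True by (simp add: ival_def)
qed (simp add: ival_def powers_containing_iprod[OF p q I(1)])

lemma ival_iprod:
  assumes q: "q \<in> finite_places K" and I: "is_ideal I" "I \<noteq> {0}" and J: "is_ideal J" "J \<noteq> {0}"
  shows "ival q (iprod I J) = ival q I + ival q J"
  using I
proof (induction rule: ideal_induct)
  case one
  then show ?case using ival_O[OF q] iprod_O_left[OF J(1)] by simp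
next
  case (prime p I)
  note P = finite_placesD[OF prime(1)]
  show ?case
    using ival_iprod_prime[OF prime(1) q is_ideal_iprod[OF prime(2) J(1)] iprod_nonzero[OF prime(2) J(1) prime(3) J(2)]]
      ival_iprod_prime[OF prime(1) q prime(2,3)] prime(4) iprod_assoc[OF P(1) prime(2) J(1)] by simp
qed

lemma finite_ival:
  assumes I: "is_ideal I" "I \<noteq> {0}"
  shows "finite {p \<in> finite_places K. ival p I \<noteq> 0}"
  using I
proof (induction rule: ideal_induct)
  case one
  have "{p \<in> finite_places K. ival p \<O> \<noteq> 0} = {}" using ival_O by auto
  then show ?case by (simp only: finite.emptyI)
next
  case (prime p I)
  have "{q \<in> finite_places K. ival q (iprod p I) \<noteq> 0} \<subseteq> insert p {q \<in> finite_places K. ival q I \<noteq> 0}"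
    using ival_iprod_prime[OF prime(1) _ prime(2,3)] by (auto split: if_splits)
  then show ?case using prime(4) by (meson finite_insert finite_subset)
qed

text \<open>The set \<open>T\<close> may exceed the support, so that the factorisations of two
  ideals can be compared over one index set.\<close>

lemma prod_ival:
  assumes I: "is_ideal I" "I \<noteq> {0}"
    and T: "finite T" "T \<subseteq> finite_places K" "{p \<in> finite_places K. ival p I \<noteq> 0} \<subseteq> T"
  shows "(\<Prod>p\<in>T. idx \<O> p ^ ival p I) = idx \<O> I"
proof -
  have "(\<Prod>p\<in>T. idx \<O> p ^ ival p I) = idx \<O> I"
    if "{p \<in> finite_places K. ival p I \<noteq> 0} \<subseteq> T" "finite T" "T \<subseteq> finite_places K" for T
    using I that
  proof (induction arbitrary: T rule: ideal_induct)
    case one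
    have "(\<Prod>p\<in>T. idx \<O> p ^ ival p \<O>) = (\<Prod>p\<in>T. 1)"
      using one ival_O by (intro prod.cong) auto
    then show ?case using idx_self[OF add_subgroup_O] by simp
  next
    case (prime p I)
    have ip: "ival q (iprod p I) = ival q I + (if p = q then 1 else 0)" if "q \<in> finite_places K" for q
      by (rule ival_iprod_prime[OF prime(1) that prime(2,3)])
    have pT: "p \<in> T" using prime(1,5) ip[OF prime(1)] by auto
    have sub: "{q \<in> finite_places K. ival q I \<noteq> 0} \<subseteq> T" using prime(5) ip by fastforce
    have "(\<Prod>q\<in>T. idx \<O> q ^ ival q (iprod p I)) = (\<Prod>q\<in>T. idx \<O> q ^ ival q I * (if q = p then idx \<O> p else 1))"
      using prime(7) ip by (intro prod.cong) (auto simp: subset_iff)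
    also have "\<dots> = idx \<O> I * idx \<O> p"
      using prime(4)[OF sub prime(6,7)] pT prime(6) by (simp add: prod.distrib)
    finally show ?case using idx_iprod_prime[OF prime(1-3)] by simp
  qed
  then show ?thesis using T by blast
qed

subsection \<open>The height in terms of ideals\<close>

lemma ideal_norm_eq: "ideal_norm K p = idx \<O> p"
proof -
  have "carrier (RO Quot p) = coset_of p ` \<O>"
    by (auto simp: FactRing_def A_RCOSETS_def' a_r_coset_def' coset_of_def)
  then show ?thesis by (simp add: ideal_norm_def idx_def)
qed

lemma ord_int_eq:
  assumes p: "p \<in> finite_places K" and a: "a \<in> \<O>"
  shows "ord_int K p a = ival p (principal a)"
proof -
  have "a \<in> ipow p k \<longleftrightarrow> principal a \<subseteq> ipow p k" for k
  proof
    assume "principal a \<subseteq> ipow p k"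
    then have "a * 1 \<in> ipow p k" by blast
    then show "a \<in> ipow p k" by simp
  qed (rule principal_subset[OF is_ideal_ipow[OF finite_placesD(1)[OF p]]])
  then show ?thesis by (simp add: ord_int_def ival_def ipow_def)
qed

lemma ival_principal_mult:
  assumes p: "p \<in> finite_places K" and ab: "a \<in> \<O>" "b \<in> \<O>" "a \<noteq> 0" "b \<noteq> 0"
  shows "ival p (principal (a * b)) = ival p (principal a) + ival p (principal b)"
proof -
  have "principal (a * b) = iprod (principal a) (principal b)"
    using iprod_principal[OF ab(1) is_ideal_principal[OF ab(2)]] by (auto simp: image_image mult.assoc)
  then show ?thesis
    using ival_iprod[OF p is_ideal_principal[OF ab(1)] principal_nonzero[OF ab(3)] is_ideal_principal[OF ab(2)] principal_nonzero[OF ab(4)]]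
    by simp
qed

lemma ord_frac_eq:
  assumes p: "p \<in> finite_places K" and ab: "a \<in> \<O>" "b \<in> \<O>" "a \<noteq> 0" "b \<noteq> 0"
  shows "ord_frac K p (a / b) = int (ival p (principal a)) - int (ival p (principal b))"
  unfolding ord_frac_def
proof (rule the_equality)
  show "\<exists>a' b'. a' \<in> carrier RO - {0} \<and> b' \<in> carrier RO - {0} \<and> a / b = a' / b' \<and>
     int (ival p (principal a)) - int (ival p (principal b)) = int (ord_int K p a') - int (ord_int K p b')"
    using ab by (intro exI[of _ a] exI[of _ b]) (auto simp: ord_int_eq[OF p])
next
  fix k assume "\<exists>a' b'. a' \<in> carrier RO - {0} \<and> b' \<in> carrier RO - {0} \<and> a / b = a' / b' \<and>
     k = int (ord_int K p a') - int (ord_int K p b')"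
  then obtain a' b' where *: "a' \<in> \<O>" "a' \<noteq> 0" "b' \<in> \<O>" "b' \<noteq> 0" "a / b = a' / b'"
     "k = int (ival p (principal a')) - int (ival p (principal b'))"
    using ord_int_eq[OF p] by auto
  have "a * b' = a' * b" using *(5) ab *(4) by (simp add: field_simps)
  then have "ival p (principal a) + ival p (principal b') = ival p (principal a') + ival p (principal b)"
    using ival_principal_mult[OF p ab(1) *(3) ab(3) *(4)] ival_principal_mult[OF p *(1) ab(2) *(2) ab(4)] by simp
  then show "k = int (ival p (principal a)) - int (ival p (principal b))" using *(6) by linarith
qed

definition gen_ideal :: "nat \<Rightarrow> (nat \<Rightarrow> complex) \<Rightarrow> complex set" where
  "gen_ideal N x = {\<Sum>i\<le>N. o' i * x i | o'. \<forall>i\<le>N. o' i \<in> \<O>}"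

lemma is_ideal_gen:
  assumes x: "\<And>i. i \<le> N \<Longrightarrow> x i \<in> \<O>"
  shows "is_ideal (gen_ideal N x)"
  unfolding is_ideal_def add_subgroup_def
proof (intro conjI ballI)
  show "gen_ideal N x \<subseteq> \<O>" using x unfolding gen_ideal_def by auto
  show "0 \<in> gen_ideal N x" unfolding gen_ideal_def by (intro CollectI exI[of _ "\<lambda>_. 0"]) auto
next
  fix u v assume "u \<in> gen_ideal N x" "v \<in> gen_ideal N x"
  then obtain a b where ab: "\<forall>i\<le>N. a i \<in> \<O>" "u = (\<Sum>i\<le>N. a i * x i)" "\<forall>i\<le>N. b i \<in> \<O>" "v = (\<Sum>i\<le>N. b i * x i)"
    unfolding gen_ideal_def by blast
  then show "u - v \<in> gen_ideal N x" unfolding gen_ideal_def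
    by (intro CollectI exI[of _ "\<lambda>i. a i - b i"]) (auto simp: left_diff_distrib sum_subtractf)
next
  fix c u assume c: "c \<in> \<O>" and "u \<in> gen_ideal N x"
  then obtain a where "\<forall>i\<le>N. a i \<in> \<O>" "u = (\<Sum>i\<le>N. a i * x i)" unfolding gen_ideal_def by blast
  then show "c * u \<in> gen_ideal N x" unfolding gen_ideal_def using c
    by (intro CollectI exI[of _ "\<lambda>i. c * a i"]) (auto simp: sum_distrib_left mult.assoc)
qed

lemma in_gen_ideal: "j \<le> N \<Longrightarrow> x j \<in> gen_ideal N x"
  unfolding gen_ideal_def
proof (intro CollectI exI[of _ "\<lambda>i. if i = j then 1 else 0"] conjI allI impI)
  assume "j \<le> N"
  have "(\<Sum>i\<le>N. (if i = j then 1 else 0) * x i) = (\<Sum>i\<le>N. if i = j then x i else 0)"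
    by (rule sum.cong) auto
  then show "x j = (\<Sum>i\<le>N. (if i = j then 1 else 0) * x i)" using \<open>j \<le> N\<close> by simp
qed auto

lemma gen_ideal_least: "is_ideal I \<Longrightarrow> (\<And>i. i \<le> N \<Longrightarrow> x i \<in> I) \<Longrightarrow> gen_ideal N x \<subseteq> I"
proof
  fix u assume I: "is_ideal I" "\<And>i. i \<le> N \<Longrightarrow> x i \<in> I" "u \<in> gen_ideal N x"
  then obtain a where a: "\<forall>i\<le>N. a i \<in> \<O>" "u = (\<Sum>i\<le>N. a i * x i)" unfolding gen_ideal_def by blast
  have "(\<Sum>i\<le>N. a i * x i) \<in> I"
    using a(1) I(2) by (intro add_subgroup_sum[OF is_idealD(2)[OF I(1)]] is_idealD(3)[OF I(1)]) auto
  then show "u \<in> I" using a(2) by simp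
qed

text \<open>The largest absolute value belongs to the least valuation among the scaled coordinates D
  x_i, and this is the valuation of the ideal they generate: the ideal lies in a power of
  \<open>p\<close> exactly when all of them do.\<close>

lemma finite_max_eq:
  assumes p: "p \<in> finite_places K" and D: "D > 0" "\<And>i. i \<le> N \<Longrightarrow> of_nat D * x i \<in> \<O>" and nz: "\<exists>i\<le>N. x i \<noteq> 0"
  defines "A \<equiv> gen_ideal N (\<lambda>i. of_nat D * x i)"
  shows "finite_max K N x p = real (idx \<O> p) ^ ival p (principal (of_nat D)) / real (idx \<O> p) ^ ival p A"
proof -
  let ?q = "real (idx \<O> p)"
  define d where "d = ival p (principal (of_nat D))"
  define z where "z = (\<lambda>i. of_nat D * x i)"
  have q: "?q > 1" using idx_prime_gt_1[OF p] by simp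
  have Ai: "is_ideal A" unfolding A_def by (rule is_ideal_gen[OF D(2)])
  obtain j where j: "j \<le> N" "z j \<noteq> 0" using nz D(1) by (auto simp: z_def)
  have "z j \<in> A" unfolding A_def z_def by (rule in_gen_ideal[OF j(1), of "\<lambda>i. of_nat D * x i"])
  then have A0: "A \<noteq> {0}" using j(2) by blast
  have zO: "z i \<in> \<O>" if "i \<le> N" for i using D(2)[OF that] by (simp add: z_def)
  have Apow: "A \<subseteq> ipow p k \<longleftrightarrow> (\<forall>i\<le>N. z i \<in> ipow p k)" for k
    using gen_ideal_least[OF is_ideal_ipow[OF finite_placesD(1)[OF p]], of N z k] in_gen_ideal[of _ N z]
    unfolding A_def z_def by blast
  have abs: "finite_abs K p (x i) = ?q ^ d / ?q ^ ival p (principal (z i))" if i: "i \<le> N" "z i \<noteq> 0" for i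
  proof -
    have xi: "x i = z i / of_nat D" using D(1) by (simp add: z_def)
    have "ord_frac K p (x i) = int (ival p (principal (z i))) - int d"
      unfolding xi d_def using zO[OF i(1)] i(2) D(1) by (intro ord_frac_eq[OF p]) auto
    moreover have "x i \<noteq> 0" using i by (auto simp: z_def)
    ultimately have "finite_abs K p (x i) = ?q powi (int d - int (ival p (principal (z i))))"
      by (simp add: finite_abs_def ideal_norm_eq)
    also have "\<dots> = ?q ^ d / ?q ^ ival p (principal (z i))"
      using q by (subst power_int_diff) auto
    finally show ?thesis .
  qed
  have ivle: "ival p A \<le> ival p (principal (z i))" if i: "i \<le> N" "z i \<noteq> 0" for i
    unfolding ival_def
  proof (rule Max_mono)
    note pr = ival_props[OF p is_ideal_principal[OF zO[OF i(1)]] principal_nonzero[OF i(2)]]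
    show "finite {k. principal (z i) \<subseteq> ipow p k}" using pr by simp
    show "{k. A \<subseteq> ipow p k} \<noteq> {}" using ival_props[OF p Ai A0] by blast
    show "{k. A \<subseteq> ipow p k} \<subseteq> {k. principal (z i) \<subseteq> ipow p k}"
      using Apow principal_subset[OF is_ideal_ipow[OF finite_placesD(1)[OF p]]] i(1) by blast
  qed
  have "\<exists>i\<le>N. z i \<noteq> 0 \<and> ival p (principal (z i)) = ival p A"
  proof -
    have "\<not> A \<subseteq> ipow p (Suc (ival p A))"
    proof
      assume "A \<subseteq> ipow p (Suc (ival p A))"
      then have "Suc (ival p A) \<le> ival p A"
        using ival_props[OF p Ai A0] unfolding ival_def by (intro Max_ge) auto
      then show False by simp
    qed
    then obtain i where i: "i \<le> N" "z i \<notin> ipow p (Suc (ival p A))" using Apow by blast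
    have z0: "z i \<noteq> 0" using i(2) ideal_0[OF is_ideal_ipow[OF finite_placesD(1)[OF p]]] by metis
    note pr = ival_props[OF p is_ideal_principal[OF zO[OF i(1)]] principal_nonzero[OF z0]]
    have "ival p (principal (z i)) \<le> ival p A"
    proof (rule ccontr)
      assume "\<not> ival p (principal (z i)) \<le> ival p A"
      then have le: "Suc (ival p A) \<le> ival p (principal (z i))" by simp
      have "ival p (principal (z i)) \<in> {k. principal (z i) \<subseteq> ipow p k}"
        using Max_in[of "{k. principal (z i) \<subseteq> ipow p k}"] pr unfolding ival_def by blast
      then have "z i * 1 \<in> ipow p (ival p (principal (z i)))" by blast
      moreover have "ipow p (a + b) \<subseteq> ipow p a" for a b
        using ipow_add[OF finite_placesD(1)[OF p], of a b] iprod_subset(2) is_ideal_ipow[OF finite_placesD(1)[OF p]] by simp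
      moreover obtain e where "ival p (principal (z i)) = Suc (ival p A) + e" using le_Suc_ex[OF le] by blast
      ultimately have "z i * 1 \<in> ipow p (Suc (ival p A))" by (metis subsetD)
      then show False using i(2) by simp
    qed
    then show ?thesis using ivle[OF i(1) z0] i(1) z0 by (intro exI[of _ i]) simp
  qed
  then obtain i where i: "i \<le> N" "z i \<noteq> 0" "ival p (principal (z i)) = ival p A" by blast
  have "Max ((\<lambda>i. finite_abs K p (x i)) ` {..N}) = ?q ^ d / ?q ^ ival p A"
  proof (rule Max_eqI)
    show "?q ^ d / ?q ^ ival p A \<in> (\<lambda>i. finite_abs K p (x i)) ` {..N}"
      using abs[OF i(1,2)] i(1,3) by (intro image_eqI[of _ _ i]) auto
    fix y assume "y \<in> (\<lambda>i. finite_abs K p (x i)) ` {..N}"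
    then obtain k where k: "k \<le> N" "y = finite_abs K p (x k)" by auto
    show "y \<le> ?q ^ d / ?q ^ ival p A"
    proof (cases "z k = 0")
      case True
      then have "x k = 0" using D(1) by (simp add: z_def)
      then show ?thesis using k(2) by (simp add: finite_abs_def)
    next
      case False
      then show ?thesis unfolding k(2) abs[OF k(1) False] using q ivle[OF k(1) False]
        by (intro divide_left_mono power_increasing mult_pos_pos) auto
    qed
  qed simp
  then show ?thesis by (simp add: finite_max_def d_def)
qed

text \<open>The local formula is multiplied over the primes dividing D or the coordinate ideal. At
  all other primes the maximum is 1, and the products of prime indices give the indices of the two
  ideals.\<close>

lemma finite_part:
  assumes D: "D > 0" "\<And>i. i \<le> N \<Longrightarrow> of_nat D * x i \<in> \<O>" and nz: "\<exists>i\<le>N. x i \<noteq> 0"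
  defines "A \<equiv> gen_ideal N (\<lambda>i. of_nat D * x i)"
  shows "(\<Prod>\<pp> | \<pp> \<in> finite_places K \<and> finite_max K N x \<pp> \<noteq> 1. finite_max K N x \<pp>) =
    real (idx \<O> (principal (of_nat D))) / real (idx \<O> A)"
proof -
  have Ai: "is_ideal A" unfolding A_def by (rule is_ideal_gen[OF D(2)])
  obtain j where j: "j \<le> N" "of_nat D * x j \<noteq> 0" using nz D(1) by auto
  have "of_nat D * x j \<in> A" unfolding A_def by (rule in_gen_ideal[OF j(1), of "\<lambda>i. of_nat D * x i"])
  then have A0: "A \<noteq> {0}" using j(2) by blast
  have P: "is_ideal (principal (of_nat D))" "principal (of_nat D) \<noteq> {0}"
    using D(1) by (intro is_ideal_principal principal_nonzero; simp)+
  define T where "T = {p \<in> finite_places K. ival p (principal (of_nat D)) \<noteq> 0} \<union> {p \<in> finite_places K. ival p A \<noteq> 0}"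
  have T: "finite T" "T \<subseteq> finite_places K" unfolding T_def using finite_ival[OF P] finite_ival[OF Ai A0] by auto
  have fm: "finite_max K N x p = real (idx \<O> p) ^ ival p (principal (of_nat D)) / real (idx \<O> p) ^ ival p A"
    if "p \<in> finite_places K" for p
    unfolding A_def by (rule finite_max_eq[OF that D nz])
  have "(\<Prod>\<pp> | \<pp> \<in> finite_places K \<and> finite_max K N x \<pp> \<noteq> 1. finite_max K N x \<pp>) = (\<Prod>p\<in>T. finite_max K N x p)"
  proof (rule prod.mono_neutral_left[OF T(1)])
    show "{\<pp> \<in> finite_places K. finite_max K N x \<pp> \<noteq> 1} \<subseteq> T"
    proof
      fix p assume "p \<in> {\<pp> \<in> finite_places K. finite_max K N x \<pp> \<noteq> 1}"
      then have p: "p \<in> finite_places K" "finite_max K N x p \<noteq> 1" by auto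
      have "ival p (principal (of_nat D)) \<noteq> 0 \<or> ival p A \<noteq> 0"
        using p(2) fm[OF p(1)] by (auto intro: ccontr)
      then show "p \<in> T" using p(1) unfolding T_def by blast
    qed
  qed (use T(2) in auto)
  also have "\<dots> = (\<Prod>p\<in>T. real (idx \<O> p ^ ival p (principal (of_nat D)))) / (\<Prod>p\<in>T. real (idx \<O> p ^ ival p A))"
    using fm T(2) by (simp add: prod_dividef[symmetric] subset_iff)
  also have "\<dots> = real (idx \<O> (principal (of_nat D))) / real (idx \<O> A)"
    using prod_ival[OF P T] prod_ival[OF Ai A0 T] by (simp add: T_def flip: of_nat_prod of_nat_power)
  finally show ?thesis .
qed

end

subsection \<open>Unimodular coordinates\<close>

definition arch_max :: "nat \<Rightarrow> (nat \<Rightarrow> complex) \<Rightarrow> (complex \<Rightarrow> complex) \<Rightarrow> real" where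
  "arch_max N x \<sigma> = Max ((\<lambda>i. cmod (\<sigma> (x i))) ` {..N})"

lemma arch_max_ge: "i \<le> N \<Longrightarrow> cmod (\<sigma> (x i)) \<le> arch_max N x \<sigma>"
  unfolding arch_max_def by (rule Max_ge) auto

lemma arch_max_nonneg: "arch_max N x \<sigma> \<ge> 0"
  using arch_max_ge[of 0 N \<sigma> x] norm_ge_zero[of "\<sigma> (x 0)"] by linarith

lemma arch_max_attained: "\<exists>i\<le>N. arch_max N x \<sigma> = cmod (\<sigma> (x i))"
proof -
  have "arch_max N x \<sigma> \<in> (\<lambda>i. cmod (\<sigma> (x i))) ` {..N}"
    unfolding arch_max_def by (rule Max_in) auto
  then show ?thesis by auto
qed

text \<open>For such coordinates the finite places contribute \<open>1\<close> to the height. In general they exist only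
  after a finite extension of the field, as the class number can exceed \<open>1\<close>.\<close>

definition unimodular :: "complex set \<Rightarrow> nat \<Rightarrow> (nat \<Rightarrow> complex) \<Rightarrow> bool" where
  "unimodular L N x \<longleftrightarrow> (\<forall>i\<le>N. x i \<in> ints_of L) \<and> (\<forall>i>N. x i = 0) \<and>
     (\<exists>o'. (\<forall>i\<le>N. o' i \<in> ints_of L) \<and> (\<Sum>i\<le>N. o' i * x i) = 1)"

definition arch_height :: "complex set \<Rightarrow> nat \<Rightarrow> (nat \<Rightarrow> complex) \<Rightarrow> real" where
  "arch_height L N x = (\<Prod>\<sigma>\<in>embeddings L. arch_max N x \<sigma>) powr (1 / real (field_degree L))"

lemma ints_of_mono: "K \<subseteq> L \<Longrightarrow> ints_of K \<subseteq> ints_of L"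
  by (auto simp: ints_of_def)

lemma unimodular_mono: "K \<subseteq> L \<Longrightarrow> unimodular K N x \<Longrightarrow> unimodular L N x"
  using ints_of_mono[of K L] unfolding unimodular_def by blast

lemma arch_height_extend:
  assumes K: "number_field K" and L: "number_field L" and KL: "K \<subseteq> L" and x: "\<And>i. i \<le> N \<Longrightarrow> x i \<in> K"
  shows "arch_height L N x = arch_height K N x"
proof -
  have "arch_max N x (restrict \<tau> K) = arch_max N x \<tau>" for \<tau>
    unfolding arch_max_def using x by (intro arg_cong[of _ _ Max] image_cong) auto
  then show ?thesis
    using prod_embeddings_extend[OF K L KL, of "arch_max N x"] arch_max_nonneg
    by (simp add: arch_height_def)
qed

context nfield
begin

lemma gen_ideal_eq_O: "unimodular K N x \<Longrightarrow> gen_ideal N x = \<O>"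
proof -
  assume u: "unimodular K N x"
  then have x: "\<And>i. i \<le> N \<Longrightarrow> x i \<in> \<O>" by (auto simp: unimodular_def)
  obtain o' where "\<forall>i\<le>N. o' i \<in> \<O>" "1 = (\<Sum>i\<le>N. o' i * x i)" using u unfolding unimodular_def by metis
  then have "1 \<in> gen_ideal N x" unfolding gen_ideal_def by blast
  then show ?thesis using ideal_1[OF is_ideal_gen[of N x, OF x]] by simp
qed

text \<open>Scaling by D multiplies the archimedean part by D^n, which is the index of D
  \<open>\<O>\<close> in the finite part. What remains is the index of the ideal of integral
  coordinates.\<close>

lemma field_height_ideal:
  assumes D: "D > 0" "\<And>i. i \<le> N \<Longrightarrow> of_nat D * x i \<in> \<O>" and x: "\<And>i. i \<le> N \<Longrightarrow> x i \<in> K"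
    and nz: "\<exists>i\<le>N. x i \<noteq> 0"
  shows "field_height K N x = (\<Prod>\<sigma>\<in>Emb. arch_max N (\<lambda>i. of_nat D * x i) \<sigma>) / real (idx \<O> (gen_ideal N (\<lambda>i. of_nat D * x i)))"
proof -
  have "arch_max N (\<lambda>i. of_nat D * x i) \<sigma> = real D * arch_max N x \<sigma>" if "\<sigma> \<in> Emb" for \<sigma>
  proof -
    interpret embedding K \<sigma> by unfold_locales fact
    have "(\<lambda>i. cmod (\<sigma> (of_nat D * x i))) ` {..N} = (*) (real D) ` (\<lambda>i. cmod (\<sigma> (x i))) ` {..N}"
      unfolding image_image using x by (intro image_cong) (auto simp: mult_hom norm_mult)
    then show ?thesis unfolding arch_max_def
      by (simp add: mono_Max_commute[symmetric] mono_def mult_left_mono)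
  qed
  then have "(\<Prod>\<sigma>\<in>Emb. arch_max N (\<lambda>i. of_nat D * x i) \<sigma>) = (\<Prod>\<sigma>\<in>Emb. real D * arch_max N x \<sigma>)"
    by (intro prod.cong refl)
  also have "\<dots> = real D ^ n * (\<Prod>\<sigma>\<in>Emb. arch_max N x \<sigma>)"
    by (simp add: prod.distrib card_Emb)
  finally have 1: "(\<Prod>\<sigma>\<in>Emb. arch_max N (\<lambda>i. of_nat D * x i) \<sigma>) = real D ^ n * (\<Prod>\<sigma>\<in>Emb. arch_max N x \<sigma>)" .
  have "real (idx \<O> (principal (of_nat D))) = real D ^ n"
    using idx_principal[of "of_nat D"] D(1) by (simp add: fnorm_of_nat[OF number_field] norm_power)
  moreover have "field_height K N x = (\<Prod>\<sigma>\<in>Emb. arch_max N x \<sigma>) *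
      (real (idx \<O> (principal (of_nat D))) / real (idx \<O> (gen_ideal N (\<lambda>i. of_nat D * x i))))"
    unfolding field_height_def arch_max_def by (subst finite_part[OF D nz]) simp_all
  ultimately show ?thesis unfolding 1 by simp
qed

lemma ipow_pow_mem: "is_ideal I \<Longrightarrow> a \<in> I \<Longrightarrow> a ^ k \<in> ipow I k"
proof (induction k)
  case (Suc k)
  then show ?case using iprodI[of "a ^ k" "ipow I k" a I] by (simp add: ipow_Suc mult.commute)
qed simp

end

text \<open>Values at \<open>x\<close> of forms of degree \<open>k\<close> with coefficients in \<open>R\<close>.\<close>

inductive is_form :: "'a::comm_ring_1 set \<Rightarrow> nat \<Rightarrow> (nat \<Rightarrow> 'a) \<Rightarrow> nat \<Rightarrow> 'a \<Rightarrow> bool" for R N x where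
  const: "a \<in> R \<Longrightarrow> is_form R N x 0 a"
| mult_var: "is_form R N x k f \<Longrightarrow> i \<le> N \<Longrightarrow> is_form R N x (Suc k) (f * x i)"
| add: "is_form R N x k f \<Longrightarrow> is_form R N x k g \<Longrightarrow> is_form R N x k (f + g)"

lemma is_form_mono: "is_form R N x k f \<Longrightarrow> R \<subseteq> R' \<Longrightarrow> is_form R' N x k f"
  by (induction rule: is_form.induct) (auto intro: is_form.intros)

lemma is_form_scale: "is_form R N x k f \<Longrightarrow> x = (\<lambda>i. c * y i) \<Longrightarrow> \<exists>g. is_form R N y k g \<and> f = c ^ k * g"
proof (induction rule: is_form.induct)
  case (const a)
  then show ?case by (intro exI[of _ a]) (auto intro: is_form.const)
next
  case (mult_var k f i)
  then obtain g where "is_form R N y k g" "f = c ^ k * g" by auto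
  then show ?case using mult_var is_form.mult_var[of R N y k g i] by (intro exI[of _ "g * y i"]) auto
next
  case (add k f g)
  then obtain f' g' where "is_form R N y k f'" "f = c ^ k * f'" "is_form R N y k g'" "g = c ^ k * g'" by auto
  then show ?case by (intro exI[of _ "f' + g'"]) (auto simp: distrib_left intro: is_form.add)
qed

context subring_set
begin

lemma is_form_mult: "is_form R N x k f \<Longrightarrow> a \<in> R \<Longrightarrow> is_form R N x k (a * f)"
proof (induction rule: is_form.induct)
  case (const b)
  then show ?case by (auto intro: is_form.const)
next
  case (mult_var k f i)
  then show ?case using is_form.mult_var[of R N x k "a * f" i] by (simp add: mult.assoc)
next
  case (add k f g)
  then show ?case by (simp add: distrib_left is_form.add)
qed

lemma is_form_0: "is_form R N x k 0"
proof (induction k)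
  case 0
  show ?case by (rule is_form.const) simp
next
  case (Suc k)
  from is_form.mult_var[OF this, of 0] show ?case by simp
qed

lemma is_form_sum: "(\<And>i. i \<in> A \<Longrightarrow> is_form R N x k (f i)) \<Longrightarrow> is_form R N x k (sum f A)"
  by (induction A rule: infinite_finite_induct) (auto simp: is_form_0 intro: is_form.add)

end

section \<open>Powers of the coordinate ideal and roots of their generators\<close>

context nfield
begin

text \<open>Elements of the k-th power are recorded as values of forms of degree k, because such
  values pick up exactly the factor l^k when the coordinates are multiplied by l.\<close>

lemma ipow_gen_forms:
  assumes x: "\<And>i. i \<le> N \<Longrightarrow> x i \<in> \<O>"
  shows "ipow (gen_ideal N x) k \<subseteq> {f. is_form \<O> N x k f}"
proof (induction k)
  case 0
  then show ?case by (auto intro: is_form.const)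
next
  case (Suc k)
  show ?case unfolding ipow_Suc
  proof (rule iprod_least)
    fix f g assume "f \<in> ipow (gen_ideal N x) k" "g \<in> gen_ideal N x"
    then obtain a where f: "is_form \<O> N x k f" and a: "\<forall>i\<le>N. a i \<in> \<O>" "g = (\<Sum>i\<le>N. a i * x i)"
      using Suc unfolding gen_ideal_def by blast
    have "f * g = (\<Sum>i\<le>N. (a i * f) * x i)" unfolding a(2) by (simp add: sum_distrib_left mult_ac)
    moreover have "is_form \<O> N x (Suc k) (\<Sum>i\<le>N. (a i * f) * x i)"
      using a(1) f by (intro Oint.is_form_sum is_form.mult_var Oint.is_form_mult) auto
    ultimately show "f * g \<in> {f. is_form \<O> N x (Suc k) f}" by simp
  qed (auto intro: is_form.add)
qed

lemma form_in_gen_ideal: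
  assumes x: "\<And>i. i \<le> N \<Longrightarrow> x i \<in> \<O>" and f: "is_form \<O> N x k f" and k: "k > 0"
  shows "f \<in> gen_ideal N x"
proof -
  note I = is_ideal_gen[of N x, OF x]
  have "f \<in> \<O> \<and> (k > 0 \<longrightarrow> f \<in> gen_ideal N x)"
    using f
  proof (induction rule: is_form.induct)
    case (mult_var k f i)
    have "f * x i \<in> gen_ideal N x"
      using is_idealD(3)[OF I _ in_gen_ideal[OF mult_var(2), of x]] mult_var(3) by auto
    then show ?case using is_idealD(1)[OF I] by auto
  qed (auto intro: ideal_add[OF I])
  then show ?thesis using k by blast
qed

end

text \<open>If the \<open>h\<close>-th power of the ideal of the coordinates is generated by \<open>c\<close>, then the coordinates
  divided by an \<open>h\<close>-th root of \<open>c\<close> are unimodular.\<close>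

definition ideal_root :: "complex set \<Rightarrow> nat \<Rightarrow> (nat \<Rightarrow> complex) \<Rightarrow> nat \<Rightarrow> complex \<Rightarrow> bool" where
  "ideal_root K N x h c \<longleftrightarrow> h > 0 \<and> c \<in> ints_of K \<and> c \<noteq> 0 \<and> (\<forall>i\<le>N. x i \<in> ints_of K \<and> x i ^ h / c \<in> ints_of K) \<and>
     is_form (ints_of K) N x h c"

context nfield
begin

lemma ex_ideal_root:
  assumes x: "\<And>i. i \<le> N \<Longrightarrow> x i \<in> \<O>" and nz: "\<exists>i\<le>N. x i \<noteq> 0"
  shows "\<exists>h c. ideal_root K N x h c \<and> real (idx \<O> (gen_ideal N x)) ^ h = cmod (Nm c)"
proof -
  let ?A = "gen_ideal N x"
  have A: "is_ideal ?A" by (rule is_ideal_gen[of N x, OF x])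
  obtain j where j: "j \<le> N" "x j \<noteq> 0" using nz by blast
  have A0: "?A \<noteq> {0}" using in_gen_ideal[OF j(1), of x] j(2) by blast
  obtain h c where hc: "h > 0" "c \<in> \<O>" "c \<noteq> 0" "ipow ?A h = principal c"
    using ideal_power_principal[OF A A0] by blast
  have "x i ^ h / c \<in> \<O>" if i: "i \<le> N" for i
  proof -
    have "x i ^ h \<in> principal c" using ipow_pow_mem[OF A in_gen_ideal[OF i, of x], of h] hc(4) by simp
    then show ?thesis using hc(3) by auto
  qed
  moreover have "is_form \<O> N x h c"
  proof -
    have "c * 1 \<in> ipow ?A h" unfolding hc(4) by blast
    then show ?thesis using ipow_gen_forms[of N x h, OF x] by auto
  qed
  ultimately have "ideal_root K N x h c" using hc x unfolding ideal_root_def by blast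
  moreover have "real (idx \<O> ?A) ^ h = cmod (Nm c)"
    using idx_ipow[OF A A0, of h] idx_principal[OF hc(2,3)] hc(4) by (metis of_nat_power)
  ultimately show ?thesis by blast
qed

text \<open>The powers y_i^h = x_i^h / c are integral, hence so are the y_i. The generator c is the
  value at x of a form of degree h; divided by l^h = c it becomes the value 1 at y, so the y_i
  generate the unit ideal.\<close>

lemma unimodular_if_root:
  assumes r: "ideal_root K N x h c" and l: "l \<in> K" "l ^ h = c" and y: "\<And>i. i \<le> N \<Longrightarrow> y i = x i / l" "\<And>i. i > N \<Longrightarrow> y i = 0"
    and x: "\<And>i. i > N \<Longrightarrow> x i = 0"
  shows "unimodular K N y"
proof -
  have h: "h > 0" "c \<noteq> 0" and xO: "\<And>i. i \<le> N \<Longrightarrow> x i \<in> \<O>" "\<And>i. i \<le> N \<Longrightarrow> x i ^ h / c \<in> \<O>"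
    and f: "is_form \<O> N x h c"
    using r by (auto simp: ideal_root_def)
  have l0: "l \<noteq> 0" using l(2) h by auto
  have yO: "y i \<in> \<O>" if "i \<le> N" for i
  proof -
    have yK: "y i \<in> K" using y(1)[OF that] l(1) xO(1)[OF that] OK by auto
    have "y i ^ h = x i ^ h / c" using y(1)[OF that] l(2) by (simp add: power_divide)
    then have "algebraic_int (y i ^ h)" using xO(2)[OF that] by (simp add: ints_of_def)
    moreover define p where "p = monom 1 h - [:y i ^ h:]"
    moreover have "coeff p j = (if j = h then 1 else 0) - (if j = 0 then y i ^ h else 0)" for j
      by (auto simp: p_def coeff_pCons split: nat.splits)
    moreover have "degree p = h"
    proof (rule antisym)
      show "degree p \<le> h" by (rule degree_le) (use calculation(3) h in auto)
      show "h \<le> degree p" by (rule le_degree) (use calculation(3) h in auto)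
    qed
    ultimately have "algebraic_int (y i)"
    proof (intro algebraic_int_monic_root[of p])
      assume a: "algebraic_int (y i ^ h)" "\<And>j. coeff p j = (if j = h then 1 else 0) - (if j = 0 then y i ^ h else 0)" "degree p = h"
      show "coeffs_in {z. algebraic_int z} p" unfolding coeffs_in_def a(2)
        using a(1) h(1) AI.neg[of "y i ^ h"] by auto
      show "lead_coeff p = 1" using a h(1) by simp
      show "poly p (y i) = 0" by (simp add: p_def poly_monom)
    qed
    then show ?thesis using yK by (simp add: ints_of_def)
  qed
  have xy: "x = (\<lambda>i. l * y i)"
  proof
    fix i show "x i = l * y i" using y x l0 by (cases "i \<le> N") auto
  qed
  obtain g where g: "is_form \<O> N y h g" "c = l ^ h * g" using is_form_scale[OF f xy] by blast
  then have "g = 1" using l(2) h(2) by simp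
  then have "1 \<in> gen_ideal N y"
    using form_in_gen_ideal[of N y h g, OF yO g(1) h(1)] by simp
  then show ?thesis using yO y(2) unfolding unimodular_def gen_ideal_def by auto
qed

text \<open>A prime above \<open>J\<close> would contain all y_i^h, then all y_i, then 1. Applied to
  J = {z. z * w is integral}, this proves a number \<open>w\<close> integral by testing it on the
  powers of the coordinates only.\<close>

lemma unimodular_powers:
  assumes u: "unimodular K N y" and J: "is_ideal J" and yJ: "\<And>i. i \<le> N \<Longrightarrow> y i ^ h \<in> J"
  shows "J = \<O>"
proof (rule ccontr)
  have yO: "\<And>i. i \<le> N \<Longrightarrow> y i \<in> \<O>" using u by (simp add: unimodular_def)
  assume "J \<noteq> \<O>"
  have "J \<noteq> {0}"
  proof
    assume "J = {0}"
    then have "y i = 0" if "i \<le> N" for i using yJ[OF that] by simp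
    then show False using u unfolding unimodular_def by auto
  qed
  then obtain p where p: "p \<in> finite_places K" "J \<subseteq> p" using ideal_below_prime[OF J _ \<open>J \<noteq> \<O>\<close>] by blast
  note P = finite_placesD[OF p(1)]
  have "y i \<in> p" if i: "i \<le> N" for i
  proof -
    have "y i ^ k \<in> p \<Longrightarrow> y i \<in> p" for k
    proof (induction k)
      case 0
      then show ?case using P(3) ideal_1[OF P(1)] by auto
    next
      case (Suc k)
      then show ?case using P(4)[of "y i" "y i ^ k"] yO[OF i] by auto
    qed
    then show ?thesis using yJ[OF i] p(2) by blast
  qed
  then have "gen_ideal N y \<subseteq> p" by (rule gen_ideal_least[OF P(1)])
  then show False using gen_ideal_eq_O[OF u] P(3) is_idealD(1)[OF P(1)] by auto
qed

text \<open>One quotient is integral as the value at y of an integral form. The other multiplies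
  each y_i^h to x_i^h / c, so \<open>unimodular_powers\<close> applies to its ideal of
  denominators.\<close>

lemma root_eq_unit:
  assumes r: "ideal_root K N x h c" and u: "unimodular K N y" and xy: "x = (\<lambda>i. l * y i)"
  shows "l ^ h / c \<in> \<O>" "c / l ^ h \<in> \<O>" "l \<noteq> 0"
proof -
  have h: "h > 0" "c \<noteq> 0" and xO: "\<And>i. i \<le> N \<Longrightarrow> x i \<in> \<O>" "\<And>i. i \<le> N \<Longrightarrow> x i ^ h / c \<in> \<O>"
    and f: "is_form \<O> N x h c"
    using r by (auto simp: ideal_root_def)
  have yO: "\<And>i. i \<le> N \<Longrightarrow> y i \<in> \<O>" using u by (simp add: unimodular_def)
  obtain g where g: "is_form \<O> N y h g" "c = l ^ h * g" using is_form_scale[OF f xy] by blast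
  show l0: "l \<noteq> 0" using g h by auto
  have "g \<in> \<O>" using form_in_gen_ideal[of N y h g, OF yO g(1) h(1)] is_idealD(1)[OF is_ideal_gen[of N y, OF yO]] by blast
  then show "c / l ^ h \<in> \<O>" using g(2) l0 by simp
  define w where "w = l ^ h / c"
  define J where "J = {z \<in> \<O>. z * w \<in> \<O>}"
  have J: "is_ideal J" unfolding is_ideal_def add_subgroup_def J_def
    by (auto simp: left_diff_distrib mult.assoc)
  have "y i ^ h \<in> J" if "i \<le> N" for i
  proof -
    have "y i ^ h * w = x i ^ h / c" by (simp add: w_def xy power_mult_distrib)
    then show ?thesis using xO(2)[OF that] yO[OF that] by (auto simp: J_def)
  qed
  then have "J = \<O>" by (rule unimodular_powers[OF u J])
  then have "1 \<in> J" by simp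
  then show "l ^ h / c \<in> \<O>" by (simp add: J_def w_def)
qed

lemma Nm_unit:
  assumes "u \<in> \<O>" "inverse u \<in> \<O>" "u \<noteq> 0"
  shows "cmod (Nm u) = 1"
proof -
  have "cmod (Nm u) \<ge> 1" "cmod (Nm (inverse u)) \<ge> 1" using assms Nm_ge_1 by auto
  moreover have "cmod (Nm u) * cmod (Nm (inverse u)) = 1"
    using Nm_mult[of u "inverse u"] assms OK Nm_1 by (simp add: norm_mult[symmetric])
  ultimately show ?thesis using mult_left_mono[of 1 "cmod (Nm (inverse u))" "cmod (Nm u)"] by simp
qed

end

lemma ideal_root_extend:
  assumes "K \<subseteq> L" "ideal_root K N x h c"
  shows "ideal_root L N x h c"
  using assms(2) ints_of_mono[OF assms(1)] is_form_mono[of "ints_of K" N x h c "ints_of L"]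
  unfolding ideal_root_def by blast

lemma arch_max_scale:
  assumes "embedding L \<tau>" "l \<in> L" "\<And>i. i \<le> N \<Longrightarrow> y i \<in> L"
  shows "arch_max N (\<lambda>i. l * y i) \<tau> = cmod (\<tau> l) * arch_max N y \<tau>"
proof -
  interpret embedding L \<tau> by fact
  have "(\<lambda>i. cmod (\<tau> (l * y i))) ` {..N} = (*) (cmod (\<tau> l)) ` (\<lambda>i. cmod (\<tau> (y i))) ` {..N}"
    unfolding image_image using assms by (intro image_cong) (auto simp: mult_hom norm_mult)
  then show ?thesis unfolding arch_max_def
    by (simp add: mono_Max_commute[symmetric] mono_def mult_left_mono)
qed

text \<open>The comparison is made for h-th powers. Over \<open>K\<close> the index of the
  coordinate ideal raised to h is the absolute norm of c, so the h-th power of the height is a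
  product over embeddings that extends to \<open>L\<close>. There c and m^h differ by a unit, whose
  norm has absolute value 1.\<close>

lemma field_height_eq_arch_height:
  assumes K: "number_field K" and L: "number_field L" and KL: "K \<subseteq> L"
    and x: "range x \<subseteq> K" "\<And>i. i > N \<Longrightarrow> x i = 0"
    and u: "unimodular L N y" and xy: "x = (\<lambda>i. l * y i)" and l: "l \<in> L" and nz: "\<exists>i\<le>N. x i \<noteq> 0"
  shows "field_height K N x powr (1 / real (field_degree K)) = arch_height L N y"
proof -
  interpret K: nfield K by unfold_locales fact
  interpret L: nfield L by unfold_locales fact
  have xK: "\<And>i. i \<le> N \<Longrightarrow> x i \<in> K" using x by auto
  obtain D :: nat where D: "D > 0" "\<And>z. z \<in> x ` {..N} \<Longrightarrow> of_nat D * z \<in> ints_of K"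
    using K.O_multiple[of "x ` {..N}"] x(1) by blast
  define z where "z = (\<lambda>i. of_nat D * x i)"
  have zO: "\<And>i. i \<le> N \<Longrightarrow> z i \<in> ints_of K" using D(2) by (auto simp: z_def)
  have znz: "\<exists>i\<le>N. z i \<noteq> 0" using nz D(1) by (auto simp: z_def)
  obtain h c where r: "ideal_root K N z h c" and idx: "real (idx (ints_of K) (K.gen_ideal N z)) ^ h = cmod (fnorm K c)"
    using K.ex_ideal_root[of N z, OF zO znz] by blast
  have h: "h > 0" "c \<in> ints_of K" "c \<noteq> 0" using r by (auto simp: ideal_root_def)
  define I where "I = real (idx (ints_of K) (K.gen_ideal N z))"
  have A: "K.is_ideal (K.gen_ideal N z)" by (rule K.is_ideal_gen[of N z, OF zO])
  have Ipos: "I > 0"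
  proof -
    obtain j where j: "j \<le> N" "z j \<noteq> 0" using znz by blast
    have "K.gen_ideal N z \<noteq> {0}" using K.in_gen_ideal[OF j(1), of z] j(2) by blast
    then show ?thesis using K.idx_ideal_pos[OF A] by (simp add: I_def)
  qed
  have fh: "field_height K N x = (\<Prod>\<sigma>\<in>embeddings K. arch_max N z \<sigma>) / I"
    unfolding I_def z_def using D by (intro K.field_height_ideal xK nz) auto
  have prod0: "(\<Prod>\<sigma>\<in>embeddings K. arch_max N z \<sigma>) \<ge> 0" by (intro prod_nonneg arch_max_nonneg)
  \<comment> \<open>Dividing by c itself keeps this factor defined over \<open>K\<close>; dividing
    by an h-th root of c would require the larger field.\<close>
  define G where "G = (\<lambda>\<sigma>. arch_max N z \<sigma> ^ h / cmod (\<sigma> c))"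
  have "field_height K N x ^ h = (\<Prod>\<sigma>\<in>embeddings K. arch_max N z \<sigma>) ^ h / cmod (fnorm K c)"
    unfolding fh power_divide using idx by (simp add: I_def)
  also have "\<dots> = (\<Prod>\<sigma>\<in>embeddings K. G \<sigma>)"
    by (simp add: G_def prod_dividef prod_power_distrib fnorm_def prod_norm)
  finally have fhh: "field_height K N x ^ h = (\<Prod>\<sigma>\<in>embeddings K. G \<sigma>)" .
  have G0: "G \<sigma> \<ge> 0" for \<sigma> unfolding G_def using arch_max_nonneg[of N z \<sigma>] by simp
  have Gr: "G (restrict \<tau> K) = G \<tau>" for \<tau>
  proof -
    have "arch_max N z (restrict \<tau> K) = arch_max N z \<tau>"
      unfolding arch_max_def using zO K.OK by (intro arg_cong[of _ _ Max] image_cong) auto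
    then show ?thesis using h(2) K.OK by (simp add: G_def)
  qed
  have e1: "(\<Prod>\<sigma>\<in>embeddings K. G \<sigma>) powr (1 / real (field_degree K)) = (\<Prod>\<tau>\<in>embeddings L. G \<tau>) powr (1 / real (field_degree L))"
    using prod_embeddings_extend[OF K L KL, of G] G0 Gr by simp
  define m where "m = of_nat D * l"
  have zy: "z = (\<lambda>i. m * y i)" by (simp add: z_def m_def xy mult.assoc)
  have mL: "m \<in> L" using l by (auto simp: m_def)
  have rL: "ideal_root L N z h c" by (rule ideal_root_extend[OF KL r])
  note un = L.root_eq_unit[OF rL u zy]
  have yL: "\<And>i. i \<le> N \<Longrightarrow> y i \<in> L" using u L.OK by (auto simp: unimodular_def)
  have cL: "c \<in> L" using h(2) KL K.OK by auto
  have "(\<Prod>\<tau>\<in>embeddings L. G \<tau>) = (\<Prod>\<tau>\<in>embeddings L. cmod (\<tau> (m ^ h / c)) * arch_max N y \<tau> ^ h)"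
  proof (rule prod.cong[OF refl])
    fix \<tau> assume t: "\<tau> \<in> embeddings L"
    interpret T: embedding L \<tau> by unfold_locales fact
    have "arch_max N z \<tau> = cmod (\<tau> m) * arch_max N y \<tau>"
      unfolding zy by (rule arch_max_scale[OF T.embedding_axioms mL yL])
    then show "G \<tau> = cmod (\<tau> (m ^ h / c)) * arch_max N y \<tau> ^ h"
      using mL cL h(3) by (simp add: G_def T.divide_hom T.power_hom L.power norm_divide norm_power power_mult_distrib)
  qed
  also have "\<dots> = cmod (fnorm L (m ^ h / c)) * (\<Prod>\<tau>\<in>embeddings L. arch_max N y \<tau>) ^ h"
    by (simp add: prod.distrib prod_norm fnorm_def prod_power_distrib)
  also have "cmod (fnorm L (m ^ h / c)) = 1"
    using un h(3) by (intro L.Nm_unit) auto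
  finally have e2: "(\<Prod>\<tau>\<in>embeddings L. G \<tau>) = (\<Prod>\<tau>\<in>embeddings L. arch_max N y \<tau>) ^ h" by simp
  have fh0: "field_height K N x \<ge> 0" unfolding fh using prod0 Ipos by simp
  have p0: "(\<Prod>\<tau>\<in>embeddings L. arch_max N y \<tau>) \<ge> 0" by (intro prod_nonneg arch_max_nonneg)
  have e3: "(X ^ h) powr a = (X powr a) ^ h" if "X \<ge> 0" for X a :: real
  proof (cases "X = 0")
    case True
    then show ?thesis using h(1) by (simp add: zero_power)
  next
    case False
    then show ?thesis using that by (simp add: powr_powr powr_realpow[symmetric] mult.commute)
  qed
  have "(field_height K N x powr (1 / real (field_degree K))) ^ h =
      (\<Prod>\<sigma>\<in>embeddings K. G \<sigma>) powr (1 / real (field_degree K))"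
    unfolding e3[OF fh0, symmetric] fhh ..
  also have "\<dots> = ((\<Prod>\<tau>\<in>embeddings L. arch_max N y \<tau>) ^ h) powr (1 / real (field_degree L))"
    unfolding e1 e2 ..
  also have "\<dots> = (arch_height L N y) ^ h"
    unfolding arch_height_def by (rule e3[OF p0])
  finally have "(field_height K N x powr (1 / real (field_degree K))) ^ h = (arch_height L N y) ^ h" .
  then show ?thesis by (rule power_eq_imp_eq_base[OF _ _ _ h(1)]) (simp_all add: arch_height_def)
qed

subsection \<open>Points of projective space\<close>

lemma proj_rel_equiv: "equiv (coord_vecs N) (proj_rel N)"
proof (rule equivI)
  show "proj_rel N \<subseteq> coord_vecs N \<times> coord_vecs N" by (auto simp: proj_rel_def)
  show "refl_on (coord_vecs N) (proj_rel N)"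
    by (rule refl_onI) (auto simp: proj_rel_def intro!: exI[of _ 1] rat_imp_algebraic)
  show "sym (proj_rel N)"
  proof (rule symI)
    fix x y assume "(x, y) \<in> proj_rel N"
    then obtain c where "x \<in> coord_vecs N" "y \<in> coord_vecs N" "algebraic c" "c \<noteq> 0" "y = (\<lambda>i. c * x i)"
      by (auto simp: proj_rel_def)
    then show "(y, x) \<in> proj_rel N"
      by (auto simp: proj_rel_def intro!: exI[of _ "inverse c"] algebraic_inverse)
  qed
  show "trans (proj_rel N)"
  proof (rule transI)
    fix x y z assume "(x, y) \<in> proj_rel N" "(y, z) \<in> proj_rel N"
    then obtain c d where "x \<in> coord_vecs N" "z \<in> coord_vecs N" "algebraic c" "c \<noteq> 0" "y = (\<lambda>i. c * x i)"
      "algebraic d" "d \<noteq> 0" "z = (\<lambda>i. d * y i)"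
      by (auto simp: proj_rel_def)
    then show "(x, z) \<in> proj_rel N" using AN.mult[of d c]
      by (auto simp: proj_rel_def intro!: exI[of _ "d * c"])
  qed
qed

lemma proj_space_coords:
  assumes P: "P \<in> proj_space N"
  shows "\<exists>x. x \<in> P" and "x \<in> P \<Longrightarrow> x \<in> coord_vecs N"
    and "x \<in> P \<Longrightarrow> P = proj_rel N `` {x}"
    and "x \<in> P \<Longrightarrow> y \<in> P \<Longrightarrow> \<exists>c. algebraic c \<and> c \<noteq> 0 \<and> y = (\<lambda>i. c * x i)"
proof -
  obtain z where z: "z \<in> coord_vecs N" "P = proj_rel N `` {z}" using P by (auto simp: proj_space_def elim: quotientE)
  show "\<exists>x. x \<in> P" using equiv_class_self[OF proj_rel_equiv z(1)] z(2) by auto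
  show xc: "x \<in> P \<Longrightarrow> x \<in> coord_vecs N" for x using z(2) by (auto simp: proj_rel_def)
  show PP: "x \<in> P \<Longrightarrow> P = proj_rel N `` {x}" for x
    using z(2) equiv_class_eq[OF proj_rel_equiv, of z x] by auto
  show "x \<in> P \<Longrightarrow> y \<in> P \<Longrightarrow> \<exists>c. algebraic c \<and> c \<noteq> 0 \<and> y = (\<lambda>i. c * x i)"
    using PP[of x] by (auto simp: proj_rel_def)
qed

lemma coord_vecs_scale:
  assumes "x \<in> coord_vecs N" "algebraic c" "c \<noteq> 0"
  shows "(\<lambda>i. c * x i) \<in> coord_vecs N" "(x, \<lambda>i. c * x i) \<in> proj_rel N"
  using assms AN.mult[of c] by (auto simp: coord_vecs_def proj_rel_def)

lemma coord_vecs_finite_range: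
  assumes "x \<in> coord_vecs N"
  shows "finite (range x)" "\<exists>i\<le>N. x i \<noteq> 0"
proof -
  have "range x \<subseteq> insert 0 (x ` {..N})"
  proof
    fix z assume "z \<in> range x"
    then obtain i where "z = x i" by auto
    then show "z \<in> insert 0 (x ` {..N})" using assms by (cases "i \<le> N") (auto simp: coord_vecs_def)
  qed
  then show "finite (range x)" by (meson finite_atMost finite_imageI finite_insert finite_subset)
  show "\<exists>i\<le>N. x i \<noteq> 0" using assms by (auto simp: coord_vecs_def) (meson not_le)
qed

text \<open>With D clearing denominators and c generating the h-th power of the ideal of the D x_i,
  the coordinates D x_i / m with m^h = c are unimodular over a field containing m. The set
  \<open>S\<close> lets that field contain prescribed numbers.\<close>

lemma ex_unimodular:
  assumes P: "P \<in> proj_space N" and x: "x \<in> P" and S: "finite S" "\<And>z. z \<in> S \<Longrightarrow> algebraic z"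
  shows "\<exists>L l y. number_field L \<and> S \<subseteq> L \<and> range x \<subseteq> L \<and> l \<in> L \<and> l \<noteq> 0 \<and> y \<in> P \<and> x = (\<lambda>i. l * y i) \<and> unimodular L N y"
proof -
  have xc: "x \<in> coord_vecs N" by (rule proj_space_coords(2)[OF P x])
  have fin: "finite (range x \<union> S)" using coord_vecs_finite_range(1)[OF xc] S by simp
  have alg: "algebraic z" if "z \<in> range x \<union> S" for z using that xc S by (auto simp: coord_vecs_def)
  obtain K where K: "number_field K" "range x \<union> S \<subseteq> K" using ex_number_field[OF fin alg] by blast
  interpret K: nfield K by unfold_locales fact
  obtain D :: nat where D: "D > 0" "\<And>z. z \<in> x ` {..N} \<Longrightarrow> of_nat D * z \<in> ints_of K"
    using K.O_multiple[of "x ` {..N}"] K(2) by blast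
  define z where "z = (\<lambda>i. of_nat D * x i)"
  have zO: "\<And>i. i \<le> N \<Longrightarrow> z i \<in> ints_of K" using D(2) by (auto simp: z_def)
  have x0: "\<And>i. i > N \<Longrightarrow> x i = 0" using xc by (auto simp: coord_vecs_def)
  have znz: "\<exists>i\<le>N. z i \<noteq> 0" using coord_vecs_finite_range(2)[OF xc] D(1) by (auto simp: z_def)
  obtain h c where r: "ideal_root K N z h c" using K.ex_ideal_root[of N z, OF zO znz] by blast
  have hc: "h > 0" "c \<in> ints_of K" "c \<noteq> 0" using r by (auto simp: ideal_root_def)
  obtain m where m: "m ^ h = c"
  proof -
    have "\<exists>m. poly (monom 1 h - [:c:]) m = 0"
    proof (rule fundamental_theorem_of_algebra_alt)
      show "\<not> (\<exists>a l. a \<noteq> 0 \<and> l = 0 \<and> monom 1 h - [:c:] = pCons a l)"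
      proof
        assume "\<exists>a l. a \<noteq> 0 \<and> l = 0 \<and> monom 1 h - [:c:] = pCons a l"
        then obtain a where "monom 1 h - [:c:] = [:a:]" by auto
        then have "coeff (monom 1 h - [:c:]) h = coeff [:a:] h" by simp
        then show False using hc(1) by (cases h) auto
      qed
    qed
    then show ?thesis using that by (auto simp: poly_monom)
  qed
  have cK: "c \<in> K" using hc(2) K.OK by simp
  have malg: "algebraic m"
  proof -
    define q where "q = monom 1 h - [:c:]"
    have cq: "coeff q j = (if j = h then 1 else 0) - (if j = 0 then c else 0)" for j
      by (auto simp: q_def coeff_pCons split: nat.splits)
    have "coeff q j \<in> {z. algebraic z}" for j unfolding cq
      using number_field_algebraic[OF K(1) cK] AN.neg[of c] AN.diff[of 1 c] AN.one by auto
    moreover have "coeff q h \<noteq> 0" using hc(1) by (simp add: cq)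
    moreover have "poly q m = 0" using m by (simp add: q_def poly_monom)
    ultimately show ?thesis by (intro algebraic_poly_root[of q]) (auto simp: coeffs_in_def)
  qed
  \<comment> \<open>Only finitely many numbers can be prescribed for the new field, so
    \<open>K\<close> is included through a primitive element.\<close>
  obtain \<theta> where th: "algebraic \<theta>" "K = Q_adjoin \<theta>" using number_field_primitive[OF K(1)] by blast
  obtain L where L: "number_field L" "{\<theta>, m} \<subseteq> L" using ex_number_field[of "{\<theta>, m}"] th malg by auto
  interpret L: nfield L by unfold_locales fact
  have KL: "K \<subseteq> L" unfolding th(2) by (rule Q_adjoin_subset[OF number_field_csubfield[OF L(1)]]) (use L in auto)
  have m0: "m \<noteq> 0" using m hc by auto
  define y where "y = (\<lambda>i. (of_nat D / m) * x i)"
  have "unimodular L N y"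
    by (rule L.unimodular_if_root[OF ideal_root_extend[OF KL r], of m])
      (use L m x0 in \<open>auto simp: y_def z_def\<close>)
  moreover have "y \<in> P"
  proof -
    have "algebraic (of_nat D / m)" using malg by (intro algebraic_divide) (auto intro: rat_imp_algebraic)
    then have "(x, y) \<in> proj_rel N" unfolding y_def using m0 D(1) by (intro coord_vecs_scale[OF xc]) auto
    then show ?thesis using proj_space_coords(3)[OF P x] by auto
  qed
  moreover have "x = (\<lambda>i. (m / of_nat D) * y i)" using m0 D(1) by (simp add: y_def)
  moreover have "m / of_nat D \<in> L" using L by auto
  ultimately show ?thesis using L KL K(2) m0 D(1)
    by (intro exI[of _ L] exI[of _ "m / of_nat D"] exI[of _ y]) auto
qed

theorem weil_height_unimodular:
  assumes P: "P \<in> proj_space N" and L: "number_field L" and y: "y \<in> P" "unimodular L N y"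
  shows "weil_height N P = arch_height L N y"
proof -
  have key: "h = arch_height L N y"
    if h: "x \<in> P" "number_field K" "range x \<subseteq> K" "h = field_height K N x powr (1 / real (field_degree K))" for h x K
  proof -
    have xc: "x \<in> coord_vecs N" by (rule proj_space_coords(2)[OF P h(1)])
    obtain c where c: "algebraic c" "c \<noteq> 0" "x = (\<lambda>i. c * y i)" using proj_space_coords(4)[OF P y(1) h(1)] by blast
    obtain a where a: "algebraic a" "K = Q_adjoin a" using number_field_primitive[OF h(2)] by blast
    obtain b where b: "algebraic b" "L = Q_adjoin b" using number_field_primitive[OF L] by blast
    obtain M where M: "number_field M" "{a, b, c} \<subseteq> M" using ex_number_field[of "{a,b,c}"] a b c by auto
    have KM: "K \<subseteq> M" unfolding a(2) by (rule Q_adjoin_subset[OF number_field_csubfield[OF M(1)]]) (use M in auto)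
    have LM: "L \<subseteq> M" unfolding b(2) by (rule Q_adjoin_subset[OF number_field_csubfield[OF M(1)]]) (use M in auto)
    have "h = arch_height M N y" unfolding h(4)
    proof (rule field_height_eq_arch_height[OF h(2) M(1) KM h(3)])
      show "x i = 0" if "i > N" for i using that xc by (auto simp: coord_vecs_def)
      show "\<exists>i\<le>N. x i \<noteq> 0" by (rule coord_vecs_finite_range(2)[OF xc])
    qed (use unimodular_mono[OF LM y(2)] c M in auto)
    also have "\<dots> = arch_height L N y"
      by (rule arch_height_extend[OF L M(1) LM]) (use y(2) in \<open>auto simp: unimodular_def ints_of_def\<close>)
    finally show ?thesis .
  qed
  obtain x where x: "x \<in> P" using proj_space_coords(1)[OF P] by blast
  obtain M where M: "number_field M" "range x \<subseteq> M" using ex_unimodular[OF P x, of "{}"] by auto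
  \<comment> \<open>The choice operator says something only if a number field containing some
    coordinate vector exists.\<close>
  have "\<exists>h. \<exists>x\<in>P. \<exists>K. number_field K \<and> range x \<subseteq> K \<and> h = field_height K N x powr (1 / real (field_degree K))"
    using x M by blast
  from someI_ex[OF this] show ?thesis unfolding weil_height_def[symmetric] using key by blast
qed

subsection \<open>The weak Nullstellensatz over the algebraic numbers\<close>

text \<open>Polynomials over the algebraic numbers are represented by functions on sequences:
  substitution becomes composition, and identities are checked pointwise.\<close>

inductive poly_fun :: "nat \<Rightarrow> ((nat \<Rightarrow> complex) \<Rightarrow> complex) \<Rightarrow> bool" for n where
  const: "algebraic c \<Longrightarrow> poly_fun n (\<lambda>x. c)"
| var: "i < n \<Longrightarrow> poly_fun n (\<lambda>x. x i)"
| add: "poly_fun n f \<Longrightarrow> poly_fun n g \<Longrightarrow> poly_fun n (\<lambda>x. f x + g x)"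
| mult: "poly_fun n f \<Longrightarrow> poly_fun n g \<Longrightarrow> poly_fun n (\<lambda>x. f x * g x)"

lemma poly_fun_sum: "(\<And>i. i \<in> A \<Longrightarrow> poly_fun n (f i)) \<Longrightarrow> poly_fun n (\<lambda>x. \<Sum>i\<in>A. f i x)"
  by (induction A rule: infinite_finite_induct) (auto intro: poly_fun.intros)

lemma poly_fun_prod: "(\<And>i. i \<in> A \<Longrightarrow> poly_fun n (f i)) \<Longrightarrow> poly_fun n (\<lambda>x. \<Prod>i\<in>A. f i x)"
  by (induction A rule: infinite_finite_induct) (auto intro: poly_fun.intros rat_imp_algebraic)

lemma poly_fun_power: "poly_fun n f \<Longrightarrow> poly_fun n (\<lambda>x. f x ^ k)"
  by (induction k) (auto intro: poly_fun.intros rat_imp_algebraic)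

lemma poly_fun_cmult: "algebraic c \<Longrightarrow> poly_fun n f \<Longrightarrow> poly_fun n (\<lambda>x. c * f x)"
  by (rule poly_fun.mult[OF poly_fun.const])

lemma poly_fun_diff: "poly_fun n f \<Longrightarrow> poly_fun n g \<Longrightarrow> poly_fun n (\<lambda>x. f x - g x)"
  using poly_fun.add[OF _ poly_fun_cmult[of "-1" n g], of f] by (simp add: rat_imp_algebraic)

lemma poly_fun_mono: "poly_fun n f \<Longrightarrow> n \<le> m \<Longrightarrow> poly_fun m f"
  by (induction rule: poly_fun.induct) (auto intro: poly_fun.intros)

lemma poly_fun_cong: "poly_fun n f \<Longrightarrow> (\<And>i. i < n \<Longrightarrow> x i = y i) \<Longrightarrow> f x = f y"
  by (induction rule: poly_fun.induct) auto

lemma poly_fun_algebraic: "poly_fun n f \<Longrightarrow> (\<And>i. i < n \<Longrightarrow> algebraic (x i)) \<Longrightarrow> algebraic (f x)"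
  by (induction rule: poly_fun.induct) (auto intro: AN.add[simplified] AN.mult[simplified])

lemma poly_fun_compose:
  "poly_fun n f \<Longrightarrow> (\<And>i. i < n \<Longrightarrow> poly_fun m (\<lambda>x. T x i)) \<Longrightarrow> poly_fun m (\<lambda>x. f (T x))"
  by (induction rule: poly_fun.induct) (auto intro: poly_fun.intros)

text \<open>Polynomials in one further variable whose coefficients are polynomial functions of the
  first n coordinates. The uniform degree bound is what makes the evaluated family a polynomial
  function again.\<close>

definition poly_family :: "nat \<Rightarrow> ((nat \<Rightarrow> complex) \<Rightarrow> complex poly) \<Rightarrow> bool" where
  "poly_family n p \<longleftrightarrow> (\<forall>k. poly_fun n (\<lambda>x. coeff (p x) k)) \<and> (\<exists>d. \<forall>x. degree (p x) \<le> d)"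

lemma poly_family_const: "coeffs_in {z. algebraic z} q \<Longrightarrow> poly_family n (\<lambda>x. q)"
  unfolding poly_family_def coeffs_in_def by (auto intro: poly_fun.const)

lemma poly_family_add: "poly_family n p \<Longrightarrow> poly_family n q \<Longrightarrow> poly_family n (\<lambda>x. p x + q x)"
  unfolding poly_family_def
proof (elim conjE exE, intro conjI allI)
  fix d e assume "\<forall>x. degree (p x) \<le> d" "\<forall>x. degree (q x) \<le> e"
  then show "\<exists>d. \<forall>x. degree (p x + q x) \<le> d"
    by (intro exI[of _ "max d e"] allI degree_add_le) (auto intro: le_max_iff_disj[THEN iffD2])
qed (auto intro: poly_fun.add)

lemma poly_family_mult: "poly_family n p \<Longrightarrow> poly_family n q \<Longrightarrow> poly_family n (\<lambda>x. p x * q x)"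
  unfolding poly_family_def
proof (elim conjE exE, intro conjI allI)
  fix d e assume "\<forall>x. degree (p x) \<le> d" "\<forall>x. degree (q x) \<le> e"
  then show "\<exists>d. \<forall>x. degree (p x * q x) \<le> d"
    by (intro exI[of _ "d + e"] allI order_trans[OF degree_mult_le] add_mono) auto
qed (auto simp: coeff_mult intro!: poly_fun_sum poly_fun.mult)

lemma poly_family_monom: "poly_fun n c \<Longrightarrow> poly_family n (\<lambda>x. monom (c x) k)"
  unfolding poly_family_def
proof (intro conjI allI exI)
  fix j assume "poly_fun n c"
  then show "poly_fun n (\<lambda>x. coeff (monom (c x) k) j)" by (cases "j = k") (auto intro: poly_fun.const)
qed (rule degree_monom_le)

lemma poly_family_diff: "poly_family n p \<Longrightarrow> poly_family n q \<Longrightarrow> poly_family n (\<lambda>x. p x - q x)"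
  using poly_family_add[OF _ poly_family_mult[OF poly_family_const[of "[:-1:]"]], of n p q]
  by (simp add: AN.coeffs_in_pCons rat_imp_algebraic)

lemma poly_fun_Suc: "poly_fun (Suc n) f \<Longrightarrow> \<exists>p. poly_family n p \<and> f = (\<lambda>x. poly (p x) (x n))"
proof (induction rule: poly_fun.induct)
  case (const c)
  then show ?case by (intro exI[of _ "\<lambda>x. [:c:]"]) (auto intro!: poly_family_const simp: AN.coeffs_in_pCons)
next
  case (var i)
  show ?case
  proof (cases "i = n")
    case True
    then show ?thesis
      by (intro exI[of _ "\<lambda>x. [:0,1:]"]) (auto intro!: poly_family_const simp: AN.coeffs_in_pCons rat_imp_algebraic)
  next
    case False
    then have "poly_fun n (\<lambda>x. x i)" using var by (intro poly_fun.var) auto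
    then show ?thesis using poly_family_monom[of n "\<lambda>x. x i" 0]
      by (intro exI[of _ "\<lambda>x. monom (x i) 0"]) (auto simp: monom_0)
  qed
next
  case (add f g)
  then obtain p q where "poly_family n p" "f = (\<lambda>x. poly (p x) (x n))" "poly_family n q" "g = (\<lambda>x. poly (q x) (x n))" by blast
  then show ?case by (intro exI[of _ "\<lambda>x. p x + q x"]) (auto intro: poly_family_add)
next
  case (mult f g)
  then obtain p q where "poly_family n p" "f = (\<lambda>x. poly (p x) (x n))" "poly_family n q" "g = (\<lambda>x. poly (q x) (x n))" by blast
  then show ?case by (intro exI[of _ "\<lambda>x. p x * q x"]) (auto intro: poly_family_mult)
qed

lemma poly_family_poly_fun:
  assumes "poly_family n p"
  shows "poly_fun (Suc n) (\<lambda>x. poly (p x) (x n))"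
proof -
  obtain d where d: "\<And>x. degree (p x) \<le> d" using assms by (auto simp: poly_family_def)
  have "poly (p x) (x n) = (\<Sum>k\<le>d. coeff (p x) k * x n ^ k)" for x
    unfolding poly_altdef using d[of x] by (intro sum.mono_neutral_left) (auto simp: coeff_eq_0 not_le)
  moreover have "poly_fun (Suc n) (\<lambda>x. \<Sum>k\<le>d. coeff (p x) k * x n ^ k)"
    using assms by (intro poly_fun_sum poly_fun.mult poly_fun_power poly_fun.var)
      (auto simp: poly_family_def intro: poly_fun_mono)
  ultimately show ?thesis by simp
qed

lemma poly_family_cong: "poly_family n p \<Longrightarrow> (\<And>i. i < n \<Longrightarrow> x i = y i) \<Longrightarrow> p x = p y"
  by (intro poly_eqI) (auto simp: poly_family_def intro: poly_fun_cong)

text \<open>The divisor is monic of constant degree, so one division scheme works for all x at once.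
  Remainders are described by vanishing coefficients, which also covers D = 0 and the zero
  remainder.\<close>

lemma poly_family_division:
  assumes G: "poly_family n G" "\<And>x. degree (G x) = D" "\<And>x. coeff (G x) D = 1" and p: "poly_family n p"
  shows "\<exists>q r. poly_family n q \<and> poly_family n r \<and> (\<forall>x. p x = q x * G x + r x) \<and> (\<forall>x. \<forall>k\<ge>D. coeff (r x) k = 0)"
proof -
  obtain d where "\<forall>x. \<forall>k\<ge>d. coeff (p x) k = 0"
    using p unfolding poly_family_def by (metis coeff_eq_0 less_eq_Suc_le order_le_less_trans)
  then show ?thesis using p
  proof (induction d arbitrary: p)
    case 0
    then show ?case using poly_family_const[of 0 n]
      by (intro exI[of _ "\<lambda>x. 0"] exI[of _ p]) auto
  next
    case (Suc d)
    show ?case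
    proof (cases "d < D")
      case True
      then show ?thesis using Suc.prems poly_family_const[of 0 n]
        by (intro exI[of _ "\<lambda>x. 0"] exI[of _ p]) auto
    next
      case False
      define m where "m = (\<lambda>x. monom (coeff (p x) d) (d - D))"
      have m: "poly_family n m" unfolding m_def
        using Suc.prems(2) by (intro poly_family_monom) (auto simp: poly_family_def)
      have "coeff (p x - m x * G x) k = 0" if "k \<ge> d" for x k
      proof (cases "k = d")
        case True
        then show ?thesis using False G(3)[of x] by (simp add: m_def coeff_monom_mult)
      next
        case k: False
        then have "coeff (G x) (k - (d - D)) = 0" using that False G(2)[of x] by (intro coeff_eq_0) auto
        then show ?thesis using k that False Suc.prems(1) by (simp add: m_def coeff_monom_mult)
      qed
      then obtain q r where qr: "poly_family n q" "poly_family n r" "\<forall>x. p x - m x * G x = q x * G x + r x"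
        "\<forall>x. \<forall>k\<ge>D. coeff (r x) k = 0"
        using Suc.IH[of "\<lambda>x. p x - m x * G x"] poly_family_diff[OF Suc.prems(2) poly_family_mult[OF m G(1)]] by blast
      have "\<forall>x. p x = (q x + m x) * G x + r x"
        using qr(3) by (simp add: algebra_simps)
      then show ?thesis using qr poly_family_add[OF qr(1) m]
        by (intro exI[of _ "\<lambda>x. q x + m x"] exI[of _ r]) blast
    qed
  qed
qed

lemma poly_fun_det:
  assumes "\<And>i j. i < m \<Longrightarrow> j < m \<Longrightarrow> poly_fun n (\<lambda>x. A x $$ (i,j))" "\<And>x. A x \<in> carrier_mat m m"
  shows "poly_fun n (\<lambda>x. det (A x))"
  unfolding det_def'[OF assms(2)]
  by (intro poly_fun_sum poly_fun_cmult poly_fun_prod assms(1))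
    (auto simp: sign_def permutes_in_image rat_imp_algebraic)

text \<open>Coordinates are replaced one at a time: in a single coordinate the function is a nonzero
  polynomial with finitely many zeros. Positive integers make the point algebraic and its last
  coordinate invertible, as the shear in \<open>weak_nullstellensatz\<close> requires.\<close>

lemma poly_fun_nonzero_point:
  assumes "poly_fun n f" "f \<noteq> (\<lambda>x. 0)"
  shows "\<exists>x. f x \<noteq> 0 \<and> (\<forall>i<n. \<exists>k::nat. k > 0 \<and> x i = of_nat k)"
proof -
  obtain y where y: "f y \<noteq> 0" using assms(2) by auto
  have "\<exists>x. f x \<noteq> 0 \<and> (\<forall>i<m. \<exists>k::nat. k > 0 \<and> x i = of_nat k)" if "m \<le> n" for m
    using that
  proof (induction m)
    case 0
    then show ?case using y by auto
  next
    case (Suc m)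
    then obtain x where x: "f x \<noteq> 0" "\<forall>i<m. \<exists>k::nat. k > 0 \<and> x i = of_nat k" by auto
    have "\<exists>p. \<forall>t. f (x(m := t)) = poly p t"
      using assms(1)
    proof (induction rule: poly_fun.induct)
      case (const c)
      then show ?case by (intro exI[of _ "[:c:]"]) auto
    next
      case (var i)
      then show ?case by (intro exI[of _ "if i = m then [:0,1:] else [:x i:]"]) auto
    next
      case (add f g)
      then show ?case by (metis poly_add)
    next
      case (mult f g)
      then show ?case by (metis poly_mult)
    qed
    then obtain p where p: "\<And>t. f (x(m := t)) = poly p t" by blast
    have "p \<noteq> 0" using p[of "x m"] x(1) by auto
    then have "finite {t. poly p t = 0}" by (rule poly_roots_finite)
    moreover have "infinite ((of_nat :: nat \<Rightarrow> complex) ` {0<..})"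
      using finite_imageD[of "of_nat :: nat \<Rightarrow> complex" "{0<..}"] infinite_Ioi by (auto simp: inj_on_def)
    ultimately obtain k :: nat where k: "k > 0" "poly p (of_nat k) \<noteq> 0"
      by (metis (mono_tags, lifting) finite_subset greaterThan_iff image_subset_iff mem_Collect_eq)
    then have "f (x(m := of_nat k)) \<noteq> 0" using p[of "of_nat k"] by (simp only: not_False_eq_True)
    then show ?case using k(1) x(2) by (intro exI[of _ "x(m := of_nat k)"]) (auto simp: less_Suc_eq simp del: fun_upd_apply, auto)
  qed
  then show ?thesis by blast
qed

text \<open>Forms of degree k as functions. The coefficient set is a parameter because it is
  narrowed later from the algebraic numbers to algebraic integers and then to a finite set.\<close>

inductive form_fun :: "complex set \<Rightarrow> nat \<Rightarrow> nat \<Rightarrow> ((nat \<Rightarrow> complex) \<Rightarrow> complex) \<Rightarrow> bool" for R n where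
  const: "c \<in> R \<Longrightarrow> form_fun R n 0 (\<lambda>x. c)"
| mult_var: "form_fun R n k f \<Longrightarrow> i < n \<Longrightarrow> form_fun R n (Suc k) (\<lambda>x. x i * f x)"
| add: "form_fun R n k f \<Longrightarrow> form_fun R n k g \<Longrightarrow> form_fun R n k (\<lambda>x. f x + g x)"

abbreviation "\<A> \<equiv> {z::complex. algebraic z}"

lemma form_fun_mono: "form_fun R n k f \<Longrightarrow> R \<subseteq> R' \<Longrightarrow> form_fun R' n k f"
  by (induction rule: form_fun.induct) (auto intro: form_fun.intros)

lemma form_fun_poly_fun: "form_fun \<A> n k f \<Longrightarrow> poly_fun n f"
  by (induction rule: form_fun.induct) (auto intro: poly_fun.intros)

lemma form_fun_homogeneous: "form_fun R n k f \<Longrightarrow> f (\<lambda>i. c * x i) = c ^ k * f x"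
  by (induction rule: form_fun.induct) (auto simp: algebra_simps)

lemma form_fun_cmult: "form_fun R n k f \<Longrightarrow> subring_set R \<Longrightarrow> a \<in> R \<Longrightarrow> form_fun R n k (\<lambda>x. a * f x)"
proof (induction rule: form_fun.induct)
  case (const c)
  then show ?case by (intro form_fun.const subring_set.mult)
next
  case (mult_var k f i)
  then show ?case using form_fun.mult_var[of R n k "\<lambda>x. a * f x" i] by (simp add: mult.left_commute)
next
  case (add k f g)
  then show ?case using form_fun.add[of R n k "\<lambda>x. a * f x" "\<lambda>x. a * g x"] by (simp add: distrib_left)
qed

lemma form_fun_mult: "form_fun R n k f \<Longrightarrow> subring_set R \<Longrightarrow> form_fun R n l g \<Longrightarrow> form_fun R n (k + l) (\<lambda>x. f x * g x)"
proof (induction rule: form_fun.induct)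
  case (const c)
  then show ?case using form_fun_cmult by auto
next
  case (mult_var k f i)
  then show ?case using form_fun.mult_var[of R n "k + l" "\<lambda>x. f x * g x" i] by (simp add: mult.assoc)
next
  case (add k f h)
  then show ?case using form_fun.add[of R n "k + l" "\<lambda>x. f x * g x" "\<lambda>x. h x * g x"] by (simp add: distrib_right)
qed

lemma form_fun_0: assumes "subring_set R" "0 < n" shows "form_fun R n k (\<lambda>x. 0)"
proof (induction k)
  case 0
  interpret subring_set R by fact
  show ?case by (rule form_fun.const) simp
next
  case (Suc k)
  from form_fun.mult_var[OF this assms(2)] show ?case by simp
qed

lemma form_fun_sum:
  assumes "subring_set R" "0 < n" "\<And>i. i \<in> A \<Longrightarrow> form_fun R n k (f i)"
  shows "form_fun R n k (\<lambda>x. \<Sum>i\<in>A. f i x)"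
  using assms(3)
  by (induction A rule: infinite_finite_induct) (auto simp: form_fun_0[OF assms(1,2)] intro: form_fun.add)

lemma form_fun_var_power:
  assumes "subring_set R" "i < n"
  shows "form_fun R n k (\<lambda>x. x i ^ k)"
proof (induction k)
  case 0
  interpret subring_set R by fact
  show ?case using form_fun.const[of 1 R n] by simp
next
  case (Suc k)
  from form_fun.mult_var[OF this assms(2)] show ?case by simp
qed

lemma poly_fun_forms:
  assumes n: "0 < n" and f: "poly_fun n f"
  shows "\<exists>D g. (\<forall>k. form_fun \<A> n k (g k)) \<and> (\<forall>k\<ge>D. g k = (\<lambda>x. 0)) \<and> f = (\<lambda>x. \<Sum>k<D. g k x)"
  using f
proof (induction rule: poly_fun.induct)
  case (const c)
  then show ?case using form_fun_0[OF subring_algebraic n]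
    by (intro exI[of _ 1] exI[of _ "\<lambda>k x. if k = 0 then c else 0"]) (auto intro!: form_fun.const)
next
  case (var i)
  have "form_fun \<A> n 1 (\<lambda>x. x i)" using form_fun_var_power[OF subring_algebraic var, of 1] by simp
  then have "form_fun \<A> n k (\<lambda>x. if k = 1 then x i else 0)" for k
    using form_fun_0[OF subring_algebraic n, of k] by (cases "k = 1") auto
  then show ?case
    by (intro exI[of _ 2] exI[of _ "\<lambda>k x. if k = 1 then x i else 0"]) (auto simp: numeral_2_eq_2)
next
  case (add f f')
  then obtain D g D' g' where g: "\<forall>k. form_fun \<A> n k (g k)" "\<forall>k\<ge>D. g k = (\<lambda>x. 0)" "f = (\<lambda>x. \<Sum>k<D. g k x)"
    "\<forall>k. form_fun \<A> n k (g' k)" "\<forall>k\<ge>D'. g' k = (\<lambda>x. 0)" "f' = (\<lambda>x. \<Sum>k<D'. g' k x)" by blast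
  have "f x + f' x = (\<Sum>k<max D D'. g k x + g' k x)" for x
  proof -
    have 0: "g k x = 0" if "\<not> k < D" for k using g(2) that by simp
    have 1: "g' k x = 0" if "\<not> k < D'" for k using g(5) that by simp
    have "f x = (\<Sum>k<max D D'. g k x)" unfolding g(3) using 0 by (intro sum.mono_neutral_left) auto
    moreover have "f' x = (\<Sum>k<max D D'. g' k x)" unfolding g(6) using 1 by (intro sum.mono_neutral_left) auto
    ultimately show ?thesis by (simp add: sum.distrib)
  qed
  then show ?case using g form_fun.add
    by (intro exI[of _ "max D D'"] exI[of _ "\<lambda>k x. g k x + g' k x"]) auto
next
  case (mult f f')
  then obtain D g D' g' where g: "\<forall>k. form_fun \<A> n k (g k)" "\<forall>k\<ge>D. g k = (\<lambda>x. 0)" "f = (\<lambda>x. \<Sum>k<D. g k x)"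
    "\<forall>k. form_fun \<A> n k (g' k)" "\<forall>k\<ge>D'. g' k = (\<lambda>x. 0)" "f' = (\<lambda>x. \<Sum>k<D'. g' k x)" by blast
  define h where "h = (\<lambda>k x. \<Sum>i\<le>k. g i x * g' (k - i) x)"
  have h: "form_fun \<A> n k (h k)" for k unfolding h_def
  proof (rule form_fun_sum[OF subring_algebraic n])
    fix i assume "i \<in> {..k}"
    then show "form_fun \<A> n k (\<lambda>x. g i x * g' (k - i) x)"
      using form_fun_mult[OF g(1)[rule_format, of i] subring_algebraic g(4)[rule_format, of "k - i"]] by simp
  qed
  have "f x * f' x = (\<Sum>k<D + D'. h k x)" for x
  proof -
    \<comment> \<open>Auxiliary polynomials that carry the values of the components as coefficients:
      evaluating their product at 1 yields the Cauchy product of the components.\<close>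
    define p where "p = (\<Sum>k<D. monom (g k x) k)"
    define q where "q = (\<Sum>k<D'. monom (g' k x) k)"
    have cp: "coeff p k = g k x" for k
      using g(2) by (auto simp: p_def coeff_sum sum.delta' cong: if_cong)
    have cq: "coeff q k = g' k x" for k
      using g(5) by (auto simp: q_def coeff_sum sum.delta' cong: if_cong)
    have "f x = poly p 1" "f' x = poly q 1" by (simp_all add: g(3,6) p_def q_def poly_sum poly_monom)
    then have "f x * f' x = poly (p * q) 1" by simp
    also have "\<dots> = (\<Sum>k\<le>degree (p * q). coeff (p * q) k)" by (simp add: poly_altdef)
    also have "\<dots> = (\<Sum>k<D + D'. coeff (p * q) k)"
    proof -
      have z: "coeff (p * q) k = 0" if "k \<ge> D + D'" for k
      proof -
        have "g i x * g' (k - i) x = 0" if "i \<le> k" for i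
          using g(2,5) \<open>k \<ge> D + D'\<close> that by (cases "i \<ge> D") auto
        then show ?thesis unfolding coeff_mult cp cq by (intro sum.neutral) simp
      qed
      have "(\<Sum>k\<le>degree (p * q). coeff (p * q) k) = (\<Sum>k<max (Suc (degree (p * q))) (D + D'). coeff (p * q) k)"
        by (intro sum.mono_neutral_left) (auto simp: coeff_eq_0)
      also have "\<dots> = (\<Sum>k<D + D'. coeff (p * q) k)"
        by (intro sum.mono_neutral_right) (auto simp: z)
      finally show ?thesis .
    qed
    also have "\<dots> = (\<Sum>k<D + D'. h k x)" by (simp add: coeff_mult cp cq h_def)
    finally show ?thesis .
  qed
  moreover have "h k = (\<lambda>x. 0)" if "k \<ge> D + D'" for k
  proof
    fix x
    have "g i x * g' (k - i) x = 0" if "i \<le> k" for i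
      using g(2,5) \<open>k \<ge> D + D'\<close> that by (cases "i \<ge> D") auto
    then show "h k x = 0" unfolding h_def by (intro sum.neutral) simp
  qed
  ultimately show ?case using h by (intro exI[of _ "D + D'"] exI[of _ h]) auto
qed

text \<open>Along a line with direction v only v contributes to the highest power of the parameter.
  A direction with f v \<noteq> 0 therefore gives degree exactly k with a leading coefficient
  independent of x.\<close>

lemma form_fun_line:
  assumes "form_fun \<A> n k f" "\<And>i. algebraic (v i)"
  shows "\<exists>p. poly_family n p \<and> (\<forall>x. \<forall>j>k. coeff (p x) j = 0) \<and> (\<forall>x. coeff (p x) k = f v) \<and>
     (\<forall>x s. f (\<lambda>i. x i + s * v i) = poly (p x) s)"
  using assms(1)
proof (induction rule: form_fun.induct)
  case (const c)
  then show ?case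
    by (intro exI[of _ "\<lambda>x. [:c:]"]) (auto intro!: poly_family_const simp: AN.coeffs_in_pCons coeff_pCons split: nat.splits)
next
  case (mult_var k f i)
  then obtain p where p: "poly_family n p" "\<forall>x. \<forall>j>k. coeff (p x) j = 0" "\<forall>x. coeff (p x) k = f v"
    "\<forall>x s. f (\<lambda>i. x i + s * v i) = poly (p x) s" by blast
  have l: "poly_family n (\<lambda>x. monom (x i) 0 + monom (v i) 1)"
    using mult_var(2) assms(2)[of i] by (intro poly_family_add poly_family_monom poly_fun.var poly_fun.const)
  have c: "coeff ((monom (x i) 0 + monom (v i) 1) * p x) j = x i * coeff (p x) j + (if j = 0 then 0 else v i * coeff (p x) (j - 1))" for x j
    by (simp add: distrib_right coeff_monom_mult)
  define P where "P = (\<lambda>x. (monom (x i) 0 + monom (v i) 1) * p x)"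
  have "coeff (P x) j = 0" if "j > Suc k" for x j
    using p(2)[rule_format, of j x] p(2)[rule_format, of "j - 1" x] that unfolding P_def c by simp
  moreover have "coeff (P x) (Suc k) = v i * f v" for x
    using p(2)[rule_format, of "Suc k" x] p(3) unfolding P_def c by simp
  moreover have "(x i + s * v i) * f (\<lambda>i. x i + s * v i) = poly (P x) s" for x s
    unfolding P_def using p(4) by (simp add: poly_monom mult.commute)
  ultimately show ?case
    using poly_family_mult[OF l p(1)] by (intro exI[of _ P]) (auto simp: P_def)
next
  case (add k f g)
  then obtain p q where p: "poly_family n p" "\<forall>x. \<forall>j>k. coeff (p x) j = 0" "\<forall>x. coeff (p x) k = f v"
    "\<forall>x s. f (\<lambda>i. x i + s * v i) = poly (p x) s" and
    q: "poly_family n q" "\<forall>x. \<forall>j>k. coeff (q x) j = 0" "\<forall>x. coeff (q x) k = g v"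
    "\<forall>x s. g (\<lambda>i. x i + s * v i) = poly (q x) s" by blast
  then show ?case by (intro exI[of _ "\<lambda>x. p x + q x"]) (auto intro: poly_family_add)
qed

section \<open>Ideals of polynomial functions and elimination of the last variable\<close>

definition fun_ideal :: "nat \<Rightarrow> ((nat \<Rightarrow> complex) \<Rightarrow> complex) set \<Rightarrow> bool" where
  "fun_ideal n I \<longleftrightarrow> (\<lambda>x. 0) \<in> I \<and> (\<forall>f\<in>I. poly_fun n f) \<and> (\<forall>f\<in>I. \<forall>g\<in>I. (\<lambda>x. f x + g x) \<in> I) \<and>
     (\<forall>f\<in>I. \<forall>h. poly_fun n h \<longrightarrow> (\<lambda>x. h x * f x) \<in> I)"

lemma fun_idealD:
  assumes "fun_ideal n I"
  shows "(\<lambda>x. 0) \<in> I" "f \<in> I \<Longrightarrow> poly_fun n f" "f \<in> I \<Longrightarrow> g \<in> I \<Longrightarrow> (\<lambda>x. f x + g x) \<in> I"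
    "f \<in> I \<Longrightarrow> poly_fun n h \<Longrightarrow> (\<lambda>x. h x * f x) \<in> I"
  using assms by (auto simp: fun_ideal_def)

lemma fun_ideal_diff: "fun_ideal n I \<Longrightarrow> f \<in> I \<Longrightarrow> g \<in> I \<Longrightarrow> (\<lambda>x. f x - g x) \<in> I"
  using fun_idealD(3)[of n I f "\<lambda>x. (-1) * g x"] fun_idealD(4)[of n I g "\<lambda>x. -1"] poly_fun.const[of "-1" n]
  by (simp add: rat_imp_algebraic)

lemma fun_ideal_sum: "fun_ideal n I \<Longrightarrow> (\<And>i. i \<in> A \<Longrightarrow> f i \<in> I) \<Longrightarrow> (\<lambda>x. \<Sum>i\<in>A. f i x) \<in> I"
  by (induction A rule: infinite_finite_induct) (auto simp: fun_idealD)

text \<open>The determinant of multiplication by \<open>f\<close> modulo \<open>g\<close> lies in the elimination ideal.\<close>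

lemma elimination_step:
  assumes I: "fun_ideal (Suc n) I" and G: "poly_family n G" "\<And>x. degree (G x) = D" "\<And>x. coeff (G x) D = 1"
    and gI: "(\<lambda>x. poly (G x) (x n)) \<in> I"
    and a: "\<And>f. f \<in> I \<Longrightarrow> poly_fun n f \<Longrightarrow> f a = 0"
    and F: "poly_family n F" "(\<lambda>x. poly (F x) (x n)) \<in> I" "F a = 1"
  shows False
proof (cases "D = 0")
  \<comment> \<open>With D = 0 the family is constantly 1, and the multiplication matrix below would
    be empty.\<close>
  case True
  have "G x = 1" for x
  proof -
    obtain c where "G x = [:c:]" using G(2)[of x] True by (auto elim: degree_eq_zeroE)
    then show ?thesis using G(3)[of x] True by (simp add: one_pCons)
  qed
  then have "(\<lambda>x. 1) \<in> I" using gI by simp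
  then show False using a[of "\<lambda>x. 1"] poly_fun.const[of 1 n] by (auto simp: rat_imp_algebraic)
next
  case False
  have "\<exists>q r. poly_family n q \<and> poly_family n r \<and> (\<forall>x. monom 1 j * F x = q x * G x + r x) \<and> (\<forall>x. \<forall>k\<ge>D. coeff (r x) k = 0)" for j
    by (rule poly_family_division[OF G poly_family_mult[OF poly_family_monom F(1)]])
      (auto intro: poly_fun.const rat_imp_algebraic)
  then obtain q r where q: "\<And>j. poly_family n (q j)" and r: "\<And>j. poly_family n (r j)"
    and qr: "\<And>j x. monom 1 j * F x = q j x * G x + r j x" and rD: "\<And>j x k. k \<ge> D \<Longrightarrow> coeff (r j x) k = 0"
    by metis
  \<comment> \<open>Row j holds the remainder of X^j * F modulo G, so this is the matrix of
    multiplication by F on polynomials of degree below D.\<close>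
  define M where "M = (\<lambda>x. mat D D (\<lambda>(j,k). coeff (r j x) k))"
  have M: "M x \<in> carrier_mat D D" for x by (simp add: M_def)
  have rI: "(\<lambda>x. poly (r j x) (x n)) \<in> I" for j
  proof -
    have "(\<lambda>x. x n ^ j * poly (F x) (x n) - poly (q j x) (x n) * poly (G x) (x n)) \<in> I"
      by (intro fun_ideal_diff[OF I] fun_idealD(4)[OF I] F(2) gI poly_fun_power poly_fun.var poly_family_poly_fun q) auto
    moreover have "x n ^ j * poly (F x) (x n) - poly (q j x) (x n) * poly (G x) (x n) = poly (r j x) (x n)" for x
      using arg_cong[OF qr[of j x], of "\<lambda>p. poly p (x n)"] by (simp add: poly_monom)
    ultimately show ?thesis by simp
  qed
  have rval: "poly (r j x) t = (\<Sum>k=0..<D. coeff (r j x) k * t ^ k)" for j x t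
  proof -
    have "poly (r j x) t = (\<Sum>k\<in>{..degree (r j x)} \<union> {0..<D}. coeff (r j x) k * t ^ k)"
      unfolding poly_altdef by (intro sum.mono_neutral_left) (auto simp: coeff_eq_0 not_le)
    also have "\<dots> = (\<Sum>k=0..<D. coeff (r j x) k * t ^ k)"
      by (intro sum.mono_neutral_right) (auto simp: rD not_less)
    finally show ?thesis .
  qed
  have entries: "poly_fun n (\<lambda>x. M x $$ (i,j))" if "i < D" "j < D" for i j
    using r[of i] that by (simp add: M_def poly_family_def)
  have detM: "poly_fun n (\<lambda>x. det (M x))" by (rule poly_fun_det[OF entries M])
  have adj: "poly_fun n (\<lambda>x. adj_mat (M x) $$ (0,j))" if j: "j < D" for j
  proof -
    have "poly_fun n (\<lambda>x. det (mat_delete (M x) j 0))"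
    proof (rule poly_fun_det)
      show "mat_delete (M x) j 0 \<in> carrier_mat (D - 1) (D - 1)" for x
        using M[of x] by (rule mat_delete_carrier)
      fix i k assume ik: "i < D - 1" "k < D - 1"
      have "mat_delete (M x) j 0 $$ (i, k) = M x $$ (if i < j then i else Suc i, Suc k)" for x
        using M[of x] ik by (simp add: mat_delete_def)
      then show "poly_fun n (\<lambda>x. mat_delete (M x) j 0 $$ (i, k))"
        using entries[of i "Suc k"] entries[of "Suc i" "Suc k"] ik j by (cases "i < j") simp_all
    qed
    then have "poly_fun n (\<lambda>x. (- 1) ^ j * det (mat_delete (M x) j 0))"
      by (intro poly_fun_cmult) (auto intro: rat_imp_algebraic)
    moreover have "adj_mat (M x) $$ (0,j) = (- 1) ^ j * det (mat_delete (M x) j 0)" for x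
      using M[of x] j False by (simp add: adj_mat_def cofactor_def)
    ultimately show ?thesis by simp
  qed
  \<comment> \<open>The matrix maps the vector of powers of the last variable to the vector of
    remainders. Its adjugate maps back up to the determinant, and entry 0 belongs to the power 1.
    Hence the determinant is a combination of members of the ideal.\<close>
  have "det (M x) = (\<Sum>j=0..<D. adj_mat (M x) $$ (0,j) * poly (r j x) (x n))" for x
  proof -
    have "(adj_mat (M x) * M x) $$ (0,k) = (if k = 0 then det (M x) else 0)" if "k < D" for k
      using adj_mat(3)[OF M[of x]] that False M[of x] by simp
    moreover have "(adj_mat (M x) * M x) $$ (0,k) = (\<Sum>j=0..<D. adj_mat (M x) $$ (0,j) * coeff (r j x) k)" if "k < D" for k
      using that False adj_mat(1)[OF M[of x]] M[of x] by (simp add: scalar_prod_def) (simp add: M_def)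
    ultimately have e: "(\<Sum>j=0..<D. adj_mat (M x) $$ (0,j) * coeff (r j x) k) = (if k = 0 then det (M x) else 0)" if "k < D" for k
      using that by simp
    have "(\<Sum>j=0..<D. adj_mat (M x) $$ (0,j) * poly (r j x) (x n)) =
        (\<Sum>k=0..<D. (\<Sum>j=0..<D. adj_mat (M x) $$ (0,j) * coeff (r j x) k) * x n ^ k)"
      unfolding rval sum_distrib_left sum_distrib_right by (subst sum.swap) (simp add: mult.assoc)
    also have "\<dots> = (\<Sum>k=0..<D. if k = 0 then det (M x) else 0)"
      by (intro sum.cong) (auto simp: e)
    also have "\<dots> = det (M x)" using False by simp
    finally show ?thesis by simp
  qed
  moreover have "(\<lambda>x. \<Sum>j=0..<D. adj_mat (M x) $$ (0,j) * poly (r j x) (x n)) \<in> I"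
    by (intro fun_ideal_sum[OF I] fun_idealD(4)[OF I] rI poly_fun_mono[OF adj]) auto
  ultimately have "(\<lambda>x. det (M x)) \<in> I" by simp
  then have d0: "det (M a) = 0" using a detM by blast
  \<comment> \<open>At \<open>a\<close> the family F is 1, so multiplication by it is the identity
    with determinant 1, whereas elimination forces the determinant to vanish there.\<close>
  have "M a = 1\<^sub>m D"
  proof (rule eq_matI)
    fix j k assume "j < dim_row (1\<^sub>m D :: complex mat)" "k < dim_col (1\<^sub>m D :: complex mat)"
    then have jk: "j < D" "k < D" by auto
    have "q j a = 0"
    proof (rule ccontr)
      assume "q j a \<noteq> 0"
      have eq: "q j a * G a = monom 1 j - r j a" using qr[of j a] F(3) by (simp add: algebra_simps)
      have "G a \<noteq> 0" using G(3)[of a] by auto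
      then have "degree (q j a * G a) = degree (q j a) + D" using \<open>q j a \<noteq> 0\<close> G(2) by (simp add: degree_mult_eq)
      moreover have "degree (monom 1 j - r j a) \<le> D - 1"
        by (rule degree_le) (use jk rD in auto)
      ultimately show False using eq False by simp
    qed
    then have "r j a = monom 1 j" using qr[of j a] F(3) by simp
    then show "M a $$ (j, k) = 1\<^sub>m D $$ (j, k)" using jk by (simp add: M_def)
  qed (auto simp: M_def)
  then show False using d0 by simp
qed

text \<open>The set \<open>U\<close> is an ideal in one variable. Its monic element of least degree
  divides all others and is not constant, so any root of it serves.\<close>

lemma common_root:
  assumes U: "\<And>u. u \<in> U \<Longrightarrow> coeffs_in \<A> u" "\<And>u v. u \<in> U \<Longrightarrow> v \<in> U \<Longrightarrow> u - v \<in> U"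
    "\<And>u q. u \<in> U \<Longrightarrow> coeffs_in \<A> q \<Longrightarrow> q * u \<in> U" and nz: "u0 \<in> U" "u0 \<noteq> 0" and one: "1 \<notin> U"
  shows "\<exists>t. algebraic t \<and> (\<forall>u\<in>U. poly u t = 0)"
proof -
  obtain u where u: "u \<in> U \<and> u \<noteq> 0" and min: "\<And>v. v \<in> U \<and> v \<noteq> 0 \<Longrightarrow> degree u \<le> degree v"
    using ex_has_least_nat[of "\<lambda>v. v \<in> U \<and> v \<noteq> 0" u0 degree] nz by blast
  have uA: "coeffs_in \<A> u" using U(1) u by blast
  define c where "c = lead_coeff u"
  have c: "c \<noteq> 0" "algebraic c" using u uA by (auto simp: c_def coeffs_in_def)
  define w where "w = [:inverse c:] * u"
  have w: "w \<in> U" unfolding w_def using u c by (intro U(3)) (auto simp: AN.coeffs_in_pCons algebraic_inverse)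
  have lw: "lead_coeff w = 1" "degree w = degree u" using c by (auto simp: w_def c_def)
  have "degree u \<noteq> 0"
  proof
    assume "degree u = 0"
    then obtain d where "w = [:d:]" using lw(2) by (metis degree_eq_zeroE)
    then have "w = 1" using lw(1) by (simp add: one_pCons)
    then show False using w one by simp
  qed
  then obtain t where t: "poly w t = 0"
    using fundamental_theorem_of_algebra[of w] lw(2) by (auto simp: constant_degree)
  have alg: "algebraic t"
    by (rule algebraic_poly_root[of w]) (use U(1)[OF w] lw t in auto)
  have "poly v t = 0" if v: "v \<in> U" for v
  proof -
    obtain q r where qr: "coeffs_in \<A> q" "v = q * w + r" "r = 0 \<or> degree r < degree w"
      using AN.monic_division[OF U(1)[OF w] lw(1) U(1)[OF v]] by blast
    have "r = v - q * w" using qr(2) by simp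
    then have "r \<in> U" using U(2)[OF v U(3)[OF w qr(1)]] by simp
    have "r = 0"
    proof (rule ccontr)
      assume "r \<noteq> 0"
      then show False using min[of r] \<open>r \<in> U\<close> qr(3) lw(2) by simp
    qed
    then show ?thesis using qr(2) t by simp
  qed
  then show ?thesis using alg by blast
qed

text \<open>Induction on the number of variables. After a shear the ideal contains an element monic
  in the last variable. If 1 is missing, the elimination ideal has a common zero a by induction. The
  polynomials obtained by fixing the first coordinates to a form an ideal in one variable, which is
  proper by \<open>elimination_step\<close>; its root t extends a to a common zero.\<close>

theorem weak_nullstellensatz:
  assumes "fun_ideal n I" "\<And>x. (\<And>i. algebraic (x i)) \<Longrightarrow> \<exists>f\<in>I. f x \<noteq> 0"
  shows "(\<lambda>x. 1) \<in> I"
  using assms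
proof (induction n arbitrary: I)
  case 0
  obtain f where f: "f \<in> I" "f (\<lambda>i. 0) \<noteq> 0" using "0.prems"(2)[of "\<lambda>i. 0"] by auto
  have pf: "poly_fun 0 f" using fun_idealD(2)[OF "0.prems"(1) f(1)] .
  define c where "c = f (\<lambda>i. 0)"
  have fc: "f x = c" for x unfolding c_def by (rule poly_fun_cong[OF pf]) auto
  have "algebraic c" unfolding c_def by (rule poly_fun_algebraic[OF pf]) auto
  then have "(\<lambda>x. inverse c * f x) \<in> I"
    by (intro fun_idealD(4)[OF "0.prems"(1) f(1)] poly_fun.const algebraic_inverse)
  then show ?case using f(2) by (simp add: fc)
next
  case (Suc n)
  note I = Suc.prems(1)
  obtain f where f: "f \<in> I" "f \<noteq> (\<lambda>x. 0)" using Suc.prems(2)[of "\<lambda>i. 0"] by auto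
  obtain D g where g: "\<And>k. form_fun \<A> (Suc n) k (g k)" "\<And>k. k \<ge> D \<Longrightarrow> g k = (\<lambda>x. 0)" "f = (\<lambda>x. \<Sum>k<D. g k x)"
    using poly_fun_forms[OF _ fun_idealD(2)[OF I f(1)]] by blast
  have "\<exists>k. k < D \<and> g k \<noteq> (\<lambda>x. 0)"
  proof (rule ccontr)
    assume "\<not> ?thesis"
    then have "f x = 0" for x unfolding g(3) by (intro sum.neutral) auto
    then show False using f(2) by auto
  qed
  define m where "m = Max {k. k < D \<and> g k \<noteq> (\<lambda>x. 0)}"
  have "m \<in> {k. k < D \<and> g k \<noteq> (\<lambda>x. 0)}"
    unfolding m_def using \<open>\<exists>k. k < D \<and> g k \<noteq> (\<lambda>x. 0)\<close> by (intro Max_in) auto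
  then have m: "m < D" "g m \<noteq> (\<lambda>x. 0)" by auto
  have gm: "g k = (\<lambda>x. 0)" if "k > m" for k
  proof (rule ccontr)
    assume "g k \<noteq> (\<lambda>x. 0)"
    then have "k \<in> {k. k < D \<and> g k \<noteq> (\<lambda>x. 0)}" using g(2)[of k] by (cases "k < D") auto
    then have "k \<le> m" unfolding m_def by (intro Max_ge) auto
    then show False using that by simp
  qed
  have fm: "f x = (\<Sum>k\<le>m. g k x)" for x
    unfolding g(3) using m gm by (intro sum.mono_neutral_right) auto
  obtain w where w: "g m w \<noteq> 0" "\<And>i. i < Suc n \<Longrightarrow> \<exists>k::nat. k > 0 \<and> w i = of_nat k"
    using poly_fun_nonzero_point[OF form_fun_poly_fun[OF g(1)] m(2)] by blast
  \<comment> \<open>Cutting off the coordinates beyond n makes every coordinate algebraic, which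
    \<open>form_fun_line\<close> requires of its direction.\<close>
  define w' where "w' = (\<lambda>i. if i < Suc n then w i else 0)"
  have gw': "g m w' \<noteq> 0"
    using w(1) poly_fun_cong[OF form_fun_poly_fun[OF g(1)], of w' w m] by (simp add: w'_def)
  have wn: "w' n \<noteq> 0" using w(2)[of n] by (auto simp: w'_def)
  define v where "v = (\<lambda>i. inverse (w' n) * w' i)"
  have vn: "v n = 1" using wn by (simp add: v_def)
  have gv: "g m v \<noteq> 0" unfolding v_def form_fun_homogeneous[OF g(1)] using gw' wn by simp
  have walg: "algebraic (w' i)" for i using w(2)[of i] by (auto simp: w'_def intro: rat_imp_algebraic)
  have valg: "algebraic (v i)" for i
    using AN.mult[of "inverse (w' n)" "w' i"] walg[of i] algebraic_inverse[OF walg[of n]] by (simp add: v_def)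
  \<comment> \<open>A shear makes \<open>f\<close> monic in the last variable.\<close>
  define T where "T = (\<lambda>(x::nat \<Rightarrow> complex) i. (if i = n then 0 else x i) + x n * v i)"
  define T' where "T' = (\<lambda>(x::nat \<Rightarrow> complex) i. if i = n then x n else x i - x n * v i)"
  have TT': "T (T' x) = x" for x by (rule ext) (auto simp: T_def T'_def vn)
  have T'T: "T' (T x) = x" for x by (rule ext) (auto simp: T_def T'_def vn)
  have polT: "poly_fun (Suc n) (\<lambda>x. T x i)" if "i < Suc n" for i
    unfolding T_def using that valg[of i]
    by (cases "i = n") (auto intro!: poly_fun.add poly_fun.mult poly_fun.var poly_fun.const)
  have polT': "poly_fun (Suc n) (\<lambda>x. T' x i)" if "i < Suc n" for i
    unfolding T'_def using that valg[of i]
    by (cases "i = n") (auto intro!: poly_fun_diff poly_fun.mult poly_fun.var poly_fun.const)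
  define J where "J = (\<lambda>f x. f (T x)) ` I"
  have J: "fun_ideal (Suc n) J" unfolding fun_ideal_def
  proof (intro conjI ballI allI impI)
    show "(\<lambda>x. 0) \<in> J" unfolding J_def using fun_idealD(1)[OF I] by force
    show "poly_fun (Suc n) f" if "f \<in> J" for f
      using that fun_idealD(2)[OF I] polT unfolding J_def by (auto intro: poly_fun_compose)
    show "(\<lambda>x. f x + g x) \<in> J" if fg: "f \<in> J" "g \<in> J" for f g
    proof -
      obtain f' g' where "f' \<in> I" "g' \<in> I" "f = (\<lambda>x. f' (T x))" "g = (\<lambda>x. g' (T x))" using fg by (auto simp: J_def)
      then show ?thesis unfolding J_def using fun_idealD(3)[OF I, of f' g'] by (intro image_eqI[of _ _ "\<lambda>x. f' x + g' x"]) auto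
    qed
    show "(\<lambda>x. h x * f x) \<in> J" if fh: "f \<in> J" "poly_fun (Suc n) h" for f h
    proof -
      obtain f' where f': "f' \<in> I" "f = (\<lambda>x. f' (T x))" using fh by (auto simp: J_def)
      have "poly_fun (Suc n) (\<lambda>x. h (T' x))" using fh(2) polT' by (rule poly_fun_compose)
      then show ?thesis unfolding J_def using fun_idealD(4)[OF I f'(1), of "\<lambda>x. h (T' x)"] f'(2)
        by (intro image_eqI[of _ _ "\<lambda>x. h (T' x) * f' x"]) (auto simp: T'T)
    qed
  qed
  have "\<exists>p. poly_family (Suc n) p \<and> (\<forall>x. \<forall>j>k. coeff (p x) j = 0) \<and> (\<forall>x. coeff (p x) k = g k v) \<and>
     (\<forall>x s. g k (\<lambda>i. x i + s * v i) = poly (p x) s)" for k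
    by (rule form_fun_line[OF g(1) valg])
  then obtain p where p: "\<And>k. poly_family (Suc n) (p k)" "\<And>k x j. j > k \<Longrightarrow> coeff (p k x) j = 0"
    "\<And>k x. coeff (p k x) k = g k v" "\<And>k x s. g k (\<lambda>i. x i + s * v i) = poly (p k x) s" by metis
  \<comment> \<open>Erasing coordinate n frees the coefficients of \<open>G\<close> from the last
    variable, which enters only as the parameter along the line.\<close>
  define x0 where "x0 = (\<lambda>(x::nat \<Rightarrow> complex) i. if i = n then 0 else x i)"
  define G where "G = (\<lambda>x. smult (inverse (g m v)) (\<Sum>k\<le>m. p k (x0 x)))"
  have cG: "coeff (G x) j = inverse (g m v) * (\<Sum>k\<le>m. coeff (p k (x0 x)) j)" for x j
    by (simp add: G_def coeff_sum)
  have cGm: "coeff (G x) m = 1" for x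
  proof -
    have "(\<Sum>k\<le>m. coeff (p k (x0 x)) m) = (\<Sum>k\<in>{m}. coeff (p k (x0 x)) m)"
      by (intro sum.mono_neutral_right) (auto simp: p(2))
    then show ?thesis using gv by (simp add: cG p(3))
  qed
  have cGgt: "coeff (G x) j = 0" if "j > m" for x j
    unfolding cG using p(2) that by simp
  have degG: "degree (G x) = m" for x
    using cGm[of x] cGgt[of _ x] by (intro antisym degree_le le_degree) auto
  have gvalg: "algebraic (g m v)" by (rule poly_fun_algebraic[OF form_fun_poly_fun[OF g(1)] valg])
  have G: "poly_family n G" unfolding poly_family_def
  proof (intro conjI allI exI)
    fix j
    have "poly_fun (Suc n) (\<lambda>x. inverse (g m v) * (\<Sum>k\<le>m. coeff (p k x) j))"
      using p(1) by (intro poly_fun_cmult algebraic_inverse gvalg poly_fun_sum) (auto simp: poly_family_def)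
    moreover have "poly_fun n (\<lambda>x. x0 x i)" if "i < Suc n" for i
      using that by (cases "i = n") (auto simp: x0_def intro: poly_fun.var poly_fun.const)
    ultimately show "poly_fun n (\<lambda>x. coeff (G x) j)"
      unfolding cG by (rule poly_fun_compose)
    show "degree (G x) \<le> m" for x using degG by simp
  qed
  have "(\<lambda>x. f (T x)) \<in> J" unfolding J_def using f(1) by blast
  then have "(\<lambda>x. inverse (g m v) * f (T x)) \<in> J"
    by (intro fun_idealD(4)[OF J] poly_fun.const algebraic_inverse gvalg)
  moreover have "inverse (g m v) * f (T x) = poly (G x) (x n)" for x
  proof -
    have "T x = (\<lambda>i. x0 x i + x n * v i)" by (simp add: T_def x0_def)
    then show ?thesis by (simp add: fm p(4) G_def poly_sum)
  qed
  ultimately have GJ: "(\<lambda>x. poly (G x) (x n)) \<in> J" by simp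
  show ?case
  proof (rule ccontr)
    assume n1: "(\<lambda>x. 1) \<notin> I"
    have n1J: "(\<lambda>x. 1) \<notin> J"
    proof
      assume "(\<lambda>x. 1) \<in> J"
      then obtain f' where f': "f' \<in> I" "(\<lambda>x. 1) = (\<lambda>x. f' (T x))" by (auto simp: J_def)
      have "f' x = 1" for x using fun_cong[OF f'(2), of "T' x"] by (simp add: TT')
      then have "f' = (\<lambda>x. 1)" by auto
      then show False using f'(1) n1 by simp
    qed
    \<comment> \<open>The elimination ideal: the members that depend on the first n coordinates
      only.\<close>
    define I' where "I' = {f \<in> J. poly_fun n f}"
    have up: "poly_fun n f \<Longrightarrow> poly_fun (Suc n) f" for f by (rule poly_fun_mono) auto
    have "fun_ideal n I'" unfolding fun_ideal_def I'_def
      using fun_idealD[OF J] up by (auto intro: poly_fun.intros)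
    moreover have "(\<lambda>x. 1) \<notin> I'" using n1J by (simp add: I'_def)
    ultimately obtain a where a: "\<And>i. algebraic (a i)" "\<And>f. f \<in> I' \<Longrightarrow> f a = 0"
      using Suc.IH[of I'] by blast
    define U where "U = {F a | F. poly_family n F \<and> (\<lambda>x. poly (F x) (x n)) \<in> J}"
    have "\<exists>t. algebraic t \<and> (\<forall>u\<in>U. poly u t = 0)"
    proof (rule common_root)
      show "coeffs_in \<A> u" if "u \<in> U" for u
        using that a(1) unfolding U_def coeffs_in_def poly_family_def by (auto intro: poly_fun_algebraic)
      show "u - v \<in> U" if uv: "u \<in> U" "v \<in> U" for u v
      proof -
        obtain F F' where "poly_family n F" "(\<lambda>x. poly (F x) (x n)) \<in> J" "u = F a"
          "poly_family n F'" "(\<lambda>x. poly (F' x) (x n)) \<in> J" "v = F' a" using uv by (auto simp: U_def)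
        then show ?thesis unfolding U_def using poly_family_diff[of n F F'] fun_ideal_diff[OF J]
          by (intro CollectI exI[of _ "\<lambda>x. F x - F' x"]) auto
      qed
      show "q * u \<in> U" if uq: "u \<in> U" "coeffs_in \<A> q" for u q
      proof -
        obtain F where F: "poly_family n F" "(\<lambda>x. poly (F x) (x n)) \<in> J" "u = F a" using uq by (auto simp: U_def)
        have q: "poly_family n (\<lambda>x. q)" by (rule poly_family_const[OF uq(2)])
        show ?thesis unfolding U_def
          using poly_family_mult[OF q F(1)] fun_idealD(4)[OF J F(2) poly_family_poly_fun[OF q]] F(3)
          by (intro CollectI exI[of _ "\<lambda>x. q * F x"]) auto
      qed
      show "G a \<in> U" unfolding U_def using G GJ by blast
      show "G a \<noteq> 0" using cGm[of a] by auto
      show "1 \<notin> U"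
      proof
        assume "1 \<in> U"
        then obtain F where F: "poly_family n F" "(\<lambda>x. poly (F x) (x n)) \<in> J" "F a = 1" by (auto simp: U_def)
        show False
          by (rule elimination_step[OF J G degG cGm GJ _ F]) (use a(2) in \<open>auto simp: I'_def\<close>)
      qed
    qed
    then obtain t where t: "algebraic t" "\<And>u. u \<in> U \<Longrightarrow> poly u t = 0" by blast
    define b where "b = a(n := t)"
    have zero: "f b = 0" if fJ: "f \<in> J" for f
    proof -
      obtain F where F: "poly_family n F" "f = (\<lambda>x. poly (F x) (x n))" using poly_fun_Suc[OF fun_idealD(2)[OF J fJ]] by blast
      have "F b = F a" by (rule poly_family_cong[OF F(1)]) (auto simp: b_def)
      moreover have "F a \<in> U" unfolding U_def using F fJ by blast
      ultimately show ?thesis using t(2) F(2) by (simp add: b_def)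
    qed
    have balg: "algebraic (b i)" for i using a(1) t(1) by (simp add: b_def)
    have "algebraic (T b i)" for i
      using AN.add[of "if i = n then 0 else b i" "b n * v i"] AN.mult[of "b n" "v i"] balg valg by (simp add: T_def)
    then obtain f' where "f' \<in> I" "f' (T b) \<noteq> 0" using Suc.prems(2)[of "T b"] by blast
    then show False using zero[of "\<lambda>x. f' (T x)"] by (auto simp: J_def)
  qed
qed

subsection \<open>Heights under endomorphisms\<close>

text \<open>All sufficiently large degrees are allowed, so that several polynomials can be brought
  to one common degree.\<close>

lemma poly_fun_homogenize:
  assumes j: "j < n" and G: "poly_fun n G"
  shows "\<exists>e. \<forall>e'\<ge>e. \<exists>h. form_fun \<A> n e' h \<and> (\<forall>x. x j \<noteq> 0 \<longrightarrow> h x = x j ^ e' * G (\<lambda>i. x i / x j))"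
  using G
proof (induction rule: poly_fun.induct)
  case (const c)
  have "form_fun \<A> n e (\<lambda>x. c * x j ^ e)" for e
    using const form_fun_cmult[OF form_fun_var_power[OF subring_algebraic j] subring_algebraic] by simp
  then have "\<exists>h. form_fun \<A> n e h \<and> (\<forall>x. x j \<noteq> 0 \<longrightarrow> h x = x j ^ e * c)" for e
    by (intro exI[of _ "\<lambda>x. c * x j ^ e"]) simp
  then show ?case by blast
next
  case (var i)
  show ?case
  proof (intro exI[of _ 1] allI impI)
    fix e :: nat assume e: "1 \<le> e"
    have "form_fun \<A> n (Suc (e - 1)) (\<lambda>x. x i * x j ^ (e - 1))"
      by (rule form_fun.mult_var[OF form_fun_var_power[OF subring_algebraic j] var])
    moreover have "x i * x j ^ (e - 1) = x j ^ e * (x i / x j)" if "x j \<noteq> 0" for x :: "nat \<Rightarrow> complex"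
      using e that by (cases e) auto
    ultimately show "\<exists>h. form_fun \<A> n e h \<and> (\<forall>x. x j \<noteq> 0 \<longrightarrow> h x = x j ^ e * (x i / x j))"
      using e by (intro exI[of _ "\<lambda>x. x i * x j ^ (e - 1)"]) simp
  qed
next
  case (add f g)
  then obtain e1 e2 where e1: "\<And>e'. e' \<ge> e1 \<Longrightarrow> \<exists>h. form_fun \<A> n e' h \<and> (\<forall>x. x j \<noteq> 0 \<longrightarrow> h x = x j ^ e' * f (\<lambda>i. x i / x j))"
    and e2: "\<And>e'. e' \<ge> e2 \<Longrightarrow> \<exists>h. form_fun \<A> n e' h \<and> (\<forall>x. x j \<noteq> 0 \<longrightarrow> h x = x j ^ e' * g (\<lambda>i. x i / x j))" by blast
  show ?case
  proof (intro exI[of _ "max e1 e2"] allI impI)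
    fix e' assume "max e1 e2 \<le> e'"
    then obtain h h' where "form_fun \<A> n e' h" "\<forall>x. x j \<noteq> 0 \<longrightarrow> h x = x j ^ e' * f (\<lambda>i. x i / x j)"
      "form_fun \<A> n e' h'" "\<forall>x. x j \<noteq> 0 \<longrightarrow> h' x = x j ^ e' * g (\<lambda>i. x i / x j)"
      using e1[of e'] e2[of e'] by auto
    then show "\<exists>h. form_fun \<A> n e' h \<and> (\<forall>x. x j \<noteq> 0 \<longrightarrow> h x = x j ^ e' * (f (\<lambda>i. x i / x j) + g (\<lambda>i. x i / x j)))"
      by (intro exI[of _ "\<lambda>x. h x + h' x"]) (auto simp: distrib_left intro: form_fun.add)
  qed
next
  case (mult f g)
  then obtain e1 e2 where e1: "\<And>e'. e' \<ge> e1 \<Longrightarrow> \<exists>h. form_fun \<A> n e' h \<and> (\<forall>x. x j \<noteq> 0 \<longrightarrow> h x = x j ^ e' * f (\<lambda>i. x i / x j))"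
    and e2: "\<And>e'. e' \<ge> e2 \<Longrightarrow> \<exists>h. form_fun \<A> n e' h \<and> (\<forall>x. x j \<noteq> 0 \<longrightarrow> h x = x j ^ e' * g (\<lambda>i. x i / x j))" by blast
  show ?case
  proof (intro exI[of _ "e1 + e2"] allI impI)
    fix e' assume e': "e1 + e2 \<le> e'"
    then have "e2 \<le> e' - e1" by simp
    then obtain h h' where h: "form_fun \<A> n e1 h" "\<forall>x. x j \<noteq> 0 \<longrightarrow> h x = x j ^ e1 * f (\<lambda>i. x i / x j)"
      "form_fun \<A> n (e' - e1) h'" "\<forall>x. x j \<noteq> 0 \<longrightarrow> h' x = x j ^ (e' - e1) * g (\<lambda>i. x i / x j)"
      using e1[of e1, OF order_refl] e2[of "e' - e1"] by blast
    have eq: "e1 + (e' - e1) = e'" using e' by simp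
    have "x j ^ e' = x j ^ e1 * x j ^ (e' - e1)" for x :: "nat \<Rightarrow> complex"
      unfolding power_add[symmetric] eq ..
    then show "\<exists>h. form_fun \<A> n e' h \<and> (\<forall>x. x j \<noteq> 0 \<longrightarrow> h x = x j ^ e' * (f (\<lambda>i. x i / x j) * g (\<lambda>i. x i / x j)))"
      using form_fun_mult[OF h(1) subring_algebraic h(3)] h(2,4) eq
      by (intro exI[of _ "\<lambda>x. h x * h' x"]) auto
  qed
qed

lemma mpoly_eval_poly_fun:
  assumes "homogeneous_on N d p" "algebraic_coeffs p"
  shows "poly_fun (Suc N) (mpoly_eval p)"
proof -
  have "poly_fun (Suc N) (\<lambda>x. \<Sum>m\<in>Poly_Mapping.keys p.
     Poly_Mapping.lookup p m * (\<Prod>i\<in>Poly_Mapping.keys m. x i ^ Poly_Mapping.lookup m i))"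
    using assms by (intro poly_fun_sum poly_fun_cmult poly_fun_prod poly_fun_power poly_fun.var)
      (auto simp: homogeneous_on_def algebraic_coeffs_def subset_iff less_Suc_eq_le)
  then show ?thesis unfolding mpoly_eval_def .
qed

lemma mpoly_eval_homogeneous:
  assumes "homogeneous_on N d p"
  shows "mpoly_eval p (\<lambda>i. c * x i) = c ^ d * mpoly_eval p x"
proof -
  have "(\<Prod>i\<in>Poly_Mapping.keys m. (c * x i) ^ Poly_Mapping.lookup m i) =
      c ^ d * (\<Prod>i\<in>Poly_Mapping.keys m. x i ^ Poly_Mapping.lookup m i)" if "m \<in> Poly_Mapping.keys p" for m
    using assms that by (simp add: power_mult_distrib prod.distrib power_sum[symmetric] homogeneous_on_def)
  then show ?thesis unfolding mpoly_eval_def sum_distrib_left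
    by (intro sum.cong refl) (simp add: mult.left_commute)
qed

lemma form_fun_integral:
  assumes "form_fun \<A> n k h"
  shows "\<exists>M::nat. M > 0 \<and> form_fun {z. algebraic_int z} n k (\<lambda>x. of_nat M * h x)"
  using assms
proof (induction rule: form_fun.induct)
  case (const c)
  then obtain M :: nat where "M > 0" "algebraic_int (of_nat M * c)" using algebraic_imp_multiple[of c] by auto
  then show ?case by (intro exI[of _ M]) (auto intro: form_fun.const)
next
  case (mult_var k f i)
  then obtain M :: nat where "M > 0" "form_fun {z. algebraic_int z} n k (\<lambda>x. of_nat M * f x)" by blast
  then show ?case using form_fun.mult_var[OF _ mult_var(2), of _ k "\<lambda>x. of_nat M * f x"]
    by (intro exI[of _ M]) (simp add: mult.left_commute)
next
  case (add k f g)
  then obtain M M' :: nat where M: "M > 0" "form_fun {z. algebraic_int z} n k (\<lambda>x. of_nat M * f x)"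
     "M' > 0" "form_fun {z. algebraic_int z} n k (\<lambda>x. of_nat M' * g x)" by blast
  have "form_fun {z. algebraic_int z} n k (\<lambda>x. of_nat M' * (of_nat M * f x) + of_nat M * (of_nat M' * g x))"
    by (intro form_fun.add form_fun_cmult[OF M(2) subring_algebraic_int, of "of_nat M'"]
        form_fun_cmult[OF M(4) subring_algebraic_int, of "of_nat M"]) (auto simp: algebraic_int_of_nat)
  then show ?case using M by (intro exI[of _ "M * M'"]) (simp add: algebra_simps)
qed

text \<open>A finite coefficient set fits into one number field, which can then be enlarged together
  with the coordinates of a point.\<close>

lemma form_fun_finite_coeffs:
  assumes "form_fun R n k h"
  shows "\<exists>S. finite S \<and> S \<subseteq> R \<and> form_fun S n k h"
  using assms
proof (induction rule: form_fun.induct)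
  case (const c)
  then show ?case by (intro exI[of _ "{c}"]) (auto intro: form_fun.const)
next
  case (mult_var k f i)
  then show ?case by (auto intro: form_fun.mult_var)
next
  case (add k f g)
  then obtain S S' where S: "finite S" "S \<subseteq> R" "form_fun S n k f" "finite S'" "S' \<subseteq> R" "form_fun S' n k g" by blast
  then have "form_fun (S \<union> S') n k (\<lambda>x. f x + g x)"
    by (intro form_fun.add) (auto intro: form_fun_mono)
  then show ?case using S by (intro exI[of _ "S \<union> S'"]) auto
qed

text \<open>The images of \<open>a\<close> under all embeddings of all fields are roots of one
  rational polynomial, so the sum of the moduli of its roots bounds them simultaneously.\<close>

lemma conjugates_bounded:
  assumes "algebraic a"
  shows "\<exists>B\<ge>0. \<forall>L \<tau>. number_field L \<and> a \<in> L \<and> \<tau> \<in> embeddings L \<longrightarrow> cmod (\<tau> a) \<le> B"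
proof -
  obtain p where p: "coeffs_in \<rat> p" "p \<noteq> 0" "poly p a = 0" using algebraic_rat_poly[OF assms] by blast
  define R where "R = {z. poly p z = 0}"
  have R: "finite R" unfolding R_def by (rule poly_roots_finite[OF p(2)])
  have "cmod (\<tau> a) \<le> sum cmod R" if "number_field L" "a \<in> L" "\<tau> \<in> embeddings L" for L \<tau>
  proof -
    interpret csubfield L by (rule number_field_csubfield) fact
    interpret embedding L \<tau> by unfold_locales fact
    have "\<tau> a \<in> R" using poly_hom[OF p(1) that(2)] p(3) by (simp add: R_def)
    then show ?thesis by (intro member_le_sum R) auto
  qed
  then show ?thesis by (intro exI[of _ "sum cmod R"]) (auto intro: sum_nonneg)
qed

text \<open>The quantifier order is the point: the constant is fixed before the field, the embedding
  and the coordinates, so it survives the passage to the extensions chosen for each point.\<close>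

lemma form_fun_arch_bound:
  assumes "form_fun S (Suc N) k h" "S \<subseteq> \<A>"
  shows "\<exists>C\<ge>0. \<forall>L \<tau> x. number_field L \<and> S \<subseteq> L \<and> \<tau> \<in> embeddings L \<and> (\<forall>i\<le>N. x i \<in> L) \<longrightarrow>
     h x \<in> L \<and> cmod (\<tau> (h x)) \<le> C * arch_max N x \<tau> ^ k"
  using assms(1)
proof (induction rule: form_fun.induct)
  case (const c)
  then have "algebraic c" using assms(2) by auto
  then obtain B where B: "B \<ge> 0" "\<And>L \<tau>. number_field L \<Longrightarrow> c \<in> L \<Longrightarrow> \<tau> \<in> embeddings L \<Longrightarrow> cmod (\<tau> c) \<le> B"
    using conjugates_bounded[of c] by blast
  then show ?case using const by (intro exI[of _ B]) auto
next
  case (mult_var k f i)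
  then obtain C where C: "C \<ge> 0" and CB: "\<And>L \<tau> x. number_field L \<Longrightarrow> S \<subseteq> L \<Longrightarrow> \<tau> \<in> embeddings L \<Longrightarrow> (\<forall>i\<le>N. x i \<in> L) \<Longrightarrow>
     f x \<in> L \<and> cmod (\<tau> (f x)) \<le> C * arch_max N x \<tau> ^ k" by blast
  have "x i * f x \<in> L \<and> cmod (\<tau> (x i * f x)) \<le> C * arch_max N x \<tau> ^ Suc k"
    if L: "number_field L" "S \<subseteq> L" "\<tau> \<in> embeddings L" "\<forall>i\<le>N. x i \<in> L" for L \<tau> x
  proof -
    interpret csubfield L by (rule number_field_csubfield) fact
    interpret embedding L \<tau> by unfold_locales fact
    have i: "i \<le> N" using mult_var(2) by simp
    note f = CB[OF L]
    have "cmod (\<tau> (x i * f x)) = cmod (\<tau> (x i)) * cmod (\<tau> (f x))"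
      using f L(4) i by (simp add: mult_hom norm_mult)
    also have "\<dots> \<le> arch_max N x \<tau> * (C * arch_max N x \<tau> ^ k)"
      using f arch_max_ge[OF i, of \<tau> x] arch_max_nonneg by (intro mult_mono) auto
    finally show ?thesis using f L(4) i by (auto simp: mult_ac)
  qed
  then show ?case using C by blast
next
  case (add k f g)
  obtain C where C: "C \<ge> 0" and CB: "\<And>L \<tau> x. number_field L \<Longrightarrow> S \<subseteq> L \<Longrightarrow> \<tau> \<in> embeddings L \<Longrightarrow> (\<forall>i\<le>N. x i \<in> L) \<Longrightarrow>
     f x \<in> L \<and> cmod (\<tau> (f x)) \<le> C * arch_max N x \<tau> ^ k" using add(3) by blast
  obtain C' where C': "C' \<ge> 0" and CB': "\<And>L \<tau> x. number_field L \<Longrightarrow> S \<subseteq> L \<Longrightarrow> \<tau> \<in> embeddings L \<Longrightarrow> (\<forall>i\<le>N. x i \<in> L) \<Longrightarrow>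
     g x \<in> L \<and> cmod (\<tau> (g x)) \<le> C' * arch_max N x \<tau> ^ k" using add(4) by blast
  have "f x + g x \<in> L \<and> cmod (\<tau> (f x + g x)) \<le> (C + C') * arch_max N x \<tau> ^ k"
    if L: "number_field L" "S \<subseteq> L" "\<tau> \<in> embeddings L" "\<forall>i\<le>N. x i \<in> L" for L \<tau> x
  proof -
    interpret csubfield L by (rule number_field_csubfield) fact
    interpret embedding L \<tau> by unfold_locales fact
    note f = CB[OF L] and g = CB'[OF L]
    have "cmod (\<tau> (f x + g x)) \<le> cmod (\<tau> (f x)) + cmod (\<tau> (g x))"
      using f g by (simp add: add_hom norm_triangle_ineq)
    then show ?thesis using f g by (auto simp: distrib_right)
  qed
  then show ?case using C C' by (intro exI[of _ "C + C'"]) auto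
qed

lemma form_fun_algebraic_int:
  assumes "form_fun S (Suc N) k h" "S \<subseteq> {z. algebraic_int z}" "\<And>i. i \<le> N \<Longrightarrow> algebraic_int (x i)"
  shows "algebraic_int (h x)"
  using assms(1)
  by (induction rule: form_fun.induct) (use assms(2,3) in \<open>auto intro: algebraic_int_mult algebraic_int_add\<close>)

text \<open>On the chart x_j = 1 the forms have no common zero, so they generate the unit ideal
  together with x_j - 1. Evaluating this relation at x / x_j removes the extra generator, and
  multiplying by a power of x_j restores homogeneity.\<close>

lemma power_relation:
  assumes F: "defines_endo N d F" and j: "j \<le> N"
  shows "\<exists>e. \<forall>e'\<ge>e. \<exists>h. (\<forall>i\<le>N. form_fun \<A> (Suc N) e' (h i)) \<and>
     (\<forall>x. x j \<noteq> 0 \<longrightarrow> x j ^ (e' + d) = (\<Sum>i\<le>N. h i x * mpoly_eval (F i) x))"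
proof -
  define f where "f = (\<lambda>i. mpoly_eval (F i))"
  have f: "poly_fun (Suc N) (f i)" if "i \<le> N" for i
    unfolding f_def using F that by (intro mpoly_eval_poly_fun[of N d]) (auto simp: defines_endo_def)
  have fh: "f i (\<lambda>k. c * x k) = c ^ d * f i x" if "i \<le> N" for i c x
    unfolding f_def using F that by (intro mpoly_eval_homogeneous[of N]) (auto simp: defines_endo_def)
  define I where "I = {\<lambda>x. (\<Sum>i\<le>N. G i x * f i x) + H x * (x j - 1) | G H.
     (\<forall>i\<le>N. poly_fun (Suc N) (G i)) \<and> poly_fun (Suc N) H}"
  have I1: "(\<lambda>x. (\<Sum>i\<le>N. G i x * f i x) + H x * (x j - 1)) \<in> I"
    if "\<And>i. i \<le> N \<Longrightarrow> poly_fun (Suc N) (G i)" "poly_fun (Suc N) H" for G H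
    unfolding I_def using that by blast
  have c0: "poly_fun (Suc N) (\<lambda>x. 0)" and c1: "poly_fun (Suc N) (\<lambda>x. 1)"
    by (auto intro: poly_fun.const rat_imp_algebraic)
  have xj: "poly_fun (Suc N) (\<lambda>x. x j - 1)" using j by (intro poly_fun_diff poly_fun.var c1) auto
  have "fun_ideal (Suc N) I" unfolding fun_ideal_def
  proof (intro conjI ballI allI impI)
    show "(\<lambda>x. 0) \<in> I" using I1[of "\<lambda>i x. 0" "\<lambda>x. 0"] c0 by simp
    show "poly_fun (Suc N) g" if "g \<in> I" for g
      using that unfolding I_def by (auto intro!: poly_fun.add poly_fun.mult poly_fun_sum f xj)
    show "(\<lambda>x. g x + g' x) \<in> I" if g: "g \<in> I" "g' \<in> I" for g g'
    proof -
      obtain G H G' H' where G: "\<forall>i\<le>N. poly_fun (Suc N) (G i)" "poly_fun (Suc N) H" "g = (\<lambda>x. (\<Sum>i\<le>N. G i x * f i x) + H x * (x j - 1))"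
        "\<forall>i\<le>N. poly_fun (Suc N) (G' i)" "poly_fun (Suc N) H'" "g' = (\<lambda>x. (\<Sum>i\<le>N. G' i x * f i x) + H' x * (x j - 1))"
        using g unfolding I_def by blast
      have "(\<lambda>x. (\<Sum>i\<le>N. (G i x + G' i x) * f i x) + (H x + H' x) * (x j - 1)) \<in> I"
        using G by (intro I1 poly_fun.add) auto
      moreover have "(\<Sum>i\<le>N. (G i x + G' i x) * f i x) + (H x + H' x) * (x j - 1) = g x + g' x" for x
        by (simp add: G(3,6) distrib_right sum.distrib)
      ultimately show ?thesis by simp
    qed
    show "(\<lambda>x. h x * g x) \<in> I" if g: "g \<in> I" and h: "poly_fun (Suc N) h" for g h
    proof -
      obtain G H where G: "\<forall>i\<le>N. poly_fun (Suc N) (G i)" "poly_fun (Suc N) H" "g = (\<lambda>x. (\<Sum>i\<le>N. G i x * f i x) + H x * (x j - 1))"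
        using g unfolding I_def by blast
      have "(\<lambda>x. (\<Sum>i\<le>N. (h x * G i x) * f i x) + (h x * H x) * (x j - 1)) \<in> I"
        using G h by (intro I1 poly_fun.mult) auto
      moreover have "(\<Sum>i\<le>N. (h x * G i x) * f i x) + (h x * H x) * (x j - 1) = h x * g x" for x
        by (simp add: G(3) distrib_left sum_distrib_left mult.assoc)
      ultimately show ?thesis by simp
    qed
  qed
  moreover have "\<exists>g\<in>I. g x \<noteq> 0" if x: "\<And>i. algebraic (x i)" for x
  proof (cases "x j = 1")
    case False
    have "(\<lambda>x. x j - 1) \<in> I" using I1[of "\<lambda>i x. 0" "\<lambda>x. 1"] c0 c1 by simp
    then show ?thesis using False by (intro bexI[of _ "\<lambda>x. x j - 1"]) auto
  next
    case True
    \<comment> \<open>Coordinate vectors must vanish beyond N; the forms only read the first N + 1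
      coordinates, so truncation does not change their values.\<close>
    define y where "y = (\<lambda>i. if i \<le> N then x i else 0)"
    have "y \<in> coord_vecs N" using x True j by (auto simp: coord_vecs_def y_def intro!: exI[of _ j])
    then obtain i where i: "i \<le> N" "f i y \<noteq> 0" using F by (auto simp: defines_endo_def f_def)
    have "f i x = f i y" by (rule poly_fun_cong[OF f[OF i(1)]]) (simp add: y_def)
    moreover have "f i \<in> I"
    proof -
      have "(\<lambda>x. (\<Sum>k\<le>N. (if k = i then 1 else 0) * f k x) + 0 * (x j - 1)) \<in> I"
        using I1[of "\<lambda>k x. if k = i then 1 else 0" "\<lambda>x. 0"] c0 c1 by simp
      moreover have "(\<Sum>k\<le>N. (if k = i then 1 else 0) * f k x) = f i x" for x
      proof -
        have "(\<Sum>k\<le>N. (if k = i then 1 else 0) * f k x) = (\<Sum>k\<le>N. if k = i then f k x else 0)"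
          by (rule sum.cong) auto
        then show ?thesis using i(1) by simp
      qed
      ultimately show ?thesis by simp
    qed
    ultimately show ?thesis using i(2) by (intro bexI[of _ "f i"]) auto
  qed
  ultimately have "(\<lambda>x. 1) \<in> I" by (rule weak_nullstellensatz)
  then obtain G H where G: "\<forall>i\<le>N. poly_fun (Suc N) (G i)" "(\<lambda>x. 1) = (\<lambda>x. (\<Sum>i\<le>N. G i x * f i x) + H x * (x j - 1))"
    unfolding I_def by blast
  have "\<forall>i\<le>N. \<exists>e. \<forall>e'\<ge>e. \<exists>h. form_fun \<A> (Suc N) e' h \<and> (\<forall>x. x j \<noteq> 0 \<longrightarrow> h x = x j ^ e' * G i (\<lambda>i. x i / x j))"
    using poly_fun_homogenize[of j "Suc N"] j G(1) by auto
  then obtain e where e: "\<And>i e'. i \<le> N \<Longrightarrow> e' \<ge> e i \<Longrightarrow> \<exists>h. form_fun \<A> (Suc N) e' h \<and> (\<forall>x. x j \<noteq> 0 \<longrightarrow> h x = x j ^ e' * G i (\<lambda>i. x i / x j))"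
    by metis
  show ?thesis
  proof (intro exI[of _ "\<Sum>i\<le>N. e i"] allI impI)
    fix e' assume e': "(\<Sum>i\<le>N. e i) \<le> e'"
    have "e i \<le> e'" if "i \<le> N" for i
      using member_le_sum[of i "{..N}" e] that e' by simp
    then have "\<forall>i\<le>N. \<exists>h. form_fun \<A> (Suc N) e' h \<and> (\<forall>x. x j \<noteq> 0 \<longrightarrow> h x = x j ^ e' * G i (\<lambda>i. x i / x j))"
      using e by blast
    then obtain h where h: "\<And>i. i \<le> N \<Longrightarrow> form_fun \<A> (Suc N) e' (h i)"
      "\<And>i x. i \<le> N \<Longrightarrow> x j \<noteq> 0 \<Longrightarrow> h i x = x j ^ e' * G i (\<lambda>i. x i / x j)" by metis
    have "x j ^ (e' + d) = (\<Sum>i\<le>N. h i x * f i x)" if x: "x j \<noteq> 0" for x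
    proof -
      define y where "y = (\<lambda>i. x i / x j)"
      have xy: "x = (\<lambda>i. x j * y i)" using x by (simp add: y_def)
      have "1 = (\<Sum>i\<le>N. G i y * f i y)" using fun_cong[OF G(2), of y] x by (simp add: y_def)
      then have "x j ^ (e' + d) = x j ^ (e' + d) * (\<Sum>i\<le>N. G i y * f i y)" by simp
      also have "\<dots> = (\<Sum>i\<le>N. (x j ^ e' * G i y) * (x j ^ d * f i y))"
        unfolding sum_distrib_left by (intro sum.cong refl) (simp add: power_add mult_ac)
      also have "\<dots> = (\<Sum>i\<le>N. h i x * f i x)"
      proof (rule sum.cong[OF refl])
        fix i assume "i \<in> {..N}"
        then have "f i x = x j ^ d * f i y" using fh[of i "x j" y] xy by simp
        then show "(x j ^ e' * G i y) * (x j ^ d * f i y) = h i x * f i x"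
          using h(2)[of i x] \<open>i \<in> {..N}\<close> x by (simp add: y_def)
      qed
      finally show ?thesis .
    qed
    then show "\<exists>h. (\<forall>i\<le>N. form_fun \<A> (Suc N) e' (h i)) \<and>
       (\<forall>x. x j \<noteq> 0 \<longrightarrow> x j ^ (e' + d) = (\<Sum>i\<le>N. h i x * mpoly_eval (F i) x))"
      using h(1) by (intro exI[of _ h]) (simp add: f_def)
  qed
qed

lemma integral_power_relation:
  assumes F: "defines_endo N d F"
  shows "\<exists>(M::nat) S e h. M > 0 \<and> finite S \<and> S \<subseteq> {z. algebraic_int z} \<and>
     (\<forall>j\<le>N. \<forall>i\<le>N. form_fun S (Suc N) e (h j i)) \<and>
     (\<forall>j\<le>N. \<forall>x. x j \<noteq> 0 \<longrightarrow> of_nat M * x j ^ (e + d) = (\<Sum>i\<le>N. h j i x * mpoly_eval (F i) x))"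
proof -
  have "\<forall>j\<le>N. \<exists>e. \<forall>e'\<ge>e. \<exists>h. (\<forall>i\<le>N. form_fun \<A> (Suc N) e' (h i)) \<and>
     (\<forall>x. x j \<noteq> 0 \<longrightarrow> x j ^ (e' + d) = (\<Sum>i\<le>N. h i x * mpoly_eval (F i) x))"
    using power_relation[OF F] by blast
  then obtain e where e: "\<And>j e'. j \<le> N \<Longrightarrow> e' \<ge> e j \<Longrightarrow> \<exists>h. (\<forall>i\<le>N. form_fun \<A> (Suc N) e' (h i)) \<and>
     (\<forall>x. x j \<noteq> 0 \<longrightarrow> x j ^ (e' + d) = (\<Sum>i\<le>N. h i x * mpoly_eval (F i) x))" by metis
  define E where "E = (\<Sum>j\<le>N. e j)"
  have "e j \<le> E" if "j \<le> N" for j unfolding E_def using member_le_sum[of j "{..N}" e] that by simp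
  then have "\<forall>j\<le>N. \<exists>h. (\<forall>i\<le>N. form_fun \<A> (Suc N) E (h i)) \<and>
     (\<forall>x. x j \<noteq> 0 \<longrightarrow> x j ^ (E + d) = (\<Sum>i\<le>N. h i x * mpoly_eval (F i) x))" using e by blast
  then obtain h where h: "\<And>j i. j \<le> N \<Longrightarrow> i \<le> N \<Longrightarrow> form_fun \<A> (Suc N) E (h j i)"
    "\<And>j x. j \<le> N \<Longrightarrow> x j \<noteq> 0 \<Longrightarrow> x j ^ (E + d) = (\<Sum>i\<le>N. h j i x * mpoly_eval (F i) x)" by metis
  let ?Z = "{z::complex. algebraic_int z}"
  have "\<forall>j i. \<exists>M::nat. M > 0 \<and> (j \<le> N \<and> i \<le> N \<longrightarrow> form_fun ?Z (Suc N) E (\<lambda>x. of_nat M * h j i x))"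
  proof (intro allI)
    fix j i
    show "\<exists>M::nat. M > 0 \<and> (j \<le> N \<and> i \<le> N \<longrightarrow> form_fun ?Z (Suc N) E (\<lambda>x. of_nat M * h j i x))"
      using form_fun_integral[OF h(1), of j i] by (cases "j \<le> N \<and> i \<le> N") (blast, auto)
  qed
  then obtain m :: "nat \<Rightarrow> nat \<Rightarrow> nat" where m: "\<And>j i. m j i > 0"
    "\<And>j i. j \<le> N \<Longrightarrow> i \<le> N \<Longrightarrow> form_fun ?Z (Suc N) E (\<lambda>x. of_nat (m j i) * h j i x)" by metis
  define M where "M = (\<Prod>(j,i)\<in>{..N} \<times> {..N}. m j i)"
  have M: "M > 0" unfolding M_def using m(1) by (intro prod_pos) auto
  have f: "form_fun ?Z (Suc N) E (\<lambda>x. of_nat M * h j i x)" if ji: "j \<le> N" "i \<le> N" for j i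
  proof -
    have "m j i dvd M" unfolding M_def using ji dvd_prodI[of "{..N} \<times> {..N}" "(j,i)" "\<lambda>(j,i). m j i"] by simp
    then obtain r where "M = m j i * r" by auto
    then have "(\<lambda>x. of_nat M * h j i x) = (\<lambda>x. of_nat r * (of_nat (m j i) * h j i x))" by (auto simp: mult_ac)
    then show ?thesis
      using form_fun_cmult[OF m(2)[OF ji] subring_algebraic_int, of "of_nat r"] algebraic_int_of_nat by simp
  qed
  have "\<forall>j i. \<exists>S. finite S \<and> S \<subseteq> ?Z \<and> (j \<le> N \<and> i \<le> N \<longrightarrow> form_fun S (Suc N) E (\<lambda>x. of_nat M * h j i x))"
  proof (intro allI)
    fix j i
    show "\<exists>S. finite S \<and> S \<subseteq> ?Z \<and> (j \<le> N \<and> i \<le> N \<longrightarrow> form_fun S (Suc N) E (\<lambda>x. of_nat M * h j i x))"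
    proof (cases "j \<le> N \<and> i \<le> N")
      case True
      then show ?thesis using form_fun_finite_coeffs[OF f, of j i] by blast
    next
      case False
      then show ?thesis by (intro exI[of _ "{}"]) auto
    qed
  qed
  then obtain S where S: "\<And>j i. finite (S j i)" "\<And>j i. S j i \<subseteq> ?Z"
    "\<And>j i. j \<le> N \<Longrightarrow> i \<le> N \<Longrightarrow> form_fun (S j i) (Suc N) E (\<lambda>x. of_nat M * h j i x)" by metis
  define S' where "S' = (\<Union>j\<le>N. \<Union>i\<le>N. S j i)"
  have "finite S'" "S' \<subseteq> ?Z" unfolding S'_def using S by (intro finite_UN_I UN_least; blast)+
  moreover have "form_fun S' (Suc N) E (\<lambda>x. of_nat M * h j i x)" if "j \<le> N" "i \<le> N" for j i
    by (rule form_fun_mono[OF S(3)[OF that]]) (use that in \<open>auto simp: S'_def\<close>)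
  moreover have "of_nat M * x j ^ (E + d) = (\<Sum>i\<le>N. (of_nat M * h j i x) * mpoly_eval (F i) x)" if "j \<le> N" "x j \<noteq> 0" for j x
    unfolding h(2)[of j x, OF that] by (simp add: sum_distrib_left mult.assoc)
  ultimately show ?thesis using M
    by (intro exI[of _ M] exI[of _ S'] exI[of _ E] exI[of _ "\<lambda>j i x. of_nat M * h j i x"] conjI allI impI) simp_all
qed

section \<open>Action on projective points and the height inequality\<close>

definition eval_vec :: "nat \<Rightarrow> (nat \<Rightarrow> mpoly) \<Rightarrow> (nat \<Rightarrow> complex) \<Rightarrow> nat \<Rightarrow> complex" where
  "eval_vec N F x = (\<lambda>i. if i \<le> N then mpoly_eval (F i) x else 0)"

lemma eval_vec_coord_vecs:
  assumes F: "defines_endo N d F" and x: "x \<in> coord_vecs N"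
  shows "eval_vec N F x \<in> coord_vecs N"
proof -
  have "algebraic (mpoly_eval (F i) x)" if "i \<le> N" for i
  proof (rule poly_fun_algebraic[OF mpoly_eval_poly_fun])
    show "homogeneous_on N d (F i)" "algebraic_coeffs (F i)" using F that by (auto simp: defines_endo_def)
    show "algebraic (x i)" for i using x by (simp add: coord_vecs_def)
  qed
  moreover obtain i where "i \<le> N" "mpoly_eval (F i) x \<noteq> 0" using F x by (auto simp: defines_endo_def)
  ultimately show ?thesis by (auto simp: coord_vecs_def eval_vec_def intro!: exI[of _ i])
qed

lemma proj_map_point:
  assumes F: "defines_endo N d F" and P: "P \<in> proj_space N" and x: "x \<in> P"
  shows "proj_map N F P \<in> proj_space N" "eval_vec N F x \<in> proj_map N F P"
proof -
  have xc: "x \<in> coord_vecs N" by (rule proj_space_coords(2)[OF P x])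
  note ex = eval_vec_coord_vecs[OF F xc]
  have "proj_map N F P = proj_rel N `` (eval_vec N F ` P)"
    using P by (simp add: proj_map_def eval_vec_def[abs_def])
  also have "\<dots> = proj_rel N `` {eval_vec N F x}"
  proof -
    have "proj_rel N `` {eval_vec N F y} = proj_rel N `` {eval_vec N F x}" if y: "y \<in> P" for y
    proof -
      obtain c where c: "algebraic c" "c \<noteq> 0" "y = (\<lambda>i. c * x i)" using proj_space_coords(4)[OF P x y] by blast
      have "mpoly_eval (F i) y = c ^ d * mpoly_eval (F i) x" if "i \<le> N" for i
        unfolding c(3) using F that by (intro mpoly_eval_homogeneous[of N]) (auto simp: defines_endo_def)
      then have "eval_vec N F y = (\<lambda>i. c ^ d * eval_vec N F x i)" by (auto simp: eval_vec_def)
      then have "(eval_vec N F x, eval_vec N F y) \<in> proj_rel N"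
        using coord_vecs_scale(2)[OF ex, of "c ^ d"] c AN.power[of c d] by simp
      then show ?thesis using equiv_class_eq[OF proj_rel_equiv] by metis
    qed
    then show ?thesis using x by blast
  qed
  finally have eq: "proj_map N F P = proj_rel N `` {eval_vec N F x}" .
  show "proj_map N F P \<in> proj_space N" unfolding eq proj_space_def by (rule quotientI[OF ex])
  show "eval_vec N F x \<in> proj_map N F P" unfolding eq by (rule equiv_class_self[OF proj_rel_equiv ex])
qed

lemma unimodular_nonzero: "unimodular L N x \<Longrightarrow> \<exists>i\<le>N. x i \<noteq> 0"
proof (rule ccontr)
  assume u: "unimodular L N x" "\<not> (\<exists>i\<le>N. x i \<noteq> 0)"
  then obtain a where "(\<Sum>i\<le>N. a i * x i) = 1" by (auto simp: unimodular_def)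
  moreover have "(\<Sum>i\<le>N. a i * x i) = 0" using u(2) by (intro sum.neutral) auto
  ultimately show False by simp
qed

lemma arch_max_pos:
  assumes L: "number_field L" and t: "\<tau> \<in> embeddings L" and x: "\<And>i. i \<le> N \<Longrightarrow> x i \<in> L" "\<exists>i\<le>N. x i \<noteq> 0"
  shows "arch_max N x \<tau> > 0"
proof -
  interpret csubfield L by (rule number_field_csubfield) fact
  interpret embedding L \<tau> by unfold_locales fact
  obtain i where i: "i \<le> N" "x i \<noteq> 0" using x(2) by blast
  then have "cmod (\<tau> (x i)) > 0" using inverse_hom(1)[of "x i"] x(1) by simp
  then show ?thesis using arch_max_ge[OF i(1), of \<tau> x] by linarith
qed

lemma weil_height_pos:
  assumes P: "P \<in> proj_space N"
  shows "weil_height N P > 0"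
proof -
  obtain x where x: "x \<in> P" using proj_space_coords(1)[OF P] by blast
  obtain L y where L: "number_field L" "y \<in> P" "unimodular L N y"
    using ex_unimodular[OF P x finite.emptyI] by blast
  have "(\<Prod>\<tau>\<in>embeddings L. arch_max N y \<tau>) > 0"
    using L by (intro prod_pos ballI arch_max_pos unimodular_nonzero) (auto simp: unimodular_def ints_of_def)
  then show ?thesis unfolding weil_height_unimodular[OF P L(1,2,3)] arch_height_def by simp
qed

text \<open>Take unimodular x and write F(x) = l y' with y' unimodular. Each embedding gives M |x|^d
  \<le> C |l| |y'|. In the product over embeddings the norm of l is at most M^n because M / l is
  integral. The powers of M cancel, and C^n becomes C after normalisation by the field
  degree.\<close>

theorem weil_height_endomorphism:
  assumes F: "defines_endo N d F" and d: "d > 0"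
  shows "\<exists>C>0. \<forall>P\<in>proj_space N. weil_height N P ^ d \<le> C * weil_height N (proj_map N F P)"
proof -
  obtain M :: nat and S e h where MS: "M > 0 \<and> finite S \<and> S \<subseteq> {z. algebraic_int z} \<and>
     (\<forall>j\<le>N. \<forall>i\<le>N. form_fun S (Suc N) e (h j i)) \<and>
     (\<forall>j\<le>N. \<forall>x. x j \<noteq> 0 \<longrightarrow> of_nat M * x j ^ (e + d) = (\<Sum>i\<le>N. h j i x * mpoly_eval (F i) x))"
    using integral_power_relation[OF F] by (elim exE)
  then have M: "M > 0" and S: "finite S" "S \<subseteq> {z. algebraic_int z}"
    and hf: "\<And>j i. j \<le> N \<Longrightarrow> i \<le> N \<Longrightarrow> form_fun S (Suc N) e (h j i)"
    and rel: "\<And>j x. j \<le> N \<Longrightarrow> x j \<noteq> 0 \<Longrightarrow> of_nat M * x j ^ (e + d) = (\<Sum>i\<le>N. h j i x * mpoly_eval (F i) x)"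
    by simp_all
  have SA: "S \<subseteq> \<A>"
  proof
    fix z assume "z \<in> S"
    then have "algebraic_int z" using S(2) by (rule_tac CollectD[OF subsetD])
    then show "z \<in> \<A>" by (simp add: algebraic_int_imp_algebraic)
  qed
  have "\<forall>j i. \<exists>C\<ge>0. j \<le> N \<and> i \<le> N \<longrightarrow> (\<forall>L \<tau> x. number_field L \<and> S \<subseteq> L \<and> \<tau> \<in> embeddings L \<and> (\<forall>i\<le>N. x i \<in> L) \<longrightarrow>
     h j i x \<in> L \<and> cmod (\<tau> (h j i x)) \<le> C * arch_max N x \<tau> ^ e)"
  proof (intro allI)
    fix j i
    show "\<exists>C\<ge>0. j \<le> N \<and> i \<le> N \<longrightarrow> (\<forall>L \<tau> x. number_field L \<and> S \<subseteq> L \<and> \<tau> \<in> embeddings L \<and> (\<forall>i\<le>N. x i \<in> L) \<longrightarrow>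
       h j i x \<in> L \<and> cmod (\<tau> (h j i x)) \<le> C * arch_max N x \<tau> ^ e)"
    proof (cases "j \<le> N \<and> i \<le> N")
      case True
      then show ?thesis using form_fun_arch_bound[OF hf SA, of j i] by simp
    next
      case False
      then show ?thesis by (intro exI[of _ 0]) auto
    qed
  qed
  then obtain c where c: "\<And>j i. c j i \<ge> (0::real)" "\<And>j i L \<tau> x. j \<le> N \<Longrightarrow> i \<le> N \<Longrightarrow> number_field L \<Longrightarrow> S \<subseteq> L \<Longrightarrow> \<tau> \<in> embeddings L \<Longrightarrow>
     (\<forall>i\<le>N. x i \<in> L) \<Longrightarrow> h j i x \<in> L \<and> cmod (\<tau> (h j i x)) \<le> c j i * arch_max N x \<tau> ^ e" by metis
  \<comment> \<open>Summing over all j gives one constant although the coordinate of largest modulus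
    depends on the embedding. The summand 1 makes it positive.\<close>
  define C where "C = 1 + (\<Sum>j\<le>N. \<Sum>i\<le>N. c j i)"
  have C: "C > 0" unfolding C_def using c(1) by (intro add_pos_nonneg sum_nonneg) auto
  have cC: "(\<Sum>i\<le>N. c j i) \<le> C" if "j \<le> N" for j
    unfolding C_def using member_le_sum[of j "{..N}" "\<lambda>j. \<Sum>i\<le>N. c j i"] that c(1) by (simp add: sum_nonneg)
  have "weil_height N P ^ d \<le> C * weil_height N (proj_map N F P)" if P: "P \<in> proj_space N" for P
  proof -
    obtain x0 where x0: "x0 \<in> P" using proj_space_coords(1)[OF P] by blast
    obtain K x where K: "number_field K" "x \<in> P" "unimodular K N x"
      using ex_unimodular[OF P x0 finite.emptyI] by blast
    obtain b where b: "algebraic b" "K = Q_adjoin b" using number_field_primitive[OF K(1)] by blast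
    define y where "y = eval_vec N F x"
    note Q = proj_map_point[OF F P K(2), folded y_def]
    have "finite (insert b S)" "\<And>z. z \<in> insert b S \<Longrightarrow> algebraic z" using S(1) SA b(1) by auto
    then obtain L l y' where L: "number_field L" "insert b S \<subseteq> L" "range y \<subseteq> L" "l \<in> L" "l \<noteq> 0"
      "y' \<in> proj_map N F P" "y = (\<lambda>i. l * y' i)" "unimodular L N y'"
      using ex_unimodular[OF Q, of "insert b S"] by blast
    interpret L: nfield L by unfold_locales (rule L(1))
    have KL: "K \<subseteq> L" unfolding b(2) by (rule Q_adjoin_subset[OF number_field_csubfield[OF L(1)]]) (use L(2) in auto)
    have ux: "unimodular L N x" by (rule unimodular_mono[OF KL K(3)])
    have xO: "\<And>i. i \<le> N \<Longrightarrow> x i \<in> L.\<O>" and yO: "\<And>i. i \<le> N \<Longrightarrow> y' i \<in> L.\<O>"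
      using ux L(8) by (auto simp: unimodular_def)
    have xL: "\<And>i. i \<le> N \<Longrightarrow> x i \<in> L" and yL: "\<And>i. i \<le> N \<Longrightarrow> y' i \<in> L" using xO yO L.OK by auto
    have SL: "S \<subseteq> L" using L(2) by auto
    have relx: "of_nat M * x j ^ (e + d) = (\<Sum>i\<le>N. h j i x * y i)" if "j \<le> N" "x j \<noteq> 0" for j
      using rel[of j x] that by (simp add: y_def eval_vec_def)
    \<comment> \<open>Membership of \<open>h j i x\<close> in L is supplied by \<open>c\<close> only
      along with an embedding, so at least one must exist.\<close>
    have embL: "embeddings L \<noteq> {}" using L.card_Emb L.n_pos by (metis card.empty less_irrefl)
    have hL: "h j i x \<in> L" if "j \<le> N" "i \<le> N" for j i
      using c(2)[OF that L(1) SL _, of _ x] embL xL by blast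
    \<comment> \<open>The common factor l of the values F_i(x) divides M: multiplying x_j^(e+d) by w
      gives an integral combination of the y'_i, and the powers x_j^(e+d) suffice by
      \<open>unimodular_powers\<close>.\<close>
    define w where "w = of_nat M / l"
    have w: "w \<in> L.\<O>"
    proof -
      define J where "J = {z \<in> L.\<O>. z * w \<in> L.\<O>}"
      have J: "L.is_ideal J" unfolding L.is_ideal_def add_subgroup_def J_def
        by (auto simp: left_diff_distrib mult.assoc)
      have "x j ^ (e + d) \<in> J" if j: "j \<le> N" for j
      proof (cases "x j = 0")
        case True
        then have z: "x j ^ (e + d) = 0" using d by (simp add: zero_power)
        show ?thesis unfolding z J_def by simp
      next
        case False
        have "x j ^ (e + d) * w = (\<Sum>i\<le>N. h j i x * y' i)"
        proof -
          have "of_nat M * x j ^ (e + d) = l * (\<Sum>i\<le>N. h j i x * y' i)"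
            unfolding relx[OF j False] L(7) by (simp add: sum_distrib_left mult_ac)
          then show ?thesis using L(5) by (simp add: w_def field_simps)
        qed
        moreover have "h j i x \<in> L.\<O>" if "i \<le> N" for i
          using form_fun_algebraic_int[OF hf[OF j that] S(2), of x] xO hL[OF j that] by (auto simp: ints_of_def)
        then have "(\<Sum>i\<le>N. h j i x * y' i) \<in> L.\<O>" using yO by (intro L.Oint.sum L.Oint.mult) auto
        ultimately show ?thesis using xO[OF j] by (auto simp: J_def)
      qed
      then have "J = L.\<O>" by (rule L.unimodular_powers[OF ux J])
      then have "1 \<in> J" by simp
      then show ?thesis by (simp add: J_def)
    qed
    have w0: "w \<noteq> 0" using M L(5) by (simp add: w_def)
    define n where "n = field_degree L"
    have n: "n > 0" unfolding n_def by (rule L.n_pos)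
    have norm_l: "cmod (fnorm L l) \<le> real M ^ n"
    proof -
      have "fnorm L w * fnorm L l = of_nat M ^ n"
        using L.Nm_mult[of w l] L.OK[OF w] L(4,5) by (simp add: w_def fnorm_of_nat[OF L(1)] n_def)
      then have "cmod (fnorm L w) * cmod (fnorm L l) = real M ^ n"
        by (metis norm_mult norm_of_nat norm_power)
      then show ?thesis using mult_right_mono[OF L.Nm_ge_1[OF w w0], of "cmod (fnorm L l)"] by simp
    qed
    define A where "A = (\<Prod>\<tau>\<in>embeddings L. arch_max N x \<tau>)"
    define Y where "Y = (\<Prod>\<tau>\<in>embeddings L. arch_max N y' \<tau>)"
    have loc: "real M * arch_max N x \<tau> ^ d \<le> C * (cmod (\<tau> l) * arch_max N y' \<tau>)" if t: "\<tau> \<in> embeddings L" for \<tau>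
    proof -
      interpret T: embedding L \<tau> by unfold_locales fact
      let ?A = "arch_max N x \<tau>" and ?Y = "arch_max N y \<tau>"
      have Apos: "?A > 0" by (rule arch_max_pos[OF L(1) t xL unimodular_nonzero[OF ux]])
      \<comment> \<open>Using the relation for a coordinate of largest modulus puts |x|^(e+d) on the
        left. The forms of degree e cost at most |x|^e, which cancels because it is
        positive.\<close>
      obtain j where j: "j \<le> N" "?A = cmod (\<tau> (x j))" using arch_max_attained by blast
      have xj: "x j \<noteq> 0" using Apos j(2) by auto
      have yiL: "y i \<in> L" for i using L(3) by auto
      have "real M * ?A ^ (e + d) = cmod (\<tau> (of_nat M * x j ^ (e + d)))"
        using xL[OF j(1)] by (simp add: T.mult_hom T.power_hom L.power norm_mult norm_power j(2))
      also have "\<dots> = cmod (\<Sum>i\<le>N. \<tau> (h j i x) * \<tau> (y i))"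
        unfolding relx[OF j(1) xj] using hL[OF j(1)] yiL by (subst T.sum_hom) (auto simp: T.mult_hom)
      also have "\<dots> \<le> (\<Sum>i\<le>N. cmod (\<tau> (h j i x) * \<tau> (y i)))" by (rule norm_sum)
      also have "\<dots> \<le> (\<Sum>i\<le>N. (c j i * ?A ^ e) * ?Y)"
      proof (rule sum_mono)
        fix i assume i: "i \<in> {..N}"
        have "cmod (\<tau> (h j i x)) \<le> c j i * ?A ^ e" using c(2)[OF j(1) _ L(1) SL t, of i x] i xL by auto
        then show "cmod (\<tau> (h j i x) * \<tau> (y i)) \<le> (c j i * ?A ^ e) * ?Y"
          unfolding norm_mult using i arch_max_ge[of i N \<tau> y] c(1)[of j i] Apos
          by (intro mult_mono) auto
      qed
      also have "\<dots> = (\<Sum>i\<le>N. c j i) * (?A ^ e * ?Y)" by (simp add: sum_distrib_right mult.assoc)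
      also have "\<dots> \<le> C * (?A ^ e * ?Y)"
        using Apos arch_max_nonneg by (intro mult_right_mono cC j(1)) auto
      finally have "?A ^ e * (real M * ?A ^ d) \<le> ?A ^ e * (C * ?Y)" by (simp add: power_add mult_ac)
      then have "real M * ?A ^ d \<le> C * ?Y" using Apos by simp
      also have "?Y = cmod (\<tau> l) * arch_max N y' \<tau>"
        unfolding L(7) by (rule arch_max_scale[OF T.embedding_axioms L(4) yL])
      finally show ?thesis .
    qed
    have "(\<Prod>\<tau>\<in>embeddings L. real M * arch_max N x \<tau> ^ d) \<le> (\<Prod>\<tau>\<in>embeddings L. C * (cmod (\<tau> l) * arch_max N y' \<tau>))"
      using arch_max_nonneg loc by (intro prod_mono conjI mult_nonneg_nonneg) auto
    then have "real M ^ n * A ^ d \<le> C ^ n * (cmod (fnorm L l) * Y)"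
      by (simp add: prod.distrib prod_power_distrib[symmetric] A_def Y_def n_def L.card_Emb fnorm_def prod_norm)
    also have "\<dots> \<le> C ^ n * (real M ^ n * Y)"
      using norm_l C by (intro mult_left_mono mult_right_mono) (auto simp: Y_def intro!: prod_nonneg arch_max_nonneg)
    finally have "real M ^ n * A ^ d \<le> real M ^ n * (C ^ n * Y)" by (simp add: mult_ac)
    then have AY: "A ^ d \<le> C ^ n * Y" using M by simp
    have A0: "A > 0" unfolding A_def
      using xL by (intro prod_pos ballI arch_max_pos[OF L(1)] unimodular_nonzero[OF ux])
    have Y0: "Y \<ge> 0" unfolding Y_def by (intro prod_nonneg arch_max_nonneg)
    have "(A powr (1 / real n)) ^ d = (A ^ d) powr (1 / real n)"
      using A0 by (simp add: powr_powr powr_realpow[symmetric] mult.commute)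
    also have "\<dots> \<le> (C ^ n * Y) powr (1 / real n)" using AY A0 by (intro powr_mono2) auto
    also have "\<dots> = C * Y powr (1 / real n)"
      using C Y0 n by (simp add: powr_mult powr_realpow[symmetric] powr_powr)
    finally show ?thesis
      unfolding weil_height_unimodular[OF P L(1) K(2) ux] weil_height_unimodular[OF Q(1) L(1) L(6) L(8)]
        arch_height_def A_def Y_def n_def .
  qed
  then show ?thesis using C by blast
qed

subsection \<open>Counting points of an orbit\<close>

primrec const_prog :: "nat \<Rightarrow> recf" where
  "const_prog 0 = Zero"
| "const_prog (Suc k) = Comp Succ [const_prog k]"

lemma computes_const_prog: "computes (const_prog k) xs k"
proof (induction k)
  case 0
  show ?case by (simp add: computes.intros(1))
next
  case (Suc k)
  have "list_all2 (\<lambda>g y. computes g xs y) [const_prog k] [k]" using Suc by simp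
  then show ?case using computes.intros(4)[OF _ computes.intros(2)] by simp
qed

lemma computes_real_from_2: "computes_real_from (const_prog (prod_encode (int_encode 2, 0))) N S 2"
proof -
  \<comment> \<open>The second component 0 stands for the denominator \<open>Suc 0\<close>.\<close>
  have "decode_rat (prod_encode (int_encode 2, 0)) = 2" by (simp add: decode_rat_def)
  then show ?thesis using computes_const_prog unfolding computes_real_from_def
    by (intro allI impI exI[of _ "prod_encode (int_encode 2, 0)"]) simp
qed

text \<open>Injectivity turns the sum into a part of the sum of 1/k^2 over k \<ge> 2, and 1/k^2
  \<le> 1/(k-1) - 1/k telescopes. The finite cut-off keeps the bound strictly below 1.\<close>

lemma sum_inverse_squares_less_1:
  fixes w :: "'a \<Rightarrow> nat"
  assumes S: "finite S" and w: "\<And>s. s \<in> S \<Longrightarrow> 2 \<le> w s" "inj_on w S"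
  shows "(\<Sum>s\<in>S. 1 / real (w s) ^ 2) < 1"
proof -
  have tele: "(\<Sum>k=2..Suc K. 1 / real k ^ 2) \<le> 1 - 1 / real (Suc K)" for K
  proof (induction K)
    case (Suc K)
    have "1 / real (Suc (Suc K)) ^ 2 \<le> 1 / (real (Suc K) * real (Suc (Suc K)))"
      unfolding power2_eq_square by (intro divide_left_mono mult_right_mono mult_pos_pos) auto
    also have "\<dots> = 1 / real (Suc K) - 1 / real (Suc (Suc K))" by (simp add: field_simps)
    finally show ?case using Suc by simp
  qed simp
  define K where "K = (\<Sum>s\<in>S. w s)"
  have "(\<Sum>s\<in>S. 1 / real (w s) ^ 2) = (\<Sum>k\<in>w ` S. 1 / real k ^ 2)"
    using w(2) by (simp add: sum.reindex)
  also have "\<dots> \<le> (\<Sum>k=2..Suc K. 1 / real k ^ 2)"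
  proof (rule sum_mono2)
    have "w s \<le> Suc K" if "s \<in> S" for s
      using member_le_sum[OF that, of w] S unfolding K_def by simp
    then show "w ` S \<subseteq> {2..Suc K}" using w(1) by auto
  qed auto
  also have "\<dots> \<le> 1 - 1 / real (Suc K)" by (rule tele)
  also have "\<dots> < 1" by simp
  finally show ?thesis .
qed

lemma sum_weights_words:
  fixes v :: "'a \<Rightarrow> real"
  shows "(\<Sum>ws | set ws \<subseteq> S \<and> length ws = n. prod_list (map v ws)) = (\<Sum>s\<in>S. v s) ^ n"
proof (induction n)
  case 0
  have "{ws. set ws \<subseteq> S \<and> length ws = 0} = {[]}" by auto
  then show ?case by simp
next
  case (Suc n)
  have "inj_on (\<lambda>(xs, a). a # xs) ({ws. set ws \<subseteq> S \<and> length ws = n} \<times> S)" by (auto simp: inj_on_def)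
  then have "(\<Sum>ws | set ws \<subseteq> S \<and> length ws = Suc n. prod_list (map v ws)) =
      (\<Sum>(xs, a)\<in>{ws. set ws \<subseteq> S \<and> length ws = n} \<times> S. v a * prod_list (map v xs))"
    unfolding lists_length_Suc_eq by (subst sum.reindex) (auto intro!: sum.cong)
  also have "\<dots> = (\<Sum>xs | set xs \<subseteq> S \<and> length xs = n. prod_list (map v xs)) * (\<Sum>a\<in>S. v a)"
    unfolding sum_product sum.cartesian_product by (auto intro!: sum.cong simp: mult.commute)
  finally show ?case using Suc by (simp add: mult.commute)
qed

text \<open>Rankin's trick: a counted word has weight at least 1 / X^2. The weights of all words of
  length n sum to \<rho>^n, and the geometric series bounds the total.\<close>

lemma card_words_le:
  fixes w :: "'a \<Rightarrow> nat"
  assumes S: "finite S" and w: "\<And>s. s \<in> S \<Longrightarrow> 2 \<le> w s"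
  defines "\<rho> \<equiv> \<Sum>s\<in>S. 1 / real (w s) ^ 2"
  assumes rho: "\<rho> < 1"
  shows "finite {ws \<in> lists S. real (prod_list (map w ws)) \<le> X}"
    and "real (card {ws \<in> lists S. real (prod_list (map w ws)) \<le> X}) \<le> X ^ 2 / (1 - \<rho>)"
proof -
  let ?W = "{ws \<in> lists S. real (prod_list (map w ws)) \<le> X}"
  let ?v = "\<lambda>s. 1 / real (w s) ^ 2"
  let ?L = "\<lambda>n. {ws. set ws \<subseteq> S \<and> length ws = n}"
  \<comment> \<open>All weights are at least 2, so a word of length n has product at least 2^n > n;
    hence counted words have length at most X.\<close>
  define m where "m = nat \<lfloor>X\<rfloor>"
  have two: "2 ^ length ws \<le> prod_list (map w ws)" if "ws \<in> lists S" for ws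
    using that by (induction ws) (auto intro: mult_mono w)
  have sub: "?W \<subseteq> (\<Union>n\<le>m. ?L n)"
  proof
    fix ws assume ws: "ws \<in> ?W"
    have "real (length ws) \<le> real (2 ^ length ws)" using less_exp[of "length ws"] by linarith
    also have "\<dots> \<le> real (prod_list (map w ws))" using two ws by (intro of_nat_mono) auto
    also have "\<dots> \<le> X" using ws by simp
    finally have "length ws \<le> m" unfolding m_def by (simp add: le_nat_floor)
    then show "ws \<in> (\<Union>n\<le>m. ?L n)" using ws by auto
  qed
  have finL: "finite (?L n)" for n by (rule finite_lists_length_eq[OF S])
  show fin: "finite ?W" by (rule finite_subset[OF sub]) (simp add: finL)
  have v0: "prod_list (map ?v ws) \<ge> 0" for ws by (induction ws) auto
  have v: "prod_list (map ?v ws) = 1 / real (prod_list (map w ws)) ^ 2" for ws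
    by (induction ws) (auto simp: power_mult_distrib)
  have "real (card ?W) = (\<Sum>ws\<in>?W. 1)" by simp
  also have "\<dots> \<le> (\<Sum>ws\<in>?W. X ^ 2 * prod_list (map ?v ws))"
  proof (rule sum_mono)
    fix ws assume ws: "ws \<in> ?W"
    define p where "p = real (prod_list (map w ws))"
    have "(2::real) ^ length ws \<le> p" unfolding p_def using of_nat_mono[OF two[of ws], where ?'a = real] ws by simp
    then have "p > 0" by (rule less_le_trans[rotated]) simp
    moreover have "p ^ 2 \<le> X ^ 2" using ws \<open>p > 0\<close> by (intro power_mono) (auto simp: p_def)
    ultimately show "1 \<le> X ^ 2 * prod_list (map ?v ws)" unfolding v p_def[symmetric] by simp
  qed
  also have "\<dots> = X ^ 2 * (\<Sum>ws\<in>?W. prod_list (map ?v ws))" by (simp add: sum_distrib_left)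
  also have "(\<Sum>ws\<in>?W. prod_list (map ?v ws)) \<le> (\<Sum>ws\<in>(\<Union>n\<le>m. ?L n). prod_list (map ?v ws))"
    using v0 finL by (intro sum_mono2 sub) auto
  also have "\<dots> = (\<Sum>n\<le>m. \<Sum>ws\<in>?L n. prod_list (map ?v ws))"
    using finL by (intro sum.UNION_disjoint) auto
  also have "\<dots> = (\<Sum>n\<le>m. \<rho> ^ n)" unfolding sum_weights_words \<rho>_def ..
  also have "\<dots> \<le> 1 / (1 - \<rho>)"
  proof -
    have r0: "\<rho> \<ge> 0" unfolding \<rho>_def by (intro sum_nonneg) auto
    have "(\<Sum>n\<le>m. \<rho> ^ n) \<le> suminf (\<lambda>n. \<rho> ^ n)"
      using r0 rho by (intro sum_le_suminf summable_geometric) auto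
    also have "\<dots> = 1 / (1 - \<rho>)" using r0 rho by (intro suminf_geometric) auto
    finally show ?thesis .
  qed
  finally show "real (card ?W) \<le> X ^ 2 / (1 - \<rho>)" by (simp add: mult_left_mono)
qed

text \<open>Several words may give the same map, which is harmless for an upper bound on the
  orbit.\<close>

lemma comp_monoid_words:
  assumes "f \<in> comp_monoid S"
  shows "\<exists>ws\<in>lists S. f = foldr (\<lambda>\<phi>. \<phi>) ws"
  using assms
proof (induction rule: comp_monoid.induct)
  case id
  then show ?case by (intro bexI[of _ "[]"]) auto
next
  case (comp \<phi> f)
  then obtain ws where "ws \<in> lists S" "f = foldr (\<lambda>\<phi>. \<phi>) ws" by blast
  then show ?case using comp(1) by (intro bexI[of _ "\<phi> # ws"]) auto
qed

lemma endomorphisms_height_bound: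
  assumes S: "finite S" and w: "\<And>\<phi>. \<phi> \<in> S \<Longrightarrow> 2 \<le> w \<phi> \<and> endomorphism N (w \<phi>) \<phi>"
  shows "\<exists>C\<ge>0. \<forall>\<phi>\<in>S. \<forall>P\<in>proj_space N. \<phi> P \<in> proj_space N \<and>
     real (w \<phi>) * ln (weil_height N P) \<le> C + ln (weil_height N (\<phi> P))"
proof -
  have "\<exists>c\<ge>0. \<forall>P\<in>proj_space N. \<phi> P \<in> proj_space N \<and>
     real (w \<phi>) * ln (weil_height N P) \<le> c + ln (weil_height N (\<phi> P))" if phi: "\<phi> \<in> S" for \<phi>
  proof -
    obtain F where F: "defines_endo N (w \<phi>) F" "\<phi> = proj_map N F"
      using w[OF phi] by (auto simp: endomorphism_def)
    have w0: "w \<phi> > 0" using w[OF phi] by simp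
    obtain c where c: "c > 0" "\<And>P. P \<in> proj_space N \<Longrightarrow> weil_height N P ^ w \<phi> \<le> c * weil_height N (\<phi> P)"
      using weil_height_endomorphism[OF F(1) w0] F(2) by blast
    \<comment> \<open>The truncation at 0 makes the constant nonnegative, so that constants can be
      added up over S and the doubling in \<open>height_growth\<close> applies.\<close>
    have "\<phi> P \<in> proj_space N \<and> real (w \<phi>) * ln (weil_height N P) \<le> max 0 (ln c) + ln (weil_height N (\<phi> P))"
      if P: "P \<in> proj_space N" for P
    proof -
      obtain x where x: "x \<in> P" using proj_space_coords(1)[OF P] by blast
      have Q: "\<phi> P \<in> proj_space N" unfolding F(2) by (rule proj_map_point(1)[OF F(1) P x])
      note pos = weil_height_pos[OF P] weil_height_pos[OF Q]
      have "real (w \<phi>) * ln (weil_height N P) = ln (weil_height N P ^ w \<phi>)" using pos by (simp add: ln_realpow)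
      also have "\<dots> \<le> ln (c * weil_height N (\<phi> P))"
        using c pos P by (subst ln_le_cancel_iff) auto
      also have "\<dots> = ln c + ln (weil_height N (\<phi> P))" using c pos by (simp add: ln_mult)
      finally show ?thesis using Q by simp
    qed
    then show ?thesis by (intro exI[of _ "max 0 (ln c)"]) auto
  qed
  then obtain c where c: "\<And>\<phi>. \<phi> \<in> S \<Longrightarrow> c \<phi> \<ge> 0 \<and> (\<forall>P\<in>proj_space N. \<phi> P \<in> proj_space N \<and>
     real (w \<phi>) * ln (weil_height N P) \<le> c \<phi> + ln (weil_height N (\<phi> P)))" by metis
  have "c \<phi> \<le> sum c S" if "\<phi> \<in> S" for \<phi>
    using c by (intro member_le_sum S that) auto
  then show ?thesis using c by (intro exI[of _ "sum c S"] conjI sum_nonneg) fastforce+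
qed

text \<open>Put h = ln H - C. Then w h(Q) \<le> ln H(\<phi> Q) + C - w C \<le> h(\<phi> Q), because
  w \<ge> 2 and C \<ge> 0. So h is multiplied at least by the degree at each step, without
  accumulating errors.\<close>

lemma height_growth:
  assumes w: "\<And>\<phi>. \<phi> \<in> S \<Longrightarrow> 2 \<le> w \<phi>" and C: "C \<ge> 0"
    and b: "\<And>\<phi> P. \<phi> \<in> S \<Longrightarrow> P \<in> proj_space N \<Longrightarrow> \<phi> P \<in> proj_space N \<and>
       real (w \<phi>) * ln (weil_height N P) \<le> C + ln (weil_height N (\<phi> P))"
    and P: "P \<in> proj_space N" and ws: "ws \<in> lists S"
  shows "foldr (\<lambda>\<phi>. \<phi>) ws P \<in> proj_space N \<and>
    real (prod_list (map w ws)) * (ln (weil_height N P) - C) \<le> ln (weil_height N (foldr (\<lambda>\<phi>. \<phi>) ws P)) - C"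
  using ws
proof (induction ws)
  case Nil
  show ?case using P by simp
next
  case (Cons \<phi> ws)
  let ?Q = "foldr (\<lambda>\<phi>. \<phi>) ws P"
  have Q: "?Q \<in> proj_space N" and IH: "real (prod_list (map w ws)) * (ln (weil_height N P) - C) \<le> ln (weil_height N ?Q) - C"
    using Cons.IH by auto
  note bQ = b[OF Cons.hyps(1) Q]
  have "real (prod_list (map w (\<phi> # ws))) * (ln (weil_height N P) - C) =
      real (w \<phi>) * (real (prod_list (map w ws)) * (ln (weil_height N P) - C))" by simp
  also have "\<dots> \<le> real (w \<phi>) * (ln (weil_height N ?Q) - C)" by (rule mult_left_mono[OF IH]) simp
  also have "\<dots> \<le> ln (weil_height N (\<phi> ?Q)) + C - real (w \<phi>) * C"
    using bQ by (simp add: right_diff_distrib)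
  also have "\<dots> \<le> ln (weil_height N (\<phi> ?Q)) - C"
    using mult_right_mono[of 2 "real (w \<phi>)" C] w[OF Cons.hyps(1)] C by simp
  finally show ?case using bQ by simp
qed

theorem corollary1p2:
  shows "\<exists>r. \<forall>N S. N \<ge> 1 \<and> finite S \<and> S \<noteq> {} \<and>
      (\<forall>\<phi>\<in>S. \<exists>d\<ge>2. endomorphism N d \<phi>) \<and>
      (\<forall>\<phi>\<in>S. \<forall>\<psi>\<in>S. \<forall>d e.
         \<phi> \<noteq> \<psi> \<and> endomorphism N d \<phi> \<and> endomorphism N e \<psi> \<longrightarrow> d \<noteq> e) \<longrightarrow>
    (\<exists>(b::real) B\<^sub>S::real. b > 0 \<and> computes_real_from r N S b \<and>
      (\<forall>P\<in>proj_space N. weil_height N P > B\<^sub>S \<longrightarrow>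
         (\<forall>B. finite {Q \<in> orbit S P. weil_height N Q \<le> B}) \<and>
         (\<lambda>B::real. real (card {Q \<in> orbit S P. weil_height N Q \<le> B}))
           \<in> O[at_top](\<lambda>B. ln B powr b)))"
proof (intro exI[of _ "const_prog (prod_encode (int_encode 2, 0))"] allI impI)
  fix N S
  assume A: "N \<ge> 1 \<and> finite S \<and> S \<noteq> {} \<and> (\<forall>\<phi>\<in>S. \<exists>d\<ge>2. endomorphism N d \<phi>) \<and>
      (\<forall>\<phi>\<in>S. \<forall>\<psi>\<in>S. \<forall>d e. \<phi> \<noteq> \<psi> \<and> endomorphism N d \<phi> \<and> endomorphism N e \<psi> \<longrightarrow> d \<noteq> e)"
  then have S: "finite S" by simp
  from A have "\<forall>\<phi>\<in>S. \<exists>d\<ge>2. endomorphism N d \<phi>" by simp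
  \<comment> \<open>One degree is picked for each map; the hypothesis on distinct maps makes this
    choice injective.\<close>
  then obtain w where w: "\<And>\<phi>. \<phi> \<in> S \<Longrightarrow> 2 \<le> w \<phi> \<and> endomorphism N (w \<phi>) \<phi>" by metis
  have inj: "inj_on w S"
  proof (rule inj_onI, rule ccontr)
    fix \<phi> \<psi> assume h: "\<phi> \<in> S" "\<psi> \<in> S" "w \<phi> = w \<psi>" "\<phi> \<noteq> \<psi>"
    then have "w \<phi> \<noteq> w \<psi>" using A w by blast
    then show False using h by simp
  qed
  define \<rho> where "\<rho> = (\<Sum>\<phi>\<in>S. 1 / real (w \<phi>) ^ 2)"
  have rho: "\<rho> < 1" unfolding \<rho>_def using sum_inverse_squares_less_1[OF S _ inj] w by blast
  obtain C where C: "C \<ge> 0" and Cb: "\<And>\<phi> P. \<phi> \<in> S \<Longrightarrow> P \<in> proj_space N \<Longrightarrow> \<phi> P \<in> proj_space N \<and>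
     real (w \<phi>) * ln (weil_height N P) \<le> C + ln (weil_height N (\<phi> P))"
    using endomorphisms_height_bound[OF S w] by blast
  show "\<exists>(b::real) B\<^sub>S::real. b > 0 \<and> computes_real_from (const_prog (prod_encode (int_encode 2, 0))) N S b \<and>
      (\<forall>P\<in>proj_space N. weil_height N P > B\<^sub>S \<longrightarrow>
         (\<forall>B. finite {Q \<in> orbit S P. weil_height N Q \<le> B}) \<and>
         (\<lambda>B::real. real (card {Q \<in> orbit S P. weil_height N Q \<le> B}))
           \<in> O[at_top](\<lambda>B. ln B powr b))"
  \<comment> \<open>The threshold exp C is where ln H(P) - C becomes positive, so that growth by the
    total degree starts.\<close>
  proof (rule exI[of _ 2], rule exI[of _ "exp C"], intro conjI ballI allI impI computes_real_from_2)
    fix P assume P: "P \<in> proj_space N" and HP: "weil_height N P > exp C"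
    define \<delta> where "\<delta> = ln (weil_height N P) - C"
    have \<delta>: "\<delta> > 0" unfolding \<delta>_def using HP weil_height_pos[OF P] using ln_less_cancel_iff[of "exp C" "weil_height N P"] by simp
    let ?O = "\<lambda>B. {Q \<in> orbit S P. weil_height N Q \<le> B}"
    let ?W = "\<lambda>X. {ws \<in> lists S. real (prod_list (map w ws)) \<le> X}"
    have sub: "?O B \<subseteq> (\<lambda>ws. foldr (\<lambda>\<phi>. \<phi>) ws P) ` ?W (ln B / \<delta>)" for B
    proof
      fix Q assume Q: "Q \<in> ?O B"
      then obtain ws where ws: "ws \<in> lists S" "Q = foldr (\<lambda>\<phi>. \<phi>) ws P"
        using comp_monoid_words unfolding orbit_def by blast
      have g: "Q \<in> proj_space N" "real (prod_list (map w ws)) * \<delta> \<le> ln (weil_height N Q) - C"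
        using height_growth[OF _ C Cb P ws(1)] w unfolding ws(2) \<delta>_def by blast+
      \<comment> \<open>Heights are positive, so a point with height at most B forces B > 0 and the
        logarithm is monotone here; for B \<le> 0 the set is empty.\<close>
      have "ln (weil_height N Q) \<le> ln B"
        using Q weil_height_pos[OF g(1)] by simp
      then have "real (prod_list (map w ws)) * \<delta> \<le> ln B" using g(2) C by simp
      then have "real (prod_list (map w ws)) \<le> ln B / \<delta>" using \<delta> by (simp add: pos_le_divide_eq)
      then show "Q \<in> (\<lambda>ws. foldr (\<lambda>\<phi>. \<phi>) ws P) ` ?W (ln B / \<delta>)" using ws by blast
    qed
    have W: "finite (?W X)" "real (card (?W X)) \<le> X ^ 2 / (1 - \<rho>)" for X
      using card_words_le[OF S, of w X] w rho unfolding \<rho>_def by blast+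
    show "finite (?O B)" for B using finite_subset[OF sub] W(1) by blast
    have "real (card (?O B)) \<le> 1 / (\<delta>\<^sup>2 * (1 - \<rho>)) * (ln B)\<^sup>2" for B
    proof -
      have "card (?O B) \<le> card (?W (ln B / \<delta>))" by (rule surj_card_le[OF W(1) sub])
      then have "real (card (?O B)) \<le> (ln B / \<delta>) ^ 2 / (1 - \<rho>)" using W(2)[of "ln B / \<delta>"] by linarith
      then show ?thesis by (simp add: power_divide)
    qed
    \<comment> \<open>For B > 1 the logarithm is positive, so \<open>powr\<close> agrees with the
      square; the asymptotic claim only concerns such B.\<close>
    moreover have "(ln B)\<^sup>2 = norm (ln B powr 2)" if "B > 1" for B :: real
      using that ln_gt_zero[OF that] by (simp add: powr_numeral)
    ultimately have "\<forall>\<^sub>F B in at_top. norm (real (card (?O B))) \<le> 1 / (\<delta>\<^sup>2 * (1 - \<rho>)) * norm (ln B powr 2)"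
      by (intro eventually_mono[OF eventually_gt_at_top[of 1]]) simp
    then show "(\<lambda>B. real (card (?O B))) \<in> O[at_top](\<lambda>B. ln B powr 2)" by (rule bigoI)
  qed simp
qed

end
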